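(* Let $\Omega \subset \mathbb{R}^2$ be a compact convex set with nonempty interior and let $M>0$. Let $f:\mathbb{R}^2\to\mathbb{R}$ be a $C^2$ function, and let $\{\xi\in\mathbb{R}^2 : \text{the smallest eigenvalue of } f''(\xi) \text{ is zero}\}$ be a closed nowhere dense set in $\mathbb{R}^2$. If $u$ minimizes the functional $F(u)=\int_\Omega f(\nabla u(x))\,dx$ in the class $\mathfrak{C}_M=\{u:\Omega\to\mathbb{R} : 0\le u\le M,\ u \text{ is convex}\}$, then the set $$C(u)=\{(x,z): x\in\Omega,\ u(x)\le z\le M\}$$ is the closure of the convex hull of $\operatorname{sing}(C(u))$: $$C(u)=\overline{\operatorname{conv}(\operatorname{sing}(C(u)))}.$$
   Context: Here $f''(\xi)$ is the second derivative (Hessian matrix) of $f$ at $\xi$. For a convex function $u:\Omega\to\mathbb{R}$, the gradient $\nabla u$ exists almost everywhere in $\Omega$ and is measurable. For a convex set $C\subset\mathbb{R}^3$, a point $\xi\in\partial C$ is called regular if there is a single plane of support to $C$ at $\xi$, and singular otherwise; $\operatorname{sing}(C)$ is the set of singular points of $\partial C$. The bar denotes closure and $\operatorname{conv}$ the convex hull.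
   Formalization: As u may jump up on the boundary of Ω, C(u) need not be closed and the stated equality can fail; it is proved whenever C(u) is closed, and for every minimizer with the closure of C(u) on the left. "Minimizes" means F(u) is finite and minimal among class members whose integral exists. *)

theory Defs
  imports "HOL-Analysis.Analysis"
begin

(* Unspecified wherever h is not differentiable. *)
definition grad :: "('a::real_inner \<Rightarrow> real) \<Rightarrow> 'a \<Rightarrow> 'a" where
  "grad h x = (THE D. GDERIV h x :> D)"

definition hessian :: "(real^'n \<Rightarrow> real) \<Rightarrow> real^'n \<Rightarrow> real^'n^'n" where
  "hessian h x = jacobian (grad h) (at x)"

definition C2 :: "(real^'n \<Rightarrow> real) \<Rightarrow> bool" where
  "C2 h \<longleftrightarrow> (\<forall>x. h differentiable (at x)) \<and> (\<forall>x. grad h differentiable (at x)) \<and>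
     continuous_on UNIV (hessian h)"

definition eigenvalues :: "real^'n^'n \<Rightarrow> real set" where
  "eigenvalues A = {l. \<exists>v. v \<noteq> 0 \<and> A *v v = l *\<^sub>R v}"

(* Meaningful for symmetric matrices, whose set of real eigenvalues is finite and nonempty. *)
definition smallest_eigenvalue :: "real^'n^'n \<Rightarrow> real" where
  "smallest_eigenvalue A = Min (eigenvalues A)"

definition nowhere_dense :: "'a::topological_space set \<Rightarrow> bool" where
  "nowhere_dense S \<longleftrightarrow> interior (closure S) = {}"

(* A plane is represented as a set of points: a flat set C has the plane containing it as a
   plane of support, and that plane counts once although it has two unit normals. *)
definition plane_of_support :: "'a::euclidean_space set \<Rightarrow> 'a \<Rightarrow> 'a set \<Rightarrow> bool" where
  "plane_of_support C p H \<longleftrightarrow>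
     (\<exists>a b. a \<noteq> 0 \<and> H = {y. a \<bullet> y = b} \<and> p \<in> H \<and> C \<subseteq> {y. a \<bullet> y \<le> b})"

definition regular_point :: "'a::euclidean_space set \<Rightarrow> 'a \<Rightarrow> bool" where
  "regular_point C p \<longleftrightarrow> p \<in> frontier C \<and> (\<exists>!H. plane_of_support C p H)"

definition sing :: "'a::euclidean_space set \<Rightarrow> 'a set" where
  "sing C = {p \<in> frontier C. \<not> regular_point C p}"

definition convex_class :: "(real^2) set \<Rightarrow> real \<Rightarrow> (real^2 \<Rightarrow> real) set" where
  "convex_class \<Omega> M = {u. convex_on \<Omega> u \<and> (\<forall>x\<in>\<Omega>. 0 \<le> u x \<and> u x \<le> M)}"

(* Only the values of u on \<Omega> matter: the frontier of a convex set is a null set, and Lebesgue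
   measure is complete, so the gradient there affects neither measurability nor the integral. *)
definition F_defined :: "(real^2) set \<Rightarrow> (real^2 \<Rightarrow> real) \<Rightarrow> (real^2 \<Rightarrow> real) \<Rightarrow> bool" where
  "F_defined \<Omega> f u \<longleftrightarrow> set_integrable lebesgue \<Omega> (\<lambda>x. f (grad u x))"

definition F :: "(real^2) set \<Rightarrow> (real^2 \<Rightarrow> real) \<Rightarrow> (real^2 \<Rightarrow> real) \<Rightarrow> real" where
  "F \<Omega> f u = (LINT x:\<Omega>|lebesgue. f (grad u x))"

(* The gradient of u may be unbounded near the frontier of \<Omega>, so for unbounded f the integral
   need not exist (and the Bochner integral is then 0 by convention); hence the comparison is
   between functions at which the integral exists. *)
definition minimizes_F ::
    "(real^2) set \<Rightarrow> real \<Rightarrow> (real^2 \<Rightarrow> real) \<Rightarrow> (real^2 \<Rightarrow> real) \<Rightarrow> bool" where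
  "minimizes_F \<Omega> M f u \<longleftrightarrow> u \<in> convex_class \<Omega> M \<and> F_defined \<Omega> f u \<and>
     (\<forall>v\<in>convex_class \<Omega> M. F_defined \<Omega> f v \<longrightarrow> F \<Omega> f u \<le> F \<Omega> f v)"

(* Closed iff u is lower semicontinuous on \<Omega> (for closed \<Omega>, u \<le> M); a convex u may fail to be so, but
   only at points of the frontier of \<Omega>. *)
definition body :: "(real^2) set \<Rightarrow> real \<Rightarrow> (real^2 \<Rightarrow> real) \<Rightarrow> ((real^2) \<times> real) set" where
  "body \<Omega> M u = {(x, z). x \<in> \<Omega> \<and> u x \<le> z \<and> z \<le> M}"

end

theory Submission
  imports Defs
begin

text \<open>
  If the convex hull of the singular points misses a point of the body, a plane cuts off a part of the graph of the minimiser
  that consists of regular points only. There the minimiser \<open>g\<close> is differentiable with gradients near some \<open>\<xi>\<close>, which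
  may be chosen such that \<open>f'' \<xi>\<close> is nondegenerate, and every small convex perturbation of its Legendre transform \<open>U\<close> near
  \<open>\<xi>\<close> gives a competitor.

  If \<open>f'' \<xi>\<close> is positive definite, cutting \<open>g\<close> by a plane of slope \<open>\<xi>\<close> decreases the integral by Jensen's inequality.

  If \<open>f'' \<xi>\<close> is negative in a direction \<open>e\<close>, note that for a ridge function \<open>f = h (n \<bullet> _)\<close> the integral, as a function of
  the Legendre transform \<open>V\<close>, is a quadratic expression in the derivative of \<open>V\<close> orthogonal to \<open>n\<close>. Sums of exponential
  ridge functions are dense, so for every \<open>f\<close> the integral is a quadratic polynomial along segments \<open>U + t W\<close>. Take
  \<open>W = max U G - U\<close>, where \<open>G\<close> is a tent function over the line through \<open>\<xi>\<close> of direction \<open>e\<close>. At \<open>max U G\<close> the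
  derivative in direction \<open>W\<close> is a positive multiple of the integral of \<open>(f'' e \<bullet> e) W\<close> over this line, hence negative.
  But minimality among the functions \<open>U + t W\<close> and among the convexifications of \<open>U - t W\<close>, which by Danskin's
  theorem differ from \<open>U - t W\<close> only by \<open>o(t)\<close>, makes it nonnegative.
\<close>

section \<open>Subgradients and the Legendre transform\<close>

text \<open>Perturbing the transform instead of the minimiser makes every condition local in the
  slope: agreement with \<open>U\<close> away from \<open>\<xi>\<close>, a uniform bound, and
  convexity. Convexity is the obstacle: it admits \<open>U + t W\<close> but not
  \<open>U - t W\<close>, and one-sided variations alone leave the sign of the derivative at
  \<open>U\<close> open on one side. Write \<open>q t\<close> for the energy at
  \<open>U + t W\<close>, a quadratic polynomial. Minimality along the segment gives
  \<open>q' 0 \<ge> 0\<close>, the convexified decrease gives \<open>q' 0 \<le> 0\<close>, so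
  \<open>q t - q 0\<close> is a nonnegative multiple of \<open>t * t\<close> and
  \<open>q' 1 \<ge> 0\<close>, against the sign of the crease. The transform of
  \<open>max U G\<close> need not be differentiable, since \<open>G\<close> is affine on half
  planes; hence \<open>q\<close> is only evaluated at \<open>0\<close>, \<open>1/4\<close>,
  \<open>1/2\<close> and extrapolated to \<open>1\<close>. The constraints \<open>0\<close> and
  \<open>M\<close> stay inactive: the cutting plane lies below \<open>M\<close>, and
  \<open>\<xi>\<close> is chosen nonzero, because where \<open>u\<close> vanishes \<open>0\<close>
  is a subgradient. Since \<open>u\<close> is given on \<open>\<Omega>\<close> only, it is replaced
  by a finite coercive function on the plane that has the same contact points for slopes near
  \<open>\<xi>\<close>.\<close>

definition subgrad :: "('a::euclidean_space \<Rightarrow> real) \<Rightarrow> 'a \<Rightarrow> 'a \<Rightarrow> bool" where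
  "subgrad g x p \<longleftrightarrow> (\<forall>y. g x + p \<bullet> (y - x) \<le> g y)"

definition lconj :: "('a::euclidean_space \<Rightarrow> real) \<Rightarrow> 'a \<Rightarrow> real" where
  "lconj g p = (SUP x. p \<bullet> x - g x)"

text \<open>Finiteness of the conjugate at every slope. The property passes to the conjugate, so on
  convex functions with it \<open>lconj\<close> is an involution without infinite values.\<close>

definition coercive :: "('a::euclidean_space \<Rightarrow> real) \<Rightarrow> bool" where
  "coercive g \<longleftrightarrow> (\<forall>p. bdd_above (range (\<lambda>x. p \<bullet> x - g x)))"

definition subgrad_on :: "'a::euclidean_space set \<Rightarrow> ('a \<Rightarrow> real) \<Rightarrow> 'a \<Rightarrow> 'a \<Rightarrow> bool" where
  "subgrad_on S u x p \<longleftrightarrow> (\<forall>y\<in>S. u x + p \<bullet> (y - x) \<le> u y)"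

text \<open>Separation of the graph point from the strict epigraph. The hyperplane is not vertical
  because \<open>S\<close> contains a ball around \<open>x\<close>, so its slope is a
  subgradient.\<close>

lemma subgrad_on_exists:
  fixes g :: "'a::euclidean_space \<Rightarrow> real"
  assumes g: "convex_on S g" and x: "x \<in> interior S"
  obtains p where "subgrad_on S g x p"
proof -
  obtain \<epsilon> where \<epsilon>: "\<epsilon> > 0" "cball x \<epsilon> \<subseteq> S" using x by (meson mem_interior_cball)
  have cS: "convex {(y, z). y \<in> S \<and> g y < z}"
  proof (rule convexI)
    fix v w :: "'a \<times> real" and s t :: real
    assume v: "v \<in> {(y, z). y \<in> S \<and> g y < z}" and w: "w \<in> {(y, z). y \<in> S \<and> g y < z}" and st: "0 \<le> s" "0 \<le> t" "s + t = 1"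
    obtain y1 z1 y2 z2 where vw: "v = (y1, z1)" "w = (y2, z2)" by (metis surj_pair)
    have *: "g (s *\<^sub>R y1 + t *\<^sub>R y2) \<le> s * g y1 + t * g y2" "s *\<^sub>R y1 + t *\<^sub>R y2 \<in> S"
      using g st v w vw by (auto simp: convex_on_def convex_def)
    have lt: "g y1 < z1" "g y2 < z2" using v w vw by auto
    have "s * g y1 + t * g y2 < s * z1 + t * z2"
    proof (cases "s = 0")
      case True then show ?thesis using lt st by simp
    next
      case False
      then have "s * g y1 < s * z1" using lt st by simp
      moreover have "t * g y2 \<le> t * z2" using lt st by (simp add: mult_left_mono)
      ultimately show ?thesis by linarith
    qed
    then show "s *\<^sub>R v + t *\<^sub>R w \<in> {(y, z). y \<in> S \<and> g y < z}" using * vw by auto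
  qed
  have xS: "x \<in> S" using x interior_subset by blast
  then have "(x, g x + 1) \<in> {(y, z). y \<in> S \<and> g y < z}" by simp
  then have ne: "{(y, z). y \<in> S \<and> g y < z} \<noteq> {}" by blast
  have "\<exists>a b. a \<noteq> 0 \<and> (\<forall>v\<in>{(x, g x)}. a \<bullet> v \<le> b) \<and> (\<forall>v\<in>{(y, z). y \<in> S \<and> g y < z}. b \<le> a \<bullet> v)"
    by (rule separating_hyperplane_sets) (use cS ne in auto)
  then obtain a b where ab: "a \<noteq> 0" "a \<bullet> (x, g x) \<le> b" "\<And>y z. y \<in> S \<Longrightarrow> g y < z \<Longrightarrow> b \<le> a \<bullet> (y, z)"
    by auto
  obtain c d where a: "a = (c, d)" by (metis surj_pair)
  have le: "c \<bullet> x + d * g x \<le> c \<bullet> y + d * z" if "y \<in> S" "g y < z" for y z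
    using ab(2) ab(3)[OF that] a by simp
  have "d \<ge> 0" using le[OF xS, of "g x + 1"] by (simp add: algebra_simps)
  have "d \<noteq> 0"
  proof
    assume "d = 0"
    then have c0: "c \<noteq> 0" using ab(1) a by (auto simp: zero_prod_def)
    let ?y = "x - (\<epsilon> / norm c) *\<^sub>R c"
    have "?y \<in> S" using \<epsilon> c0 by (intro subsetD[OF \<epsilon>(2)]) (simp add: dist_norm)
    then have "c \<bullet> x \<le> c \<bullet> ?y" using le[of ?y "g ?y + 1"] \<open>d = 0\<close> by simp
    then have "(\<epsilon> / norm c) * (c \<bullet> c) \<le> 0" by (simp add: inner_diff_right)
    moreover have "(\<epsilon> / norm c) * (c \<bullet> c) > 0" using \<epsilon>(1) c0 by (intro mult_pos_pos divide_pos_pos) auto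
    ultimately show False by linarith
  qed
  with \<open>d \<ge> 0\<close> have d: "d > 0" by simp
  have le2: "c \<bullet> x + d * g x \<le> c \<bullet> y + d * g y" if "y \<in> S" for y
  proof (rule field_le_epsilon)
    fix e :: real assume "e > 0"
    have "c \<bullet> x + d * g x \<le> c \<bullet> y + d * (g y + e / d)"
      by (rule le[OF that]) (use d \<open>e > 0\<close> in simp)
    then show "c \<bullet> x + d * g x \<le> c \<bullet> y + d * g y + e" using d by (simp add: algebra_simps)
  qed
  show ?thesis
  proof (rule that[of "- (c /\<^sub>R d)"])
    show "subgrad_on S g x (- (c /\<^sub>R d))"
      unfolding subgrad_on_def
    proof
      fix y assume "y \<in> S"
      then have "d * g x \<le> d * g y + (c \<bullet> y - c \<bullet> x)" using le2[of y] by simp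
      then have "g x \<le> g y + (c \<bullet> y - c \<bullet> x) / d"
        using d by (simp add: field_simps)
      then show "g x + - (c /\<^sub>R d) \<bullet> (y - x) \<le> g y"
        by (simp add: inner_diff_right divide_inverse algebra_simps)
    qed
  qed
qed

lemma subgrad_exists:
  fixes g :: "'a::euclidean_space \<Rightarrow> real"
  assumes "convex_on UNIV g"
  obtains p where "subgrad g x p"
proof -
  obtain p where "subgrad_on UNIV g x p" by (rule subgrad_on_exists[OF assms]) simp
  then show ?thesis by (intro that) (simp add: subgrad_on_def subgrad_def)
qed

section \<open>The Legendre-Fenchel transform of finite functions\<close>

lemma lconj_ge: "coercive g \<Longrightarrow> p \<bullet> x - g x \<le> lconj g p"
  unfolding coercive_def lconj_def by (rule cSUP_upper[OF UNIV_I], erule spec)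

lemma lconj_le: "(\<And>x. p \<bullet> x - g x \<le> c) \<Longrightarrow> lconj g p \<le> c"
  unfolding lconj_def by (rule cSUP_least[OF UNIV_not_empty])

lemma lconj_eqI: "p \<bullet> x - g x = c \<Longrightarrow> (\<And>y. p \<bullet> y - g y \<le> c) \<Longrightarrow> lconj g p = c"
  unfolding lconj_def by (rule cSup_eq_maximum) blast+

lemma coerciveI: "(\<And>p. \<exists>c. \<forall>x. p \<bullet> x - g x \<le> c) \<Longrightarrow> coercive g"
  unfolding coercive_def bdd_above_def by blast

lemma coercive_mono: "coercive g \<Longrightarrow> (\<And>x. g x - c \<le> h x) \<Longrightarrow> coercive h"
proof (rule coerciveI)
  fix p assume "coercive g" "\<And>x. g x - c \<le> h x"
  then show "\<exists>c. \<forall>x. p \<bullet> x - h x \<le> c"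
  proof (intro exI allI)
    fix x show "p \<bullet> x - h x \<le> lconj g p + c"
      using lconj_ge[OF \<open>coercive g\<close>, of p x] \<open>\<And>x. g x - c \<le> h x\<close>[of x] by simp
  qed
qed

lemma convex_lconj:
  assumes "coercive g" shows "convex_on UNIV (lconj g)"
proof (rule convex_onI)
  fix t :: real and p q assume t: "0 < t" "t < 1"
  show "lconj g ((1 - t) *\<^sub>R p + t *\<^sub>R q) \<le> (1 - t) * lconj g p + t * lconj g q"
  proof (rule lconj_le)
    fix x
    have "((1 - t) *\<^sub>R p + t *\<^sub>R q) \<bullet> x - g x = (1 - t) * (p \<bullet> x - g x) + t * (q \<bullet> x - g x)"
      by (simp add: inner_add_left algebra_simps)
    also have "\<dots> \<le> (1 - t) * lconj g p + t * lconj g q"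
      using t lconj_ge[OF assms] by (intro add_mono mult_left_mono) auto
    finally show "((1 - t) *\<^sub>R p + t *\<^sub>R q) \<bullet> x - g x \<le> (1 - t) * lconj g p + t * lconj g q" .
  qed
qed simp

text \<open>Equality in the Fenchel-Young inequality. The condition is symmetric, so it passes
  subgradients between \<open>g\<close> and \<open>lconj g\<close>; the gap
  \<open>g x + lconj g p - p \<bullet> x\<close> later serves as a continuous measure of how far
  \<open>p\<close> is from being a subgradient at \<open>x\<close>.\<close>

lemma subgrad_iff_lconj:
  assumes "coercive g" shows "subgrad g x p \<longleftrightarrow> g x + lconj g p = p \<bullet> x"
proof
  assume "subgrad g x p"
  then have "lconj g p = p \<bullet> x - g x"
    by (intro lconj_eqI) (auto simp: subgrad_def inner_diff_right algebra_simps)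
  then show "g x + lconj g p = p \<bullet> x" by simp
next
  assume "g x + lconj g p = p \<bullet> x"
  show "subgrad g x p"
    unfolding subgrad_def
  proof (intro allI)
    fix y
    note \<open>g x + lconj g p = p \<bullet> x\<close>
    moreover have "p \<bullet> y - g y \<le> lconj g p" by (rule lconj_ge[OF assms])
    ultimately show "g x + p \<bullet> (y - x) \<le> g y" by (simp add: inner_diff_right)
  qed
qed

lemma coercive_lconj: "coercive g \<Longrightarrow> coercive (lconj g)"
proof (rule coerciveI)
  fix x assume g: "coercive g"
  show "\<exists>c. \<forall>p. x \<bullet> p - lconj g p \<le> c"
  proof (intro exI allI)
    show "x \<bullet> p - lconj g p \<le> g x" for p using lconj_ge[OF g, of p x] by (simp add: inner_commute)
  qed
qed

lemma lconj_lconj: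
  assumes "convex_on UNIV g" "coercive g" shows "lconj (lconj g) = g"
proof
  fix x
  obtain p where p: "subgrad g x p" using subgrad_exists[OF assms(1)] .
  show "lconj (lconj g) x = g x"
  proof (rule lconj_eqI)
    show "x \<bullet> p - lconj g p = g x" using p subgrad_iff_lconj[OF assms(2)] by (simp add: inner_commute)
    show "x \<bullet> q - lconj g q \<le> g x" for q using lconj_ge[OF assms(2), of q x] by (simp add: inner_commute)
  qed
qed

lemma lconj_attained:
  assumes "convex_on UNIV g" "coercive g"
  obtains x where "g x + lconj g p = p \<bullet> x"
proof -
  obtain x where "subgrad (lconj g) p x" using subgrad_exists[OF convex_lconj[OF assms(2)]] .
  then have "lconj g p + g x = x \<bullet> p"
    using subgrad_iff_lconj[OF coercive_lconj[OF assms(2)]] lconj_lconj[OF assms] by metis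
  then show ?thesis using that by (metis add.commute inner_commute)
qed

text \<open>Order reversal for \<open>c = 0\<close>; used in both directions it makes conjugation
  1-Lipschitz in the sup norm.\<close>

lemma lconj_mono_bound:
  assumes "coercive g" "\<And>x. g x - c \<le> h x" shows "lconj h p \<le> lconj g p + c"
proof (rule lconj_le)
  fix x show "p \<bullet> x - h x \<le> lconj g p + c"
    using lconj_ge[OF assms(1), of p x] assms(2)[of x] by simp
qed

text \<open>The right directional derivative; for convex functions it is everywhere defined and Borel,
  so that integrals of gradients need no discussion of points of nondifferentiability.\<close>

definition rd :: "('a::euclidean_space \<Rightarrow> real) \<Rightarrow> 'a \<Rightarrow> 'a \<Rightarrow> real" where
  "rd v n x = (INF t\<in>{0<..}. (v (x + t *\<^sub>R n) - v x) / t)"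

lemma subgrad_slope:
  assumes "subgrad v x p" "t > 0" shows "p \<bullet> n \<le> (v (x + t *\<^sub>R n) - v x) / t"
proof -
  have "v x + p \<bullet> (x + t *\<^sub>R n - x) \<le> v (x + t *\<^sub>R n)" using assms(1) unfolding subgrad_def by blast
  then show ?thesis using assms(2) by (simp add: field_simps)
qed

lemma rd_le:
  assumes "convex_on UNIV v" "t > 0" shows "rd v n x \<le> (v (x + t *\<^sub>R n) - v x) / t"
proof -
  obtain p where p: "subgrad v x p" using subgrad_exists[OF assms(1)] .
  show ?thesis unfolding rd_def
    by (rule cINF_lower) (use subgrad_slope[OF p] assms(2) in \<open>auto intro!: bdd_belowI2[where m="p \<bullet> n"]\<close>)
qed

lemma rd_ge: "subgrad v x p \<Longrightarrow> p \<bullet> n \<le> rd v n x"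
  unfolding rd_def by (rule cINF_greatest) (use subgrad_slope in auto)

lemma rd_ge_backward:
  assumes "convex_on UNIV v" "t > 0" shows "(v x - v (x - t *\<^sub>R n)) / t \<le> rd v n x"
  unfolding rd_def
proof (rule cINF_greatest)
  fix s :: real assume "s \<in> {0<..}"
  then have s: "s > 0" by simp
  have st: "1 - t / (s + t) = s / (s + t)" using s assms(2) by (simp add: field_simps)
  have eq: "x = (s / (s + t)) *\<^sub>R (x - t *\<^sub>R n) + (t / (s + t)) *\<^sub>R (x + s *\<^sub>R n)"
  proof -
    have "(s / (s + t)) *\<^sub>R (x - t *\<^sub>R n) + (t / (s + t)) *\<^sub>R (x + s *\<^sub>R n)
      = ((s / (s+t)) + (t / (s+t))) *\<^sub>R x + ((t / (s+t)) * s - (s / (s+t)) * t) *\<^sub>R n"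
      by (simp add: algebra_simps)
    also have "\<dots> = x" using s assms(2) by (simp add: add_divide_distrib[symmetric])
    finally show ?thesis by simp
  qed
  have "v x \<le> (s * v (x - t *\<^sub>R n) + t * v (x + s *\<^sub>R n)) / (s + t)"
    using convex_onD[OF assms(1), of "t / (s + t)" "x - t *\<^sub>R n" "x + s *\<^sub>R n"] s assms(2)
    unfolding st eq[symmetric] by (simp add: add_divide_distrib)
  then have "v x * (s + t) \<le> s * v (x - t *\<^sub>R n) + t * v (x + s *\<^sub>R n)"
    using s assms(2) by (subst (asm) pos_le_divide_eq) auto
  then show "(v x - v (x - t *\<^sub>R n)) / t \<le> (v (x + s *\<^sub>R n) - v x) / s"
    using s assms(2) by (simp add: field_simps)
qed auto

lemma slope_mono:
  assumes "convex_on UNIV v" "0 < s" "s \<le> t"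
  shows "(v (x + s *\<^sub>R n) - v x) / s \<le> (v (x + t *\<^sub>R n) - v x) / t"
proof -
  have eq: "x + s *\<^sub>R n = (1 - s/t) *\<^sub>R x + (s/t) *\<^sub>R (x + t *\<^sub>R n)"
    using assms by (simp add: algebra_simps)
  have "v (x + s *\<^sub>R n) \<le> (1 - s/t) * v x + (s/t) * v (x + t *\<^sub>R n)"
    unfolding eq using assms by (intro convex_onD) auto
  then show ?thesis using assms by (simp add: field_simps)
qed

lemma rd_tendsto:
  assumes "convex_on UNIV v"
  shows "(\<lambda>j. (v (x + (1 / real (Suc j)) *\<^sub>R n) - v x) * real (Suc j)) \<longlonglongrightarrow> rd v n x"
proof (rule LIMSEQ_I)
  fix e :: real assume e: "e > 0"
  have "\<exists>t>0. (v (x + t *\<^sub>R n) - v x) / t < rd v n x + e"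
  proof (rule ccontr)
    assume "\<not> ?thesis"
    then have "rd v n x + e \<le> rd v n x"
      unfolding rd_def by (intro cINF_greatest) auto
    then show False using e by simp
  qed
  then obtain t where t: "t > 0" "(v (x + t *\<^sub>R n) - v x) / t < rd v n x + e" by blast
  obtain N where N: "1 / real (Suc N) < t" using t(1) by (metis nat_approx_posE)
  show "\<exists>no. \<forall>j\<ge>no. norm ((v (x + (1 / real (Suc j)) *\<^sub>R n) - v x) * real (Suc j) - rd v n x) < e"
  proof (intro exI[of _ N] allI impI)
    fix j assume "j \<ge> N"
    then have le: "1 / real (Suc j) \<le> t" using N
      by (smt (verit) frac_le of_nat_0_less_iff of_nat_mono zero_less_Suc Suc_le_mono)
    have "(v (x + (1 / real (Suc j)) *\<^sub>R n) - v x) / (1 / real (Suc j)) \<le> (v (x + t *\<^sub>R n) - v x) / t"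
      by (rule slope_mono[OF assms _ le]) simp
    moreover have "rd v n x \<le> (v (x + (1 / real (Suc j)) *\<^sub>R n) - v x) / (1 / real (Suc j))"
      by (rule rd_le[OF assms]) simp
    ultimately show "norm ((v (x + (1 / real (Suc j)) *\<^sub>R n) - v x) * real (Suc j) - rd v n x) < e"
      using t(2) by simp
  qed
qed

lemma rd_eqI:
  assumes "convex_on UNIV v" "d > 0" "\<And>t. 0 < t \<Longrightarrow> t < d \<Longrightarrow> v (x + t *\<^sub>R n) - v x = w (x + t *\<^sub>R n) - w x"
    "convex_on UNIV w"
  shows "rd v n x = rd w n x"
proof (rule LIMSEQ_unique[OF rd_tendsto[OF assms(1)]])
  obtain N where N: "1 / real (Suc N) < d" using assms(2) by (metis nat_approx_posE)
  have "eventually (\<lambda>j. (w (x + (1 / real (Suc j)) *\<^sub>R n) - w x) * real (Suc j)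
     = (v (x + (1 / real (Suc j)) *\<^sub>R n) - v x) * real (Suc j)) sequentially"
  proof (rule eventually_sequentiallyI[of N])
    fix j assume "N \<le> j"
    then have "1 / real (Suc j) \<le> 1 / real (Suc N)" by (simp add: frac_le)
    then show "(w (x + (1 / real (Suc j)) *\<^sub>R n) - w x) * real (Suc j)
     = (v (x + (1 / real (Suc j)) *\<^sub>R n) - v x) * real (Suc j)"
      using assms(3)[of "1 / real (Suc j)"] N by simp
  qed
  then show "(\<lambda>j. (v (x + (1 / real (Suc j)) *\<^sub>R n) - v x) * real (Suc j)) \<longlonglongrightarrow> rd w n x"
    by (rule Lim_transform_eventually[OF rd_tendsto[OF assms(4)]])
qed

lemma convex_continuous: "convex_on UNIV (v::'a::euclidean_space \<Rightarrow> real) \<Longrightarrow> continuous_on S v"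
  using convex_on_continuous[OF open_UNIV] continuous_on_subset by blast

lemma rd_measurable [measurable]:
  assumes "convex_on UNIV v" shows "rd v n \<in> borel_measurable borel"
proof (rule borel_measurable_LIMSEQ_real[OF rd_tendsto[OF assms]])
  show "(\<lambda>x. (v (x + (1 / real (Suc j)) *\<^sub>R n) - v x) * real (Suc j)) \<in> borel_measurable borel" for j
    by (intro borel_measurable_continuous_onI continuous_intros continuous_on_compose2[OF convex_continuous[OF assms]]) auto
qed

lemma rd_linear:
  assumes "convex_on UNIV v" "convex_on UNIV w" "convex_on UNIV z" "\<And>x. z x = a * v x + b * w x"
  shows "rd z n x = a * rd v n x + b * rd w n x"
proof (rule LIMSEQ_unique[OF rd_tendsto[OF assms(3)]])
  have "(\<lambda>j. a * ((v (x + (1 / real (Suc j)) *\<^sub>R n) - v x) * real (Suc j)) +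
     b * ((w (x + (1 / real (Suc j)) *\<^sub>R n) - w x) * real (Suc j))) \<longlonglongrightarrow> a * rd v n x + b * rd w n x"
    by (intro tendsto_intros rd_tendsto assms)
  then show "(\<lambda>j. (z (x + (1 / real (Suc j)) *\<^sub>R n) - z x) * real (Suc j)) \<longlonglongrightarrow> a * rd v n x + b * rd w n x"
    by (simp add: assms(4) algebra_simps)
qed

section \<open>Derivatives of convex functions on the line\<close>

lemma rd_subgrad_real:
  fixes a :: "real \<Rightarrow> real"
  assumes "convex_on UNIV a" shows "subgrad a s (rd a 1 s)"
  unfolding subgrad_def
proof
  fix y
  consider "y > s" | "y = s" | "y < s" by linarith
  then show "a s + rd a 1 s \<bullet> (y - s) \<le> a y"
  proof cases
    case 1
    then show ?thesis using rd_le[OF assms, of "y - s" 1 s] by (simp add: field_simps)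
  next
    case 2
    then show ?thesis by simp
  next
    case 3
    have "(a s - a (s - (s - y) *\<^sub>R 1)) / (s - y) \<le> rd a 1 s"
      by (rule rd_ge_backward[OF assms]) (use 3 in simp)
    then show ?thesis using 3 by (simp add: field_simps)
  qed
qed

lemma rd_mono_real:
  fixes a :: "real \<Rightarrow> real"
  assumes "convex_on UNIV a" "s \<le> t" shows "rd a 1 s \<le> rd a 1 t"
proof (cases "s = t")
  case False
  then have st: "s < t" using assms by simp
  have "a s + rd a 1 s * (t - s) \<le> a t" "a t + rd a 1 t * (s - t) \<le> a s"
    using rd_subgrad_real[OF assms(1)] unfolding subgrad_def by (metis inner_real_def)+
  then have "rd a 1 s * (t - s) \<le> rd a 1 t * (t - s)" by (simp add: algebra_simps)
  then show ?thesis using st by simp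
qed simp

lemma rd_bounded_on_interval:
  fixes a :: "real \<Rightarrow> real"
  assumes "convex_on UNIV a"
  obtains L where "L > 0" "\<And>s. s \<in> {\<alpha>..\<beta>} \<Longrightarrow> \<bar>rd a 1 s\<bar> \<le> L"
proof
  show "\<bar>rd a 1 \<alpha>\<bar> + \<bar>rd a 1 \<beta>\<bar> + 1 > 0" by simp
  fix s assume "s \<in> {\<alpha>..\<beta>}"
  then show "\<bar>rd a 1 s\<bar> \<le> \<bar>rd a 1 \<alpha>\<bar> + \<bar>rd a 1 \<beta>\<bar> + 1"
    using rd_mono_real[OF assms, of \<alpha> s] rd_mono_real[OF assms, of s \<beta>] by auto
qed

lemma set_integrable_bounded:
  fixes f :: "'a::euclidean_space \<Rightarrow> 'b::{banach,second_countable_topology}"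
  assumes "f \<in> borel_measurable borel" "S \<in> sets borel" "bounded S" "\<And>s. s \<in> S \<Longrightarrow> norm (f s) \<le> C"
  shows "set_integrable lborel S f"
  unfolding set_integrable_def
proof (rule integrableI_bounded_set[where A=S and B=C])
  show "emeasure lborel S < \<infinity>" using emeasure_bounded_finite[OF assms(3)] .
qed (use assms in \<open>auto split: split_indicator\<close>)

lemma rd_set_integrable:
  fixes a :: "real \<Rightarrow> real"
  assumes "convex_on UNIV a" shows "set_integrable lborel {\<alpha>..\<beta>} (rd a 1)"
proof -
  obtain L where "\<And>s. s \<in> {\<alpha>..\<beta>} \<Longrightarrow> \<bar>rd a 1 s\<bar> \<le> L" using rd_bounded_on_interval[OF assms] by blast
  then show ?thesis by (intro set_integrable_bounded[where C=L] rd_measurable assms) auto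
qed

text \<open>With \<open>N + 1\<close> equal pieces the bounds telescope to
  \<open>D \<beta> - D \<alpha>\<close> times the mesh size. This replaces the fundamental theorem
  of calculus for a derivative that may jump.\<close>

lemma telescoping_bound:
  fixes E D :: "real \<Rightarrow> real"
  assumes ab: "\<alpha> \<le> \<beta>" and E: "\<And>c d. \<alpha> \<le> c \<Longrightarrow> c \<le> d \<Longrightarrow> d \<le> \<beta> \<Longrightarrow> \<bar>E d - E c\<bar> \<le> (D d - D c) * (d - c)"
  shows "E \<beta> = E \<alpha>"
proof -
  have *: "\<bar>E \<beta> - E \<alpha>\<bar> \<le> (D \<beta> - D \<alpha>) * (\<beta> - \<alpha>) / real (Suc N)" for N
  proof -
    let ?h = "(\<beta> - \<alpha>) / real (Suc N)"
    let ?s = "\<lambda>i. \<alpha> + real i * ?h"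
    have h: "?h \<ge> 0" using ab by simp
    have top: "?s (Suc N) = \<beta>" by (simp add: field_simps)
    have le: "?s i \<le> \<beta>" if "i \<le> Suc N" for i
    proof -
      have "real i * ?h \<le> real (Suc N) * ?h" using h that by (intro mult_right_mono) auto
      then show ?thesis using top by linarith
    qed
    have "\<bar>E (?s i) - E \<alpha>\<bar> \<le> (D (?s i) - D \<alpha>) * ?h" if "i \<le> Suc N" for i
      using that
    proof (induction i)
      case (Suc i)
      have ge: "\<alpha> \<le> ?s i" using mult_nonneg_nonneg[OF of_nat_0_le_iff[of i] h] by linarith
      have step: "?s (Suc i) - ?s i = ?h" unfolding of_nat_Suc[of i] distrib_right by simp
      have "?s i \<le> ?s (Suc i)" using step h by linarith
      then have "\<bar>E (?s (Suc i)) - E (?s i)\<bar> \<le> (D (?s (Suc i)) - D (?s i)) * ?h"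
        using E[OF ge _ le[OF Suc.prems]] step by metis
      moreover have "\<bar>E (?s i) - E \<alpha>\<bar> \<le> (D (?s i) - D \<alpha>) * ?h" using Suc by simp
      ultimately have "\<bar>E (?s (Suc i)) - E \<alpha>\<bar> \<le> (D (?s (Suc i)) - D (?s i)) * ?h + (D (?s i) - D \<alpha>) * ?h"
        by linarith
      then show ?case by (simp only: left_diff_distrib)
    qed simp
    from this[of "Suc N"] show ?thesis using top by simp
  qed
  have "(\<lambda>N. (D \<beta> - D \<alpha>) * (\<beta> - \<alpha>) / real (Suc N)) \<longlonglongrightarrow> 0"
    by (intro LIMSEQ_Suc lim_const_over_n)
  then have "\<bar>E \<beta> - E \<alpha>\<bar> \<le> 0"
    by (rule LIMSEQ_le_const) (use * in auto)
  then show ?thesis by simp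
qed

lemma LBINT_bounds:
  fixes f :: "real \<Rightarrow> real"
  assumes "set_integrable lborel {c..d} f" "c \<le> d" "\<And>s. s \<in> {c..d} \<Longrightarrow> m \<le> f s \<and> f s \<le> M"
  shows "m * (d - c) \<le> (LBINT s:{c..d}. f s)" "(LBINT s:{c..d}. f s) \<le> M * (d - c)"
proof -
  have c: "set_integrable lborel {c..d} (\<lambda>s. k)" "(LBINT s:{c..d}. k) = k * (d - c)" for k :: real
    using assms(2) by (simp_all add: set_integrable_def set_lebesgue_integral_def)
  have "(LBINT s:{c..d}. m) \<le> (LBINT s:{c..d}. f s)" "(LBINT s:{c..d}. f s) \<le> (LBINT s:{c..d}. M)"
    using assms(3) by (auto intro!: set_integral_mono c assms(1))
  then show "m * (d - c) \<le> (LBINT s:{c..d}. f s)" "(LBINT s:{c..d}. f s) \<le> M * (d - c)"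
    using c by auto
qed

lemma LBINT_Icc_split:
  fixes f :: "real \<Rightarrow> real"
  assumes "set_integrable lborel {c..e} f" "c \<le> d" "d \<le> e"
  shows "(LBINT s:{c..e}. f s) = (LBINT s:{c..d}. f s) + (LBINT s:{d..e}. f s)"
proof -
  have i: "set_integrable lborel {c..d} f" "set_integrable lborel {d..e} f"
    using assms by (auto intro: set_integrable_subset)
  show ?thesis
    using Henstock_Kurzweil_Integration.integral_combine[OF assms(2,3) set_borel_integral_eq_integral(1)[OF assms(1)]]
    by (simp add: set_borel_integral_eq_integral(2)[OF assms(1)] set_borel_integral_eq_integral(2)[OF i(1)]
        set_borel_integral_eq_integral(2)[OF i(2)])
qed

text \<open>As \<open>rd a 1\<close> is monotone, the integral over \<open>{c..d}\<close> and the
  increment of \<open>a\<close> lie between the same two one-step Riemann sums, and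
  \<open>telescoping_bound\<close> compares them.\<close>

lemma LBINT_rd:
  fixes a :: "real \<Rightarrow> real"
  assumes "convex_on UNIV a" "\<alpha> \<le> \<beta>"
  shows "(LBINT s:{\<alpha>..\<beta>}. rd a 1 s) = a \<beta> - a \<alpha>"
proof -
  let ?I = "\<lambda>c d. (LBINT s:{c..d}. rd a 1 s)"
  have b: "rd a 1 c * (d - c) \<le> ?I c d \<and> ?I c d \<le> rd a 1 d * (d - c)" if "c \<le> d" for c d
    using LBINT_bounds[OF rd_set_integrable[OF assms(1)] that, of "rd a 1 c" "rd a 1 d"]
      rd_mono_real[OF assms(1)] by auto
  have b2: "rd a 1 c * (d - c) \<le> a d - a c \<and> a d - a c \<le> rd a 1 d * (d - c)" for c d
  proof -
    have "a c + rd a 1 c * (d - c) \<le> a d" "a d + rd a 1 d * (c - d) \<le> a c"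
      using rd_subgrad_real[OF assms(1)] unfolding subgrad_def by (metis inner_real_def)+
    then show ?thesis by (simp add: algebra_simps)
  qed
  have "a \<beta> - ?I \<alpha> \<beta> = a \<alpha> - ?I \<alpha> \<alpha>"
  proof (rule telescoping_bound[where D="rd a 1", OF assms(2)])
    fix c d assume cd: "\<alpha> \<le> c" "c \<le> d" "d \<le> \<beta>"
    have "?I \<alpha> d = ?I \<alpha> c + ?I c d" by (rule LBINT_Icc_split[OF rd_set_integrable[OF assms(1)]]) (use cd in auto)
    then show "\<bar>a d - ?I \<alpha> d - (a c - ?I \<alpha> c)\<bar> \<le> (rd a 1 d - rd a 1 c) * (d - c)"
      using b[OF cd(2)] b2[of c d] left_diff_distrib[of "rd a 1 d" "rd a 1 c" "d - c"] by linarith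
  qed
  moreover have "?I \<alpha> \<alpha> = 0" using b[of \<alpha> \<alpha>] by simp
  ultimately show ?thesis by simp
qed

text \<open>The monotone function \<open>rd a 1 s - k\<close> changes sign at a maximiser
  \<open>s0\<close> of \<open>k * s - a s\<close>, so the positive part is integrated by
  \<open>LBINT_rd\<close> over \<open>{s0..\<beta>}\<close>. The result is the conjugate of
  \<open>a\<close> restricted to the interval, up to a term from the end
  \<open>\<beta>\<close>.\<close>

lemma LBINT_rd_pos_part:
  fixes a :: "real \<Rightarrow> real"
  assumes a: "convex_on UNIV a" and s0: "s0 \<in> {\<alpha>..\<beta>}" and max: "\<And>s. s \<in> {\<alpha>..\<beta>} \<Longrightarrow> k * s - a s \<le> k * s0 - a s0"
  shows "(LBINT s:{\<alpha>..\<beta>}. max (rd a 1 s - k) 0) = a \<beta> - k * \<beta> + (k * s0 - a s0)"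
proof -
  obtain L where L: "\<And>s. s \<in> {\<alpha>..\<beta>} \<Longrightarrow> \<bar>rd a 1 s\<bar> \<le> L" using rd_bounded_on_interval[OF a] by blast
  have int: "set_integrable lborel {\<alpha>..\<beta>} (\<lambda>s. max (rd a 1 s - k) 0)"
  proof (rule set_integrable_bounded[where C="L + \<bar>k\<bar>"])
    show "(\<lambda>s. max (rd a 1 s - k) 0) \<in> borel_measurable borel" using rd_measurable[OF a, of 1] by measurable
    show "norm (max (rd a 1 s - k) 0) \<le> L + \<bar>k\<bar>" if "s \<in> {\<alpha>..\<beta>}" for s using L[OF that] by auto
  qed auto
  have lo: "rd a 1 s \<le> k" if "\<alpha> \<le> s" "s < s0" for s
  proof -
    have "rd a 1 s \<le> (a (s + (s0 - s) *\<^sub>R 1) - a s) / (s0 - s)" by (rule rd_le[OF a]) (use that in simp)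
    also have "\<dots> \<le> k" using max[of s] that s0 by (simp add: field_simps)
    finally show ?thesis .
  qed
  \<comment> \<open>\<open>\<beta>\<close> is excluded: for \<open>s0 = \<beta>\<close> the right
    derivative there depends on values of \<open>a\<close> beyond the interval.\<close>
  have hi: "k \<le> rd a 1 s" if "s0 \<le> s" "s < \<beta>" for s
  proof -
    have "k \<le> rd a 1 s0" if "s0 < \<beta>"
      unfolding rd_def
    proof (rule cINF_greatest)
      fix t :: real assume "t \<in> {0<..}"
      then have t: "t > 0" by simp
      let ?u = "min t (\<beta> - s0)"
      have u: "?u > 0" "?u \<le> t" "s0 + ?u \<in> {\<alpha>..\<beta>}" using t that s0 by auto
      have "k \<le> (a (s0 + ?u *\<^sub>R 1) - a s0) / ?u" using max[OF u(3)] u(1) by (simp add: field_simps)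
      also have "\<dots> \<le> (a (s0 + t *\<^sub>R 1) - a s0) / t" by (rule slope_mono[OF a u(1,2)])
      finally show "k \<le> (a (s0 + t *\<^sub>R 1) - a s0) / t" .
    qed auto
    then show ?thesis using rd_mono_real[OF a that(1)] that by linarith
  qed
  have "(LBINT s:{\<alpha>..\<beta>}. max (rd a 1 s - k) 0) = (LBINT s:{\<alpha>..s0}. max (rd a 1 s - k) 0) + (LBINT s:{s0..\<beta>}. max (rd a 1 s - k) 0)"
    using LBINT_Icc_split[OF int] s0 by auto
  also have "(LBINT s:{\<alpha>..s0}. max (rd a 1 s - k) 0) = (LBINT s:{\<alpha>..s0}. 0)"
    by (rule set_lebesgue_integral_cong_AE)
       (use AE_lborel_singleton[of s0] lo rd_measurable[OF a, of 1] in \<open>auto elim!: eventually_mono intro!: max_absorb2\<close>)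
  also have "(LBINT s:{s0..\<beta>}. max (rd a 1 s - k) 0) = (LBINT s:{s0..\<beta>}. rd a 1 s - k)"
    by (rule set_lebesgue_integral_cong_AE)
       (use AE_lborel_singleton[of \<beta>] hi rd_measurable[OF a, of 1] in \<open>auto elim!: eventually_mono intro!: max_absorb1\<close>)
  also have "\<dots> = (LBINT s:{s0..\<beta>}. rd a 1 s) - (LBINT s:{s0..\<beta>}. k)"
    by (intro set_integral_diff rd_set_integrable a set_integrable_bounded[where C="\<bar>k\<bar>"]) auto
  also have "\<dots> = a \<beta> - a s0 - k * (\<beta> - s0)"
    using s0 LBINT_rd[OF a, of s0 \<beta>] by (simp add: set_lebesgue_integral_def)
  finally show ?thesis by (simp add: algebra_simps)
qed

text \<open>If both suprema are attained in \<open>{\<alpha>..\<beta>}\<close>, this is the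
  difference of two instances of \<open>LBINT_rd_pos_part\<close>, whose end terms cancel. If one is
  attained at a point outside, where the functions coincide, convexity makes that point a maximiser
  for the other as well, and both sides vanish.\<close>

lemma lconj_diff_real:
  fixes a b :: "real \<Rightarrow> real"
  assumes a: "convex_on UNIV a" "coercive a" and b: "convex_on UNIV b" "coercive b"
    and eq: "\<And>s. s \<notin> {\<alpha><..<\<beta>} \<Longrightarrow> a s = b s" and ab: "\<alpha> \<le> \<beta>"
  shows "lconj a k - lconj b k = (LBINT s:{\<alpha>..\<beta>}. max (rd a 1 s - k) 0) - (LBINT s:{\<alpha>..\<beta>}. max (rd b 1 s - k) 0)"
proof -
  have ex: "\<exists>s0\<in>{\<alpha>..\<beta>}. \<forall>s\<in>{\<alpha>..\<beta>}. k * s - c s \<le> k * s0 - c s0" if "convex_on UNIV c" for c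
    using ab by (intro continuous_attains_sup continuous_on_diff continuous_on_mult continuous_on_const
        continuous_on_id convex_continuous that) auto
  obtain sa where sa: "sa \<in> {\<alpha>..\<beta>}" "\<And>s. s \<in> {\<alpha>..\<beta>} \<Longrightarrow> k * s - a s \<le> k * sa - a sa" using ex[OF a(1)] by blast
  obtain sb where sb: "sb \<in> {\<alpha>..\<beta>}" "\<And>s. s \<in> {\<alpha>..\<beta>} \<Longrightarrow> k * s - b s \<le> k * sb - b sb" using ex[OF b(1)] by blast
  have key: "lconj a k - lconj b k = (k * sa - a sa) - (k * sb - b sb)"
    if a: "convex_on UNIV a" "coercive a" and b: "convex_on UNIV b" "coercive b"
    and eq: "\<And>s. s \<notin> {\<alpha><..<\<beta>} \<Longrightarrow> a s = b s"
    and sa: "sa \<in> {\<alpha>..\<beta>}" "\<And>s. s \<in> {\<alpha>..\<beta>} \<Longrightarrow> k * s - a s \<le> k * sa - a sa"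
    and sb: "sb \<in> {\<alpha>..\<beta>}" "\<And>s. s \<in> {\<alpha>..\<beta>} \<Longrightarrow> k * s - b s \<le> k * sb - b sb"
    and x: "b x + lconj b k = k * x" "x \<notin> {\<alpha>..\<beta>}" for a b sa sb x
  proof -
    have cvx: "convex_on UNIV (\<lambda>s. a s - k * s)" "convex_on UNIV (\<lambda>s. b s - k * s)"
    proof -
      have "convex_on UNIV (\<lambda>s. - k * s)" by (simp add: convex_on_def algebra_simps)
      then show "convex_on UNIV (\<lambda>s. a s - k * s)" "convex_on UNIV (\<lambda>s. b s - k * s)"
        using convex_on_add[OF a(1)] convex_on_add[OF b(1)] by fastforce+
    qed
    have bmin: "b x - k * x \<le> b s - k * s" for s
      using lconj_ge[OF b(2), of k s] x(1) by simp
    obtain d where d: "d > 0" "ball x d \<subseteq> - {\<alpha>..\<beta>}"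
      by (rule openE[of "- {\<alpha>..\<beta>}" x]) (use x(2) in \<open>auto simp: open_Compl\<close>)
    have ae: "a s = b s" if "s \<in> ball x d" for s
    proof -
      have "s \<notin> {\<alpha>..\<beta>}" using d(2) that by blast
      then show ?thesis by (intro eq) auto
    qed
    have "\<forall>s\<in>UNIV. a x - k * x \<le> a s - k * s"
      by (rule convex_local_global_minimum[OF d(1) cvx(1)]) (use bmin ae d(1) in auto)
    then have amin: "a x - k * x \<le> a s - k * s" for s by simp
    have axb: "a x = b x" using ae d(1) by simp
    have la: "lconj a k = k * x - a x"
    proof (rule lconj_eqI[where x=x])
      show "k \<bullet> y - a y \<le> k * x - a x" for y using amin[of y] by simp
    qed simp
    have mono: "c \<gamma> - k * \<gamma> \<le> c s - k * s" if c: "convex_on UNIV (\<lambda>s. c s - k * s)"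
      "\<And>s. c x - k * x \<le> c s - k * s" and \<gamma>: "\<gamma> \<in> closed_segment s x" for c \<gamma> s
    proof -
      obtain t where t: "0 \<le> t" "t \<le> 1" "\<gamma> = (1 - t) *\<^sub>R s + t *\<^sub>R x"
        using \<gamma> unfolding in_segment by blast
      have "c \<gamma> - k * \<gamma> \<le> (1 - t) * (c s - k * s) + t * (c x - k * x)"
        using convex_onD[OF c(1) t(1,2), of s x] t(3) by simp
      also have "\<dots> \<le> (1 - t) * (c s - k * s) + t * (c s - k * s)"
        using c(2)[of s] t by (intro add_left_mono mult_left_mono) auto
      finally show ?thesis by (simp add: algebra_simps)
    qed
    \<comment> \<open>The end of the interval that faces \<open>x\<close>; the restricted maxima of
      both functions are attained there.\<close>
    define \<gamma> where "\<gamma> = (if x > \<beta> then \<beta> else \<alpha>)"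
    have seg: "\<gamma> \<in> closed_segment s x" if "s \<in> {\<alpha>..\<beta>}" for s
      using x(2) that by (auto simp: \<gamma>_def closed_segment_eq_real_ivl)
    have g: "\<gamma> \<in> {\<alpha>..\<beta>}" "a \<gamma> = b \<gamma>" using ab eq by (auto simp: \<gamma>_def)
    have "a sa - k * sa = a \<gamma> - k * \<gamma>"
      using mono[OF cvx(1) amin seg[OF sa(1)]] sa(2)[OF g(1)] by simp
    moreover have "b sb - k * sb = b \<gamma> - k * \<gamma>"
      using mono[OF cvx(2) bmin seg[OF sb(1)]] sb(2)[OF g(1)] by simp
    ultimately show ?thesis using la x(1) g axb by simp
  qed
  obtain xa where xa: "a xa + lconj a k = k * xa" using lconj_attained[OF a, of k] by auto
  obtain xb where xb: "b xb + lconj b k = k * xb" using lconj_attained[OF b, of k] by auto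
  have "lconj a k - lconj b k = (k * sa - a sa) - (k * sb - b sb)"
  proof (cases "xa \<in> {\<alpha>..\<beta>} \<and> xb \<in> {\<alpha>..\<beta>}")
    case True
    then have "lconj a k \<le> k * sa - a sa" "lconj b k \<le> k * sb - b sb"
      using sa(2)[of xa] sb(2)[of xb] xa xb by auto
    moreover have "k * sa - a sa \<le> lconj a k" "k * sb - b sb \<le> lconj b k"
      using lconj_ge[OF a(2), of k sa] lconj_ge[OF b(2), of k sb] by auto
    ultimately show ?thesis by linarith
  next
    case False
    then consider "xb \<notin> {\<alpha>..\<beta>}" | "xa \<notin> {\<alpha>..\<beta>}" by blast
    then show ?thesis
    proof cases
      case 1
      show ?thesis by (rule key[OF a b eq sa sb xb 1])
    next
      case 2
      have "lconj b k - lconj a k = (k * sb - b sb) - (k * sa - a sa)"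
        by (rule key[OF b a eq[symmetric] sb sa xa 2])
      then show ?thesis by simp
    qed
  qed
  then show ?thesis
    using LBINT_rd_pos_part[OF a(1) sa] LBINT_rd_pos_part[OF b(1) sb] eq[of \<beta>] by simp
qed

text \<open>Taylor's formula at \<open>-L\<close> with integral remainder. The positive part extends
  the remainder to a fixed interval, so that \<open>q\<close> can vary with a second variable under
  Fubini.\<close>

lemma taylor_pos_part:
  fixes h h' h'' :: "real \<Rightarrow> real"
  assumes h: "\<And>x. (h has_real_derivative h' x) (at x)" "\<And>x. (h' has_real_derivative h'' x) (at x)"
    and c: "continuous_on UNIV h''" and q: "\<bar>q\<bar> \<le> L"
  shows "(LBINT k:{-L..L}. h'' k * max (q - k) 0) = h q - h (-L) - h' (-L) * (q + L)"
proof -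
  have cont: "continuous_on S (\<lambda>k. h'' k * max (q - k) 0)" for S
    by (intro continuous_intros continuous_on_subset[OF c]) auto
  have int: "set_integrable lborel {-L..L} (\<lambda>k. h'' k * max (q - k) 0)"
    by (rule borel_integrable_atLeastAtMost'[OF cont])
  have "(LBINT k:{-L..L}. h'' k * max (q - k) 0) = (LBINT k:{-L..q}. h'' k * max (q - k) 0) + (LBINT k:{q..L}. h'' k * max (q - k) 0)"
    by (rule LBINT_Icc_split[OF int]) (use q in auto)
  also have "(LBINT k:{q..L}. h'' k * max (q - k) 0) = (LBINT k:{q..L}. 0)"
    by (rule set_lebesgue_integral_cong) auto
  also have "(LBINT k:{-L..q}. h'' k * max (q - k) 0) = (LBINT k:{-L..q}. h'' k * (q - k))"
    by (rule set_lebesgue_integral_cong) auto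
  also have "\<dots> = (h' q * (q - q) + h q) - (h' (-L) * (q - (-L)) + h (-L))"
    unfolding set_lebesgue_integral_def real_scaleR_def mult.commute[of "indicator _ _"]
  proof (rule integral_FTC_Icc_real)
    show "-L \<le> q" using q by simp
    show "DERIV (\<lambda>k. h' k * (q - k) + h k) x :> h'' x * (q - x)" for x
      by (auto intro!: derivative_eq_intros h)
    show "isCont (\<lambda>k. h'' k * (q - k)) x" for x
      using c by (auto intro!: continuous_intros simp: continuous_on_eq_continuous_at)
  qed
  finally show ?thesis by simp
qed

lemma lborel_pair_integrable_bounded:
  fixes f :: "('a::euclidean_space \<times> 'b::euclidean_space) \<Rightarrow> real"
  assumes "f \<in> borel_measurable (lborel \<Otimes>\<^sub>M lborel)" "bounded S" "bounded T"
    "\<And>x y. \<bar>f (x, y)\<bar> \<le> C" "\<And>x y. x \<notin> S \<or> y \<notin> T \<Longrightarrow> f (x, y) = 0"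
  shows "integrable (lborel \<Otimes>\<^sub>M lborel) f"
proof -
  have b: "bounded (closure S \<times> closure T)" using assms by (intro bounded_Times) auto
  show ?thesis
    unfolding lborel_prod
  proof (rule integrableI_bounded_set[where A="closure S \<times> closure T" and B=C])
    show "closure S \<times> closure T \<in> sets lborel" by (simp add: closed_Times)
    show "f \<in> borel_measurable lborel" using assms(1) by (simp add: lborel_prod)
    show "emeasure lborel (closure S \<times> closure T) < \<infinity>" using emeasure_bounded_finite[OF b] .
    show "AE x in lborel. x \<in> closure S \<times> closure T \<longrightarrow> norm (f x) \<le> C" using assms(4) by auto
    show "AE x in lborel. x \<notin> closure S \<times> closure T \<longrightarrow> f x = 0"
    proof (intro AE_I2 impI)
      fix z assume z: "z \<notin> closure S \<times> closure T"
      obtain x y where "z = (x, y)" by (metis surj_pair)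
      then show "f z = 0"
        using z assms(5)[of x y] closure_subset[of S] closure_subset[of T] by blast
    qed
  qed
qed

lemma continuous_bounded_Icc:
  fixes h :: "real \<Rightarrow> real"
  assumes "continuous_on UNIV h"
  obtains C where "C \<ge> 0" "\<And>k. k \<in> {-L..L} \<Longrightarrow> \<bar>h k\<bar> \<le> C"
proof -
  have "bounded (h ` {-L..L})" using assms by (intro compact_imp_bounded compact_continuous_image continuous_on_subset[OF assms]) auto
  then obtain C where "C > 0" "\<And>y. y \<in> h ` {-L..L} \<Longrightarrow> norm y \<le> C" using bounded_pos by metis
  then show ?thesis by (intro that[of C]) auto
qed

text \<open>Both sides equal the double integral of \<open>h'' k * (max (a' s - k) 0 - max (b' s - k) 0)\<close>.\<close>

lemma integral_derivative_eq_integral_lconj: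
  fixes a b h h' h'' :: "real \<Rightarrow> real"
  assumes a: "convex_on UNIV a" "coercive a" and b: "convex_on UNIV b" "coercive b"
    and eq: "\<And>s. s \<notin> {\<alpha><..<\<beta>} \<Longrightarrow> a s = b s" and ab: "\<alpha> \<le> \<beta>"
    and h: "\<And>x. (h has_real_derivative h' x) (at x)" "\<And>x. (h' has_real_derivative h'' x) (at x)"
      "continuous_on UNIV h''"
    and L: "\<And>s. s \<in> {\<alpha>..\<beta>} \<Longrightarrow> \<bar>rd a 1 s\<bar> \<le> L" "\<And>s. s \<in> {\<alpha>..\<beta>} \<Longrightarrow> \<bar>rd b 1 s\<bar> \<le> L"
  shows "(LBINT s:{\<alpha>..\<beta>}. h (rd a 1 s) - h (rd b 1 s)) = (LBINT k:{-L..L}. h'' k * (lconj a k - lconj b k))"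
proof -
  note [measurable] = rd_measurable[OF a(1)] rd_measurable[OF b(1)]
  have [measurable]: "h'' \<in> borel_measurable borel" using h(3) by (rule borel_measurable_continuous_onI)
  obtain C where C: "C \<ge> 0" "\<And>k. k \<in> {-L..L} \<Longrightarrow> \<bar>h'' k\<bar> \<le> C" using continuous_bounded_Icc[OF h(3)] by blast
  define G where "G s k = indicator {\<alpha>..\<beta>} s * (indicator {-L..L} k * (h'' k * (max (rd a 1 s - k) 0 - max (rd b 1 s - k) 0)))" for s k :: real
  have intG: "integrable (lborel \<Otimes>\<^sub>M lborel) (\<lambda>(s, k). G s k)"
  proof (rule lborel_pair_integrable_bounded[where S="{\<alpha>..\<beta>}" and T="{-L..L}" and C="C * (2 * L + 2 * L)"])
    show "(\<lambda>(s, k). G s k) \<in> borel_measurable (lborel \<Otimes>\<^sub>M lborel)"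
      unfolding G_def by measurable
    show "\<bar>case (s, k) of (s, k) \<Rightarrow> G s k\<bar> \<le> C * (2 * L + 2 * L)" for s k
    proof (cases "s \<in> {\<alpha>..\<beta>} \<and> k \<in> {-L..L}")
      case True
      have "\<bar>max (rd a 1 s - k) 0 - max (rd b 1 s - k) 0\<bar> \<le> 2 * L + 2 * L"
        using True L[of s] by auto
      then have "\<bar>h'' k\<bar> * \<bar>max (rd a 1 s - k) 0 - max (rd b 1 s - k) 0\<bar> \<le> C * (2 * L + 2 * L)"
        using C True by (intro mult_mono) auto
      then show ?thesis using True by (simp add: G_def abs_mult)
    next
      case False
      have "0 \<le> L" using L(1)[of \<alpha>] ab by auto
      then show ?thesis using False C by (auto simp: G_def)
    qed
  qed (auto simp: G_def)
  have s: "(\<integral>k. G s k \<partial>lborel) = indicator {\<alpha>..\<beta>} s * (h (rd a 1 s) - h (rd b 1 s) - h' (-L) * (rd a 1 s - rd b 1 s))" for s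
  proof (cases "s \<in> {\<alpha>..\<beta>}")
    case True
    have i: "set_integrable lborel {-L..L} (\<lambda>k. h'' k * max (q - k) 0)" for q
      by (rule borel_integrable_atLeastAtMost') (intro continuous_intros continuous_on_subset[OF h(3)], auto)
    have "(\<integral>k. G s k \<partial>lborel) = (LBINT k:{-L..L}. h'' k * max (rd a 1 s - k) 0 - h'' k * max (rd b 1 s - k) 0)"
      using True by (simp add: G_def set_lebesgue_integral_def right_diff_distrib)
    also have "\<dots> = (LBINT k:{-L..L}. h'' k * max (rd a 1 s - k) 0) - (LBINT k:{-L..L}. h'' k * max (rd b 1 s - k) 0)"
      by (rule set_integral_diff(2)[OF i i])
    also have "\<dots> = h (rd a 1 s) - h (rd b 1 s) - h' (-L) * (rd a 1 s - rd b 1 s)"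
      using taylor_pos_part[OF h L(1)[OF True]] taylor_pos_part[OF h L(2)[OF True]] by (simp add: algebra_simps)
    finally show ?thesis using True by simp
  qed (simp add: G_def)
  have k: "(\<integral>s. G s k \<partial>lborel) = indicator {-L..L} k * (h'' k * (lconj a k - lconj b k))" for k
  proof -
    have i: "set_integrable lborel {\<alpha>..\<beta>} (\<lambda>s. max (rd c 1 s - k) 0)" if "convex_on UNIV c" "\<And>s. s \<in> {\<alpha>..\<beta>} \<Longrightarrow> \<bar>rd c 1 s\<bar> \<le> L" for c :: "real \<Rightarrow> real"
    proof (rule set_integrable_bounded[where C="L + \<bar>k\<bar>"])
      show "(\<lambda>s. max (rd c 1 s - k) 0) \<in> borel_measurable borel" using rd_measurable[OF that(1), of 1] by measurable
      show "norm (max (rd c 1 s - k) 0) \<le> L + \<bar>k\<bar>" if "s \<in> {\<alpha>..\<beta>}" for s using \<open>\<And>s. s \<in> {\<alpha>..\<beta>} \<Longrightarrow> \<bar>rd c 1 s\<bar> \<le> L\<close>[OF that] by auto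
    qed auto
    have "(\<integral>s. G s k \<partial>lborel) = (indicator {-L..L} k * h'' k) * (LBINT s:{\<alpha>..\<beta>}. max (rd a 1 s - k) 0 - max (rd b 1 s - k) 0)"
      unfolding G_def set_lebesgue_integral_def
      by (subst integral_mult_right_zero[symmetric]) (rule Bochner_Integration.integral_cong, auto)
    also have "(LBINT s:{\<alpha>..\<beta>}. max (rd a 1 s - k) 0 - max (rd b 1 s - k) 0) = lconj a k - lconj b k"
      using set_integral_diff(2)[OF i[OF a(1) L(1)] i[OF b(1) L(2)]] lconj_diff_real[OF a b eq ab] by simp
    finally show ?thesis by simp
  qed
  have hm: "h \<in> borel_measurable borel"
    using h(1) by (intro borel_measurable_continuous_onI) (auto simp: continuous_on_eq_continuous_at intro!: DERIV_isCont)
  note [measurable] = hm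
  have hc: "continuous_on UNIV h" using h(1) by (auto simp: continuous_on_eq_continuous_at intro!: DERIV_isCont)
  obtain M where M: "\<And>k. k \<in> {-L..L} \<Longrightarrow> \<bar>h k\<bar> \<le> M" using continuous_bounded_Icc[OF hc] by blast
  have i1: "set_integrable lborel {\<alpha>..\<beta>} (\<lambda>s. h (rd a 1 s) - h (rd b 1 s))"
  proof (rule set_integrable_bounded[where C="M + M"])
    show "(\<lambda>s. h (rd a 1 s) - h (rd b 1 s)) \<in> borel_measurable borel" by measurable
    show "norm (h (rd a 1 s) - h (rd b 1 s)) \<le> M + M" if "s \<in> {\<alpha>..\<beta>}" for s
    proof -
      have "rd a 1 s \<in> {-L..L}" "rd b 1 s \<in> {-L..L}" using L[OF that] by (auto simp: abs_le_iff)
      then show ?thesis using M[of "rd a 1 s"] M[of "rd b 1 s"] by simp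
    qed
  qed auto
  \<comment> \<open>The first-order Taylor term drops out, because \<open>a\<close> and
    \<open>b\<close> have the same increment over the interval.\<close>
  have "(LBINT s:{\<alpha>..\<beta>}. h (rd a 1 s) - h (rd b 1 s)) =
      (LBINT s:{\<alpha>..\<beta>}. (h (rd a 1 s) - h (rd b 1 s)) - h' (-L) * (rd a 1 s - rd b 1 s))"
  proof -
    have i2: "set_integrable lborel {\<alpha>..\<beta>} (\<lambda>s. rd a 1 s - rd b 1 s)"
      by (rule set_integral_diff(1)[OF rd_set_integrable[OF a(1)] rd_set_integrable[OF b(1)]])
    have "(LBINT s:{\<alpha>..\<beta>}. rd a 1 s - rd b 1 s) = 0"
      using set_integral_diff(2)[OF rd_set_integrable[OF a(1)] rd_set_integrable[OF b(1)], of \<alpha> \<beta>]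
        LBINT_rd[OF a(1) ab] LBINT_rd[OF b(1) ab] eq by simp
    then have "(LBINT s:{\<alpha>..\<beta>}. h' (-L) * (rd a 1 s - rd b 1 s)) = 0"
      by simp
    then show ?thesis using set_integral_diff(2)[OF i1 set_integrable_mult_right[OF i2, of "h' (-L)"]] by simp
  qed
  also have "\<dots> = (\<integral>s. (\<integral>k. G s k \<partial>lborel) \<partial>lborel)" by (simp add: s set_lebesgue_integral_def)
  also have "\<dots> = (\<integral>k. (\<integral>s. G s k \<partial>lborel) \<partial>lborel)" by (rule lborel_pair.Fubini_integral[OF intG, symmetric])
  also have "\<dots> = (LBINT k:{-L..L}. h'' k * (lconj a k - lconj b k))" by (simp add: k set_lebesgue_integral_def)
  finally show ?thesis .
qed

text \<open>For \<open>k > L\<close> the positive parts in \<open>lconj_diff_real\<close> vanish;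
  for \<open>k < -L\<close> they are the full differences \<open>rd _ 1 s - k\<close>, whose
  integrals depend on the end values only.\<close>

lemma lconj_eq_outside_slopes:
  fixes a b :: "real \<Rightarrow> real"
  assumes a: "convex_on UNIV a" "coercive a" and b: "convex_on UNIV b" "coercive b"
    and eq: "\<And>s. s \<notin> {\<alpha><..<\<beta>} \<Longrightarrow> a s = b s" and ab: "\<alpha> \<le> \<beta>"
    and L: "\<And>s. s \<in> {\<alpha>..\<beta>} \<Longrightarrow> \<bar>rd a 1 s\<bar> \<le> L" "\<And>s. s \<in> {\<alpha>..\<beta>} \<Longrightarrow> \<bar>rd b 1 s\<bar> \<le> L"
    and k: "k \<notin> {-L..L}"
  shows "lconj a k = lconj b k"
proof -
  have "(LBINT s:{\<alpha>..\<beta>}. max (rd a 1 s - k) 0) = (LBINT s:{\<alpha>..\<beta>}. max (rd b 1 s - k) 0)"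
  proof (cases "k > L")
    case True
    have "(LBINT s:{\<alpha>..\<beta>}. max (rd c 1 s - k) 0) = (LBINT s:{\<alpha>..\<beta>}. 0)" if "\<And>s. s \<in> {\<alpha>..\<beta>} \<Longrightarrow> \<bar>rd c 1 s\<bar> \<le> L" for c :: "real \<Rightarrow> real"
      by (rule set_lebesgue_integral_cong) (use that True in fastforce)+
    then show ?thesis using L by metis
  next
    case False
    with k have kL: "k < -L" by auto
    have "(LBINT s:{\<alpha>..\<beta>}. max (rd c 1 s - k) 0) = c \<beta> - c \<alpha> - (LBINT s:{\<alpha>..\<beta>}. k)"
      if "convex_on UNIV c" "\<And>s. s \<in> {\<alpha>..\<beta>} \<Longrightarrow> \<bar>rd c 1 s\<bar> \<le> L" for c :: "real \<Rightarrow> real"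
    proof -
      have "(LBINT s:{\<alpha>..\<beta>}. max (rd c 1 s - k) 0) = (LBINT s:{\<alpha>..\<beta>}. rd c 1 s - k)"
        by (rule set_lebesgue_integral_cong) (use that(2) kL in fastforce)+
      also have "\<dots> = (LBINT s:{\<alpha>..\<beta>}. rd c 1 s) - (LBINT s:{\<alpha>..\<beta>}. k)"
        by (intro set_integral_diff rd_set_integrable that set_integrable_bounded[where C="\<bar>k\<bar>"]) auto
      finally show ?thesis using LBINT_rd[OF that(1) ab] by simp
    qed
    from this[OF a(1) L(1)] this[OF b(1) L(2)] show ?thesis using eq by simp
  qed
  then show ?thesis using lconj_diff_real[OF a b eq ab, of k] by simp
qed

section \<open>Slices of functions on the plane\<close>

definition perp :: "real^2 \<Rightarrow> real^2" where
  "perp n = vector [- n $ 2, n $ 1]"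

lemma perp_nth [simp]: "perp n $ 1 = - n $ 2" "perp n $ 2 = n $ 1"
  by (simp_all add: perp_def)

lemma inner_real2: "(x::real^2) \<bullet> y = x $ 1 * y $ 1 + x $ 2 * y $ 2"
  by (simp add: inner_vec_def sum_2)

lemma perp_inner [simp]: "perp n \<bullet> n = 0" "n \<bullet> perp n = 0" "perp n \<bullet> perp m = n \<bullet> m"
  by (simp_all add: inner_real2 algebra_simps)

lemma norm_perp [simp]: "norm (perp n) = norm n"
  by (simp add: norm_eq_sqrt_inner)

lemma perp_expand:
  assumes "norm n = 1" shows "(n \<bullet> x) *\<^sub>R n + (perp n \<bullet> x) *\<^sub>R perp n = x"
proof -
  have n: "n $ 1 * n $ 1 + n $ 2 * n $ 2 = 1"
    using assms by (simp add: norm_eq_sqrt_inner inner_real2)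
  have "(n $ 1 * x $ 1 + n $ 2 * x $ 2) * n $ 1 + (- n $ 2 * x $ 1 + n $ 1 * x $ 2) * - n $ 2
      = (n $ 1 * n $ 1 + n $ 2 * n $ 2) * x $ 1"
    "(n $ 1 * x $ 1 + n $ 2 * x $ 2) * n $ 2 + (- n $ 2 * x $ 1 + n $ 1 * x $ 2) * n $ 1
      = (n $ 1 * n $ 1 + n $ 2 * n $ 2) * x $ 2"
    by algebra+
  then show ?thesis using n by (simp add: vec_eq_iff forall_2 inner_real2)
qed

lemma frame_inner:
  assumes "norm n = 1"
  shows "(k *\<^sub>R n + p *\<^sub>R perp n) \<bullet> (s *\<^sub>R n + r *\<^sub>R perp n) = k * s + p * r"
proof -
  have "n \<bullet> n = 1" using assms by (simp add: norm_eq_sqrt_inner)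
  then show ?thesis by (simp add: inner_add_left inner_add_right)
qed

lemma frame_norm:
  assumes "norm n = 1" shows "norm (s *\<^sub>R n + r *\<^sub>R perp n) = sqrt (s\<^sup>2 + r\<^sup>2)"
  using frame_inner[OF assms, of s r s r] by (simp add: norm_eq_sqrt_inner power2_eq_square)

lemma frame_norm_ge:
  assumes "norm n = 1" shows "\<bar>s\<bar> \<le> norm (s *\<^sub>R n + r *\<^sub>R perp n)" "\<bar>r\<bar> \<le> norm (s *\<^sub>R n + r *\<^sub>R perp n)"
  unfolding frame_norm[OF assms] by (auto intro!: real_le_rsqrt)

lemma continuous_on_vector2: "continuous_on UNIV (\<lambda>(s, r). vector [s, r] :: real^2)"
proof -
  have "(\<lambda>(s, r). vector [s, r] :: real^2) = (\<lambda>z. fst z *\<^sub>R axis 1 1 + snd z *\<^sub>R axis 2 1)"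
    by (auto simp: fun_eq_iff vec_eq_iff forall_2 axis_def)
  then show ?thesis by (auto intro!: continuous_intros)
qed

section \<open>Lebesgue measure on the plane in a rotated frame\<close>

lemma lborel_real2: "distr (lborel \<Otimes>\<^sub>M lborel) borel (\<lambda>(s, r). vector [s, r]) = (lborel :: (real^2) measure)"
proof (rule lborel_eqI[symmetric])
  have [measurable]: "(\<lambda>(s, r). vector [s, r] :: real^2) \<in> borel_measurable (lborel \<Otimes>\<^sub>M lborel)"
    unfolding lborel_prod using borel_measurable_continuous_onI[OF continuous_on_vector2] by simp
  fix l u :: "real^2" assume le: "\<And>b. b \<in> Basis \<Longrightarrow> l \<bullet> b \<le> u \<bullet> b"
  have B: "(Basis :: (real^2) set) = {axis 1 1, axis 2 1}"
    by (auto simp: Basis_vec_def UNIV_2)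
  have le': "l $ 1 \<le> u $ 1" "l $ 2 \<le> u $ 2"
    using le[of "axis 1 1"] le[of "axis 2 1"] by (auto simp: B inner_axis)
  have "(\<lambda>(s, r). vector [s, r]) -` box l u \<inter> space (lborel \<Otimes>\<^sub>M lborel)
    = {l $ 1<..<u $ 1} \<times> {l $ 2<..<u $ 2}"
    by (auto simp: box_def B inner_axis space_pair_measure)
  then have "emeasure (distr (lborel \<Otimes>\<^sub>M lborel) borel (\<lambda>(s, r). vector [s, r])) (box l u)
     = emeasure (lborel \<Otimes>\<^sub>M lborel) ({l $ 1<..<u $ 1} \<times> {l $ 2<..<u $ 2})"
    by (subst emeasure_distr) auto
  also have "\<dots> = ennreal (u $ 1 - l $ 1) * ennreal (u $ 2 - l $ 2)"
    using le' by (subst lborel.emeasure_pair_measure_Times) auto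
  also have "\<dots> = ennreal (\<Prod>b\<in>Basis. (u - l) \<bullet> b)"
    using le' by (simp add: B axis_eq_axis inner_axis ennreal_mult inner_diff_left)
  finally show "emeasure (distr (lborel \<Otimes>\<^sub>M lborel) borel (\<lambda>(s, r). vector [s, r])) (box l u) = (\<Prod>b\<in>Basis. (u - l) \<bullet> b)" .
qed simp

lemma lborel_orthogonal:
  fixes T :: "real^2 \<Rightarrow> real^2"
  assumes "orthogonal_transformation T"
  shows "distr lborel borel T = lborel"
proof (rule lborel_eqI[symmetric])
  have lin: "linear T" using assms by (rule orthogonal_transformation_linear)
  have bij: "bij T" using assms orthogonal_transformation_bij by blast
  have [measurable]: "T \<in> borel_measurable lborel"
    using lin by (simp add: borel_measurable_continuous_onI linear_continuous_on linear_conv_bounded_linear)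
  fix l u :: "real^2" assume le: "\<And>b. b \<in> Basis \<Longrightarrow> l \<bullet> b \<le> u \<bullet> b"
  let ?S = "inv T ` box l u"
  have orth: "orthogonal_transformation (inv T)" using assms orthogonal_transformation_inv by blast
  have vim: "T -` box l u = ?S" using bij by (simp add: bij_vimage_eq_inv_image)
  have op: "open ?S" using vim lin by (metis open_box open_vimage linear_continuous_on linear_conv_bounded_linear)
  have lm: "box l u \<in> lmeasurable" by simp
  have "emeasure (distr lborel borel T) (box l u) = emeasure lborel ?S"
    using vim by (subst emeasure_distr) auto
  also have "\<dots> = emeasure lebesgue ?S" using op by simp
  also have "\<dots> = emeasure lebesgue (box l u)"
    using measure_orthogonal_image[OF orth lm] measurable_orthogonal_image[OF orth lm] lm
    by (simp add: emeasure_eq_measure2)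
  also have "\<dots> = (\<Prod>b\<in>Basis. (u - l) \<bullet> b)"
    using le by simp
  finally show "emeasure (distr lborel borel T) (box l u) = (\<Prod>b\<in>Basis. (u - l) \<bullet> b)" .
qed simp

lemma lborel_frame:
  assumes "norm n = 1"
  shows "distr (lborel \<Otimes>\<^sub>M lborel) borel (\<lambda>(s, r). s *\<^sub>R n + r *\<^sub>R perp n) = (lborel :: (real^2) measure)"
proof -
  let ?T = "\<lambda>x::real^2. x $ 1 *\<^sub>R n + x $ 2 *\<^sub>R perp n"
  have lin: "linear ?T" by (rule linearI) (auto simp: algebra_simps)
  have "orthogonal_transformation ?T"
    unfolding orthogonal_transformation_def using lin frame_inner[OF assms] by (simp add: inner_real2[symmetric])
  then have "lborel = distr lborel borel ?T" by (rule lborel_orthogonal[symmetric])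
  also have "\<dots> = distr (distr (lborel \<Otimes>\<^sub>M lborel) borel (\<lambda>(s, r). vector [s, r])) borel ?T"
    by (simp add: lborel_real2)
  also have "\<dots> = distr (lborel \<Otimes>\<^sub>M lborel) borel (?T \<circ> (\<lambda>(s, r). vector [s, r]))"
  proof (rule distr_distr)
    show "(\<lambda>(s, r). vector [s, r] :: real^2) \<in> borel_measurable (lborel \<Otimes>\<^sub>M lborel)"
      unfolding lborel_prod using borel_measurable_continuous_onI[OF continuous_on_vector2] by simp
    show "?T \<in> borel \<rightarrow>\<^sub>M borel"
      by (intro borel_measurable_continuous_onI continuous_intros)
  qed
  also have "?T \<circ> (\<lambda>(s, r). vector [s, r]) = (\<lambda>(s, r). s *\<^sub>R n + r *\<^sub>R perp n)"
    by (auto simp: fun_eq_iff)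
  finally show ?thesis by simp
qed

lemma frame_measurable [measurable]: "(\<lambda>(s, r). s *\<^sub>R n + r *\<^sub>R m :: real^2) \<in> borel_measurable (lborel \<Otimes>\<^sub>M lborel)"
  unfolding lborel_prod case_prod_beta by (auto intro!: borel_measurable_continuous_onI continuous_intros)

lemma integrable_frame:
  fixes \<phi> :: "real^2 \<Rightarrow> real"
  assumes "norm n = 1" "integrable lborel \<phi>"
  shows "integrable (lborel \<Otimes>\<^sub>M lborel) (\<lambda>(s, r). \<phi> (s *\<^sub>R n + r *\<^sub>R perp n))"
proof -
  have "integrable (distr (lborel \<Otimes>\<^sub>M lborel) borel (\<lambda>(s, r). s *\<^sub>R n + r *\<^sub>R perp n)) \<phi>"
    using assms(2) lborel_frame[OF assms(1)] by simp
  then show ?thesis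
    by (subst (asm) integrable_distr_eq) (use assms(2) in \<open>auto simp: case_prod_beta' dest: borel_measurable_integrable\<close>)
qed

lemma integral_frame:
  fixes \<phi> :: "real^2 \<Rightarrow> real"
  assumes "norm n = 1" "integrable lborel \<phi>"
  shows "(\<integral>x. \<phi> x \<partial>lborel) = (\<integral>r. (\<integral>s. \<phi> (s *\<^sub>R n + r *\<^sub>R perp n) \<partial>lborel) \<partial>lborel)"
proof -
  have "(\<integral>x. \<phi> x \<partial>lborel) = (\<integral>x. \<phi> x \<partial>distr (lborel \<Otimes>\<^sub>M lborel) borel (\<lambda>(s, r). s *\<^sub>R n + r *\<^sub>R perp n))"
    using lborel_frame[OF assms(1)] by simp
  also have "\<dots> = (\<integral>z. (case z of (s, r) \<Rightarrow> \<phi> (s *\<^sub>R n + r *\<^sub>R perp n)) \<partial>(lborel \<Otimes>\<^sub>M lborel))"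
    by (subst integral_distr) (use assms(2) in \<open>auto simp: case_prod_beta' dest: borel_measurable_integrable\<close>)
  also have "\<dots> = (\<integral>r. (\<integral>s. \<phi> (s *\<^sub>R n + r *\<^sub>R perp n) \<partial>lborel) \<partial>lborel)"
    using lborel_pair.integral_snd[OF integrable_frame[OF assms]] by simp
  finally show ?thesis .
qed

lemma convex_slice:
  assumes "convex_on UNIV v" shows "convex_on UNIV (\<lambda>s. v (s *\<^sub>R n + x))"
proof (rule convex_onI)
  fix t :: real and a b :: real assume "0 < t" "t < 1"
  have "((1 - t) *\<^sub>R a + t *\<^sub>R b) *\<^sub>R n + x = (1 - t) *\<^sub>R (a *\<^sub>R n + x) + t *\<^sub>R (b *\<^sub>R n + x)"
    by (simp add: algebra_simps)
  then show "v (((1 - t) *\<^sub>R a + t *\<^sub>R b) *\<^sub>R n + x) \<le> (1 - t) * v (a *\<^sub>R n + x) + t * v (b *\<^sub>R n + x)"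
    using convex_onD[OF assms, of t "a *\<^sub>R n + x" "b *\<^sub>R n + x"] \<open>0 < t\<close> \<open>t < 1\<close> by simp
qed simp

lemma coercive_slice:
  assumes "coercive v" "norm n = 1" shows "coercive (\<lambda>s. v (s *\<^sub>R n + x))"
proof (rule coerciveI)
  fix k :: real
  have nn: "n \<bullet> n = 1" using assms(2) by (simp add: norm_eq_sqrt_inner)
  show "\<exists>c. \<forall>s. k \<bullet> s - v (s *\<^sub>R n + x) \<le> c"
  proof (intro exI allI)
    fix s
    show "k \<bullet> s - v (s *\<^sub>R n + x) \<le> lconj v (k *\<^sub>R n) - k * (n \<bullet> x)"
      using lconj_ge[OF assms(1), of "k *\<^sub>R n" "s *\<^sub>R n + x"] by (simp add: inner_add_right nn algebra_simps)
  qed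
qed

lemma rd_slice: "rd (\<lambda>s. v (s *\<^sub>R n + x)) 1 s = rd v n (s *\<^sub>R n + x)"
  unfolding rd_def by (simp add: algebra_simps)

text \<open>Conjugating in the two frame variables one after the other is the full conjugation. The
  partial conjugate along \<open>n\<close> is concave in \<open>r\<close>, which causes the sign; a
  subgradient of its negative in \<open>r\<close> is the maximiser. The formula turns slices of
  \<open>v\<close> along \<open>n\<close> into slices of \<open>lconj v\<close> along
  \<open>perp n\<close>.\<close>

lemma lconj_slice:
  fixes v :: "real^2 \<Rightarrow> real"
  assumes v: "convex_on UNIV v" "coercive v" and n: "norm n = 1"
  shows "lconj (\<lambda>\<sigma>. lconj v (k *\<^sub>R n + \<sigma> *\<^sub>R perp n)) r = - lconj (\<lambda>s. v (s *\<^sub>R n + r *\<^sub>R perp n)) k"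
proof -
  let ?H = "\<lambda>r. lconj (\<lambda>s. v (s *\<^sub>R n + r *\<^sub>R perp n)) k"
  have sl: "convex_on UNIV (\<lambda>s. v (s *\<^sub>R n + x))" "coercive (\<lambda>s. v (s *\<^sub>R n + x))" for x
    using v n by (auto intro: convex_slice coercive_slice)
  have att: "\<exists>s. v (s *\<^sub>R n + r *\<^sub>R perp n) - k * s = - ?H r" for r
    using lconj_attained[OF sl, of "r *\<^sub>R perp n" k] by (smt (verit) inner_real_def)
  have le: "- ?H r \<le> v (s *\<^sub>R n + r *\<^sub>R perp n) - k * s" for r s
    using lconj_ge[OF sl(2), of k s "r *\<^sub>R perp n"] by simp
  have "convex_on UNIV (\<lambda>r. - ?H r)"
  proof (rule convex_onI)
    fix t a b :: real assume t: "0 < t" "t < 1"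
    obtain s1 where s1: "v (s1 *\<^sub>R n + a *\<^sub>R perp n) - k * s1 = - ?H a" using att by blast
    obtain s2 where s2: "v (s2 *\<^sub>R n + b *\<^sub>R perp n) - k * s2 = - ?H b" using att by blast
    let ?s = "(1 - t) * s1 + t * s2"
    let ?r = "(1 - t) *\<^sub>R a + t *\<^sub>R b"
    have eq: "?s *\<^sub>R n + ?r *\<^sub>R perp n = (1 - t) *\<^sub>R (s1 *\<^sub>R n + a *\<^sub>R perp n) + t *\<^sub>R (s2 *\<^sub>R n + b *\<^sub>R perp n)"
      by (simp add: algebra_simps)
    have "- ?H ?r \<le> v (?s *\<^sub>R n + ?r *\<^sub>R perp n) - k * ?s" by (rule le)
    also have "v (?s *\<^sub>R n + ?r *\<^sub>R perp n) \<le> (1 - t) * v (s1 *\<^sub>R n + a *\<^sub>R perp n) + t * v (s2 *\<^sub>R n + b *\<^sub>R perp n)"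
      unfolding eq by (rule convex_onD[OF v(1)]) (use t in auto)
    also have "(1 - t) * v (s1 *\<^sub>R n + a *\<^sub>R perp n) + t * v (s2 *\<^sub>R n + b *\<^sub>R perp n) - k * ?s = (1 - t) * (- ?H a) + t * (- ?H b)"
      unfolding s1[symmetric] s2[symmetric] by (simp add: algebra_simps)
    finally show "- ?H ?r \<le> (1 - t) * (- ?H a) + t * (- ?H b)" by simp
  qed simp
  then obtain \<sigma> where \<sigma>: "subgrad (\<lambda>r. - ?H r) r \<sigma>" using subgrad_exists by blast
  show ?thesis
  proof (rule lconj_eqI[where x=\<sigma>])
    have ub: "r * \<tau> - lconj v (k *\<^sub>R n + \<tau> *\<^sub>R perp n) \<le> - ?H r" for \<tau>
    proof -
      have "?H r \<le> lconj v (k *\<^sub>R n + \<tau> *\<^sub>R perp n) - r * \<tau>"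
      proof (rule lconj_le)
        fix s show "k \<bullet> s - v (s *\<^sub>R n + r *\<^sub>R perp n) \<le> lconj v (k *\<^sub>R n + \<tau> *\<^sub>R perp n) - r * \<tau>"
          using lconj_ge[OF v(2), of "k *\<^sub>R n + \<tau> *\<^sub>R perp n" "s *\<^sub>R n + r *\<^sub>R perp n"]
          unfolding frame_inner[OF n] by (simp add: algebra_simps)
      qed
      then show ?thesis by simp
    qed
    then show "r \<bullet> \<tau> - lconj v (k *\<^sub>R n + \<tau> *\<^sub>R perp n) \<le> - ?H r" for \<tau> by simp
    have "lconj v (k *\<^sub>R n + \<sigma> *\<^sub>R perp n) \<le> r * \<sigma> + ?H r"
    proof (rule lconj_le)
      fix x
      let ?s = "n \<bullet> x" and ?r = "perp n \<bullet> x"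
      have x: "x = ?s *\<^sub>R n + ?r *\<^sub>R perp n" using perp_expand[OF n] by simp
      have "(k *\<^sub>R n + \<sigma> *\<^sub>R perp n) \<bullet> x - v x = k * ?s + \<sigma> * ?r - v (?s *\<^sub>R n + ?r *\<^sub>R perp n)"
        by (subst (1 2) x) (simp only: frame_inner[OF n])
      also have "\<dots> \<le> \<sigma> * ?r + ?H ?r" using le[of ?r ?s] by simp
      also have "\<dots> \<le> r * \<sigma> + ?H r"
        using \<sigma> unfolding subgrad_def by (auto simp: algebra_simps dest!: spec[of _ ?r])
      finally show "(k *\<^sub>R n + \<sigma> *\<^sub>R perp n) \<bullet> x - v x \<le> r * \<sigma> + ?H r" .
    qed
    with ub[of \<sigma>] show "r \<bullet> \<sigma> - lconj v (k *\<^sub>R n + \<sigma> *\<^sub>R perp n) = - ?H r" by simp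
  qed
qed

section \<open>Ridge functions of the gradient\<close>

lemma rd_bounded:
  fixes v :: "'a::euclidean_space \<Rightarrow> real"
  assumes "convex_on UNIV v" "norm n \<le> 1"
  obtains L where "L > 0" "\<And>x. norm x \<le> R \<Longrightarrow> \<bar>rd v n x\<bar> \<le> L"
proof -
  have "bounded (v ` cball 0 (R + 1))"
    by (intro compact_imp_bounded compact_continuous_image convex_continuous assms) auto
  then obtain B where B: "B > 0" "\<And>x. norm x \<le> R + 1 \<Longrightarrow> \<bar>v x\<bar> \<le> B"
    unfolding bounded_pos by (auto simp: dist_norm)
  show ?thesis
  proof
    show "2 * B > 0" using B by simp
    fix x :: 'a assume x: "norm x \<le> R"
    have "norm (x + 1 *\<^sub>R n) \<le> R + 1" "norm (x - 1 *\<^sub>R n) \<le> R + 1" "norm x \<le> R + 1"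
      using x assms(2) norm_triangle_ineq[of x n] norm_triangle_ineq4[of x n] by auto
    then have "\<bar>v (x + 1 *\<^sub>R n)\<bar> \<le> B" "\<bar>v (x - 1 *\<^sub>R n)\<bar> \<le> B" "\<bar>v x\<bar> \<le> B" using B by auto
    moreover have "rd v n x \<le> (v (x + 1 *\<^sub>R n) - v x) / 1" by (rule rd_le[OF assms(1)]) simp
    moreover have "(v x - v (x - 1 *\<^sub>R n)) / 1 \<le> rd v n x" by (rule rd_ge_backward[OF assms(1)]) simp
    ultimately show "\<bar>rd v n x\<bar> \<le> 2 * B" by (simp add: abs_le_iff)
  qed
qed

lemma rd_eq_outside:
  fixes v w :: "'a::euclidean_space \<Rightarrow> real"
  assumes "convex_on UNIV v" "convex_on UNIV w" "closed K" "\<And>y. y \<notin> K \<Longrightarrow> v y = w y" "x \<notin> K"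
  shows "rd v n x = rd w n x"
proof -
  obtain d where d: "d > 0" "ball x d \<subseteq> - K"
    by (rule openE[of "- K" x]) (use assms in \<open>auto simp: open_Compl\<close>)
  have pos: "d / (norm n + 1) > 0" using d(1) by (simp add: add_nonneg_pos)
  show ?thesis
  proof (rule rd_eqI[OF assms(1) pos _ assms(2)])
    fix t assume t: "0 < t" "t < d / (norm n + 1)"
    have "t * norm n \<le> t * (norm n + 1)" using t by simp
    also have "\<dots> < d" using t by (simp add: pos_less_divide_eq add_nonneg_pos)
    finally have "x + t *\<^sub>R n \<in> ball x d" using t by (simp add: dist_norm)
    then have "x + t *\<^sub>R n \<notin> K" using d by auto
    then show "v (x + t *\<^sub>R n) - v x = w (x + t *\<^sub>R n) - w x" using assms by simp
  qed
qed

lemma rd_eq_outside_ball: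
  fixes v w :: "'a::euclidean_space \<Rightarrow> real"
  assumes "convex_on UNIV v" "convex_on UNIV w" "\<And>y. R \<le> norm y \<Longrightarrow> v y = w y" "R < norm x"
  shows "rd v n x = rd w n x"
  by (rule rd_eq_outside[OF assms(1,2), of "cball 0 R"]) (use assms in auto)

lemma integrable_cball:
  fixes \<phi> :: "'a::euclidean_space \<Rightarrow> real"
  assumes "\<phi> \<in> borel_measurable borel" "\<And>x. norm x \<le> R \<Longrightarrow> \<bar>\<phi> x\<bar> \<le> C" "\<And>x. R < norm x \<Longrightarrow> \<phi> x = 0"
  shows "integrable lborel \<phi>"
proof (rule integrableI_bounded_set[where A="cball 0 R" and B=C])
  show "emeasure lborel (cball 0 R :: 'a set) < \<infinity>" by (rule emeasure_bounded_finite) simp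
qed (use assms in auto)

lemma LINT_zero_outside:
  fixes \<phi> :: "real \<Rightarrow> real"
  assumes "\<And>s. s \<notin> {a..b} \<Longrightarrow> \<phi> s = 0" shows "(\<integral>s. \<phi> s \<partial>lborel) = (LBINT s:{a..b}. \<phi> s)"
  unfolding set_lebesgue_integral_def
  by (rule Bochner_Integration.integral_cong) (use assms in \<open>auto simp: indicator_def\<close>)

text \<open>For measurability: as a countable supremum the conjugate of a slice is jointly
  measurable in the slope and the position of the slice.\<close>

lemma convex_dense_SUP:
  fixes c :: "real \<Rightarrow> real"
  assumes "convex_on UNIV c" "coercive c"
  shows "lconj c k = (SUP s\<in>\<rat>. k * s - c s)"
proof (rule antisym)
  have bdd: "bdd_above ((\<lambda>s. k * s - c s) ` S)" for S
    using lconj_ge[OF assms(2), of k] by (intro bdd_aboveI2[where M="lconj c k"]) auto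
  show "lconj c k \<le> (SUP s\<in>\<rat>. k * s - c s)"
  proof (rule lconj_le)
    fix s
    have cont: "continuous_on UNIV (\<lambda>s. k * s - c s)"
      by (intro continuous_on_diff continuous_on_mult continuous_on_const continuous_on_id convex_continuous assms)
    have "closed {s. k * s - c s \<le> (SUP s\<in>\<rat>. k * s - c s)}"
      using closed_Collect_le[OF cont continuous_on_const] .
    moreover have "\<rat> \<subseteq> {s. k * s - c s \<le> (SUP s\<in>\<rat>. k * s - c s)}"
      using cSUP_upper[OF _ bdd] by auto
    ultimately have "closure \<rat> \<subseteq> {s. k * s - c s \<le> (SUP s\<in>\<rat>. k * s - c s)}"
      by (rule closure_minimal[rotated])
    then show "k \<bullet> s - c s \<le> (SUP s\<in>\<rat>. k * s - c s)"
      by (simp add: Rats_closure_real subset_iff)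
  qed
  show "(SUP s\<in>\<rat>. k * s - c s) \<le> lconj c k"
    by (rule cSUP_least) (use lconj_ge[OF assms(2), of k] in \<open>auto intro: exI[of _ 0]\<close>)
qed

lemma lconj_slice_measurable:
  fixes v :: "real^2 \<Rightarrow> real"
  assumes v: "convex_on UNIV v" "coercive v" and n: "norm n = 1"
  shows "(\<lambda>(k, r). lconj (\<lambda>s. v (s *\<^sub>R n + r *\<^sub>R m)) k) \<in> borel_measurable (lborel \<Otimes>\<^sub>M lborel)"
proof -
  have sl: "convex_on UNIV (\<lambda>s. v (s *\<^sub>R n + x))" "coercive (\<lambda>s. v (s *\<^sub>R n + x))" for x
    using v n by (auto intro: convex_slice coercive_slice)
  have "(\<lambda>z. SUP s\<in>\<rat>. fst z * s - v (s *\<^sub>R n + snd z *\<^sub>R m)) \<in> borel_measurable (lborel \<Otimes>\<^sub>M lborel)"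
  proof (rule borel_measurable_cSUP)
    show "countable (\<rat> :: real set)" by (rule countable_rat)
    fix s :: real
    show "(\<lambda>z. fst z * s - v (s *\<^sub>R n + snd z *\<^sub>R m)) \<in> borel_measurable (lborel \<Otimes>\<^sub>M lborel)"
      unfolding lborel_prod
      by (simp, intro borel_measurable_continuous_onI continuous_on_diff continuous_on_compose2[OF convex_continuous[OF v(1), of UNIV]] continuous_intros) auto
  next
    fix z :: "real \<times> real"
    show "bdd_above ((\<lambda>s. fst z * s - v (s *\<^sub>R n + snd z *\<^sub>R m)) ` \<rat>)"
      using lconj_ge[OF sl(2), of "fst z" _ "snd z *\<^sub>R m"]
      by (intro bdd_aboveI2[where M="lconj (\<lambda>s. v (s *\<^sub>R n + snd z *\<^sub>R m)) (fst z)"]) auto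
  qed
  then show ?thesis by (simp add: case_prod_beta' convex_dense_SUP[OF sl])
qed

text \<open>The squares are subtracted before integrating, as neither is integrable alone in
  general; \<open>V0\<close> and \<open>V1\<close> will agree outside a ball, so that the difference
  has bounded support.\<close>

definition dual_energy_density :: "(real^2 \<Rightarrow> real) \<Rightarrow> (real^2 \<Rightarrow> real) \<Rightarrow> real^2 \<Rightarrow> real \<Rightarrow> real" where
  "dual_energy_density V0 V1 n k =
     (\<integral>\<sigma>. (rd V0 (perp n) (\<sigma> *\<^sub>R perp n + k *\<^sub>R n))\<^sup>2 - (rd V1 (perp n) (\<sigma> *\<^sub>R perp n + k *\<^sub>R n))\<^sup>2 \<partial>lborel)"

text \<open>\<open>lconj_slice\<close> rewrites the left side through conjugates of slices of
  \<open>lconj v0\<close> and \<open>lconj v1\<close>. In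
  \<open>integral_derivative_eq_integral_lconj\<close> the integrand with second derivative
  \<open>1\<close> is \<open>x\<^sup>2 / 2\<close>, hence the squares.\<close>

lemma dual_energy_density_eq:
  fixes v0 v1 :: "real^2 \<Rightarrow> real"
  assumes v0: "convex_on UNIV v0" "coercive v0" and v1: "convex_on UNIV v1" "coercive v1"
    and n: "norm n = 1"
    and R: "\<And>x. R \<le> norm x \<Longrightarrow> v0 x = v1 x"
    and S: "\<And>p. S \<le> norm p \<Longrightarrow> lconj v0 p = lconj v1 p"
  shows "(\<integral>r. lconj (\<lambda>s. v1 (s *\<^sub>R n + r *\<^sub>R perp n)) k - lconj (\<lambda>s. v0 (s *\<^sub>R n + r *\<^sub>R perp n)) k \<partial>lborel)
    = dual_energy_density (lconj v0) (lconj v1) n k / 2"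
proof -
  define T where "T = \<bar>S\<bar> + 1"
  have T: "T > 0" "\<And>p. T \<le> norm p \<Longrightarrow> lconj v0 p = lconj v1 p" using S by (auto simp: T_def)
  have np: "norm (perp n) = 1" using n by simp
  let ?a = "\<lambda>\<sigma>. lconj v0 (\<sigma> *\<^sub>R perp n + k *\<^sub>R n)" and ?b = "\<lambda>\<sigma>. lconj v1 (\<sigma> *\<^sub>R perp n + k *\<^sub>R n)"
  have a: "convex_on UNIV ?a" "coercive ?a" and b: "convex_on UNIV ?b" "coercive ?b"
    using v0 v1 np by (auto intro: convex_slice coercive_slice convex_lconj coercive_lconj)
  have eq: "?a \<sigma> = ?b \<sigma>" if "T \<le> \<bar>\<sigma>\<bar>" for \<sigma>
    using frame_norm_ge(2)[OF n, of \<sigma> k] that by (intro T) (simp add: add.commute)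
  obtain L1 where L1: "\<And>s. s \<in> {-T..T} \<Longrightarrow> \<bar>rd ?a 1 s\<bar> \<le> L1" using rd_bounded_on_interval[OF a(1)] by blast
  obtain L2 where L2: "\<And>s. s \<in> {-T..T} \<Longrightarrow> \<bar>rd ?b 1 s\<bar> \<le> L2" using rd_bounded_on_interval[OF b(1)] by blast
  define L where "L = max (max L1 L2) (\<bar>R\<bar> + 1)"
  have L: "\<bar>rd ?a 1 s\<bar> \<le> L" "\<bar>rd ?b 1 s\<bar> \<le> L" if "s \<in> {-T..T}" for s
    using L1[OF that] L2[OF that] by (auto simp: L_def)
  let ?D = "\<lambda>r. lconj (\<lambda>s. v1 (s *\<^sub>R n + r *\<^sub>R perp n)) k - lconj (\<lambda>s. v0 (s *\<^sub>R n + r *\<^sub>R perp n)) k"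
  have zero: "?D r = 0" if "r \<notin> {-L..L}" for r
  proof -
    have "R \<le> norm (s *\<^sub>R n + r *\<^sub>R perp n)" for s
      using frame_norm_ge(2)[OF n, of r s] that by (auto simp: L_def)
    then have "v0 (s *\<^sub>R n + r *\<^sub>R perp n) = v1 (s *\<^sub>R n + r *\<^sub>R perp n)" for s by (rule R)
    then show ?thesis by simp
  qed
  have conj: "lconj ?a r = - lconj (\<lambda>s. v0 (s *\<^sub>R n + r *\<^sub>R perp n)) k"
    "lconj ?b r = - lconj (\<lambda>s. v1 (s *\<^sub>R n + r *\<^sub>R perp n)) k" for r
    using lconj_slice[OF v0 n, of k r] lconj_slice[OF v1 n, of k r] by (simp_all add: add.commute)
  have "(\<integral>r. ?D r \<partial>lborel) = (LBINT r:{-L..L}. 1 * (lconj ?a r - lconj ?b r))"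
    using LINT_zero_outside[of "-L" L ?D, OF zero] by (simp add: conj)
  also have "\<dots> = (LBINT s:{-T..T}. (rd ?a 1 s)\<^sup>2 / 2 - (rd ?b 1 s)\<^sup>2 / 2)"
  proof (rule integral_derivative_eq_integral_lconj[OF a b _ _ _ _ _ L, symmetric, where h'="\<lambda>x. x"])
    show "((\<lambda>x. x\<^sup>2 / 2) has_real_derivative x) (at x)" for x :: real by (auto intro!: derivative_eq_intros)
    show "((\<lambda>x. x) has_real_derivative 1) (at x)" for x :: real by (auto intro!: derivative_eq_intros)
    show "?a s = ?b s" if "s \<notin> {-T<..<T}" for s by (rule eq) (use that T in auto)
  qed (use T in auto)
  also have "\<dots> = (\<integral>s. (rd ?a 1 s)\<^sup>2 / 2 - (rd ?b 1 s)\<^sup>2 / 2 \<partial>lborel)"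
  proof (rule LINT_zero_outside[symmetric])
    fix s assume "s \<notin> {-T..T}"
    then have "rd ?a 1 s = rd ?b 1 s"
      by (intro rd_eq_outside[OF a(1) b(1), of "{-T..T}"] eq) auto
    then show "(rd ?a 1 s)\<^sup>2 / 2 - (rd ?b 1 s)\<^sup>2 / 2 = 0" by simp
  qed
  also have "\<dots> = dual_energy_density (lconj v0) (lconj v1) n k / 2"
    unfolding dual_energy_density_def rd_slice by (simp add: diff_divide_distrib[symmetric])
  finally show ?thesis .
qed

text \<open>The energy of a function of \<open>n \<bullet> \<nabla> v\<close> is a quadratic expression in the derivative of
  the Legendre transform in the orthogonal direction.\<close>

lemma ridge_formula:
  fixes v0 v1 :: "real^2 \<Rightarrow> real"
  assumes v0: "convex_on UNIV v0" "coercive v0" and v1: "convex_on UNIV v1" "coercive v1"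
    and n: "norm n = 1"
    and R0: "\<And>x. R \<le> norm x \<Longrightarrow> v0 x = v1 x"
    and S: "\<And>p. S \<le> norm p \<Longrightarrow> lconj v0 p = lconj v1 p"
    and h: "\<And>x. (h has_real_derivative h' x) (at x)" "\<And>x. (h' has_real_derivative h'' x) (at x)"
      "continuous_on UNIV h''"
  shows "integrable lborel (\<lambda>x. h (rd v1 n x) - h (rd v0 n x))"
    and "integrable lborel (\<lambda>k. h'' k * dual_energy_density (lconj v0) (lconj v1) n k)"
    and "(\<integral>x. h (rd v1 n x) - h (rd v0 n x) \<partial>lborel)
      = (\<integral>k. h'' k * dual_energy_density (lconj v0) (lconj v1) n k \<partial>lborel) / 2"
proof -
  define Q where "Q = \<bar>R\<bar> + 1"
  have Q: "Q > 0" "\<And>x. Q \<le> norm x \<Longrightarrow> v0 x = v1 x" using R0 by (auto simp: Q_def)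
  \<comment> \<open>The ball of radius \<open>2 * Q\<close> contains the square of points with both
    frame coordinates in \<open>{-Q..Q}\<close>, over which the slices run.\<close>
  obtain L0 where L0: "L0 > 0" "\<And>x. norm x \<le> 2 * Q \<Longrightarrow> \<bar>rd v0 n x\<bar> \<le> L0" using rd_bounded[OF v0(1), of n "2 * Q"] n by auto
  obtain L1 where L1: "\<And>x. norm x \<le> 2 * Q \<Longrightarrow> \<bar>rd v1 n x\<bar> \<le> L1" using rd_bounded[OF v1(1), of n "2 * Q"] n by auto
  define L where "L = max L0 L1"
  have L: "\<bar>rd v0 n x\<bar> \<le> L" "\<bar>rd v1 n x\<bar> \<le> L" if "norm x \<le> 2 * Q" for x
    using L0(2)[OF that] L1[OF that] by (auto simp: L_def)
  have Lpos: "L > 0" using L0(1) by (simp add: L_def)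
  have hc: "continuous_on UNIV h" using h(1) by (auto simp: continuous_on_eq_continuous_at intro!: DERIV_isCont)
  have [measurable]: "h \<in> borel_measurable borel" "h'' \<in> borel_measurable borel"
    using hc h(3) by (auto intro: borel_measurable_continuous_onI)
  note [measurable] = rd_measurable[OF v0(1)] rd_measurable[OF v1(1)]
  obtain M where M: "\<And>k. k \<in> {-L..L} \<Longrightarrow> \<bar>h k\<bar> \<le> M" using continuous_bounded_Icc[OF hc] by blast
  obtain C where C: "C \<ge> 0" "\<And>k. k \<in> {-L..L} \<Longrightarrow> \<bar>h'' k\<bar> \<le> C" using continuous_bounded_Icc[OF h(3)] by blast
  let ?\<phi> = "\<lambda>x. h (rd v1 n x) - h (rd v0 n x)"
  have \<phi>0: "?\<phi> x = 0" if "Q < norm x" for x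
    using rd_eq_outside_ball[OF v0(1) v1(1) Q(2) that] by simp
  show int: "integrable lborel ?\<phi>"
  proof (rule integrable_cball[where R=Q and C="M + M"])
    show "?\<phi> \<in> borel_measurable borel" by measurable
    fix x :: "real^2" assume "norm x \<le> Q"
    then have "norm x \<le> 2 * Q" using Q(1) by simp
    then have "rd v0 n x \<in> {-L..L}" "rd v1 n x \<in> {-L..L}" using L[of x] by (auto simp: abs_le_iff)
    then show "\<bar>?\<phi> x\<bar> \<le> M + M" using M[of "rd v0 n x"] M[of "rd v1 n x"] by linarith
  qed (rule \<phi>0)
  let ?H = "\<lambda>v k r. lconj (\<lambda>s. v (s *\<^sub>R n + r *\<^sub>R perp n)) k"
  define G where "G k r = indicator {-L..L} k * (h'' k * (?H v1 k r - ?H v0 k r))" for k r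
  obtain B where B: "B \<ge> 0" "\<And>x. \<bar>v1 x - v0 x\<bar> \<le> B"
  proof -
    have "bounded ((\<lambda>x. v1 x - v0 x) ` cball 0 Q)"
      by (intro compact_imp_bounded compact_continuous_image continuous_on_diff convex_continuous v0 v1) auto
    then obtain B where B: "B > 0" "\<And>x. norm x \<le> Q \<Longrightarrow> \<bar>v1 x - v0 x\<bar> \<le> B"
      unfolding bounded_pos by (auto simp: dist_norm)
    show ?thesis
    proof (rule that[of B])
      show "\<bar>v1 x - v0 x\<bar> \<le> B" for x using B Q(2)[of x] by (cases "norm x \<le> Q") auto
    qed (use B in simp)
  qed
  have sl: "convex_on UNIV (\<lambda>s. v0 (s *\<^sub>R n + x))" "coercive (\<lambda>s. v0 (s *\<^sub>R n + x))"
      "convex_on UNIV (\<lambda>s. v1 (s *\<^sub>R n + x))" "coercive (\<lambda>s. v1 (s *\<^sub>R n + x))" for x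
    using v0 v1 n by (auto intro: convex_slice coercive_slice)
  have Hb: "\<bar>?H v1 k r - ?H v0 k r\<bar> \<le> B" for k r
  proof -
    have ab: "v0 x - B \<le> v1 x" "v1 x - B \<le> v0 x" for x using B(2)[of x] by auto
    have "?H v1 k r \<le> ?H v0 k r + B" by (rule lconj_mono_bound[OF sl(2)]) (rule ab)
    moreover have "?H v0 k r \<le> ?H v1 k r + B" by (rule lconj_mono_bound[OF sl(4)]) (rule ab)
    ultimately show ?thesis by simp
  qed
  have Hr: "?H v1 k r = ?H v0 k r" if "r \<notin> {-Q..Q}" for k r
  proof -
    have "v0 (s *\<^sub>R n + r *\<^sub>R perp n) = v1 (s *\<^sub>R n + r *\<^sub>R perp n)" for s
      using frame_norm_ge(2)[OF n, of r s] that by (intro Q(2)) auto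
    then show ?thesis by simp
  qed
  have slope: "\<bar>rd (\<lambda>s. v0 (s *\<^sub>R n + r *\<^sub>R perp n)) 1 s\<bar> \<le> L" "\<bar>rd (\<lambda>s. v1 (s *\<^sub>R n + r *\<^sub>R perp n)) 1 s\<bar> \<le> L"
    if "s \<in> {-Q..Q}" "r \<in> {-Q..Q}" for r s
  proof -
    have "norm (s *\<^sub>R n + r *\<^sub>R perp n) \<le> norm (s *\<^sub>R n) + norm (r *\<^sub>R perp n)" by (rule norm_triangle_ineq)
    also have "\<dots> \<le> 2 * Q" using that n by auto
    finally show "\<bar>rd (\<lambda>s. v0 (s *\<^sub>R n + r *\<^sub>R perp n)) 1 s\<bar> \<le> L" "\<bar>rd (\<lambda>s. v1 (s *\<^sub>R n + r *\<^sub>R perp n)) 1 s\<bar> \<le> L"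
      unfolding rd_slice by (auto intro: L)
  qed
  have eqs: "v1 (s *\<^sub>R n + r *\<^sub>R perp n) = v0 (s *\<^sub>R n + r *\<^sub>R perp n)" if "s \<notin> {-Q<..<Q}" for r s
    using frame_norm_ge(1)[OF n, of s r] that by (intro Q(2)[symmetric]) auto
  have Hk: "?H v1 k r = ?H v0 k r" if "k \<notin> {-L..L}" for k r
  proof (cases "r \<in> {-Q..Q}")
    case True
    show ?thesis
      by (rule lconj_eq_outside_slopes[OF sl(3,4) sl(1,2) eqs _ slope(2)[OF _ True] slope(1)[OF _ True] that]) (use Q in auto)
  qed (rule Hr)
  have intG: "integrable (lborel \<Otimes>\<^sub>M lborel) (\<lambda>(k, r). G k r)"
  proof (rule lborel_pair_integrable_bounded[where S="{-L..L}" and T="{-Q..Q}" and C="C * B"])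
    have "(\<lambda>z. ?H v (fst z) (snd z)) \<in> borel_measurable (lborel \<Otimes>\<^sub>M lborel)" if "convex_on UNIV v" "coercive v" for v
      using lconj_slice_measurable[OF that n, of "perp n"] by (simp add: case_prod_beta')
    note [measurable] = this[OF v0] this[OF v1]
    show "(\<lambda>(k, r). G k r) \<in> borel_measurable (lborel \<Otimes>\<^sub>M lborel)"
      unfolding G_def case_prod_beta' by measurable
    show "\<bar>case (k, r) of (k, r) \<Rightarrow> G k r\<bar> \<le> C * B" for k r
    proof (cases "k \<in> {-L..L}")
      case True
      then have "\<bar>h'' k\<bar> * \<bar>?H v1 k r - ?H v0 k r\<bar> \<le> C * B"
        using C Hb B by (intro mult_mono) auto
      then show ?thesis using True by (simp add: G_def abs_mult)
    qed (use C B in \<open>simp add: G_def\<close>)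
    show "(case (k, r) of (k, r) \<Rightarrow> G k r) = 0" if "k \<notin> {-L..L} \<or> r \<notin> {-Q..Q}" for k r
      using that Hr[of r k] by (auto simp: G_def)
  qed auto
  \<comment> \<open>On each line in the direction \<open>n\<close> the one-dimensional formula
    trades positions \<open>s\<close> for slopes \<open>k\<close>.\<close>
  have inner_s: "(\<integral>s. ?\<phi> (s *\<^sub>R n + r *\<^sub>R perp n) \<partial>lborel) = (\<integral>k. G k r \<partial>lborel)" for r
  proof (cases "r \<in> {-Q..Q}")
    case True
    have "(\<integral>s. ?\<phi> (s *\<^sub>R n + r *\<^sub>R perp n) \<partial>lborel) = (LBINT s:{-Q..Q}. ?\<phi> (s *\<^sub>R n + r *\<^sub>R perp n))"
    proof (rule LINT_zero_outside)
      fix s assume "s \<notin> {-Q..Q}"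
      then show "?\<phi> (s *\<^sub>R n + r *\<^sub>R perp n) = 0"
        using frame_norm_ge(1)[OF n, of s r] by (intro \<phi>0) auto
    qed
    also have "\<dots> = (LBINT k:{-L..L}. h'' k * (?H v1 k r - ?H v0 k r))"
      using integral_derivative_eq_integral_lconj[OF sl(3,4) sl(1,2) eqs _ h slope(2)[OF _ True] slope(1)[OF _ True]] Q(1)
      unfolding rd_slice by simp
    finally show ?thesis by (simp add: G_def set_lebesgue_integral_def)
  next
    case False
    then have "Q < norm (s *\<^sub>R n + r *\<^sub>R perp n)" for s
      using frame_norm_ge(2)[OF n, of r s] by auto
    then have "?\<phi> (s *\<^sub>R n + r *\<^sub>R perp n) = 0" for s by (rule \<phi>0)
    then show ?thesis using Hr[OF False] by (simp add: G_def)
  qed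
  \<comment> \<open>At fixed slope, integrating over the lines gives half the dual energy density;
    Fubini then puts \<open>k\<close> outermost.\<close>
  have inner_r: "(\<integral>r. G k r \<partial>lborel) = h'' k * dual_energy_density (lconj v0) (lconj v1) n k / 2" for k
  proof -
    have e: "(\<integral>r. ?H v1 k r - ?H v0 k r \<partial>lborel) = dual_energy_density (lconj v0) (lconj v1) n k / 2"
      by (rule dual_energy_density_eq[OF v0 v1 n, where R=R and S=S]) (use R0 S in auto)
    show ?thesis
    proof (cases "k \<in> {-L..L}")
      case True
      then show ?thesis using e by (simp add: G_def)
    next
      case False
      then have "dual_energy_density (lconj v0) (lconj v1) n k = 0"
        using e Hk[OF False] by simp
      then show ?thesis using False by (simp add: G_def)
    qed
  qed
  have "integrable lborel (\<lambda>k. \<integral>r. G k r \<partial>lborel)"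
    using lborel_pair.integrable_fst[OF intG] .
  then have "integrable lborel (\<lambda>k. 2 * (h'' k * dual_energy_density (lconj v0) (lconj v1) n k / 2))"
    unfolding inner_r by (rule integrable_mult_right)
  then show "integrable lborel (\<lambda>k. h'' k * dual_energy_density (lconj v0) (lconj v1) n k)" by simp
  have "(\<integral>x. ?\<phi> x \<partial>lborel) = (\<integral>r. (\<integral>k. G k r \<partial>lborel) \<partial>lborel)"
    unfolding integral_frame[OF n int] inner_s ..
  also have "\<dots> = (\<integral>k. (\<integral>r. G k r \<partial>lborel) \<partial>lborel)" by (rule lborel_pair.Fubini_integral[OF intG])
  also have "\<dots> = (\<integral>k. h'' k * dual_energy_density (lconj v0) (lconj v1) n k \<partial>lborel) / 2"
    unfolding inner_r by simp
  finally show "(\<integral>x. ?\<phi> x \<partial>lborel) = (\<integral>k. h'' k * dual_energy_density (lconj v0) (lconj v1) n k \<partial>lborel) / 2" .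
qed

section \<open>Unique subgradients\<close>

lemma rd_bound:
  fixes v :: "'a::euclidean_space \<Rightarrow> real"
  assumes "convex_on UNIV v" "norm n \<le> 1" "\<And>y. norm y \<le> R + 1 \<Longrightarrow> \<bar>v y\<bar> \<le> B" "norm x \<le> R"
  shows "\<bar>rd v n x\<bar> \<le> 2 * B"
proof -
  have "norm (x + 1 *\<^sub>R n) \<le> R + 1" "norm (x - 1 *\<^sub>R n) \<le> R + 1" "norm x \<le> R + 1"
    using assms(2,4) norm_triangle_ineq[of x n] norm_triangle_ineq4[of x n] by auto
  then have "\<bar>v (x + 1 *\<^sub>R n)\<bar> \<le> B" "\<bar>v (x - 1 *\<^sub>R n)\<bar> \<le> B" "\<bar>v x\<bar> \<le> B" using assms(3) by auto
  moreover have "rd v n x \<le> (v (x + 1 *\<^sub>R n) - v x) / 1" by (rule rd_le[OF assms(1)]) simp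
  moreover have "(v x - v (x - 1 *\<^sub>R n)) / 1 \<le> rd v n x" by (rule rd_ge_backward[OF assms(1)]) simp
  ultimately show ?thesis by (simp add: abs_le_iff)
qed

text \<open>The conjugate is tested at \<open>x + sgn p\<close>, where \<open>p \<bullet> _\<close>
  has grown by \<open>norm p\<close> while \<open>v\<close> is still bounded by
  \<open>B\<close>.\<close>

lemma eps_subgrad_bound:
  fixes v :: "'a::euclidean_space \<Rightarrow> real"
  assumes "coercive v" "\<And>y. norm y \<le> R + 1 \<Longrightarrow> \<bar>v y\<bar> \<le> B" "norm x \<le> R" "v x + lconj v p - p \<bullet> x \<le> 1"
  shows "norm p \<le> 2 * B + 1"
proof (cases "p = 0")
  case True
  then show ?thesis using assms(2)[of x] assms(3) by simp
next
  case False
  let ?y = "x + sgn p"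
  have "norm ?y \<le> R + 1" "norm x \<le> R + 1"
    using norm_triangle_ineq[of x "sgn p"] assms(3) False by (auto simp: norm_sgn)
  then have "\<bar>v ?y\<bar> \<le> B" "\<bar>v x\<bar> \<le> B" using assms(2) by auto
  moreover have "p \<bullet> ?y - v ?y \<le> lconj v p" by (rule lconj_ge[OF assms(1)])
  moreover have "p \<bullet> ?y = p \<bullet> x + norm p"
    using False by (simp add: inner_add_right sgn_div_norm power2_norm_eq_inner[symmetric] power2_eq_square)
  ultimately show ?thesis using assms(4) by linarith
qed

lemma convex_bounded_ball:
  fixes v :: "'a::euclidean_space \<Rightarrow> real"
  assumes "convex_on UNIV v"
  obtains B where "B > 0" "\<And>y. norm y \<le> R \<Longrightarrow> \<bar>v y\<bar> \<le> B"
proof -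
  have "bounded (v ` cball 0 R)"
    by (intro compact_imp_bounded compact_continuous_image convex_continuous assms) auto
  then obtain B where "B > 0" "\<And>x. norm x \<le> R \<Longrightarrow> \<bar>v x\<bar> \<le> B"
    unfolding bounded_pos by (auto simp: dist_norm)
  then show ?thesis by (rule that)
qed

text \<open>Compactness: the gap is continuous, nonnegative and zero exactly at subgradients. On the
  compact set of triples \<open>(x, p, q)\<close> with \<open>q\<close> a subgradient at
  \<open>x\<close> and \<open>p\<close> at distance at least \<open>e\<close> from \<open>q\<close>,
  uniqueness keeps it away from zero.\<close>

lemma eps_subgrad_modulus:
  fixes v :: "'a::euclidean_space \<Rightarrow> real"
  assumes v: "convex_on UNIV v" "coercive v" and K: "compact K"
    and uniq: "\<And>x p q. x \<in> K \<Longrightarrow> subgrad v x p \<Longrightarrow> subgrad v x q \<Longrightarrow> p = q" and e: "e > 0"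
  obtains \<theta> where "\<theta> > 0"
    "\<And>x p q. x \<in> K \<Longrightarrow> v x + lconj v p - p \<bullet> x \<le> \<theta> \<Longrightarrow> subgrad v x q \<Longrightarrow> norm (p - q) < e"
proof -
  obtain R where R: "\<And>x. x \<in> K \<Longrightarrow> norm x \<le> R"
    using compact_imp_bounded[OF K] unfolding bounded_iff by blast
  obtain B where B: "B > 0" "\<And>y. norm y \<le> R + 1 \<Longrightarrow> \<bar>v y\<bar> \<le> B" using convex_bounded_ball[OF v(1)] by blast
  let ?L = "2 * B + 1"
  let ?C = "K \<times> cball 0 ?L \<times> cball 0 ?L"
  let ?gap = "\<lambda>x p. v x + lconj v p - p \<bullet> x"
  have cV: "convex_on UNIV (lconj v)" using convex_lconj v by blast
  have c1: "continuous_on UNIV (\<lambda>z::'a\<times>'a\<times>'a. ?gap (fst z) (fst (snd z)))"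
    "continuous_on UNIV (\<lambda>z::'a\<times>'a\<times>'a. ?gap (fst z) (snd (snd z)))"
    by (intro continuous_intros continuous_on_compose2[OF convex_continuous[OF v(1), of UNIV]]
        continuous_on_compose2[OF convex_continuous[OF cV, of UNIV]]; simp)+
  define S where "S = ?C \<inter> ({z. ?gap (fst z) (snd (snd z)) \<le> 0} \<inter> {z. e \<le> norm (fst (snd z) - snd (snd z))})"
  have "closed {z::'a\<times>'a\<times>'a. ?gap (fst z) (snd (snd z)) \<le> 0}"
    by (rule closed_Collect_le[OF c1(2) continuous_on_const])
  moreover have "closed {z::'a\<times>'a\<times>'a. e \<le> norm (fst (snd z) - snd (snd z))}"
    by (rule closed_Collect_le) (intro continuous_intros)+
  ultimately have S: "compact S" unfolding S_def
    by (intro compact_Int_closed closed_Int compact_Times K) auto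
  have gap0: "0 \<le> ?gap x p" for x p using lconj_ge[OF v(2), of p x] by simp
  have sub: "subgrad v x p \<longleftrightarrow> ?gap x p = 0" for x p using subgrad_iff_lconj[OF v(2)] by auto
  have inS: "(x, p, q) \<in> S" if "x \<in> K" "?gap x p \<le> 1" "subgrad v x q" "\<not> norm (p - q) < e" for x p q
  proof -
    have "norm p \<le> ?L" "norm q \<le> ?L"
      using eps_subgrad_bound[OF v(2) B(2) R[OF that(1)]] that sub by auto
    then show ?thesis using that sub unfolding S_def by auto
  qed
  show ?thesis
  proof (cases "S = {}")
    case True
    show ?thesis by (rule that[of 1]) (use inS True in auto)
  next
    case False
    obtain z where z: "z \<in> S" "\<And>w. w \<in> S \<Longrightarrow> ?gap (fst z) (fst (snd z)) \<le> ?gap (fst w) (fst (snd w))"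
      using continuous_attains_inf[OF S False continuous_on_subset[OF c1(1)]] by blast
    have pos: "?gap (fst z) (fst (snd z)) > 0"
    proof (rule ccontr)
      assume "\<not> ?thesis"
      then have "?gap (fst z) (fst (snd z)) = 0" using gap0 by (metis order_antisym not_le_imp_less)
      moreover have "?gap (fst z) (snd (snd z)) = 0" using z(1) gap0[of "fst z" "snd (snd z)"] unfolding S_def by auto
      ultimately have "fst (snd z) = snd (snd z)"
        using uniq[of "fst z" "fst (snd z)" "snd (snd z)"] z(1) sub by (auto simp: S_def mem_Times_iff)
      then show False using z(1) e unfolding S_def by auto
    qed
    let ?\<theta> = "min 1 (?gap (fst z) (fst (snd z)) / 2)"
    show ?thesis
    proof (rule that[of ?\<theta>])
      show "0 < ?\<theta>" using pos by simp
      fix x p q assume x: "x \<in> K" "?gap x p \<le> ?\<theta>" "subgrad v x q"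
      show "norm (p - q) < e"
      proof (rule ccontr)
        assume "\<not> ?thesis"
        then have "(x, p, q) \<in> S" using inS x by auto
        from z(2)[OF this] x(2) pos show False by auto
      qed
    qed
  qed
qed

text \<open>A subgradient at a point \<open>y\<close> close to \<open>x\<close> has a small gap at
  \<open>x\<close>, so the modulus for the single point \<open>x\<close> applies to it.\<close>

lemma subgrad_near:
  fixes v :: "'a::euclidean_space \<Rightarrow> real"
  assumes v: "convex_on UNIV v" "coercive v"
    and p: "subgrad v x p" and uniq: "\<And>q. subgrad v x q \<Longrightarrow> q = p" and e: "e > 0"
  obtains d where "d > 0" "\<And>y q. dist y x < d \<Longrightarrow> subgrad v y q \<Longrightarrow> norm (q - p) < e"
proof -
  obtain \<theta> where \<theta>: "\<theta> > 0" "\<And>q. v x + lconj v q - q \<bullet> x \<le> \<theta> \<Longrightarrow> norm (q - p) < e"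
  proof -
    have u: "q = s" if "y \<in> {x}" "subgrad v y q" "subgrad v y s" for y q s
    proof -
      have "q = p" "s = p" using that uniq by blast+
      then show ?thesis by simp
    qed
    obtain \<theta> where a: "0 < \<theta>" and b: "\<And>y q s. y \<in> {x} \<Longrightarrow> v y + lconj v q - q \<bullet> y \<le> \<theta> \<Longrightarrow> subgrad v y s \<Longrightarrow> norm (q - s) < e"
    proof (rule eps_subgrad_modulus[OF v compact_sing[of x] u e])
      fix \<theta> :: real
      assume "0 < \<theta>" "\<And>y q s. y \<in> {x} \<Longrightarrow> v y + lconj v q - q \<bullet> y \<le> \<theta> \<Longrightarrow> subgrad v y s \<Longrightarrow> norm (q - s) < e"
      then show ?thesis by (rule that)
    qed
    show thesis by (rule that[OF a]) (rule b[OF singletonI _ p])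
  qed
  obtain B where B: "B > 0" "\<And>y. norm y \<le> (norm x + 1) + 1 \<Longrightarrow> \<bar>v y\<bar> \<le> B" using convex_bounded_ball[OF v(1)] by blast
  have cont: "continuous (at x) v" using convex_continuous[OF v(1), of UNIV] by (simp add: continuous_on_eq_continuous_at)
  then obtain d1 where d1: "d1 > 0" "\<And>y. dist y x < d1 \<Longrightarrow> dist (v y) (v x) < \<theta> / 2"
    unfolding continuous_at by (metis \<theta>(1) half_gt_zero cont continuous_at_eps_delta dist_commute)
  let ?L = "2 * B + 1"
  define d where "d = min (min 1 d1) (\<theta> / (2 * ?L))"
  show ?thesis
  proof (rule that[of d])
    show "d > 0" using d1 \<theta> B by (simp add: d_def)
    fix y q assume y: "dist y x < d" and q: "subgrad v y q"
    have gap: "v y + lconj v q = q \<bullet> y" using q subgrad_iff_lconj[OF v(2)] by blast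
    have "norm y \<le> norm x + 1" using y norm_triangle_sub[of y x] by (auto simp: d_def dist_norm)
    then have qL: "norm q \<le> ?L" using eps_subgrad_bound[OF v(2) B(2), where x=y and p=q and R="norm x + 1"] gap by simp
    have "v x + lconj v q - q \<bullet> x = (v x - v y) + q \<bullet> (y - x)" using gap by (simp add: inner_diff_right)
    also have "\<dots> \<le> \<theta> / 2 + norm q * norm (y - x)"
    proof (rule add_mono)
      have "dist (v y) (v x) < \<theta> / 2" using d1(2)[of y] y by (simp add: d_def)
      then show "v x - v y \<le> \<theta> / 2" unfolding dist_real_def by linarith
      show "q \<bullet> (y - x) \<le> norm q * norm (y - x)" using Cauchy_Schwarz_ineq2[of q "y - x"] by linarith
    qed
    also have "norm q * norm (y - x) \<le> ?L * (\<theta> / (2 * ?L))"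
      using qL y B by (intro mult_mono) (auto simp: d_def dist_norm)
    also have "?L * (\<theta> / (2 * ?L)) = \<theta> / 2" using B by (simp add: field_simps)
    finally show "norm (q - p) < e" by (intro \<theta>(2)) simp
  qed
qed

text \<open>With a subgradient \<open>q\<close> at \<open>y\<close>, the first-order error at
  \<open>y\<close> lies between \<open>0\<close> and \<open>(q - p) \<bullet> (y - x)\<close>, and
  \<open>q\<close> is close to \<open>p\<close> by \<open>subgrad_near\<close>.\<close>

lemma gderiv_unique_subgrad:
  fixes v :: "'a::euclidean_space \<Rightarrow> real"
  assumes v: "convex_on UNIV v" "coercive v"
    and p: "subgrad v x p" and uniq: "\<And>q. subgrad v x q \<Longrightarrow> q = p"
  shows "GDERIV v x :> p"
  unfolding gderiv_def has_derivative_at_alt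
proof (intro conjI allI impI)
  show "bounded_linear (\<lambda>h. h \<bullet> p)" by (rule bounded_linear_inner_left)
  fix e :: real assume "e > 0"
  then obtain d where d: "d > 0" "\<And>y q. dist y x < d \<Longrightarrow> subgrad v y q \<Longrightarrow> norm (q - p) < e"
    using subgrad_near[OF v p uniq] by metis
  show "\<exists>d>0. \<forall>y. norm (y - x) < d \<longrightarrow> norm (v y - v x - (y - x) \<bullet> p) \<le> e * norm (y - x)"
  proof (intro exI[of _ d] conjI allI impI d(1))
    fix y assume y: "norm (y - x) < d"
    obtain q where q: "subgrad v y q" using subgrad_exists[OF v(1)] .
    have "v y + q \<bullet> (x - y) \<le> v x" "v x + p \<bullet> (y - x) \<le> v y"
      using p q unfolding subgrad_def by blast+
    then have "0 \<le> v y - v x - (y - x) \<bullet> p" "v y - v x - (y - x) \<bullet> p \<le> (q - p) \<bullet> (y - x)"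
      by (simp_all add: inner_commute inner_diff_left inner_diff_right)
    moreover have "(q - p) \<bullet> (y - x) \<le> norm (q - p) * norm (y - x)"
      using Cauchy_Schwarz_ineq2[of "q - p" "y - x"] by auto
    moreover have "norm (q - p) * norm (y - x) \<le> e * norm (y - x)"
      using d(2)[of y q] y q by (intro mult_right_mono) (auto simp: dist_norm)
    ultimately show "norm (v y - v x - (y - x) \<bullet> p) \<le> e * norm (y - x)" by simp
  qed
qed

lemma rd_unique_subgrad:
  fixes v :: "'a::euclidean_space \<Rightarrow> real"
  assumes v: "convex_on UNIV v" "coercive v"
    and p: "subgrad v x p" and uniq: "\<And>q. subgrad v x q \<Longrightarrow> q = p"
  shows "rd v n x = p \<bullet> n"
proof (rule antisym)
  show "p \<bullet> n \<le> rd v n x" by (rule rd_ge[OF p])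
  show "rd v n x \<le> p \<bullet> n"
  proof (rule field_le_epsilon)
    fix e :: real assume e: "e > 0"
    have e': "e / (norm n + 1) > 0" using e by (simp add: add_nonneg_pos)
    obtain d where d: "d > 0" "\<And>y q. dist y x < d \<Longrightarrow> subgrad v y q \<Longrightarrow> norm (q - p) < e / (norm n + 1)"
      using subgrad_near[OF v p uniq e'] by metis
    define t where "t = d / (norm n + 1) / 2"
    have n1: "norm n + 1 > 0" by (simp add: add_nonneg_pos)
    have t: "t > 0" "dist (x + t *\<^sub>R n) x < d"
    proof -
      show "t > 0" using d n1 by (simp add: t_def)
      have "t * norm n \<le> t * (norm n + 1)" using \<open>t > 0\<close> by simp
      also have "\<dots> = d / 2" using n1 unfolding t_def by (metis less_irrefl nonzero_eq_divide_eq times_divide_eq_left)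
      finally show "dist (x + t *\<^sub>R n) x < d" using d(1) \<open>t > 0\<close> by (simp add: dist_norm)
    qed
    obtain q where q: "subgrad v (x + t *\<^sub>R n) q" using subgrad_exists[OF v(1)] .
    then have "v (x + t *\<^sub>R n) + q \<bullet> (x - (x + t *\<^sub>R n)) \<le> v x" unfolding subgrad_def by blast
    then have "(v (x + t *\<^sub>R n) - v x) / t \<le> q \<bullet> n" using t by (simp add: field_simps)
    moreover have "rd v n x \<le> (v (x + t *\<^sub>R n) - v x) / t" by (rule rd_le[OF v(1) t(1)])
    moreover have "q \<bullet> n \<le> p \<bullet> n + e"
    proof -
      have "(q - p) \<bullet> n \<le> norm (q - p) * norm n" using Cauchy_Schwarz_ineq2[of "q - p" n] by auto
      also have "\<dots> \<le> e / (norm n + 1) * (norm n + 1)"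
        using d(2)[OF t(2) q] e' by (intro mult_mono) auto
      also have "\<dots> = e" using n1 by simp
      finally show ?thesis by (simp add: inner_diff_left)
    qed
    ultimately show "rd v n x \<le> p \<bullet> n + e" by linarith
  qed
qed

text \<open>Total and Borel even where \<open>v\<close> has several subgradients; it is the gradient
  wherever the subgradient is unique.\<close>

definition rgrad :: "(real^'n \<Rightarrow> real) \<Rightarrow> real^'n \<Rightarrow> real^'n" where
  "rgrad v x = (\<chi> i. rd v (axis i 1) x)"

lemma rgrad_unique_subgrad:
  fixes v :: "real^'n \<Rightarrow> real"
  assumes v: "convex_on UNIV v" "coercive v"
    and p: "subgrad v x p" and uniq: "\<And>q. subgrad v x q \<Longrightarrow> q = p"
  shows "rgrad v x = p"
  unfolding rgrad_def using rd_unique_subgrad[OF v p uniq]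
  by (simp add: vec_eq_iff inner_axis)

lemma rgrad_measurable [measurable]:
  fixes v :: "real^'n \<Rightarrow> real"
  assumes "convex_on UNIV v" shows "rgrad v \<in> borel_measurable borel"
proof -
  have "(\<lambda>x. \<Sum>i\<in>UNIV. rd v (axis i 1) x *\<^sub>R (axis i 1 :: real^'n)) \<in> borel_measurable borel"
    using rd_measurable[OF assms] by measurable
  also have "(\<lambda>x. \<Sum>i\<in>UNIV. rd v (axis i 1) x *\<^sub>R (axis i 1 :: real^'n)) = rgrad v"
    by (auto simp: fun_eq_iff rgrad_def vec_eq_iff axis_def if_distrib cong: if_cong)
  finally show ?thesis .
qed

text \<open>One difference quotient in the direction \<open>n\<close> bounds
  \<open>rd (w j) n x\<close> from above and one in the direction \<open>-n\<close> from below. Both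
  converge pointwise, and for a unique subgradient of \<open>v\<close> the limits can be brought
  arbitrarily close together.\<close>

lemma rd_tendsto_unique:
  fixes v :: "'a::euclidean_space \<Rightarrow> real"
  assumes v: "convex_on UNIV v" "coercive v"
    and p: "subgrad v x p" and uniq: "\<And>q. subgrad v x q \<Longrightarrow> q = p"
    and w: "\<And>j. convex_on UNIV (w j)" and lim: "\<And>y. (\<lambda>j. w j y) \<longlonglongrightarrow> v y"
  shows "(\<lambda>j. rd (w j) n x) \<longlonglongrightarrow> rd v n x"
proof (rule LIMSEQ_I)
  fix e :: real assume e: "e > 0"
  have neg: "rd v (-n) x = - rd v n x"
    using rd_unique_subgrad[OF v p uniq] by simp
  have ex: "\<exists>t>0. (v (x + t *\<^sub>R m) - v x) / t < rd v m x + e / 2" for m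
  proof (rule ccontr)
    assume "\<not> ?thesis"
    then have "rd v m x + e / 2 \<le> rd v m x"
      unfolding rd_def by (intro cINF_greatest) auto
    then show False using e by simp
  qed
  obtain t where t: "t > 0" "(v (x + t *\<^sub>R n) - v x) / t < rd v n x + e / 2" using ex by blast
  obtain s where s: "s > 0" "(v (x + s *\<^sub>R (-n)) - v x) / s < rd v (-n) x + e / 2" using ex by blast
  have "(\<lambda>j. (w j (x + t *\<^sub>R n) - w j x) / t) \<longlonglongrightarrow> (v (x + t *\<^sub>R n) - v x) / t"
    using t(1) by (intro tendsto_intros lim) auto
  then have "eventually (\<lambda>j. (w j (x + t *\<^sub>R n) - w j x) / t < rd v n x + e / 2) sequentially"
    using order_tendstoD(2) t(2) by blast
  moreover have "(\<lambda>j. (w j (x + s *\<^sub>R (-n)) - w j x) / s) \<longlonglongrightarrow> (v (x + s *\<^sub>R (-n)) - v x) / s"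
    using s(1) by (intro tendsto_intros lim) auto
  then have "eventually (\<lambda>j. (w j (x + s *\<^sub>R (-n)) - w j x) / s < rd v (-n) x + e / 2) sequentially"
    using order_tendstoD(2) s(2) by blast
  ultimately have "eventually (\<lambda>j. norm (rd (w j) n x - rd v n x) < e) sequentially"
  proof eventually_elim
    case (elim j)
    have "rd (w j) n x \<le> (w j (x + t *\<^sub>R n) - w j x) / t" by (rule rd_le[OF w t(1)])
    moreover have "(w j x - w j (x - s *\<^sub>R n)) / s \<le> rd (w j) n x" by (rule rd_ge_backward[OF w s(1)])
    moreover have "(w j x - w j (x - s *\<^sub>R n)) / s = - ((w j (x + s *\<^sub>R (-n)) - w j x) / s)"
      by (simp add: diff_divide_distrib)
    ultimately show ?case using elim neg e by (simp add: abs_less_iff)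
  qed
  then show "\<exists>no. \<forall>j\<ge>no. norm (rd (w j) n x - rd v n x) < e"
    unfolding eventually_sequentially .
qed

text \<open>Each summand is a ridge function, and products of exponentials are again exponentials,
  so these sums form an algebra made of ridge functions.\<close>

inductive_set expsums :: "('a::euclidean_space \<Rightarrow> real) set" where
  exp_in: "(\<lambda>p. c * exp (\<nu> \<bullet> p)) \<in> expsums"
| add_in: "f \<in> expsums \<Longrightarrow> g \<in> expsums \<Longrightarrow> (\<lambda>p. f p + g p) \<in> expsums"

lemma expsums_continuous: "f \<in> expsums \<Longrightarrow> continuous_on S f"
  by (induction rule: expsums.induct) (intro continuous_intros; assumption)+

lemma expsums_mult:
  assumes "f \<in> expsums" "g \<in> expsums" shows "(\<lambda>p. f p * g p) \<in> expsums"
  using assms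
proof (induction arbitrary: g rule: expsums.induct)
  case (exp_in c \<nu>)
  then show ?case
  proof (induction rule: expsums.induct)
    case (exp_in d \<mu>)
    have "(\<lambda>p. c * exp (\<nu> \<bullet> p) * (d * exp (\<mu> \<bullet> p))) = (\<lambda>p. (c * d) * exp ((\<nu> + \<mu>) \<bullet> p))"
      by (auto simp: fun_eq_iff inner_add_left exp_add)
    then show ?case by (simp only: expsums.exp_in)
  next
    case (add_in f g)
    then show ?case using expsums.add_in[OF add_in.IH] by (simp add: distrib_left)
  qed
next
  case (add_in f1 f2)
  then show ?case using expsums.add_in[OF add_in.IH(1)[OF add_in.prems] add_in.IH(2)[OF add_in.prems]]
    by (simp add: distrib_right)
qed

text \<open>Stone-Weierstrass; the exponential with direction \<open>x - y\<close> separates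
  \<open>x\<close> from \<open>y\<close>.\<close>

lemma expsums_dense:
  fixes f :: "'a::euclidean_space \<Rightarrow> real"
  assumes "compact S" "continuous_on S f" "e > 0"
  obtains g where "g \<in> expsums" "\<And>x. x \<in> S \<Longrightarrow> \<bar>f x - g x\<bar> < e"
proof -
  interpret function_ring_on "expsums :: ('a \<Rightarrow> real) set" S
  proof
    show "(\<lambda>_. c) \<in> expsums" for c :: real using expsums.exp_in[of c 0] by simp
    fix x y :: 'a assume "x \<noteq> y"
    show "\<exists>f\<in>expsums. f x \<noteq> f y"
    proof (rule bexI[of _ "\<lambda>p. 1 * exp ((x - y) \<bullet> p)"])
      have "(x - y) \<bullet> (x - y) \<noteq> 0" using \<open>x \<noteq> y\<close> by simp
      then show "1 * exp ((x - y) \<bullet> x) \<noteq> 1 * exp ((x - y) \<bullet> y)" by (simp add: inner_diff_right)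
    qed (rule expsums.exp_in)
  qed (use assms expsums_continuous expsums_mult expsums.add_in in auto)
  show ?thesis using Stone_Weierstrass_basic[OF assms(2,3)] that by (metis abs_minus_commute)
qed

section \<open>Perturbations of the Legendre transform near a slope\<close>

lemma convex_on_combination:
  fixes A B :: "'a::real_vector \<Rightarrow> real"
  assumes "convex_on UNIV A" "convex_on UNIV B" "0 \<le> t" "t \<le> 1"
  shows "convex_on UNIV (\<lambda>p. (1 - t) * A p + t * B p)"
  using assms by (intro convex_on_add convex_on_cmul) auto

text \<open>The points at which some slope within distance \<open>r\<close> of \<open>\<xi>\<close> is an approximate subgradient form a subset of
  \<open>K\<close>; hence perturbing the Legendre transform near \<open>\<xi>\<close> changes \<open>g\<close> on \<open>K\<close> only.\<close>

locale cap =
  fixes g :: "real^2 \<Rightarrow> real" and K D :: "(real^2) set" and \<xi> :: "real^2" and r \<eta> :: real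
  assumes g: "convex_on UNIV g" "coercive g"
    and K: "compact K" "K \<subseteq> D" and D: "open D"
    and uniq: "\<And>x p q. x \<in> D \<Longrightarrow> subgrad g x p \<Longrightarrow> subgrad g x q \<Longrightarrow> p = q"
    and r: "r > 0" and \<eta>: "\<eta> > 0"
    and caps: "\<And>p x. norm (p - \<xi>) \<le> r \<Longrightarrow> g x + lconj g p - p \<bullet> x \<le> \<eta> \<Longrightarrow> x \<in> K"
begin

abbreviation U :: "real^2 \<Rightarrow> real" where "U \<equiv> lconj g"

lemma U: "convex_on UNIV U" "coercive U" "lconj U = g"
  using g by (auto intro: convex_lconj coercive_lconj lconj_lconj)

definition adm :: "(real^2 \<Rightarrow> real) \<Rightarrow> bool" where
  "adm V \<longleftrightarrow> convex_on UNIV V \<and> (\<forall>p. r \<le> norm (p - \<xi>) \<longrightarrow> V p = U p) \<and> (\<forall>p. \<bar>V p - U p\<bar> \<le> \<eta>)"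

text \<open>Averaging with \<open>U\<close> keeps the transform differentiable on \<open>D\<close>, because \<open>U\<close> is strictly
  convex where it matters.\<close>

definition adm2 :: "(real^2 \<Rightarrow> real) \<Rightarrow> bool" where
  "adm2 V \<longleftrightarrow> adm V \<and> (\<exists>V1. convex_on UNIV V1 \<and> (\<forall>p. V p = U p / 2 + V1 p / 2))"

lemma adm_U: "adm U" "adm2 U"
proof -
  show "adm U" using U \<eta> by (auto simp: adm_def)
  then show "adm2 U" unfolding adm2_def using U(1) by (auto intro!: exI[of _ U])
qed

lemma adm_convex: "adm V \<Longrightarrow> convex_on UNIV V" by (simp add: adm_def)

lemma adm_coercive: "adm V \<Longrightarrow> coercive V"
  by (rule coercive_mono[OF U(2), where c=\<eta>]) (auto simp: adm_def abs_le_iff algebra_simps dest!: spec)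

lemma adm_lconj:
  assumes "adm V"
  shows "convex_on UNIV (lconj V)" "coercive (lconj V)" "lconj (lconj V) = V"
  using assms adm_convex adm_coercive by (auto intro: convex_lconj coercive_lconj lconj_lconj)

lemma adm2_adm: "adm2 V \<Longrightarrow> adm V" by (simp add: adm2_def)

lemma adm_combination:
  assumes "adm A" "adm B" "0 \<le> t" "t \<le> 1" shows "adm (\<lambda>p. (1 - t) * A p + t * B p)"
  unfolding adm_def
proof (intro conjI allI impI)
  show "convex_on UNIV (\<lambda>p. (1 - t) * A p + t * B p)"
    using assms adm_convex by (intro convex_on_combination) auto
  show "(1 - t) * A p + t * B p = U p" if "r \<le> norm (p - \<xi>)" for p
    using assms that by (simp add: adm_def algebra_simps)
  fix p
  have "\<bar>(1 - t) * A p + t * B p - U p\<bar> = \<bar>(1 - t) * (A p - U p) + t * (B p - U p)\<bar>"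
    by (simp add: algebra_simps)
  also have "\<dots> \<le> (1 - t) * \<bar>A p - U p\<bar> + t * \<bar>B p - U p\<bar>"
    using assms abs_triangle_ineq[of "(1 - t) * (A p - U p)" "t * (B p - U p)"] by (simp add: abs_mult)
  also have "\<dots> \<le> (1 - t) * \<eta> + t * \<eta>"
    using assms by (intro add_mono mult_left_mono) (auto simp: adm_def)
  finally show "\<bar>(1 - t) * A p + t * B p - U p\<bar> \<le> \<eta>" by (simp add: algebra_simps)
qed

lemma adm2_combination:
  assumes "adm2 A" "adm2 B" "0 \<le> t" "t \<le> 1" shows "adm2 (\<lambda>p. (1 - t) * A p + t * B p)"
proof -
  obtain A1 where A1: "convex_on UNIV A1" "\<And>p. A p = U p / 2 + A1 p / 2" using assms(1) unfolding adm2_def by auto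
  obtain B1 where B1: "convex_on UNIV B1" "\<And>p. B p = U p / 2 + B1 p / 2" using assms(2) unfolding adm2_def by auto
  have "adm (\<lambda>p. (1 - t) * A p + t * B p)" using assms by (intro adm_combination adm2_adm)
  then show ?thesis
    unfolding adm2_def
  proof (intro conjI exI[of _ "\<lambda>p. (1 - t) * A1 p + t * B1 p"] allI)
    show "convex_on UNIV (\<lambda>p. (1 - t) * A1 p + t * B1 p)" using A1 B1 assms by (intro convex_on_combination) auto
    show "(1 - t) * A p + t * B p = U p / 2 + ((1 - t) * A1 p + t * B1 p) / 2" for p
      by (simp add: A1(2) B1(2) field_simps)
  qed
qed

lemma adm2_half:
  assumes "adm V" shows "adm2 (\<lambda>p. U p / 2 + V p / 2)"
  unfolding adm2_def
proof (intro conjI exI[of _ V])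
  have "adm (\<lambda>p. (1 - 1/2) * U p + (1/2) * V p)" using assms adm_U by (intro adm_combination) auto
  then show "adm (\<lambda>p. U p / 2 + V p / 2)" by simp
qed (use assms adm_convex in auto)

text \<open>At a point off \<open>K\<close> every slope near \<open>\<xi>\<close> has gap above
  \<open>\<eta>\<close>, more than the change from \<open>U\<close> to \<open>V\<close> can make up,
  and the slope that is active for \<open>g\<close> lies where \<open>V = U\<close>.\<close>

lemma adm_outside:
  assumes V: "adm V" and x: "x \<notin> K" shows "lconj V x = g x"
proof (rule antisym)
  show "lconj V x \<le> g x"
  proof (rule lconj_le)
    fix p
    show "x \<bullet> p - V p \<le> g x"
    proof (cases "norm (p - \<xi>) \<le> r")
      case True
      then have "\<eta> < g x + U p - p \<bullet> x" using caps x by (meson not_le)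
      moreover have "U p - \<eta> \<le> V p" using V by (auto simp: adm_def abs_le_iff dest!: spec[of _ p])
      ultimately show ?thesis by (simp add: inner_commute)
    next
      case False
      then have "V p = U p" using V by (simp add: adm_def)
      then show ?thesis using lconj_ge[OF g(2), of p x] by (simp add: inner_commute)
    qed
  qed
  obtain p where p: "g x + U p = p \<bullet> x"
    using subgrad_exists[OF g(1), of x] subgrad_iff_lconj[OF g(2)] by metis
  have "\<not> norm (p - \<xi>) \<le> r"
    using caps[of p x] p \<eta> x by auto
  then have "V p = U p" using V by (simp add: adm_def)
  then show "g x \<le> lconj V x"
    using lconj_ge[OF adm_coercive[OF V], of x p] p by (simp add: inner_commute)
qed

lemma adm_close:
  assumes "adm V" "\<And>p. \<bar>V p - U p\<bar> \<le> c" shows "\<bar>lconj V x - g x\<bar> \<le> c"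
proof -
  have ab: "U p - c \<le> V p" "V p - c \<le> U p" for p using assms(2)[of p] by auto
  have "lconj V x \<le> lconj U x + c" by (rule lconj_mono_bound[OF U(2)]) (rule ab)
  moreover have "lconj U x \<le> lconj V x + c" by (rule lconj_mono_bound[OF adm_coercive[OF assms(1)]]) (rule ab)
  ultimately show ?thesis using U(3) by simp
qed

text \<open>Two subgradients \<open>p\<close> and \<open>q\<close> make \<open>V\<close> affine
  between them, and then also \<open>U\<close>, being half of a convex sum. If the midpoint is near
  \<open>\<xi>\<close>, it touches \<open>g\<close> at some point of \<open>K\<close>, where
  \<open>p\<close> and \<open>q\<close> are then two subgradients of \<open>g\<close>. If not,
  \<open>V = U\<close> around the midpoint, so it is a subgradient of \<open>g\<close> at
  \<open>x\<close> itself, and again \<open>p\<close> and \<open>q\<close> are as well.\<close>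

lemma adm2_uniq:
  assumes V: "adm2 V" and x: "x \<in> D" and p: "subgrad (lconj V) x p" and q: "subgrad (lconj V) x q"
  shows "p = q"
proof (rule ccontr)
  assume ne: "p \<noteq> q"
  obtain V1 where V1: "convex_on UNIV V1" "\<And>p. V p = U p / 2 + V1 p / 2" using V unfolding adm2_def by auto
  have a: "adm V" using V by (rule adm2_adm)
  have pq: "lconj V x + V p = p \<bullet> x" "lconj V x + V q = q \<bullet> x"
    using p q subgrad_iff_lconj[OF adm_lconj(2)[OF a]] adm_lconj(3)[OF a] by auto
  let ?m = "\<lambda>t. (1 - t) *\<^sub>R p + t *\<^sub>R q"
  have ge: "c \<bullet> x - V c \<le> lconj V x" for c using lconj_ge[OF adm_coercive[OF a], of x c] by (simp add: inner_commute)
  have cv: "W (?m t) \<le> (1 - t) * W p + t * W q" if "convex_on UNIV W" "0 \<le> t" "t \<le> 1" for W :: "real^2 \<Rightarrow> real" and t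
    by (rule convex_onD[OF that(1)]) (use that in auto)
  have Vlin: "V (?m t) = (1 - t) * V p + t * V q" if t: "0 \<le> t" "t \<le> 1" for t
  proof (rule antisym)
    show "V (?m t) \<le> (1 - t) * V p + t * V q" by (rule cv[OF adm_convex[OF a] t])
    have "?m t \<bullet> x - lconj V x \<le> V (?m t)" using ge[of "?m t"] by simp
    moreover have "?m t \<bullet> x - lconj V x = (1 - t) * (p \<bullet> x - lconj V x) + t * (q \<bullet> x - lconj V x)"
      by (simp add: inner_add_left algebra_simps)
    moreover have "V p = p \<bullet> x - lconj V x" "V q = q \<bullet> x - lconj V x" using pq by auto
    ultimately show "(1 - t) * V p + t * V q \<le> V (?m t)" by simp
  qed
  have Ulin: "U (?m t) = (1 - t) * U p + t * U q" if t: "0 \<le> t" "t \<le> 1" for t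
  proof -
    have "U (?m t) / 2 + V1 (?m t) / 2 = ((1 - t) * U p + t * U q) / 2 + ((1 - t) * V1 p + t * V1 q) / 2"
      using Vlin[OF t] by (simp add: V1(2) field_simps)
    moreover have "\<And>x y a b :: real. x / 2 + y / 2 = a / 2 + b / 2 \<Longrightarrow> x \<le> a \<Longrightarrow> y \<le> b \<Longrightarrow> x = a" by linarith
    ultimately show ?thesis using cv[OF U(1) t] cv[OF V1(1) t] by blast
  qed
  have sub: "subgrad g y c" if "subgrad g y (?m (1/2))" "c = p \<or> c = q" for y c
  proof -
    have y: "g y + U (?m (1/2)) = ?m (1/2) \<bullet> y" using that(1) subgrad_iff_lconj[OF g(2)] by simp
    have "U (?m (1/2)) = U p / 2 + U q / 2" using Ulin[of "1/2"] by simp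
    moreover have "?m (1/2) \<bullet> y = p \<bullet> y / 2 + q \<bullet> y / 2" by (simp add: inner_add_left)
    moreover have "p \<bullet> y - g y \<le> U p" "q \<bullet> y - g y \<le> U q" using lconj_ge[OF g(2)] by auto
    ultimately have "g y + U p = p \<bullet> y" "g y + U q = q \<bullet> y" using y by linarith+
    then show ?thesis using that(2) subgrad_iff_lconj[OF g(2)] by auto
  qed
  show False
  proof (cases "norm (?m (1/2) - \<xi>) \<le> r")
    case True
    obtain y where y: "g y + U (?m (1/2)) = ?m (1/2) \<bullet> y" using lconj_attained[OF g] .
    have "y \<in> K" using caps[OF True, of y] y \<eta> by simp
    then have "y \<in> D" using K by blast
    moreover have "subgrad g y (?m (1/2))" using y subgrad_iff_lconj[OF g(2)] by simp
    ultimately show False using uniq sub ne by blast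
  next
    case False
    let ?c = "?m (1/2)"
    define d where "d = norm (?c - \<xi>) - r"
    have d: "d > 0" using False by (simp add: d_def)
    have near: "V c = U c" if "c \<in> ball ?c d" for c
    proof -
      have "norm (?c - \<xi>) \<le> norm (?c - c) + norm (c - \<xi>)" using dist_triangle[of ?c \<xi> c] by (simp only: dist_norm)
      then have "r \<le> norm (c - \<xi>)" using that by (simp add: d_def dist_norm)
      then show ?thesis using a by (simp add: adm_def)
    qed
    have cvx: "convex_on UNIV (\<lambda>c. U c - c \<bullet> x)"
    proof -
      have "convex_on UNIV (\<lambda>c::real^2. - (c \<bullet> x))" by (simp add: convex_on_def inner_add_left algebra_simps)
      then show ?thesis using convex_on_add[OF U(1)] by fastforce
    qed
    have Vc: "V ?c - ?c \<bullet> x \<le> V c - c \<bullet> x" for c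
    proof -
      have "V ?c = (p \<bullet> x - lconj V x) / 2 + (q \<bullet> x - lconj V x) / 2" 
      proof -
        have "V p = p \<bullet> x - lconj V x" "V q = q \<bullet> x - lconj V x" using pq by auto
        then show ?thesis using Vlin[of "1/2"] by simp
      qed
      moreover have "?c \<bullet> x = p \<bullet> x / 2 + q \<bullet> x / 2" by (simp add: inner_add_left)
      ultimately have "V ?c - ?c \<bullet> x = - lconj V x" by (simp add: field_simps)
      then show ?thesis using ge[of c] by simp
    qed
    have "\<forall>c\<in>UNIV. U ?c - ?c \<bullet> x \<le> U c - c \<bullet> x"
    proof (rule convex_local_global_minimum[OF d cvx], simp)
      show "\<forall>c\<in>ball ?c d. U ?c - ?c \<bullet> x \<le> U c - c \<bullet> x"
        using near Vc d by (metis centre_in_ball)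
    qed
    then have min: "U ?c - ?c \<bullet> x \<le> U c - c \<bullet> x" for c by simp
    have "lconj U x = ?c \<bullet> x - U ?c"
    proof (rule lconj_eqI[where x="?c"])
      show "x \<bullet> ?c - U ?c = ?c \<bullet> x - U ?c" by (simp only: inner_commute)
      show "x \<bullet> c - U c \<le> ?c \<bullet> x - U ?c" for c using min[of c] inner_commute[of x c] by linarith
    qed
    then have "g x = ?c \<bullet> x - U ?c" by (simp only: U(3))
    then have "subgrad g x ?c" using subgrad_iff_lconj[OF g(2)] by simp
    then show False using uniq[OF x] sub ne by blast
  qed
qed

text \<open>Restricted to \<open>K\<close>, since admissible transforms do not change
  \<open>g\<close> elsewhere; on \<open>K\<close> their gradients are uniformly bounded, so this is
  finite for every continuous \<open>f\<close>.\<close>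

definition \<Phi> :: "(real^2 \<Rightarrow> real) \<Rightarrow> (real^2 \<Rightarrow> real) \<Rightarrow> real" where
  "\<Phi> f V = (LBINT x:K. f (rgrad (lconj V) x))"

lemma gradient_bound:
  obtains L where "L > 0" "\<And>V x. adm V \<Longrightarrow> x \<in> K \<Longrightarrow> norm (rgrad (lconj V) x) \<le> L"
    "\<And>V x n. adm V \<Longrightarrow> x \<in> K \<Longrightarrow> norm n \<le> 1 \<Longrightarrow> \<bar>rd (lconj V) n x\<bar> \<le> L"
proof -
  obtain R where R: "\<And>x. x \<in> K \<Longrightarrow> norm x \<le> R"
    using compact_imp_bounded[OF K(1)] unfolding bounded_iff by blast
  obtain B where B: "B > 0" "\<And>y. norm y \<le> R + 1 \<Longrightarrow> \<bar>g y\<bar> \<le> B" using convex_bounded_ball[OF g(1)] by blast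
  have rdb: "\<bar>rd (lconj V) n x\<bar> \<le> 2 * (B + \<eta>)" if "adm V" "x \<in> K" "norm n \<le> 1" for V x n
  proof (rule rd_bound[OF adm_lconj(1)[OF that(1)] that(3) _ R[OF that(2)]])
    fix y :: "real^2" assume "norm y \<le> R + 1"
    then have "\<bar>g y\<bar> \<le> B" by (rule B)
    moreover have "\<bar>lconj V y - g y\<bar> \<le> \<eta>" using that(1) by (intro adm_close) (auto simp: adm_def)
    ultimately show "\<bar>lconj V y\<bar> \<le> B + \<eta>" by linarith
  qed
  show ?thesis
  proof (rule that[of "4 * (B + \<eta>)"])
    show "0 < 4 * (B + \<eta>)" using B \<eta> by simp
    fix V x assume V: "adm V" "x \<in> K"
    have "norm (rgrad (lconj V) x) \<le> (\<Sum>i\<in>UNIV. \<bar>rgrad (lconj V) x $ i\<bar>)" by (rule norm_le_l1_cart)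
    also have "\<dots> \<le> (\<Sum>i\<in>(UNIV::2 set). 2 * (B + \<eta>))"
    proof (rule sum_mono)
      fix i :: 2
      have "\<bar>rd (lconj V) (axis i 1) x\<bar> \<le> 2 * (B + \<eta>)" by (rule rdb[OF V]) simp
      then show "\<bar>rgrad (lconj V) x $ i\<bar> \<le> 2 * (B + \<eta>)" by (simp add: rgrad_def)
    qed
    also have "\<dots> = 4 * (B + \<eta>)" by simp
    finally show "norm (rgrad (lconj V) x) \<le> 4 * (B + \<eta>)" .
  next
    fix V x n assume "adm V" "x \<in> K" "norm (n::real^2) \<le> 1"
    then have "\<bar>rd (lconj V) n x\<bar> \<le> 2 * (B + \<eta>)" by (rule rdb)
    then show "\<bar>rd (lconj V) n x\<bar> \<le> 4 * (B + \<eta>)" using B \<eta> by linarith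
  qed
qed

lemma rd_rgrad:
  assumes "adm2 V" "x \<in> D" shows "rd (lconj V) n x = n \<bullet> rgrad (lconj V) x" "subgrad (lconj V) x (rgrad (lconj V) x)"
proof -
  note a = adm_lconj[OF adm2_adm[OF assms(1)]]
  obtain p where p: "subgrad (lconj V) x p" using subgrad_exists[OF a(1)] .
  have u: "q = p" if "subgrad (lconj V) x q" for q using adm2_uniq[OF assms] p that by blast
  show "rd (lconj V) n x = n \<bullet> rgrad (lconj V) x" "subgrad (lconj V) x (rgrad (lconj V) x)"
    using rd_unique_subgrad[OF a(1,2) p u] rgrad_unique_subgrad[OF a(1,2) p u] p by (auto simp: inner_commute)
qed

lemma \<Phi>_integrable:
  fixes f :: "real^2 \<Rightarrow> real"
  assumes f: "continuous_on UNIV f" and V: "adm V"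
  shows "set_integrable lborel K (\<lambda>x. f (rgrad (lconj V) x))"
proof -
  obtain L where L: "\<And>V x. adm V \<Longrightarrow> x \<in> K \<Longrightarrow> norm (rgrad (lconj V) x) \<le> L" using gradient_bound by metis
  have "bounded (f ` cball 0 L)"
    by (intro compact_imp_bounded compact_continuous_image continuous_on_subset[OF f]) auto
  then obtain B where B: "\<And>p. norm p \<le> L \<Longrightarrow> norm (f p) \<le> B"
    unfolding bounded_iff by (metis imageI mem_cball_0)
  show ?thesis
  proof (rule set_integrable_bounded[where C=B])
    have [measurable]: "f \<in> borel_measurable borel" using f by (rule borel_measurable_continuous_onI)
    show "(\<lambda>x. f (rgrad (lconj V) x)) \<in> borel_measurable borel"
      using rgrad_measurable[OF adm_lconj(1)[OF V]] by measurable
    show "K \<in> sets borel" "bounded K" using K by (auto simp: compact_imp_closed compact_imp_bounded)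
  qed (use B L V in auto)
qed

lemma \<Phi>_add:
  assumes "continuous_on UNIV f1" "continuous_on UNIV f2" "adm V"
  shows "\<Phi> (\<lambda>p. f1 p + f2 p) V = \<Phi> f1 V + \<Phi> f2 V"
  unfolding \<Phi>_def by (rule set_integral_add(2)[OF \<Phi>_integrable[OF assms(1,3)] \<Phi>_integrable[OF assms(2,3)]])

lemma measure_bound:
  assumes f: "set_integrable lborel K f" and b: "\<And>x. x \<in> K \<Longrightarrow> \<bar>f x\<bar> \<le> e"
  shows "\<bar>LBINT x:K. f x\<bar> \<le> e * measure lborel K"
proof -
  have fin: "emeasure lborel K < \<infinity>" using compact_imp_bounded[OF K(1)] by (rule emeasure_bounded_finite)
  have Kb: "K \<in> sets lborel" using K by (simp add: compact_imp_closed)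
  have ie: "set_integrable lborel K (\<lambda>x. c)" "(LBINT x:K. c) = c * measure lborel K" for c :: real
    using fin Kb by (auto simp: set_integrable_def set_lebesgue_integral_def)
  have "(LBINT x:K. f x) \<le> (LBINT x:K. e)" "(LBINT x:K. - e) \<le> (LBINT x:K. f x)"
    by (intro set_integral_mono f ie; use b in \<open>force simp: abs_le_iff\<close>)+
  then show ?thesis using ie by (simp add: abs_le_iff)
qed

lemma \<Phi>_approx:
  assumes "continuous_on UNIV f1" "continuous_on UNIV f2" "adm V"
    "\<And>x. x \<in> K \<Longrightarrow> \<bar>f1 (rgrad (lconj V) x) - f2 (rgrad (lconj V) x)\<bar> \<le> e"
  shows "\<bar>\<Phi> f1 V - \<Phi> f2 V\<bar> \<le> e * measure lborel K"
proof -
  note i = \<Phi>_integrable[OF assms(1,3)] \<Phi>_integrable[OF assms(2,3)]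
  have "\<Phi> f1 V - \<Phi> f2 V = (LBINT x:K. f1 (rgrad (lconj V) x) - f2 (rgrad (lconj V) x))"
    unfolding \<Phi>_def by (rule set_integral_diff(2)[OF i, symmetric])
  then show ?thesis using measure_bound[OF set_integral_diff(1)[OF i] assms(4)] by simp
qed

lemma adm_far: "adm V \<Longrightarrow> r + norm \<xi> \<le> norm p \<Longrightarrow> V p = U p"
  using norm_triangle_ineq2[of p \<xi>] by (auto simp: adm_def)

text \<open>\<open>ridge_formula\<close> speaks of the directional derivative \<open>rd _ n\<close>;
  condition \<open>adm2\<close> is what identifies it with \<open>n \<bullet> rgrad _\<close> on
  \<open>K\<close>. Off \<open>K\<close> the integrand vanishes.\<close>

lemma \<Phi>_ridge:
  assumes A: "adm2 A" and B: "adm2 B" and n: "norm n = 1"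
    and h: "\<And>x. (h has_real_derivative h' x) (at x)" "\<And>x. (h' has_real_derivative h'' x) (at x)"
      "continuous_on UNIV h''"
  shows "integrable lborel (\<lambda>k. h'' k * dual_energy_density A B n k)"
    "\<Phi> (\<lambda>p. h (n \<bullet> p)) B - \<Phi> (\<lambda>p. h (n \<bullet> p)) A = (\<integral>k. h'' k * dual_energy_density A B n k \<partial>lborel) / 2"
proof -
  note a = adm_lconj[OF adm2_adm[OF A]] and b = adm_lconj[OF adm2_adm[OF B]]
  have eqK: "lconj A x = lconj B x" if "x \<notin> K" for x
    using adm_outside[OF adm2_adm[OF A] that] adm_outside[OF adm2_adm[OF B] that] by simp
  obtain R where R: "\<And>x. x \<in> K \<Longrightarrow> norm x \<le> R"
    using compact_imp_bounded[OF K(1)] unfolding bounded_iff by blast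
  have far: "lconj A x = lconj B x" if "R + 1 \<le> norm x" for x
    using eqK R that by (metis add_le_same_cancel1 not_one_le_zero order_trans)
  have dfar: "lconj (lconj A) p = lconj (lconj B) p" if "r + norm \<xi> \<le> norm p" for p
    using adm_far[OF adm2_adm[OF A] that] adm_far[OF adm2_adm[OF B] that] a(3) b(3) by simp
  note rf = ridge_formula[OF a(1,2) b(1,2) n far dfar h, unfolded a(3) b(3)]
  show "integrable lborel (\<lambda>k. h'' k * dual_energy_density A B n k)" by (rule rf(2))
  have hc: "continuous_on UNIV h" using h(1) by (auto simp: continuous_on_eq_continuous_at intro!: DERIV_isCont)
  have hc': "continuous_on UNIV (\<lambda>p::real^2. h (n \<bullet> p))"
    by (rule continuous_on_compose2[OF hc]) (auto intro!: continuous_intros)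
  have "(\<integral>x. h (rd (lconj B) n x) - h (rd (lconj A) n x) \<partial>lborel)
      = (LBINT x:K. h (rd (lconj B) n x) - h (rd (lconj A) n x))"
    unfolding set_lebesgue_integral_def
  proof (rule Bochner_Integration.integral_cong)
    fix x
    show "h (rd (lconj B) n x) - h (rd (lconj A) n x) = indicat_real K x *\<^sub>R (h (rd (lconj B) n x) - h (rd (lconj A) n x))"
    proof (cases "x \<in> K")
      case False
      have "rd (lconj A) n x = rd (lconj B) n x"
        by (rule rd_eq_outside[OF a(1) b(1) compact_imp_closed[OF K(1)] eqK False])
      then show ?thesis by simp
    qed simp
  qed simp
  also have "\<dots> = (LBINT x:K. h (n \<bullet> rgrad (lconj B) x) - h (n \<bullet> rgrad (lconj A) x))"
    by (rule set_lebesgue_integral_cong) (use rd_rgrad(1)[OF A] rd_rgrad(1)[OF B] K in \<open>auto simp: compact_imp_closed subset_iff\<close>)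
  also have "\<dots> = \<Phi> (\<lambda>p. h (n \<bullet> p)) B - \<Phi> (\<lambda>p. h (n \<bullet> p)) A"
    unfolding \<Phi>_def
    by (rule set_integral_diff(2)[OF \<Phi>_integrable[OF hc' adm2_adm[OF B]] \<Phi>_integrable[OF hc' adm2_adm[OF A]]])
  finally show "\<Phi> (\<lambda>p. h (n \<bullet> p)) B - \<Phi> (\<lambda>p. h (n \<bullet> p)) A = (\<integral>k. h'' k * dual_energy_density A B n k \<partial>lborel) / 2"
    using rf(3) by simp
qed

end

text \<open>Meant for \<open>T\<close> the difference of the two sides of an identity that is linear
  in the integrand. Every member of \<open>expsums\<close> is a sum of exponentials along unit
  vectors, so \<open>T\<close> vanishes on it, and the sup norm bound carries this over to the
  closure.\<close>

lemma exp_extend: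
  fixes T :: "(real^2 \<Rightarrow> real) \<Rightarrow> real"
  assumes add: "\<And>f1 f2. continuous_on UNIV f1 \<Longrightarrow> continuous_on UNIV f2 \<Longrightarrow> T (\<lambda>p. f1 p + f2 p) = T f1 + T f2"
    and base: "\<And>c \<kappa> n. norm n = 1 \<Longrightarrow> T (\<lambda>p. c * exp (\<kappa> * (n \<bullet> p))) = 0"
    and bound: "\<And>f1 f2 e. continuous_on UNIV f1 \<Longrightarrow> continuous_on UNIV f2 \<Longrightarrow>
      (\<And>p. norm p \<le> L \<Longrightarrow> \<bar>f1 p - f2 p\<bar> \<le> e) \<Longrightarrow> \<bar>T f1 - T f2\<bar> \<le> C * e"
    and C: "C \<ge> 0" and f: "continuous_on UNIV f"
  shows "T f = 0"
proof -
  have E: "T h = 0" if "h \<in> expsums" for h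
    using that
  proof (induction rule: expsums.induct)
    case (exp_in c \<nu>)
    obtain \<kappa> n where "norm (n::real^2) = 1" "\<nu> = \<kappa> *\<^sub>R n"
    proof (cases "\<nu> = 0")
      case True
      then show ?thesis by (intro that[of "axis 1 1" 0]) auto
    next
      case False
      then show ?thesis by (intro that[of "sgn \<nu>" "norm \<nu>"]) (auto simp: norm_sgn sgn_div_norm)
    qed
    then show ?case using base[of n c \<kappa>] by simp
  next
    case (add_in f g)
    then show ?case
      using add[OF expsums_continuous[OF add_in.hyps(1)] expsums_continuous[OF add_in.hyps(2)]] by simp
  qed
  have "\<bar>T f\<bar> \<le> C * e" if e: "e > 0" for e
  proof -
    obtain h where h: "h \<in> expsums" "\<And>x. x \<in> cball 0 L \<Longrightarrow> \<bar>f x - h x\<bar> < e"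
      using expsums_dense[OF compact_cball continuous_on_subset[OF f] e] by (metis subset_UNIV)
    have "\<bar>T f - T h\<bar> \<le> C * e"
      by (rule bound[OF f expsums_continuous[OF h(1)]]) (use h(2) in \<open>force simp: dist_norm\<close>)
    then show ?thesis using E[OF h(1)] by simp
  qed
  then have "\<bar>T f\<bar> \<le> 0 + e" if "e > 0" for e
  proof -
    have "C * (e / (C + 1)) \<le> e" using C that by (simp add: field_simps)
    then show ?thesis using \<open>\<And>e. e > 0 \<Longrightarrow> \<bar>T f\<bar> \<le> C * e\<close>[of "e / (C + 1)"] C that by simp
  qed
  then have "\<bar>T f\<bar> \<le> 0" by (rule field_le_epsilon)
  then show ?thesis by simp
qed

lemma exp_ridge_derivs:
  fixes c \<kappa> :: real
  shows "((\<lambda>x. c * exp (\<kappa> * x)) has_real_derivative (c * \<kappa> * exp (\<kappa> * x))) (at x)"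
    "((\<lambda>x. c * \<kappa> * exp (\<kappa> * x)) has_real_derivative (c * \<kappa>\<^sup>2 * exp (\<kappa> * x))) (at x)"
    "continuous_on UNIV (\<lambda>x. c * \<kappa>\<^sup>2 * exp (\<kappa> * x))"
  by (auto intro!: derivative_eq_intros continuous_intros simp: power2_eq_square)

context cap
begin

lemma dual_energy_integrable:
  assumes "adm A" "adm B" "norm n = 1"
  shows "integrable lborel (\<lambda>\<sigma>. (rd A (perp n) (\<sigma> *\<^sub>R perp n + k *\<^sub>R n))\<^sup>2 - (rd B (perp n) (\<sigma> *\<^sub>R perp n + k *\<^sub>R n))\<^sup>2)"
proof -
  let ?T = "r + norm \<xi>"
  note cA = adm_convex[OF assms(1)] and cB = adm_convex[OF assms(2)]
  obtain LA where LA: "\<And>x. norm x \<le> ?T + \<bar>k\<bar> \<Longrightarrow> \<bar>rd A (perp n) x\<bar> \<le> LA"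
    using rd_bounded[OF cA, of "perp n" "?T + \<bar>k\<bar>"] assms(3) by auto
  obtain LB where LB: "\<And>x. norm x \<le> ?T + \<bar>k\<bar> \<Longrightarrow> \<bar>rd B (perp n) x\<bar> \<le> LB"
    using rd_bounded[OF cB, of "perp n" "?T + \<bar>k\<bar>"] assms(3) by auto
  show ?thesis
  proof (rule integrable_cball[where R="?T" and C="LA\<^sup>2 + LB\<^sup>2"])
    have [measurable]: "rd A (perp n) \<in> borel_measurable borel" "rd B (perp n) \<in> borel_measurable borel"
      using cA cB by (auto intro: rd_measurable)
    show "(\<lambda>\<sigma>. (rd A (perp n) (\<sigma> *\<^sub>R perp n + k *\<^sub>R n))\<^sup>2 - (rd B (perp n) (\<sigma> *\<^sub>R perp n + k *\<^sub>R n))\<^sup>2) \<in> borel_measurable borel"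
      by measurable
  next
    fix \<sigma> :: real assume s: "norm \<sigma> \<le> ?T"
    have "norm (\<sigma> *\<^sub>R perp n + k *\<^sub>R n) \<le> ?T + \<bar>k\<bar>"
      using norm_triangle_ineq[of "\<sigma> *\<^sub>R perp n" "k *\<^sub>R n"] s assms(3) by auto
    then have "\<bar>rd A (perp n) (\<sigma> *\<^sub>R perp n + k *\<^sub>R n)\<bar> \<le> LA" "\<bar>rd B (perp n) (\<sigma> *\<^sub>R perp n + k *\<^sub>R n)\<bar> \<le> LB"
      using LA LB by auto
    then have "(rd A (perp n) (\<sigma> *\<^sub>R perp n + k *\<^sub>R n))\<^sup>2 \<le> LA\<^sup>2" "(rd B (perp n) (\<sigma> *\<^sub>R perp n + k *\<^sub>R n))\<^sup>2 \<le> LB\<^sup>2"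
      by (auto intro: abs_le_square_iff[THEN iffD1] order_trans[OF _ abs_ge_self])
    moreover have "\<And>x y a b :: real. 0 \<le> x \<Longrightarrow> 0 \<le> y \<Longrightarrow> x \<le> a \<Longrightarrow> y \<le> b \<Longrightarrow> \<bar>x - y\<bar> \<le> a + b" by linarith
    ultimately show "\<bar>(rd A (perp n) (\<sigma> *\<^sub>R perp n + k *\<^sub>R n))\<^sup>2 - (rd B (perp n) (\<sigma> *\<^sub>R perp n + k *\<^sub>R n))\<^sup>2\<bar> \<le> LA\<^sup>2 + LB\<^sup>2"
      by (meson zero_le_power2)
  next
    fix \<sigma> :: real assume "?T < norm \<sigma>"
    then have "?T < norm (\<sigma> *\<^sub>R perp n + k *\<^sub>R n)"
      using frame_norm_ge(2)[OF assms(3), of \<sigma> k] by (simp add: add.commute)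
    then have "rd A (perp n) (\<sigma> *\<^sub>R perp n + k *\<^sub>R n) = rd B (perp n) (\<sigma> *\<^sub>R perp n + k *\<^sub>R n)"
    proof (rule rd_eq_outside_ball[OF cA cB, where R="?T", rotated])
      show "A y = B y" if "?T \<le> norm y" for y using adm_far[OF assms(1) that] adm_far[OF assms(2) that] by simp
    qed
    then show "(rd A (perp n) (\<sigma> *\<^sub>R perp n + k *\<^sub>R n))\<^sup>2 - (rd B (perp n) (\<sigma> *\<^sub>R perp n + k *\<^sub>R n))\<^sup>2 = 0" by simp
  qed
qed

lemma dual_energy_quadratic:
  assumes A: "adm A" and B: "adm B" and n: "norm n = 1" and t: "0 \<le> t" "t \<le> 1"
  shows "dual_energy_density A (\<lambda>p. (1 - t) * A p + t * B p) n k =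
    4 * t * (1 - t) * dual_energy_density A (\<lambda>p. (1 - 1/2) * A p + (1/2) * B p) n k
    + t * (2 * t - 1) * dual_energy_density A B n k"
proof -
  let ?m = "\<lambda>s p. (1 - s) * A p + s * B p"
  have adm: "adm (?m s)" if "0 \<le> s" "s \<le> 1" for s using adm_combination[OF A B that] .
  have rdm: "rd (?m s) (perp n) x = (1 - s) * rd A (perp n) x + s * rd B (perp n) x" if "0 \<le> s" "s \<le> 1" for s x
    by (rule rd_linear) (use adm_convex[OF A] adm_convex[OF B] adm_convex[OF adm[OF that]] in auto)
  let ?a = "\<lambda>\<sigma>. rd A (perp n) (\<sigma> *\<^sub>R perp n + k *\<^sub>R n)" and ?b = "\<lambda>\<sigma>. rd B (perp n) (\<sigma> *\<^sub>R perp n + k *\<^sub>R n)"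
  \<comment> \<open>Lagrange interpolation: a quadratic in \<open>t\<close> that vanishes at
    \<open>0\<close> is recovered from its values at \<open>1/2\<close> and
    \<open>1\<close>.\<close>
  have alg: "x\<^sup>2 - ((1 - t) * x + t * y)\<^sup>2 = 4 * t * (1 - t) * (x\<^sup>2 - ((1 - 1/2) * x + (1/2) * y)\<^sup>2)
      + t * (2 * t - 1) * (x\<^sup>2 - y\<^sup>2)" for x y :: real
    by (simp add: power2_eq_square field_simps)
  have "dual_energy_density A (?m t) n k = (\<integral>\<sigma>. 4 * t * (1 - t) * ((?a \<sigma>)\<^sup>2 - ((1 - 1/2) * ?a \<sigma> + (1/2) * ?b \<sigma>)\<^sup>2)
      + t * (2 * t - 1) * ((?a \<sigma>)\<^sup>2 - (?b \<sigma>)\<^sup>2) \<partial>lborel)"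
    unfolding dual_energy_density_def rdm[OF t]
    by (rule Bochner_Integration.integral_cong[OF refl]) (rule alg)
  also have "\<dots> = 4 * t * (1 - t) * dual_energy_density A (?m (1/2)) n k + t * (2 * t - 1) * dual_energy_density A B n k"
    using dual_energy_integrable[OF A adm[of "1/2"] n, of k] dual_energy_integrable[OF A B n, of k]
    unfolding dual_energy_density_def using rdm[of "1/2"] by simp
  finally show ?thesis .
qed

lemma \<Phi>_cong_bound:
  obtains L M where "M \<ge> 0" "\<And>(f1 :: real^2 \<Rightarrow> real) f2 V e. continuous_on UNIV f1 \<Longrightarrow> continuous_on UNIV f2 \<Longrightarrow> adm V \<Longrightarrow>
      (\<And>p. norm p \<le> L \<Longrightarrow> \<bar>f1 p - f2 p\<bar> \<le> e) \<Longrightarrow> \<bar>\<Phi> f1 V - \<Phi> f2 V\<bar> \<le> M * e"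
proof -
  obtain L where L: "\<And>V x. adm V \<Longrightarrow> x \<in> K \<Longrightarrow> norm (rgrad (lconj V) x) \<le> L" using gradient_bound by metis
  show ?thesis
  proof (rule that[of "measure lborel K" L])
    fix f1 f2 :: "real^2 \<Rightarrow> real" and V e
    assume "continuous_on UNIV f1" "continuous_on UNIV f2" "adm V" "\<And>p. norm p \<le> L \<Longrightarrow> \<bar>f1 p - f2 p\<bar> \<le> e"
    then show "\<bar>\<Phi> f1 V - \<Phi> f2 V\<bar> \<le> measure lborel K * e"
      using \<Phi>_approx[of f1 f2 V e] L by (simp add: mult.commute)
  qed simp
qed

text \<open>Lagrange interpolation at \<open>0\<close>, \<open>1/2\<close>, \<open>1\<close>: along segments of dual functions \<open>\<Phi> f\<close> is a
  quadratic polynomial.\<close>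

lemma \<Phi>_quadratic:
  assumes f: "continuous_on UNIV f" and A: "adm2 A" and B: "adm2 B" and t: "0 \<le> t" "t \<le> 1"
  shows "\<Phi> f (\<lambda>p. (1 - t) * A p + t * B p) = (1 - t) * (1 - 2 * t) * \<Phi> f A
     + 4 * t * (1 - t) * \<Phi> f (\<lambda>p. (1 - 1/2) * A p + (1/2) * B p) + t * (2 * t - 1) * \<Phi> f B"
proof -
  let ?m = "\<lambda>s p. (1 - s) * A p + s * B p"
  let ?T = "\<lambda>f. \<Phi> f (?m t) - ((1 - t) * (1 - 2 * t) * \<Phi> f A + 4 * t * (1 - t) * \<Phi> f (?m (1/2)) + t * (2 * t - 1) * \<Phi> f B)"
  have m: "adm2 (?m s)" if "0 \<le> s" "s \<le> 1" for s using adm2_combination[OF A B that] .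
  note adms = adm2_adm[OF A] adm2_adm[OF B] adm2_adm[OF m[OF t]] adm2_adm[OF m[of "1/2"], simplified]
  obtain L M where M: "M \<ge> 0" "\<And>(f1 :: real^2 \<Rightarrow> real) f2 V e. continuous_on UNIV f1 \<Longrightarrow> continuous_on UNIV f2 \<Longrightarrow> adm V \<Longrightarrow>
      (\<And>p. norm p \<le> L \<Longrightarrow> \<bar>f1 p - f2 p\<bar> \<le> e) \<Longrightarrow> \<bar>\<Phi> f1 V - \<Phi> f2 V\<bar> \<le> M * e"
    using \<Phi>_cong_bound by metis
  \<comment> \<open>In the constant below, \<open>7 = 1 + 1 + 4 + 1\<close> adds the bounds for the
    coefficients of the four energies.\<close>
  have "?T f = 0"
  proof (rule exp_extend[where L=L and C="7 * M", OF _ _ _ _ f])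
    show "?T (\<lambda>p. f1 p + f2 p) = ?T f1 + ?T f2" if "continuous_on UNIV f1" "continuous_on UNIV f2" for f1 f2
      using \<Phi>_add[OF that adms(1)] \<Phi>_add[OF that adms(2)] \<Phi>_add[OF that adms(3)] \<Phi>_add[OF that adms(4)]
      by (simp add: algebra_simps)
  next
    fix c \<kappa> :: real and n :: "real^2" assume n: "norm n = 1"
    let ?h = "\<lambda>x. c * exp (\<kappa> * x)"
    let ?F = "\<lambda>p::real^2. c * exp (\<kappa> * (n \<bullet> p))"
    let ?J = "\<lambda>V k. c * \<kappa>\<^sup>2 * exp (\<kappa> * k) * dual_energy_density A V n k"
    note R = \<Phi>_ridge[OF A _ n exp_ridge_derivs, of _ c \<kappa>]
    have "\<Phi> ?F (?m t) - \<Phi> ?F A = (\<integral>k. ?J (?m t) k \<partial>lborel) / 2" by (rule R(2)[OF m[OF t]])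
    also have "(\<integral>k. ?J (?m t) k \<partial>lborel) = (\<integral>k. 4 * t * (1 - t) * ?J (?m (1/2)) k + t * (2 * t - 1) * ?J B k \<partial>lborel)"
      unfolding dual_energy_quadratic[OF adms(1,2) n t]
      by (rule Bochner_Integration.integral_cong) (auto simp: algebra_simps)
    also have "\<dots> = 4 * t * (1 - t) * (\<integral>k. ?J (?m (1/2)) k \<partial>lborel) + t * (2 * t - 1) * (\<integral>k. ?J B k \<partial>lborel)"
      using R(1)[OF m[of "1/2"]] R(1)[OF B] by simp
    also have "(\<integral>k. ?J (?m (1/2)) k \<partial>lborel) = 2 * (\<Phi> ?F (?m (1/2)) - \<Phi> ?F A)" using R(2)[OF m[of "1/2"]] by simp
    also have "(\<integral>k. ?J B k \<partial>lborel) = 2 * (\<Phi> ?F B - \<Phi> ?F A)" using R(2)[OF B] by simp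
    finally show "?T ?F = 0" by (simp add: algebra_simps)
  next
    fix f1 f2 :: "real^2 \<Rightarrow> real" and e
    assume c: "continuous_on UNIV f1" "continuous_on UNIV f2" "\<And>p. norm p \<le> L \<Longrightarrow> \<bar>f1 p - f2 p\<bar> \<le> e"
    let ?d = "\<lambda>V. \<Phi> f1 V - \<Phi> f2 V"
    have b: "\<bar>?d A\<bar> \<le> M * e" "\<bar>?d B\<bar> \<le> M * e" "\<bar>?d (?m t)\<bar> \<le> M * e" "\<bar>?d (?m (1/2))\<bar> \<le> M * e"
      using M(2)[OF c(1,2) _ c(3)] adms by simp_all
    have pos: "0 \<le> M * e" using b(1) by linarith
    have w: "\<bar>(1 - t) * (1 - 2 * t)\<bar> \<le> 1" "\<bar>4 * t * (1 - t)\<bar> \<le> 4" "\<bar>t * (2 * t - 1)\<bar> \<le> 1"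
    proof -
      show "\<bar>(1 - t) * (1 - 2 * t)\<bar> \<le> 1" unfolding abs_mult using t by (intro mult_le_one) auto
      show "\<bar>t * (2 * t - 1)\<bar> \<le> 1" unfolding abs_mult using t by (intro mult_le_one) auto
      have "t * (1 - t) \<le> 1" "0 \<le> t * (1 - t)" using t by (auto intro: mult_le_one)
      then show "\<bar>4 * t * (1 - t)\<bar> \<le> 4" by (simp add: mult.assoc)
    qed
    have mb: "\<bar>u * v\<bar> \<le> c * (M * e)" if "\<bar>u\<bar> \<le> c" "\<bar>v\<bar> \<le> M * e" for u v c :: real
      unfolding abs_mult using that by (intro mult_mono) auto
    have "?T f1 - ?T f2 = ?d (?m t) - ((1 - t) * (1 - 2 * t) * ?d A + 4 * t * (1 - t) * ?d (?m (1/2)) + t * (2 * t - 1) * ?d B)"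
      by (simp add: algebra_simps)
    then show "\<bar>?T f1 - ?T f2\<bar> \<le> 7 * M * e"
      using b(3) mb[OF w(1) b(1)] mb[OF w(2) b(4)] mb[OF w(3) b(2)] by linarith
  qed (use M in simp)
  then show ?thesis by simp
qed

end

section \<open>Creases\<close>

lemma rd_affine: "rd (\<lambda>s::real. a + b * s) 1 s = b"
proof -
  have "(\<lambda>t. (a + b * (s + t *\<^sub>R 1) - (a + b * s)) / t) ` {0<..} = (\<lambda>t. b) ` {0::real<..}"
    by (rule image_cong[OF refl]) (simp add: distrib_left)
  then have "rd (\<lambda>s::real. a + b * s) 1 s = (INF t\<in>{0::real<..}. b)"
    unfolding rd_def by (rule arg_cong)
  also have "\<dots> = b" by (rule cINF_const) auto
  finally show ?thesis .
qed

lemma convex_affine_real: "convex_on UNIV (\<lambda>s::real. a + b * s)"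
  by (rule convex_onI) (auto simp: algebra_simps)

lemma convex_kink:
  fixes c0 c1 J c :: real
  assumes "J \<ge> 0" shows "convex_on UNIV (\<lambda>s. c0 + c1 * s + J * max (s - c) 0)"
proof -
  have "convex_on UNIV (\<lambda>s::real. max (s - c) 0)"
  proof (rule convex_onI)
    fix t x y :: real assume t: "0 < t" "t < 1"
    have "(1 - t) *\<^sub>R x + t *\<^sub>R y - c = (1 - t) * (x - c) + t * (y - c)" by (simp add: algebra_simps)
    also have "\<dots> \<le> (1 - t) * max (x - c) 0 + t * max (y - c) 0"
      using t by (intro add_mono mult_left_mono) auto
    finally show "max ((1 - t) *\<^sub>R x + t *\<^sub>R y - c) 0 \<le> (1 - t) * max (x - c) 0 + t * max (y - c) 0"
      using t by (auto intro!: add_nonneg_nonneg)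
  qed simp
  then show ?thesis by (intro convex_on_add convex_affine_real convex_on_cmul assms)
qed

lemma convex_max:
  assumes "convex_on UNIV A" "convex_on UNIV (B :: 'a::real_vector \<Rightarrow> real)" shows "convex_on UNIV (\<lambda>x. max (A x) (B x))"
proof (rule convex_onI)
  fix t :: real and x y assume t: "0 < t" "t < 1"
  have "A ((1 - t) *\<^sub>R x + t *\<^sub>R y) \<le> (1 - t) * max (A x) (B x) + t * max (A y) (B y)"
    using convex_onD[OF assms(1), of t x y] t
    by (smt (verit) UNIV_I max.cobounded1 mult_left_mono)
  moreover have "B ((1 - t) *\<^sub>R x + t *\<^sub>R y) \<le> (1 - t) * max (A x) (B x) + t * max (A y) (B y)"
    using convex_onD[OF assms(2), of t x y] t
    by (smt (verit) UNIV_I max.cobounded2 mult_left_mono)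
  ultimately show "max (A ((1 - t) *\<^sub>R x + t *\<^sub>R y)) (B ((1 - t) *\<^sub>R x + t *\<^sub>R y)) \<le> (1 - t) * max (A x) (B x) + t * max (A y) (B y)"
    by simp
qed simp

lemma rd_kink:
  fixes c0 c1 J c :: real
  assumes "J \<ge> 0"
  shows "rd (\<lambda>s. c0 + c1 * s + J * max (s - c) 0) 1 s = c1 + J * indicator {c..} s"
proof (cases "c \<le> s")
  case True
  have "rd (\<lambda>s. c0 + c1 * s + J * max (s - c) 0) 1 s = rd (\<lambda>s. (c0 - J * c) + (c1 + J) * s) 1 s"
    by (rule rd_eqI[OF convex_kink[OF assms] zero_less_one _ convex_affine_real]) (use True in \<open>auto simp: algebra_simps max_def\<close>)
  then show ?thesis using True unfolding rd_affine by simp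
next
  case False
  have "rd (\<lambda>s. c0 + c1 * s + J * max (s - c) 0) 1 s = rd (\<lambda>s. c0 + c1 * s) 1 s"
    by (rule rd_eqI[OF convex_kink[OF assms] _ _ convex_affine_real, of "c - s"]) (use False in \<open>auto simp: max_def\<close>)
  then show ?thesis using False unfolding rd_affine by simp
qed

text \<open>Where the maximum of \<open>A\<close> and \<open>G\<close> equals \<open>A\<close>, its derivative is that of \<open>A\<close> almost everywhere;
  elsewhere it is the derivative of \<open>G\<close>, which jumps only at \<open>c\<close>.\<close>

lemma kink_identity:
  fixes A :: "real \<Rightarrow> real" and c0 c1 J c :: real
  defines "G \<equiv> \<lambda>s. c0 + c1 * s + J * max (s - c) 0"
  defines "B \<equiv> \<lambda>s. max (A s) (G s)"
  assumes A: "convex_on UNIV A" and J: "J \<ge> 0" and out: "\<And>s. T \<le> \<bar>s\<bar> \<Longrightarrow> G s \<le> A s"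
  shows "integrable lborel (\<lambda>s. (rd B 1 s - rd A 1 s) * rd B 1 s)"
    "(\<integral>s. (rd B 1 s - rd A 1 s) * rd B 1 s \<partial>lborel) = - (J * (B c - A c))"
proof -
  have G: "convex_on UNIV G" unfolding G_def by (rule convex_kink[OF J])
  have B: "convex_on UNIV B" unfolding B_def by (rule convex_max[OF A G])
  define Q where "Q = \<bar>T\<bar> + \<bar>c\<bar> + 1"
  have BA: "B s = A s" if "s \<notin> {-Q<..<Q}" for s
    using out[of s] that by (auto simp: B_def Q_def max_def)
  have Qc: "- Q \<le> c" "c \<le> Q" "0 < Q" by (auto simp: Q_def)
  let ?D = "\<lambda>s. rd B 1 s - rd A 1 s"
  have D0: "?D s = 0" if "s \<notin> {-Q..Q}" for s
  proof -
    have "rd B 1 s = rd A 1 s"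
      by (rule rd_eq_outside[OF B A closed_atLeastAtMost _ that]) (rule BA, auto)
    then show ?thesis by simp
  qed
  have Dpos: "rd B 1 s = c1 + J * indicator {c..} s" if AG: "A s < G s" for s
  proof -
    have "open {s. A s < G s}" using convex_continuous[OF A] convex_continuous[OF G] by (intro open_Collect_less)
    then obtain d where d: "d > 0" "ball s d \<subseteq> {s. A s < G s}"
      by (rule openE[of _ s]) (use AG in auto)
    have "rd B 1 s = rd G 1 s"
    proof (rule rd_eqI[OF B d(1) _ G])
      fix t assume t: "0 < t" "t < d"
      have "s + t *\<^sub>R 1 \<in> ball s d" using t by (simp add: dist_real_def)
      then have "A (s + t *\<^sub>R 1) < G (s + t *\<^sub>R 1)" using d by blast
      then show "B (s + t *\<^sub>R 1) - B s = G (s + t *\<^sub>R 1) - G s" using AG by (simp add: B_def)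
    qed
    then show ?thesis unfolding G_def rd_kink[OF J] .
  qed
  \<comment> \<open>\<open>A\<close> touches \<open>B\<close> from below at \<open>s\<close>.
    Quotients to the right give one inequality; quotients to the left bound \<open>rd B 1\<close>
    only at points before \<open>s\<close>, and continuity brings the bound to
    \<open>s\<close>.\<close>
  have Dzero: "?D s = 0" if s: "G s \<le> A s" and cont: "isCont (rd B 1) s" for s
  proof -
    have Bs: "B s = A s" using s by (simp add: B_def)
    have "rd A 1 s \<le> rd B 1 s"
      unfolding rd_def[of B]
    proof (rule cINF_greatest)
      fix t :: real assume t: "t \<in> {0<..}"
      have "rd A 1 s \<le> (A (s + t *\<^sub>R 1) - A s) / t" by (rule rd_le[OF A]) (use t in simp)
      also have "\<dots> \<le> (B (s + t *\<^sub>R 1) - B s) / t"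
        using t Bs by (intro divide_right_mono) (auto simp: B_def)
      finally show "rd A 1 s \<le> (B (s + t *\<^sub>R 1) - B s) / t" .
    qed auto
    moreover have le: "rd B 1 (s - t) \<le> rd A 1 s" if "t > 0" for t
    proof -
      have "rd B 1 (s - t) \<le> (B (s - t + t *\<^sub>R 1) - B (s - t)) / t" by (rule rd_le[OF B that])
      also have "\<dots> \<le> (A s - A (s - t *\<^sub>R 1)) / t"
        using that Bs by (intro divide_right_mono) (auto simp: B_def)
      also have "\<dots> \<le> rd A 1 s" by (rule rd_ge_backward[OF A that])
      finally show ?thesis .
    qed
    have "rd B 1 s \<le> rd A 1 s"
    proof (rule tendsto_upperbound)
      have "(\<lambda>j. s - 1 / real (Suc j)) \<longlonglongrightarrow> s - 0"
        by (rule tendsto_diff[OF tendsto_const LIMSEQ_Suc[OF lim_const_over_n]])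
      then show "(\<lambda>j. rd B 1 (s - 1 / real (Suc j))) \<longlonglongrightarrow> rd B 1 s"
        using isCont_tendsto_compose[OF cont] by simp
      show "eventually (\<lambda>j. rd B 1 (s - 1 / real (Suc j)) \<le> rd A 1 s) sequentially"
        by (intro always_eventually allI le) simp
    qed simp
    ultimately show ?thesis by simp
  qed
  have "countable {s. \<not> isCont (rd B 1) s}"
    by (rule mono_ctble_discont) (auto intro!: monoI rd_mono_real[OF B])
  then have ae: "AE s in lborel. isCont (rd B 1) s"
    using AE_not_in[OF countable_imp_null_set_lborel] by fastforce
  have int: "set_integrable lborel S ?D" if "S = {-Q..Q} \<or> S = {c..Q}" for S
    using that set_integral_diff(1)[OF rd_set_integrable[OF B] rd_set_integrable[OF A]] by auto
  have LD: "(LBINT s:{a..b}. ?D s) = (B b - A b) - (B a - A a)" if "a \<le> b" for a b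
    using set_integral_diff(2)[OF rd_set_integrable[OF B] rd_set_integrable[OF A], of a b]
      LBINT_rd[OF B that] LBINT_rd[OF A that] by simp
  have ind: "indicator {c..} s * ?D s = indicator {c..Q} s * ?D s" for s :: real
    using D0[of s] Qc by (auto simp: indicator_def)
  have i1: "integrable lborel ?D"
  proof -
    have "set_integrable lborel {-Q..Q} ?D" by (rule int) simp
    then show ?thesis
      unfolding set_integrable_def
      by (rule Bochner_Integration.integrable_cong[OF refl, THEN iffD1, rotated]) (use D0 in \<open>auto simp: indicator_def\<close>)
  qed
  have i2: "integrable lborel (\<lambda>s. indicator {c..} s * ?D s)"
    using int[of "{c..Q}"] unfolding ind by (simp add: set_integrable_def)
  \<comment> \<open>Where the factor \<open>?D s\<close> is nonzero, \<open>rd B 1 s\<close> takes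
    one of the two slopes of \<open>G\<close>; this makes the product linear in
    \<open>?D\<close>.\<close>
  have AEeq: "AE s in lborel. ?D s * rd B 1 s = c1 * ?D s + J * (indicator {c..} s * ?D s)"
    using ae
  proof eventually_elim
    case (elim s)
    show ?case
    proof (cases "A s < G s")
      case True
      show ?thesis using Dpos[OF True] by (simp add: algebra_simps)
    next
      case False
      then show ?thesis using Dzero[of s] elim by simp
    qed
  qed
  have [measurable]: "rd A 1 \<in> borel_measurable borel" "rd B 1 \<in> borel_measurable borel"
    using A B by (auto intro: rd_measurable)
  have rhs: "integrable lborel (\<lambda>s. c1 * ?D s + J * (indicator {c..} s * ?D s))"
    using i1 i2 by (intro Bochner_Integration.integrable_add integrable_mult_right)
  show "integrable lborel (\<lambda>s. ?D s * rd B 1 s)"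
    by (rule integrable_cong_AE_imp[OF rhs]) (use AEeq in auto)
  have "(\<integral>s. ?D s * rd B 1 s \<partial>lborel) = (\<integral>s. c1 * ?D s + J * (indicator {c..} s * ?D s) \<partial>lborel)"
    by (rule integral_cong_AE) (use AEeq in auto)
  also have "\<dots> = c1 * (\<integral>s. ?D s \<partial>lborel) + J * (\<integral>s. indicator {c..} s * ?D s \<partial>lborel)"
    using i1 i2 by simp
  also have "(\<integral>s. ?D s \<partial>lborel) = 0"
    using LINT_zero_outside[of "-Q" Q ?D, OF D0] LD[of "-Q" Q] BA[of Q] BA[of "-Q"] Qc by simp
  also have "(\<integral>s. indicator {c..} s * ?D s \<partial>lborel) = (LBINT s:{c..Q}. ?D s)"
    unfolding ind by (simp add: set_lebesgue_integral_def)
  also have "\<dots> = - (B c - A c)" using LD[OF Qc(2)] BA[of Q] by simp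
  finally show "(\<integral>s. ?D s * rd B 1 s \<partial>lborel) = - (J * (B c - A c))" by (simp add: algebra_simps)
qed

text \<open>The bound is a tent: an affine function of gradient \<open>x0\<close> with a kink of
  strength \<open>j\<close> along the line through \<open>\<xi>\<close> of direction
  \<open>e\<close>. It is high enough to matter only within the ball of radius \<open>r\<close>, and
  low enough that the maximum with \<open>U\<close> remains admissible.\<close>

locale crease = cap +
  fixes e x0 :: "real^2" and l0 j :: real
  assumes e: "norm e = 1" and j: "j \<ge> 0"
    and out: "\<And>p. r \<le> norm (p - \<xi>) \<Longrightarrow> l0 + x0 \<bullet> p + j * max (perp e \<bullet> (p - \<xi>)) 0 \<le> U p"
    and small: "\<And>p. l0 + x0 \<bullet> p + j * max (perp e \<bullet> (p - \<xi>)) 0 \<le> U p + \<eta>"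
begin

definition G :: "real^2 \<Rightarrow> real" where "G p = l0 + x0 \<bullet> p + j * max (perp e \<bullet> (p - \<xi>)) 0"
definition B :: "real^2 \<Rightarrow> real" where "B p = max (U p) (G p)"
text \<open>\<open>V1\<close> and \<open>V2\<close> are the points \<open>t = 1/2\<close> and
  \<open>t = 1/4\<close> on the segment from \<open>U\<close> to \<open>B\<close>. The end
  \<open>B\<close> itself is only known to satisfy \<open>adm\<close>, not
  \<open>adm2\<close>.\<close>

definition V1 :: "real^2 \<Rightarrow> real" where "V1 p = U p / 2 + B p / 2"
definition V2 :: "real^2 \<Rightarrow> real" where "V2 p = (1 - 1/2) * U p + (1/2) * V1 p"

lemma convex_G: "convex_on UNIV G"
proof (rule convex_onI)
  fix t :: real and p q :: "real^2" assume t: "0 < t" "t < 1"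
  let ?m = "(1 - t) *\<^sub>R p + t *\<^sub>R q"
  let ?c = "\<lambda>p. perp e \<bullet> (p - \<xi>)"
  have "?c ?m = (1 - t) * ?c p + t * ?c q" by (simp add: inner_diff_right inner_add_right algebra_simps)
  also have "\<dots> \<le> (1 - t) * max (?c p) 0 + t * max (?c q) 0"
    using t by (intro add_mono mult_left_mono) auto
  finally have "max (?c ?m) 0 \<le> (1 - t) * max (?c p) 0 + t * max (?c q) 0"
    using t by (auto intro!: add_nonneg_nonneg)
  then have "j * max (?c ?m) 0 \<le> j * ((1 - t) * max (?c p) 0 + t * max (?c q) 0)"
    using j by (rule mult_left_mono)
  then show "G ?m \<le> (1 - t) * G p + t * G q"
    unfolding G_def by (simp add: inner_add_right algebra_simps)
qed simp

lemma adm_B: "adm B"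
  unfolding adm_def
proof (intro conjI allI impI)
  show "convex_on UNIV B" unfolding B_def by (rule convex_max[OF U(1) convex_G])
  show "B p = U p" if "r \<le> norm (p - \<xi>)" for p using out[OF that] by (simp add: B_def G_def)
  show "\<bar>B p - U p\<bar> \<le> \<eta>" for p using small[of p] \<eta> by (auto simp: B_def G_def max_def)
qed

lemma adm2_V: "adm2 V1" "adm2 V2"
proof -
  show 1: "adm2 V1" using adm2_half[OF adm_B] unfolding V1_def .
  show "adm2 V2" using adm2_combination[OF adm_U(2) 1, of "1/2"] unfolding V2_def by simp
qed

lemma B_eq_U: "r \<le> norm (p - \<xi>) \<Longrightarrow> B p = U p"
  using adm_B by (simp add: adm_def)

text \<open>For a quadratic \<open>q\<close> one has
  \<open>q' 1 = 14 * (q (1/2) - q 0) - 24 * (q (1/4) - q 0)\<close>. So the left side is the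
  derivative of the density at \<open>B\<close> in the direction \<open>B - U\<close>, namely
  \<open>-2\<close> times an integral that \<open>kink_identity\<close> evaluates: on the line
  \<open>n \<bullet> p = k\<close> the tent has a kink of size
  \<open>j * \<bar>n \<bullet> e\<bar>\<close> where that line meets the crease.\<close>

lemma crease_slice:
  assumes n: "norm n = 1"
  shows "14 * dual_energy_density U V1 n k - 24 * dual_energy_density U V2 n k =
    (if n \<bullet> e = 0 then 0 else 2 * j * \<bar>n \<bullet> e\<bar> * (B (\<xi> + ((k - n \<bullet> \<xi>) / (n \<bullet> e)) *\<^sub>R e) - U (\<xi> + ((k - n \<bullet> \<xi>) / (n \<bullet> e)) *\<^sub>R e)))"
proof -
  let ?m = "perp n"
  let ?z = "\<lambda>\<sigma>. \<sigma> *\<^sub>R ?m + k *\<^sub>R n"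
  let ?a = "\<lambda>\<sigma>. rd U ?m (?z \<sigma>)" and ?b = "\<lambda>\<sigma>. rd B ?m (?z \<sigma>)"
  define \<mu> where "\<mu> = n \<bullet> e"
  define J where "J = j * \<bar>\<mu>\<bar>"
  have J: "J \<ge> 0" using j by (simp add: J_def)
  have cV: "convex_on UNIV V1" "convex_on UNIV V2" using adm2_V adm2_adm adm_convex by blast+
  have r1: "rd V1 ?m x = (1/2) * rd U ?m x + (1/2) * rd B ?m x" for x
    by (rule rd_linear[OF U(1) adm_convex[OF adm_B] cV(1)]) (simp add: V1_def)
  have r2: "rd V2 ?m x = (3/4) * rd U ?m x + (1/4) * rd B ?m x" for x
    by (rule rd_linear[OF U(1) adm_convex[OF adm_B] cV(2)]) (simp add: V2_def V1_def field_simps)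
  have i: "integrable lborel (\<lambda>\<sigma>. (?a \<sigma>)\<^sup>2 - ((1/2) * ?a \<sigma> + (1/2) * ?b \<sigma>)\<^sup>2)"
    "integrable lborel (\<lambda>\<sigma>. (?a \<sigma>)\<^sup>2 - ((3/4) * ?a \<sigma> + (1/4) * ?b \<sigma>)\<^sup>2)"
    using dual_energy_integrable[OF adm_U(1) adm2_adm[OF adm2_V(1)] n, of k]
      dual_energy_integrable[OF adm_U(1) adm2_adm[OF adm2_V(2)] n, of k]
    by (simp_all only: r1 r2)
  have "14 * dual_energy_density U V1 n k - 24 * dual_energy_density U V2 n k
      = (\<integral>\<sigma>. 14 * ((?a \<sigma>)\<^sup>2 - ((1/2) * ?a \<sigma> + (1/2) * ?b \<sigma>)\<^sup>2) - 24 * ((?a \<sigma>)\<^sup>2 - ((3/4) * ?a \<sigma> + (1/4) * ?b \<sigma>)\<^sup>2) \<partial>lborel)"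
    unfolding dual_energy_density_def r1 r2
    by (simp only: Bochner_Integration.integral_diff[OF integrable_mult_right[OF i(1)] integrable_mult_right[OF i(2)]]
      integral_mult_right_zero)
  also have "\<dots> = (\<integral>\<sigma>. - 2 * ((?b \<sigma> - ?a \<sigma>) * ?b \<sigma>) \<partial>lborel)"
    by (rule Bochner_Integration.integral_cong[OF refl]) (simp add: power2_eq_square field_simps)
  also have "\<dots> = - 2 * (\<integral>\<sigma>. (?b \<sigma> - ?a \<sigma>) * ?b \<sigma> \<partial>lborel)" by simp
  finally have eq: "14 * dual_energy_density U V1 n k - 24 * dual_energy_density U V2 n k = - 2 * (\<integral>\<sigma>. (?b \<sigma> - ?a \<sigma>) * ?b \<sigma> \<partial>lborel)" .
  define c where "c = (if \<mu> = 0 then 0 else (perp e \<bullet> \<xi> - k * (perp e \<bullet> n)) / \<mu>)"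
  define d0 where "d0 = perp e \<bullet> (k *\<^sub>R n) - perp e \<bullet> \<xi>"
  have pe: "perp e \<bullet> ?m = \<mu>" by (simp add: \<mu>_def inner_commute)
  have arg: "perp e \<bullet> (?z \<sigma> - \<xi>) = \<mu> * \<sigma> + d0" for \<sigma>
    by (simp add: d0_def inner_diff_right inner_add_right \<mu>_def inner_commute[of n e] algebra_simps)
  have \<mu>c: "\<mu> * c = - d0" if "\<mu> \<noteq> 0" using that by (simp add: c_def d0_def)
  obtain c0 c1 where Gs: "\<And>\<sigma>. G (?z \<sigma>) = c0 + c1 * \<sigma> + J * max (\<sigma> - c) 0"
  proof -
    consider "\<mu> = 0" | "\<mu> > 0" | "\<mu> < 0" by linarith
    then show ?thesis
    proof cases
      case 1
      show ?thesis
        by (rule that[of "l0 + x0 \<bullet> (k *\<^sub>R n) + j * max d0 0" "x0 \<bullet> ?m"])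
           (simp add: G_def arg[unfolded 1] 1 J_def inner_add_right)
    next
      case 2
      have "max (\<mu> * \<sigma> + d0) 0 = \<mu> * max (\<sigma> - c) 0" for \<sigma>
      proof -
        have "\<mu> * \<sigma> + d0 = \<mu> * (\<sigma> - c)" using \<mu>c 2 by (simp add: algebra_simps)
        then show ?thesis using 2 by (auto simp: max_def zero_le_mult_iff mult_le_0_iff)
      qed
      then show ?thesis
        by (intro that[of "l0 + x0 \<bullet> (k *\<^sub>R n)" "x0 \<bullet> ?m"])
           (use 2 in \<open>simp add: G_def arg J_def inner_add_right\<close>)
    next
      case 3
      \<comment> \<open>For negative \<open>\<mu>\<close> the ramp faces the other way; turning it
        round only changes the affine part.\<close>
      have "max (\<mu> * \<sigma> + d0) 0 = \<mu> * (\<sigma> - c) + (- \<mu>) * max (\<sigma> - c) 0" for \<sigma>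
      proof -
        have "\<mu> * \<sigma> + d0 = \<mu> * (\<sigma> - c)" using \<mu>c 3 by (simp add: algebra_simps)
        moreover have "max (\<mu> * y) 0 = \<mu> * y + (- \<mu>) * max y 0" for y
          using 3 by (cases "y \<le> 0") (auto simp: max_def mult_nonpos_nonpos mult_le_0_iff)
        ultimately show ?thesis by simp
      qed
      then show ?thesis
        by (intro that[of "l0 + x0 \<bullet> (k *\<^sub>R n) - j * \<mu> * c" "x0 \<bullet> ?m + j * \<mu>"])
           (use 3 in \<open>simp add: G_def arg J_def inner_add_right ring_distribs\<close>)
    qed
  qed
  have outs: "c0 + c1 * s + J * max (s - c) 0 \<le> U (?z s)" if "r + norm \<xi> \<le> \<bar>s\<bar>" for s
  proof -
    have "norm (?z s) \<le> norm (?z s - \<xi>) + norm \<xi>" using norm_triangle_ineq[of "?z s - \<xi>" \<xi>] by simp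
    moreover have "\<bar>s\<bar> \<le> norm (?z s)" using frame_norm_ge(2)[OF n, of s k] by (simp add: add.commute)
    ultimately have "r \<le> norm (?z s - \<xi>)" using that by linarith
    then show ?thesis using out[of "?z s"] Gs[of s] by (simp add: G_def)
  qed
  have Bs: "(\<lambda>s. max (U (?z s)) (c0 + c1 * s + J * max (s - c) 0)) = (\<lambda>s. B (?z s))"
    by (simp add: B_def Gs)
  have "(\<integral>\<sigma>. (?b \<sigma> - ?a \<sigma>) * ?b \<sigma> \<partial>lborel) = - (J * (B (?z c) - U (?z c)))"
    using kink_identity(2)[OF convex_slice[OF U(1)] J outs, unfolded Bs rd_slice] Bs[THEN fun_cong, of c] by simp
  then have main: "14 * dual_energy_density U V1 n k - 24 * dual_energy_density U V2 n k = 2 * (J * (B (?z c) - U (?z c)))"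
    using eq by simp
  show ?thesis
  proof (cases "\<mu> = 0")
    case True
    then show ?thesis using main by (simp add: J_def \<mu>_def)
  next
    case False
    \<comment> \<open>The point where the line \<open>n \<bullet> p = k\<close> crosses the
      crease.\<close>
    let ?q = "\<xi> + ((k - n \<bullet> \<xi>) / \<mu>) *\<^sub>R e"
    have ne: "e \<bullet> e = 1" "n \<bullet> n = 1" using e n by (auto simp: norm_eq_sqrt_inner)
    have "n \<bullet> ?z c = n \<bullet> ?q"
      using False ne by (simp add: inner_add_right \<mu>_def)
    moreover have "perp e \<bullet> ?z c = perp e \<bullet> ?q"
      using arg[of c] \<mu>c[OF False] by (simp add: inner_add_right inner_diff_right)
    ultimately have o: "n \<bullet> (?z c - ?q) = 0" "perp e \<bullet> (?z c - ?q) = 0" by (simp_all add: inner_diff_right)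
    let ?w = "?z c - ?q"
    have w: "?w = (e \<bullet> ?w) *\<^sub>R e" using perp_expand[OF e, of ?w] o(2) by simp
    then have "n \<bullet> ?w = (e \<bullet> ?w) * \<mu>" by (metis \<mu>_def inner_scaleR_right)
    then have "e \<bullet> ?w = 0" using o(1) False by simp
    then have "?z c = ?q" using w by simp
    then show ?thesis using main False by (simp add: J_def \<mu>_def)
  qed
qed

text \<open>Through these conjugates the integral of \<open>h'' * (B - U)\<close> along the crease
  is written in terms of values of \<open>f\<close> alone. That gives it a meaning for merely
  continuous \<open>f\<close>, as the approximation by exponentials requires.\<close>

definition Bl :: "real \<Rightarrow> real" where "Bl = lconj (\<lambda>\<tau>. B (\<tau> *\<^sub>R e + \<xi>))"
definition Ul :: "real \<Rightarrow> real" where "Ul = lconj (\<lambda>\<tau>. U (\<tau> *\<^sub>R e + \<xi>))"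

lemma line:
  "convex_on UNIV (\<lambda>\<tau>. B (\<tau> *\<^sub>R e + \<xi>))" "coercive (\<lambda>\<tau>. B (\<tau> *\<^sub>R e + \<xi>))"
  "convex_on UNIV (\<lambda>\<tau>. U (\<tau> *\<^sub>R e + \<xi>))" "coercive (\<lambda>\<tau>. U (\<tau> *\<^sub>R e + \<xi>))"
  "convex_on UNIV Bl" "coercive Bl" "convex_on UNIV Ul" "coercive Ul"
  "lconj Bl = (\<lambda>\<tau>. B (\<tau> *\<^sub>R e + \<xi>))" "lconj Ul = (\<lambda>\<tau>. U (\<tau> *\<^sub>R e + \<xi>))"
proof -
  show 1: "convex_on UNIV (\<lambda>\<tau>. B (\<tau> *\<^sub>R e + \<xi>))" "coercive (\<lambda>\<tau>. B (\<tau> *\<^sub>R e + \<xi>))"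
    "convex_on UNIV (\<lambda>\<tau>. U (\<tau> *\<^sub>R e + \<xi>))" "coercive (\<lambda>\<tau>. U (\<tau> *\<^sub>R e + \<xi>))"
    using U adm_convex[OF adm_B] adm_coercive[OF adm_B] e by (auto intro: convex_slice coercive_slice)
  show "convex_on UNIV Bl" "coercive Bl" "convex_on UNIV Ul" "coercive Ul"
    "lconj Bl = (\<lambda>\<tau>. B (\<tau> *\<^sub>R e + \<xi>))" "lconj Ul = (\<lambda>\<tau>. U (\<tau> *\<^sub>R e + \<xi>))"
    unfolding Bl_def Ul_def using 1 by (auto intro: convex_lconj coercive_lconj lconj_lconj)
qed

lemma line_outside: "r \<le> \<bar>\<tau>\<bar> \<Longrightarrow> B (\<tau> *\<^sub>R e + \<xi>) = U (\<tau> *\<^sub>R e + \<xi>)"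
  using e by (intro B_eq_U) simp

lemma line_conj_outside:
  obtains L where "L > 0" "\<And>s. s \<notin> {-L<..<L} \<Longrightarrow> Bl s = Ul s"
proof -
  obtain L1 where L1: "\<And>s. s \<in> {-r..r} \<Longrightarrow> \<bar>rd (\<lambda>\<tau>. B (\<tau> *\<^sub>R e + \<xi>)) 1 s\<bar> \<le> L1" using rd_bounded_on_interval[OF line(1)] by blast
  obtain L2 where L2: "\<And>s. s \<in> {-r..r} \<Longrightarrow> \<bar>rd (\<lambda>\<tau>. U (\<tau> *\<^sub>R e + \<xi>)) 1 s\<bar> \<le> L2" using rd_bounded_on_interval[OF line(3)] by blast
  define L where "L = max L1 L2"
  have L: "\<bar>rd (\<lambda>\<tau>. B (\<tau> *\<^sub>R e + \<xi>)) 1 s\<bar> \<le> L" "\<bar>rd (\<lambda>\<tau>. U (\<tau> *\<^sub>R e + \<xi>)) 1 s\<bar> \<le> L" if "s \<in> {-r..r}" for s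
    using L1[OF that] L2[OF that] by (auto simp: L_def)
  show ?thesis
  proof (rule that[of "\<bar>L\<bar> + 1"])
    fix s assume "s \<notin> {- (\<bar>L\<bar> + 1)<..<\<bar>L\<bar> + 1}"
    then have "s \<notin> {-L..L}" by auto
    then show "Bl s = Ul s"
      unfolding Bl_def Ul_def
      by (intro lconj_eq_outside_slopes[OF line(1-4) _ _ L]) (use line_outside r in auto)
  qed simp
qed

text \<open>Independent of \<open>L\<close> once \<open>Bl\<close> and \<open>Ul\<close> agree outside \<open>{-L<..<L}\<close>.\<close>

definition line_energy :: "real \<Rightarrow> (real^2 \<Rightarrow> real) \<Rightarrow> real" where
  "line_energy L f = (LBINT s:{-L..L}. f (rd Bl 1 s *\<^sub>R e + \<xi>) - f (rd Ul 1 s *\<^sub>R e + \<xi>))"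

text \<open>The one-dimensional formula with exchanged roles: \<open>Bl\<close> and
  \<open>Ul\<close> are the functions, and the restrictions of \<open>B\<close> and \<open>U\<close>
  to the crease are their conjugates.\<close>

lemma line_energy_smooth:
  assumes L: "L > 0" "\<And>s. s \<notin> {-L<..<L} \<Longrightarrow> Bl s = Ul s"
    and h: "\<And>x. (h has_real_derivative h' x) (at x)" "\<And>x. (h' has_real_derivative h'' x) (at x)"
      "continuous_on UNIV h''" and hf: "\<And>\<tau>. f (\<tau> *\<^sub>R e + \<xi>) = h \<tau>"
  shows "line_energy L f = (LBINT \<tau>:{-r..r}. h'' \<tau> * (B (\<tau> *\<^sub>R e + \<xi>) - U (\<tau> *\<^sub>R e + \<xi>)))"
    "integrable lborel (\<lambda>\<tau>. h'' \<tau> * (B (\<tau> *\<^sub>R e + \<xi>) - U (\<tau> *\<^sub>R e + \<xi>)))"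
    "line_energy L f = (\<integral>\<tau>. h'' \<tau> * (B (\<tau> *\<^sub>R e + \<xi>) - U (\<tau> *\<^sub>R e + \<xi>)) \<partial>lborel)"
proof -
  let ?w = "\<lambda>\<tau>. h'' \<tau> * (B (\<tau> *\<^sub>R e + \<xi>) - U (\<tau> *\<^sub>R e + \<xi>))"
  obtain M1 where M1: "\<And>s. s \<in> {-L..L} \<Longrightarrow> \<bar>rd Bl 1 s\<bar> \<le> M1" using rd_bounded_on_interval[OF line(5)] by blast
  obtain M2 where M2: "\<And>s. s \<in> {-L..L} \<Longrightarrow> \<bar>rd Ul 1 s\<bar> \<le> M2" using rd_bounded_on_interval[OF line(7)] by blast
  define M where "M = max (max M1 M2) r"
  have M: "\<bar>rd Bl 1 s\<bar> \<le> M" "\<bar>rd Ul 1 s\<bar> \<le> M" if "s \<in> {-L..L}" for s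
    using M1[OF that] M2[OF that] by (auto simp: M_def)
  have "line_energy L f = (LBINT k:{-M..M}. h'' k * (lconj Bl k - lconj Ul k))"
    unfolding line_energy_def hf
    by (rule integral_derivative_eq_integral_lconj[OF line(5-8) L(2) _ h M]) (use L in auto)
  also have "\<dots> = (\<integral>\<tau>. ?w \<tau> \<partial>lborel)"
    unfolding line(9,10)
    by (rule LINT_zero_outside[symmetric]) (use line_outside in \<open>auto simp: M_def\<close>)
  finally show 1: "line_energy L f = (\<integral>\<tau>. ?w \<tau> \<partial>lborel)" .
  show 2: "line_energy L f = (LBINT \<tau>:{-r..r}. ?w \<tau>)"
    unfolding 1 by (rule LINT_zero_outside) (use line_outside in auto)
  have ci: "set_integrable lborel {-r..r} ?w"
    by (rule borel_integrable_atLeastAtMost')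
       (intro continuous_on_mult continuous_on_diff continuous_on_subset[OF h(3)] convex_continuous line; simp)
  have z: "?w \<tau> = 0" if "\<tau> \<notin> {-r..r}" for \<tau>
  proof -
    have "r \<le> \<bar>\<tau>\<bar>" using that by (auto simp: abs_if)
    then show ?thesis using line_outside[of \<tau>] by simp
  qed
  have "(\<lambda>\<tau>. indicator {-r..r} \<tau> *\<^sub>R ?w \<tau>) = ?w"
  proof
    fix \<tau> show "indicator {-r..r} \<tau> *\<^sub>R ?w \<tau> = ?w \<tau>" using z[of \<tau>] by (cases "\<tau> \<in> {-r..r}") auto
  qed
  then show "integrable lborel ?w" using ci by (simp add: set_integrable_def)
qed

text \<open>Both sides are additive and sup norm continuous in \<open>f\<close>, so exponentials
  along a unit vector \<open>n\<close> suffice. For them \<open>crease_slice\<close> is integrated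
  over \<open>k\<close> and moved to the crease by
  \<open>k = n \<bullet> \<xi> + \<mu> * \<tau>\<close>. The kink and the substitution contribute a
  factor \<open>\<bar>\<mu>\<bar>\<close> each, which together are the factor of the second
  derivative of \<open>f\<close> along \<open>e\<close>.\<close>

lemma crease_identity:
  assumes L: "L > 0" "\<And>s. s \<notin> {-L<..<L} \<Longrightarrow> Bl s = Ul s" and f: "continuous_on UNIV f"
  shows "14 * \<Phi> f V1 - 24 * \<Phi> f V2 + 10 * \<Phi> f U = j * line_energy L f"
proof -
  note adms = adm2_adm[OF adm2_V(1)] adm2_adm[OF adm2_V(2)] adm_U(1)
  obtain Q M where M: "M \<ge> 0" "\<And>(f1 :: real^2 \<Rightarrow> real) f2 V e. continuous_on UNIV f1 \<Longrightarrow> continuous_on UNIV f2 \<Longrightarrow> adm V \<Longrightarrow>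
      (\<And>p. norm p \<le> Q \<Longrightarrow> \<bar>f1 p - f2 p\<bar> \<le> e) \<Longrightarrow> \<bar>\<Phi> f1 V - \<Phi> f2 V\<bar> \<le> M * e"
    using \<Phi>_cong_bound by metis
  obtain M1 where M1: "\<And>s. s \<in> {-L..L} \<Longrightarrow> \<bar>rd Bl 1 s\<bar> \<le> M1" using rd_bounded_on_interval[OF line(5)] by blast
  obtain M2 where M2: "\<And>s. s \<in> {-L..L} \<Longrightarrow> \<bar>rd Ul 1 s\<bar> \<le> M2" using rd_bounded_on_interval[OF line(7)] by blast
  define P where "P = max (max M1 M2 + norm \<xi>) Q"
  have PQ: "Q \<le> P" by (simp add: P_def)
  have P: "norm (rd Bl 1 s *\<^sub>R e + \<xi>) \<le> P" "norm (rd Ul 1 s *\<^sub>R e + \<xi>) \<le> P" if "s \<in> {-L..L}" for s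
  proof -
    have "norm (rd Bl 1 s *\<^sub>R e + \<xi>) \<le> \<bar>rd Bl 1 s\<bar> + norm \<xi>" "norm (rd Ul 1 s *\<^sub>R e + \<xi>) \<le> \<bar>rd Ul 1 s\<bar> + norm \<xi>"
      using norm_triangle_ineq[of "rd Bl 1 s *\<^sub>R e" \<xi>] norm_triangle_ineq[of "rd Ul 1 s *\<^sub>R e" \<xi>] e by auto
    then show "norm (rd Bl 1 s *\<^sub>R e + \<xi>) \<le> P" "norm (rd Ul 1 s *\<^sub>R e + \<xi>) \<le> P"
      using M1[OF that] M2[OF that] by (auto simp: P_def)
  qed
  have meas: "(\<lambda>s. h (rd Bl 1 s *\<^sub>R e + \<xi>) - h (rd Ul 1 s *\<^sub>R e + \<xi>)) \<in> borel_measurable borel"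
    if "continuous_on UNIV h" for h :: "real^2 \<Rightarrow> real"
  proof -
    have [measurable]: "h \<in> borel_measurable borel" using that by (rule borel_measurable_continuous_onI)
    have [measurable]: "rd Bl 1 \<in> borel_measurable borel" "rd Ul 1 \<in> borel_measurable borel"
      using line by (auto intro: rd_measurable)
    show ?thesis by measurable
  qed
  have li: "set_integrable lborel {-L..L} (\<lambda>s. h (rd Bl 1 s *\<^sub>R e + \<xi>) - h (rd Ul 1 s *\<^sub>R e + \<xi>))"
    if h: "continuous_on UNIV h" for h :: "real^2 \<Rightarrow> real"
  proof -
    have "bounded (h ` cball 0 P)"
      by (intro compact_imp_bounded compact_continuous_image continuous_on_subset[OF h]) auto
    then obtain C where C: "\<And>p. norm p \<le> P \<Longrightarrow> norm (h p) \<le> C"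
      unfolding bounded_iff by (metis imageI mem_cball_0)
    show ?thesis
    proof (rule set_integrable_bounded[where C="C + C", OF meas[OF h]])
      fix s assume "s \<in> {-L..L}"
      then have "\<bar>h (rd Bl 1 s *\<^sub>R e + \<xi>)\<bar> \<le> C" "\<bar>h (rd Ul 1 s *\<^sub>R e + \<xi>)\<bar> \<le> C" using C P by auto
      then show "norm (h (rd Bl 1 s *\<^sub>R e + \<xi>) - h (rd Ul 1 s *\<^sub>R e + \<xi>)) \<le> C + C" by simp
    qed auto
  qed
  have le_add: "line_energy L (\<lambda>p. f1 p + f2 p) = line_energy L f1 + line_energy L f2"
    if "continuous_on UNIV f1" "continuous_on UNIV f2" for f1 f2
    using set_integral_add(2)[OF li[OF that(1)] li[OF that(2)]] unfolding line_energy_def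
    by (simp add: algebra_simps)
  let ?T = "\<lambda>f. 14 * \<Phi> f V1 - 24 * \<Phi> f V2 + 10 * \<Phi> f U - j * line_energy L f"
  \<comment> \<open>In the constant below, \<open>48 = 14 + 24 + 10\<close>, and
    \<open>4 * L\<close> is the length \<open>2 * L\<close> of the interval times the two values of
    \<open>f\<close> at each point.\<close>
  have "?T f = 0"
  proof (rule exp_extend[where L=P and C="48 * M + j * (4 * L)", OF _ _ _ _ f])
    show "?T (\<lambda>p. f1 p + f2 p) = ?T f1 + ?T f2" if "continuous_on UNIV f1" "continuous_on UNIV f2" for f1 f2
      using \<Phi>_add[OF that adms(1)] \<Phi>_add[OF that adms(2)] \<Phi>_add[OF that adms(3)] le_add[OF that]
      by (simp add: algebra_simps)
  next
    fix c \<kappa> :: real and n :: "real^2" assume n: "norm n = 1"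
    let ?F = "\<lambda>p::real^2. c * exp (\<kappa> * (n \<bullet> p))"
    let ?h2 = "\<lambda>k. c * \<kappa>\<^sup>2 * exp (\<kappa> * k)"
    let ?J = "\<lambda>V k. ?h2 k * dual_energy_density U V n k"
    let ?w = "\<lambda>\<tau>. B (\<tau> *\<^sub>R e + \<xi>) - U (\<tau> *\<^sub>R e + \<xi>)"
    note R = \<Phi>_ridge[OF adm_U(2) _ n exp_ridge_derivs, of _ c \<kappa>]
    define \<mu> where "\<mu> = n \<bullet> e"
    have "14 * (\<Phi> ?F V1 - \<Phi> ?F U) - 24 * (\<Phi> ?F V2 - \<Phi> ?F U) = (\<integral>k. 14 * ?J V1 k - 24 * ?J V2 k \<partial>lborel) / 2"
      unfolding R(2)[OF adm2_V(1)] R(2)[OF adm2_V(2)] using R(1)[OF adm2_V(1)] R(1)[OF adm2_V(2)] by simp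
    also have "(\<integral>k. 14 * ?J V1 k - 24 * ?J V2 k \<partial>lborel) = (\<integral>k. ?h2 k * (14 * dual_energy_density U V1 n k - 24 * dual_energy_density U V2 n k) \<partial>lborel)"
      by (rule Bochner_Integration.integral_cong[OF refl]) (simp add: algebra_simps)
    also have "\<dots> = 2 * (j * (\<integral>\<tau>. (\<mu>\<^sup>2 * ?h2 (n \<bullet> \<xi> + \<mu> * \<tau>)) * ?w \<tau> \<partial>lborel))"
    proof (cases "\<mu> = 0")
      case True
      then show ?thesis unfolding crease_slice[OF n] \<mu>_def by simp
    next
      case False
      have "(\<integral>k. ?h2 k * (14 * dual_energy_density U V1 n k - 24 * dual_energy_density U V2 n k) \<partial>lborel)
        = (\<integral>k. ?h2 k * (2 * j * \<bar>\<mu>\<bar> * ?w ((k - n \<bullet> \<xi>) / \<mu>)) \<partial>lborel)"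
        unfolding crease_slice[OF n] using False by (simp add: \<mu>_def add.commute)
      also have "\<dots> = \<bar>\<mu>\<bar> *\<^sub>R (\<integral>\<tau>. ?h2 (n \<bullet> \<xi> + \<mu> * \<tau>) * (2 * j * \<bar>\<mu>\<bar> * ?w ((n \<bullet> \<xi> + \<mu> * \<tau> - n \<bullet> \<xi>) / \<mu>)) \<partial>lborel)"
        by (rule lborel_integral_real_affine[OF False])
      also have "\<dots> = (\<integral>\<tau>. \<bar>\<mu>\<bar> * (?h2 (n \<bullet> \<xi> + \<mu> * \<tau>) * (2 * j * \<bar>\<mu>\<bar> * ?w \<tau>)) \<partial>lborel)"
        using False by simp
      also have "\<dots> = (\<integral>\<tau>. 2 * j * ((\<mu>\<^sup>2 * ?h2 (n \<bullet> \<xi> + \<mu> * \<tau>)) * ?w \<tau>) \<partial>lborel)"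
      proof (rule Bochner_Integration.integral_cong[OF refl])
        fix \<tau>
        have "\<bar>\<mu>\<bar> * \<bar>\<mu>\<bar> = \<mu>\<^sup>2" by (simp add: power2_eq_square)
        moreover have "\<bar>\<mu>\<bar> * (?h2 (n \<bullet> \<xi> + \<mu> * \<tau>) * (2 * j * \<bar>\<mu>\<bar> * ?w \<tau>)) = 2 * j * (((\<bar>\<mu>\<bar> * \<bar>\<mu>\<bar>) * ?h2 (n \<bullet> \<xi> + \<mu> * \<tau>)) * ?w \<tau>)"
          by (simp only: mult_ac)
        ultimately show "\<bar>\<mu>\<bar> * (?h2 (n \<bullet> \<xi> + \<mu> * \<tau>) * (2 * j * \<bar>\<mu>\<bar> * ?w \<tau>)) = 2 * j * ((\<mu>\<^sup>2 * ?h2 (n \<bullet> \<xi> + \<mu> * \<tau>)) * ?w \<tau>)"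
          by simp
      qed
      finally show ?thesis by simp
    qed
    also have "(\<integral>\<tau>. (\<mu>\<^sup>2 * ?h2 (n \<bullet> \<xi> + \<mu> * \<tau>)) * ?w \<tau> \<partial>lborel) = line_energy L ?F"
    proof (rule line_energy_smooth(3)[OF L, symmetric])
      show "((\<lambda>\<tau>. c * exp (\<kappa> * (n \<bullet> \<xi> + \<mu> * \<tau>))) has_real_derivative (c * (\<kappa> * \<mu>) * exp (\<kappa> * (n \<bullet> \<xi> + \<mu> * x)))) (at x)" for x
        by (auto intro!: derivative_eq_intros)
      show "((\<lambda>\<tau>. c * (\<kappa> * \<mu>) * exp (\<kappa> * (n \<bullet> \<xi> + \<mu> * \<tau>))) has_real_derivative (\<mu>\<^sup>2 * ?h2 (n \<bullet> \<xi> + \<mu> * x))) (at x)" for x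
        by (auto intro!: derivative_eq_intros simp: power2_eq_square)
      show "continuous_on UNIV (\<lambda>x. \<mu>\<^sup>2 * ?h2 (n \<bullet> \<xi> + \<mu> * x))" by (intro continuous_intros)
      show "?F (\<tau> *\<^sub>R e + \<xi>) = c * exp (\<kappa> * (n \<bullet> \<xi> + \<mu> * \<tau>))" for \<tau>
        by (simp add: inner_add_right \<mu>_def algebra_simps)
    qed
    finally show "?T ?F = 0" by simp
  next
    fix f1 f2 :: "real^2 \<Rightarrow> real" and \<epsilon>
    assume c: "continuous_on UNIV f1" "continuous_on UNIV f2" "\<And>p. norm p \<le> P \<Longrightarrow> \<bar>f1 p - f2 p\<bar> \<le> \<epsilon>"
    have b: "\<bar>\<Phi> f1 V - \<Phi> f2 V\<bar> \<le> M * \<epsilon>" if "adm V" for V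
      using M(2)[OF c(1,2) that] c(3) PQ by (meson order_trans)
    have "line_energy L f1 - line_energy L f2 = (LBINT s:{-L..L}. (f1 (rd Bl 1 s *\<^sub>R e + \<xi>) - f1 (rd Ul 1 s *\<^sub>R e + \<xi>)) - (f2 (rd Bl 1 s *\<^sub>R e + \<xi>) - f2 (rd Ul 1 s *\<^sub>R e + \<xi>)))"
      unfolding line_energy_def by (rule set_integral_diff(2)[OF li[OF c(1)] li[OF c(2)], symmetric])
    moreover have pt: "- (2 * \<epsilon>) \<le> f1 (rd Bl 1 s *\<^sub>R e + \<xi>) - f1 (rd Ul 1 s *\<^sub>R e + \<xi>) - (f2 (rd Bl 1 s *\<^sub>R e + \<xi>) - f2 (rd Ul 1 s *\<^sub>R e + \<xi>)) \<and>
        f1 (rd Bl 1 s *\<^sub>R e + \<xi>) - f1 (rd Ul 1 s *\<^sub>R e + \<xi>) - (f2 (rd Bl 1 s *\<^sub>R e + \<xi>) - f2 (rd Ul 1 s *\<^sub>R e + \<xi>)) \<le> 2 * \<epsilon>"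
      if "s \<in> {-L..L}" for s
    proof -
      have "\<bar>f1 (rd Bl 1 s *\<^sub>R e + \<xi>) - f2 (rd Bl 1 s *\<^sub>R e + \<xi>)\<bar> \<le> \<epsilon>" "\<bar>f1 (rd Ul 1 s *\<^sub>R e + \<xi>) - f2 (rd Ul 1 s *\<^sub>R e + \<xi>)\<bar> \<le> \<epsilon>"
        using c(3) P[OF that] by auto
      then show ?thesis by linarith
    qed
    moreover note LBINT_bounds[OF set_integral_diff(1)[OF li[OF c(1)] li[OF c(2)]] _ pt]
    ultimately have "\<bar>line_energy L f1 - line_energy L f2\<bar> \<le> 4 * L * \<epsilon>"
      using L(1) by (simp add: abs_le_iff algebra_simps)
    then have "\<bar>j * (line_energy L f1 - line_energy L f2)\<bar> \<le> j * (4 * L * \<epsilon>)"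
      unfolding abs_mult using j by (intro mult_mono) auto
    moreover have "?T f1 - ?T f2 = 14 * (\<Phi> f1 V1 - \<Phi> f2 V1) - 24 * (\<Phi> f1 V2 - \<Phi> f2 V2) + 10 * (\<Phi> f1 U - \<Phi> f2 U)
        - j * (line_energy L f1 - line_energy L f2)"
      by (simp add: algebra_simps)
    moreover have "(48 * M + j * (4 * L)) * \<epsilon> = 14 * (M * \<epsilon>) + 24 * (M * \<epsilon>) + 10 * (M * \<epsilon>) + j * (4 * L * \<epsilon>)"
      by (simp add: algebra_simps)
    moreover have "\<And>a b c d m l :: real. \<bar>a\<bar> \<le> m \<Longrightarrow> \<bar>b\<bar> \<le> m \<Longrightarrow> \<bar>c\<bar> \<le> m \<Longrightarrow> \<bar>d\<bar> \<le> l \<Longrightarrow>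
        \<bar>14 * a - 24 * b + 10 * c - d\<bar> \<le> 14 * m + 24 * m + 10 * m + l"
      by linarith
    ultimately show "\<bar>?T f1 - ?T f2\<bar> \<le> (48 * M + j * (4 * L)) * \<epsilon>"
      using b[OF adms(1)] b[OF adms(2)] b[OF adms(3)] by presburger
  qed (use M j L in simp)
  then show ?thesis by simp
qed

end

section \<open>Cuts\<close>

lemma rd_affine_inner: "rd (\<lambda>x::'a::euclidean_space. p \<bullet> x - c) n x = p \<bullet> n"
proof -
  have "(\<lambda>t. (p \<bullet> (x + t *\<^sub>R n) - c - (p \<bullet> x - c)) / t) ` {0<..} = (\<lambda>t. p \<bullet> n) ` {0::real<..}"
    by (rule image_cong[OF refl]) (simp add: inner_add_right)
  then have "rd (\<lambda>x. p \<bullet> x - c) n x = (INF t\<in>{0::real<..}. p \<bullet> n)"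
    unfolding rd_def by (rule arg_cong)
  also have "\<dots> = p \<bullet> n" by (rule cINF_const) auto
  finally show ?thesis .
qed

lemma convex_affine_inner: "convex_on UNIV (\<lambda>x::'a::euclidean_space. p \<bullet> x - c)"
  by (rule convex_onI) (auto simp: algebra_simps inner_add_right)

lemma frontier_null:
  fixes S :: "'a::euclidean_space set"
  assumes "convex S" shows "frontier S \<in> null_sets lborel"
proof -
  have "frontier S \<in> null_sets lebesgue"
    using negligible_convex_frontier[OF assms] by (simp add: negligible_iff_null_sets)
  then show ?thesis by (subst (asm) null_sets_completion_iff) auto
qed

lemma convex_below:
  assumes "convex_on UNIV y" "convex_on UNIV (\<lambda>x. - l x)" shows "convex {x. y x < (l x :: real)}"
proof (rule convexI)
  fix a b u v assume a: "a \<in> {x. y x < l x}" and b: "b \<in> {x. y x < l x}" and uv: "0 \<le> u" "0 \<le> v" "u + v = (1::real)"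
  have "y (u *\<^sub>R a + v *\<^sub>R b) \<le> u * y a + v * y b" using assms(1) uv by (simp add: convex_on_def)
  moreover have "- l (u *\<^sub>R a + v *\<^sub>R b) \<le> u * - l a + v * - l b" using assms(2) uv unfolding convex_on_def by blast
  moreover have "u * y a + v * y b < u * l a + v * l b"
  proof (cases "u = 0")
    case True
    then show ?thesis using b uv by simp
  next
    case False
    then have "u * y a < u * l a" using a uv by simp
    moreover have "v * y b \<le> v * l b" using b uv by (simp add: mult_left_mono)
    ultimately show ?thesis by linarith
  qed
  ultimately show "u *\<^sub>R a + v *\<^sub>R b \<in> {x. y x < l x}" by simp
qed

lemma equal_in_frontier:
  assumes y: "convex_on UNIV (y :: 'a::euclidean_space \<Rightarrow> real)" and x: "y x = p \<bullet> x - c" and z: "y z < p \<bullet> z - c"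
  shows "x \<in> frontier {x. y x < p \<bullet> x - c}"
proof -
  let ?S = "{x. y x < p \<bullet> x - c}"
  have op: "open ?S" using convex_continuous[OF y] by (intro open_Collect_less continuous_intros) auto
  have s: "(1 - t) *\<^sub>R x + t *\<^sub>R z \<in> ?S" if t: "0 < t" "t < 1" for t
  proof -
    have "y ((1 - t) *\<^sub>R x + t *\<^sub>R z) \<le> (1 - t) * y x + t * y z" by (rule convex_onD[OF y]) (use t in auto)
    also have "\<dots> < (1 - t) * (p \<bullet> x - c) + t * (p \<bullet> z - c)" using x z t by simp
    finally show ?thesis by (simp add: inner_add_right algebra_simps)
  qed
  have "(\<lambda>j. (1 - 1 / real (Suc j)) *\<^sub>R x + (1 / real (Suc j)) *\<^sub>R z) \<longlonglongrightarrow> (1 - 0) *\<^sub>R x + 0 *\<^sub>R z"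
    by (intro tendsto_add tendsto_scaleR tendsto_diff tendsto_const LIMSEQ_Suc[OF lim_const_over_n])
  then have lim: "(\<lambda>j. (1 - 1 / real (Suc j)) *\<^sub>R x + (1 / real (Suc j)) *\<^sub>R z) \<longlonglongrightarrow> x" by simp
  have "(1 - 1 / real (Suc (Suc j))) *\<^sub>R x + (1 / real (Suc (Suc j))) *\<^sub>R z \<in> closure ?S" for j
    by (rule subsetD[OF closure_subset s]) auto
  then have "x \<in> closure ?S"
    by (intro Lim_in_closed_set[OF closed_closure _ _ LIMSEQ_Suc[OF lim]]) (simp_all del: of_nat_Suc)
  then show ?thesis using x op by (auto simp: frontier_def interior_open)
qed

lemma continuous_bounded_cball:
  fixes f :: "real^2 \<Rightarrow> real"
  assumes "continuous_on UNIV f" obtains C where "C > 0" "\<And>p. norm p \<le> L \<Longrightarrow> \<bar>f p\<bar> \<le> C"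
proof -
  have "bounded (f ` cball 0 L)"
    by (intro compact_imp_bounded compact_continuous_image continuous_on_subset[OF assms]) auto
  then obtain C where "C > 0" "\<And>y. y \<in> f ` cball 0 L \<Longrightarrow> norm y \<le> C" unfolding bounded_pos by blast
  then show ?thesis by (intro that[of C]) auto
qed

context cap
begin

text \<open>Keeps successive cuts in the admissible class: conjugation reverses the order, so the
  transform of a function between two admissible ones is squeezed as well.\<close>

lemma adm_sandwich:
  assumes A: "adm A" and B: "adm B" and y: "convex_on UNIV y" "\<And>x. lconj A x \<le> y x" "\<And>x. y x \<le> lconj B x"
  shows "adm (lconj y)" "lconj (lconj y) = y" "\<And>p. lconj y p \<le> A p" "\<And>p. B p \<le> lconj y p"
proof -
  have cy: "coercive y" by (rule coercive_mono[OF adm_lconj(2)[OF A], where c=0]) (use y in auto)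
  show "lconj (lconj y) = y" by (rule lconj_lconj[OF y(1) cy])
  show le: "lconj y p \<le> A p" for p
    using lconj_mono_bound[OF adm_lconj(2)[OF A], of 0 y p] y(2) adm_lconj(3)[OF A] by simp
  show ge: "B p \<le> lconj y p" for p
    using lconj_mono_bound[OF cy, of 0 "lconj B" p] y(3) adm_lconj(3)[OF B] by simp
  show "adm (lconj y)"
    unfolding adm_def
  proof (intro conjI allI impI)
    show "convex_on UNIV (lconj y)" by (rule convex_lconj[OF cy])
    fix p
    show "lconj y p = U p" if "r \<le> norm (p - \<xi>)" using le[of p] ge[of p] A B that by (simp add: adm_def)
    have "\<bar>A p - U p\<bar> \<le> \<eta>" "\<bar>B p - U p\<bar> \<le> \<eta>" using A B by (auto simp: adm_def)
    then show "\<bar>lconj y p - U p\<bar> \<le> \<eta>" using le[of p] ge[of p] by linarith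
  qed
qed

text \<open>Dominated convergence. Only the limit has to satisfy \<open>adm2\<close>: its unique
  subgradients force the gradients to converge at every point of \<open>K\<close>.\<close>

lemma \<Phi>_tendsto:
  assumes f: "continuous_on UNIV f" and Vj: "\<And>j. adm (Vj j)" and V: "adm2 V"
    and lim: "\<And>y. (\<lambda>j. lconj (Vj j) y) \<longlonglongrightarrow> lconj V y"
  shows "(\<lambda>j. \<Phi> f (Vj j)) \<longlonglongrightarrow> \<Phi> f V"
proof -
  obtain L where L: "\<And>V x. adm V \<Longrightarrow> x \<in> K \<Longrightarrow> norm (rgrad (lconj V) x) \<le> L" using gradient_bound by metis
  obtain C where C: "C > 0" "\<And>p. norm p \<le> L \<Longrightarrow> \<bar>f p\<bar> \<le> C" using continuous_bounded_cball[OF f] by blast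
  note a = adm_lconj[OF adm2_adm[OF V]]
  have Kb: "K \<in> sets lborel" using K by (simp add: compact_imp_closed)
  have fin: "emeasure lborel K < \<infinity>" using compact_imp_bounded[OF K(1)] by (rule emeasure_bounded_finite)
  have fm: "f \<in> borel_measurable borel" using f by (rule borel_measurable_continuous_onI)
  have meas: "(\<lambda>x. indicator K x *\<^sub>R f (rgrad (lconj W) x)) \<in> borel_measurable lborel" if "adm W" for W
    using rgrad_measurable[OF adm_lconj(1)[OF that]] fm Kb by measurable
  show ?thesis
    unfolding \<Phi>_def set_lebesgue_integral_def
  proof (rule integral_dominated_convergence[where w="\<lambda>x. indicator K x * C"])
    show "integrable lborel (\<lambda>x. indicator K x * C)" using fin Kb by simp
    show "AE x in lborel. (\<lambda>j. indicat_real K x *\<^sub>R f (rgrad (lconj (Vj j)) x)) \<longlonglongrightarrow> indicat_real K x *\<^sub>R f (rgrad (lconj V) x)"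
    proof (rule AE_I2)
      fix x
      show "(\<lambda>j. indicat_real K x *\<^sub>R f (rgrad (lconj (Vj j)) x)) \<longlonglongrightarrow> indicat_real K x *\<^sub>R f (rgrad (lconj V) x)"
      proof (cases "x \<in> K")
        case True
        then have xD: "x \<in> D" using K by blast
        have s: "subgrad (lconj V) x (rgrad (lconj V) x)" by (rule rd_rgrad(2)[OF V xD])
        have u: "q = rgrad (lconj V) x" if "subgrad (lconj V) x q" for q using adm2_uniq[OF V xD that s] .
        have "(\<lambda>j. rgrad (lconj (Vj j)) x) \<longlonglongrightarrow> rgrad (lconj V) x"
        proof (rule vec_tendstoI)
          fix i
          show "(\<lambda>j. rgrad (lconj (Vj j)) x $ i) \<longlonglongrightarrow> rgrad (lconj V) x $ i"
            unfolding rgrad_def vec_lambda_beta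
            by (rule rd_tendsto_unique[OF a(1,2) s u adm_lconj(1)[OF Vj] lim])
        qed
        then have "(\<lambda>j. f (rgrad (lconj (Vj j)) x)) \<longlonglongrightarrow> f (rgrad (lconj V) x)"
          using f by (auto simp: continuous_on_eq_continuous_at intro: isCont_tendsto_compose)
        then show ?thesis by (intro tendsto_intros)
      qed simp
    qed
    show "AE x in lborel. norm (indicat_real K x *\<^sub>R f (rgrad (lconj (Vj j)) x)) \<le> indicat_real K x * C" for j
      using C(2) L[OF Vj[of j]] by (intro AE_I2) (auto simp: indicator_def)
  qed (use meas adm2_adm[OF V] Vj in auto)
qed

text \<open>The mean of the gradient is fixed by the values off \<open>K\<close>; this is
  \<open>ridge_formula\<close> for the identity, whose second derivative is zero.\<close>

lemma ridge_mean:
  assumes A: "adm A" and B: "adm B" and n: "norm n = 1"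
  shows "(LBINT x:K. rd (lconj A) n x) = (LBINT x:K. rd (lconj B) n x)"
proof -
  note a = adm_lconj[OF A] and b = adm_lconj[OF B]
  have eqK: "lconj A x = lconj B x" if "x \<notin> K" for x
    using adm_outside[OF A that] adm_outside[OF B that] by simp
  obtain R where R: "\<And>x. x \<in> K \<Longrightarrow> norm x \<le> R"
    using compact_imp_bounded[OF K(1)] unfolding bounded_iff by blast
  have far: "lconj A x = lconj B x" if "R + 1 \<le> norm x" for x
    using eqK R that by (metis add_le_same_cancel1 not_one_le_zero order_trans)
  have dfar: "lconj (lconj A) p = lconj (lconj B) p" if "r + norm \<xi> \<le> norm p" for p
    using adm_far[OF A that] adm_far[OF B that] a(3) b(3) by simp
  have h: "((\<lambda>x::real. x) has_real_derivative 1) (at x)" "((\<lambda>x::real. 1) has_real_derivative 0) (at x)"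
    "continuous_on UNIV (\<lambda>x::real. 0::real)" for x
    by (auto intro!: derivative_eq_intros)
  have zero: "(\<integral>x. rd (lconj B) n x - rd (lconj A) n x \<partial>lborel) = 0"
    using ridge_formula(3)[OF a(1,2) b(1,2) n far dfar h] by simp
  obtain L where L: "\<And>V x n. adm V \<Longrightarrow> x \<in> K \<Longrightarrow> norm n \<le> 1 \<Longrightarrow> \<bar>rd (lconj V) n x\<bar> \<le> L"
    using gradient_bound by metis
  have i: "set_integrable lborel K (rd (lconj V) n)" if "adm V" for V
  proof (rule set_integrable_bounded[where C=L])
    show "rd (lconj V) n \<in> borel_measurable borel" by (rule rd_measurable[OF adm_lconj(1)[OF that]])
    show "K \<in> sets borel" "bounded K" using K by (auto simp: compact_imp_closed compact_imp_bounded)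
  qed (use L that n in auto)
  have "(\<integral>x. rd (lconj B) n x - rd (lconj A) n x \<partial>lborel) = (LBINT x:K. rd (lconj B) n x - rd (lconj A) n x)"
    unfolding set_lebesgue_integral_def
  proof (rule Bochner_Integration.integral_cong)
    fix x
    show "rd (lconj B) n x - rd (lconj A) n x = indicat_real K x *\<^sub>R (rd (lconj B) n x - rd (lconj A) n x)"
    proof (cases "x \<in> K")
      case False
      have "rd (lconj A) n x = rd (lconj B) n x"
        by (rule rd_eq_outside[OF a(1) b(1) compact_imp_closed[OF K(1)] eqK False])
      then show ?thesis by simp
    qed simp
  qed simp
  also have "\<dots> = (LBINT x:K. rd (lconj B) n x) - (LBINT x:K. rd (lconj A) n x)"
    by (rule set_integral_diff(2)[OF i[OF B] i[OF A]])
  finally show ?thesis using zero by simp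
qed

lemma \<Phi>_linear:
  assumes "adm A" "adm B" shows "\<Phi> (\<lambda>q. a \<bullet> q) A = \<Phi> (\<lambda>q. a \<bullet> q) B"
proof -
  have c: "\<Phi> (\<lambda>q. a $ i * q $ i) A = \<Phi> (\<lambda>q. a $ i * q $ i) B" for i
  proof -
    have "\<Phi> (\<lambda>q. a $ i * q $ i) V = a $ i * (LBINT x:K. rd (lconj V) (axis i 1) x)" for V
      unfolding \<Phi>_def rgrad_def by (simp add: set_lebesgue_integral_def mult.left_commute)
    then show ?thesis using ridge_mean[OF assms, of "axis i 1"] by simp
  qed
  have s: "\<Phi> (\<lambda>q. a \<bullet> q) V = \<Phi> (\<lambda>q. a $ 1 * q $ 1) V + \<Phi> (\<lambda>q. a $ 2 * q $ 2) V" if "adm V" for V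
    unfolding inner_real2 by (rule \<Phi>_add[OF _ _ that]) (auto intro!: continuous_intros)
  show ?thesis using s[OF assms(1)] s[OF assms(2)] c by simp
qed

text \<open>Raising a convex function to an affine one replaces its gradient by its mean; the
  supporting affine function of \<open>f\<close> at \<open>p\<close> turns this into Jensen's inequality.\<close>

lemma cut_gradient_AE:
  assumes Y: "adm Y" and Y': "adm Y'" "lconj Y' = (\<lambda>x. max (lconj Y x) (p \<bullet> x - c))"
  shows "AE x in lborel. rgrad (lconj Y') x = (if lconj Y x < p \<bullet> x - c then p else rgrad (lconj Y) x)"
proof -
  let ?S = "{x. lconj Y x < p \<bullet> x - c}"
  note y = adm_lconj(1)[OF Y] and y' = adm_lconj(1)[OF Y'(1)]
  have cont: "continuous_on UNIV (lconj Y)" by (rule convex_continuous[OF y])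
  have op: "open ?S" using cont by (intro open_Collect_less continuous_intros) auto
  have op2: "closed {x. lconj Y x \<le> p \<bullet> x - c}" using cont by (intro closed_Collect_le continuous_intros) auto
  have neg: "convex_on UNIV (\<lambda>x. - (p \<bullet> x - c))"
    by (rule convex_onI) (auto simp: algebra_simps inner_add_right)
  have "convex ?S" by (rule convex_below[OF y neg])
  then have "AE x in lborel. x \<notin> frontier ?S" by (intro AE_not_in frontier_null)
  then show ?thesis
  proof eventually_elim
    case (elim x)
    \<comment> \<open>Contact without crossing can happen on a set of positive measure only if
      \<open>?S\<close> is empty, and then nothing has changed; otherwise the contact points lie on
      the frontier of the convex set \<open>?S\<close>.\<close>
    consider "lconj Y x < p \<bullet> x - c" | "p \<bullet> x - c < lconj Y x" | "?S = {}" "p \<bullet> x - c = lconj Y x"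
      | "?S \<noteq> {}" "lconj Y x = p \<bullet> x - c" by fastforce
    then show ?case
    proof cases
      case 1
      have "rd (lconj Y') n x = rd (\<lambda>x. p \<bullet> x - c) n x" for n
        by (rule rd_eq_outside[OF y' convex_affine_inner, of "- ?S"]) (use 1 op Y'(2) in auto)
      then have "rd (lconj Y') n x = p \<bullet> n" for n by (simp only: rd_affine_inner)
      then show ?thesis using 1 by (simp add: rgrad_def vec_eq_iff inner_axis)
    next
      case 2
      have "rd (lconj Y') n x = rd (lconj Y) n x" for n
        by (rule rd_eq_outside[OF y' y op2]) (use 2 Y'(2) in auto)
      then show ?thesis using 2 by (simp add: rgrad_def)
    next
      case 3
      have "lconj Y' = lconj Y"
      proof
        fix z show "lconj Y' z = lconj Y z" using 3(1) Y'(2) by (auto simp: max_def not_less antisym)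
      qed
      then show ?thesis using 3 by simp
    next
      case 4
      then have "x \<in> frontier ?S" using equal_in_frontier[OF y] by blast
      then show ?thesis using elim by simp
    qed
  qed
qed

text \<open>By \<open>\<Phi>_linear\<close> the linear function \<open>a \<bullet> _\<close> may be
  subtracted from \<open>f\<close>; afterwards the value at \<open>p\<close> does not exceed the
  values at the gradients that \<open>p\<close> replaces.\<close>

lemma cut_step:
  assumes f: "continuous_on UNIV f" and Y: "adm Y" and Y': "adm Y'" "lconj Y' = (\<lambda>x. max (lconj Y x) (p \<bullet> x - c))"
    and supp: "\<And>x. x \<in> K \<Longrightarrow> f p + a \<bullet> (rgrad (lconj Y) x - p) \<le> f (rgrad (lconj Y) x)"
  shows "\<Phi> f Y' \<le> \<Phi> f Y"
proof -
  let ?z = "\<lambda>q. f q + (- a) \<bullet> q"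
  have cz: "continuous_on UNIV (\<lambda>q. (- a) \<bullet> q)" "continuous_on UNIV ?z" using f by (auto intro!: continuous_intros)
  have "\<Phi> ?z Y' \<le> \<Phi> ?z Y"
    unfolding \<Phi>_def
  proof (rule set_integral_mono_AE[OF \<Phi>_integrable[OF cz(2) Y'(1)] \<Phi>_integrable[OF cz(2) Y]])
    show "AE x\<in>K in lborel. ?z (rgrad (lconj Y') x) \<le> ?z (rgrad (lconj Y) x)"
      using cut_gradient_AE[OF Y Y']
    proof eventually_elim
      case (elim x)
      then show ?case using supp[of x] by (auto simp: inner_diff_right)
    qed
  qed
  then show ?thesis
    using \<Phi>_add[OF f cz(1) Y'(1)] \<Phi>_add[OF f cz(1) Y] \<Phi>_linear[OF Y'(1) Y, of "-a"] by simp
qed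

text \<open>For an integrand with supporting affine functions, lowering the transform lowers the
  energy. The function \<open>lconj B\<close> is the increasing limit of \<open>lconj A\<close> cut
  by tangent planes of \<open>lconj B\<close> at a dense sequence in \<open>K\<close>, and no cut
  raises the energy.\<close>

lemma \<Phi>_antimono:
  assumes f: "continuous_on UNIV f" and A: "adm A" and B: "adm2 B" and le: "\<And>p. B p \<le> A p"
    and L: "\<And>V x. adm V \<Longrightarrow> x \<in> K \<Longrightarrow> norm (rgrad (lconj V) x) \<le> L"
    and supp: "\<And>p q. norm p \<le> L \<Longrightarrow> norm q \<le> L \<Longrightarrow> f p + a p \<bullet> (q - p) \<le> f q"
  shows "\<Phi> f B \<le> \<Phi> f A"
proof (cases "K = {}")
  case True
  then show ?thesis unfolding \<Phi>_def set_lebesgue_integral_def by simp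
next
  case False
  note b = adm_lconj[OF adm2_adm[OF B]]
  obtain T where T: "countable T" "T \<subseteq> K" "K \<subseteq> closure T" by (rule separable)
  have "T \<noteq> {}" using T(3) False by auto
  define d where "d = from_nat_into T"
  have d: "range d = T" unfolding d_def by (rule range_from_nat_into[OF \<open>T \<noteq> {}\<close> T(1)])
  have dK: "d i \<in> K" for i using d T(2) by blast
  define g' where "g' = (\<lambda>i. rgrad (lconj B) (d i))"
  have sg: "subgrad (lconj B) (d i) (g' i)" for i unfolding g'_def using rd_rgrad(2)[OF B] dK K by blast
  have gL: "norm (g' i) \<le> L" for i unfolding g'_def by (rule L[OF adm2_adm[OF B] dK])
  define l where "l = (\<lambda>i x. g' i \<bullet> x - (g' i \<bullet> d i - lconj B (d i)))"
  have l_le: "l i x \<le> lconj B x" for i x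
  proof -
    have "lconj B (d i) + g' i \<bullet> (x - d i) \<le> lconj B x" using sg unfolding subgrad_def by blast
    then show ?thesis by (simp add: l_def inner_diff_right)
  qed
  define y where "y = rec_nat (lconj A) (\<lambda>n z x. max (z x) (l n x))"
  have y0: "y 0 = lconj A" and yS: "y (Suc n) = (\<lambda>x. max (y n x) (l n x))" for n by (simp_all add: y_def)
  have AB: "lconj A x \<le> lconj B x" for x
    using lconj_mono_bound[OF adm_coercive[OF adm2_adm[OF B]], of 0 A x] le by simp
  have y: "convex_on UNIV (y n) \<and> (\<forall>x. lconj A x \<le> y n x) \<and> (\<forall>x. y n x \<le> lconj B x)" for n
  proof (induction n)
    case 0
    then show ?case using y0 adm_lconj(1)[OF A] AB by simp
  next
    case (Suc n)
    have "convex_on UNIV (l n)" unfolding l_def by (rule convex_affine_inner)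
    then have "convex_on UNIV (y (Suc n))" unfolding yS using Suc by (intro convex_max) auto
    moreover have "lconj A x \<le> y (Suc n) x" for x unfolding yS using Suc by (simp add: le_max_iff_disj)
    moreover have "y (Suc n) x \<le> lconj B x" for x unfolding yS using Suc l_le by simp
    ultimately show ?case by simp
  qed
  have ya: "adm (lconj (y n))" "lconj (lconj (y n)) = y n" for n
    using adm_sandwich(1,2)[OF A adm2_adm[OF B]] y[of n] by auto
  have step: "\<Phi> f (lconj (y (Suc n))) \<le> \<Phi> f (lconj (y n))" for n
  proof (rule cut_step[OF f ya(1) ya(1)])
    show "lconj (lconj (y (Suc n))) = (\<lambda>x. max (lconj (lconj (y n)) x) (g' n \<bullet> x - (g' n \<bullet> d n - lconj B (d n))))"
      by (simp only: ya(2)) (simp only: yS l_def)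
    show "f (g' n) + a (g' n) \<bullet> (rgrad (lconj (lconj (y n))) x - g' n) \<le> f (rgrad (lconj (lconj (y n))) x)" if "x \<in> K" for x
      by (rule supp[OF gL L[OF ya(1) that]])
  qed
  have dec: "\<Phi> f (lconj (y n)) \<le> \<Phi> f A" for n
  proof (induction n)
    case 0
    then show ?case using y0 adm_lconj(3)[OF A] by simp
  next
    case (Suc n)
    then show ?case using step[of n] by simp
  qed
  have mono: "y m x \<le> y n x" if "m \<le> n" for m n x
    by (rule lift_Suc_mono_le[OF _ that]) (simp add: yS)
  have lim: "(\<lambda>n. y n x) \<longlonglongrightarrow> lconj B x" for x
  proof (cases "x \<in> K")
    case False
    have "y n x = lconj B x" for n
      using y[of n] adm_outside[OF A False] adm_outside[OF adm2_adm[OF B] False] by (metis antisym)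
    then show ?thesis by simp
  next
    case True
    have L0: "L \<ge> 0" using gL[of 0] norm_ge_zero order_trans by blast
    show ?thesis
    proof (rule LIMSEQ_I)
      fix e :: real assume e: "e > 0"
      have "isCont (lconj B) x" using convex_continuous[OF b(1), of UNIV] by (simp add: continuous_on_eq_continuous_at)
      then obtain s where s: "s > 0" "\<And>z. dist z x < s \<Longrightarrow> dist (lconj B z) (lconj B x) < e / 2"
        unfolding continuous_at_eps_delta using e half_gt_zero by blast
      have "min s (e / (2 * (L + 1))) > 0" using s e L0 by simp
      then obtain z where z: "z \<in> T" "dist z x < min s (e / (2 * (L + 1)))"
        using True T(3) by (meson closure_approachable subsetD)
      then obtain i where i: "d i = z" using d by blast
      have "l i x = lconj B (d i) + g' i \<bullet> (x - d i)" by (simp add: l_def inner_diff_right)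
      moreover have "lconj B (d i) > lconj B x - e / 2"
      proof -
        have "\<bar>lconj B z - lconj B x\<bar> < e / 2" using s(2)[of z] z unfolding dist_real_def by simp
        then show ?thesis unfolding i by linarith
      qed
      moreover have "\<bar>g' i \<bullet> (x - d i)\<bar> \<le> e / 2"
      proof -
        have "\<bar>g' i \<bullet> (x - d i)\<bar> \<le> norm (g' i) * norm (x - d i)" by (rule Cauchy_Schwarz_ineq2)
        also have "\<dots> \<le> (L + 1) * (e / (2 * (L + 1)))"
          using z i gL[of i] L0 by (intro mult_mono) (auto simp: dist_norm norm_minus_commute)
        also have "\<dots> = e / 2"
        proof -
          have "\<And>c::real. c > 0 \<Longrightarrow> c * (e / (2 * c)) = e / 2" by simp
          then show ?thesis using L0 by (meson add_nonneg_pos zero_less_one)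
        qed
        finally show ?thesis .
      qed
      ultimately have li: "l i x > lconj B x - e" by linarith
      show "\<exists>no. \<forall>n\<ge>no. norm (y n x - lconj B x) < e"
      proof (intro exI allI impI)
        fix n assume "Suc i \<le> n"
        then have "y (Suc i) x \<le> y n x" by (rule mono)
        moreover have "l i x \<le> y (Suc i) x" by (simp add: yS)
        moreover have "y n x \<le> lconj B x" using y by blast
        ultimately show "norm (y n x - lconj B x) < e" using li e by simp
      qed
    qed
  qed
  have "(\<lambda>n. \<Phi> f (lconj (y n))) \<longlonglongrightarrow> \<Phi> f B"
    by (rule \<Phi>_tendsto[OF f ya(1) B]) (simp only: ya lim)
  then show ?thesis using dec by (intro LIMSEQ_le_const2) auto
qed

section \<open>Energy estimates in terms of the uniform distance\<close>

lemma adm_rd_bound: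
  obtains L where "L > 0" "\<And>V x n. adm V \<Longrightarrow> norm x \<le> R \<Longrightarrow> norm n \<le> 1 \<Longrightarrow> \<bar>rd V n x\<bar> \<le> L"
proof -
  obtain C where C: "C > 0" "\<And>y. norm y \<le> R + 1 \<Longrightarrow> \<bar>U y\<bar> \<le> C" using convex_bounded_ball[OF U(1)] by blast
  show ?thesis
  proof (rule that[of "2 * (C + \<eta>)"])
    fix V and x n :: "real^2" assume V: "adm V" and x: "norm x \<le> R" "norm n \<le> 1"
    show "\<bar>rd V n x\<bar> \<le> 2 * (C + \<eta>)"
    proof (rule rd_bound[OF adm_convex[OF V] x(2) _ x(1)])
      fix y :: "real^2" assume "norm y \<le> R + 1"
      then have "\<bar>U y\<bar> \<le> C" by (rule C)
      moreover have "\<bar>V y - U y\<bar> \<le> \<eta>" using V by (simp add: adm_def)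
      ultimately show "\<bar>V y\<bar> \<le> C + \<eta>" by linarith
    qed
  qed (use C \<eta> in simp)
qed

text \<open>Uniform closeness of \<open>A\<close> and \<open>B\<close> says little about their
  derivatives pointwise. The one-dimensional formula with second derivative \<open>2\<close> turns
  the difference of squares into a difference of conjugates, which is bounded by
  \<open>s\<close>.\<close>

lemma dual_energy_bound:
  obtains C where "C \<ge> 0" "\<And>A B n k s. adm A \<Longrightarrow> adm B \<Longrightarrow> norm n = 1 \<Longrightarrow> (\<And>p. \<bar>A p - B p\<bar> \<le> s) \<Longrightarrow>
    \<bar>dual_energy_density A B n k\<bar> \<le> C * s * indicator {-(r + norm \<xi>)..r + norm \<xi>} k"
proof -
  let ?T = "r + norm \<xi>"
  have T0: "?T \<ge> 0" using r by simp
  obtain L where L: "L > 0" "\<And>V x n. adm V \<Longrightarrow> norm x \<le> 2 * ?T \<Longrightarrow> norm n \<le> 1 \<Longrightarrow> \<bar>rd V n x\<bar> \<le> L"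
    using adm_rd_bound by blast
  have "\<bar>dual_energy_density A B n k\<bar> \<le> (4 * L) * s * indicator {-?T..?T} k"
    if A: "adm A" and B: "adm B" and n: "norm n = 1" and s: "\<And>p. \<bar>A p - B p\<bar> \<le> s" for A B n k s
  proof -
    let ?z = "\<lambda>\<sigma>. \<sigma> *\<^sub>R perp n + k *\<^sub>R n"
    have zn: "\<bar>k\<bar> \<le> norm (?z \<sigma>)" "\<bar>\<sigma>\<bar> \<le> norm (?z \<sigma>)" for \<sigma>
      unfolding add.commute[of "\<sigma> *\<^sub>R perp n"] by (rule frame_norm_ge[OF n])+
    show ?thesis
    proof (cases "\<bar>k\<bar> \<le> ?T")
      case False
      have "rd A (perp n) (?z \<sigma>) = rd B (perp n) (?z \<sigma>)" for \<sigma>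
      proof (rule rd_eq_outside_ball[OF adm_convex[OF A] adm_convex[OF B], of ?T])
        show "A y = B y" if "?T \<le> norm y" for y using adm_far[OF A that] adm_far[OF B that] by simp
        show "?T < norm (?z \<sigma>)" using zn(1)[of \<sigma>] False by simp
      qed
      then have "dual_energy_density A B n k = 0" by (simp add: dual_energy_density_def)
      moreover have "indicator {-?T..?T} k = (0::real)" using False by (auto simp: indicator_def)
      ultimately show ?thesis by simp
    next
      case True
      let ?a = "\<lambda>\<sigma>. A (?z \<sigma>)" and ?b = "\<lambda>\<sigma>. B (?z \<sigma>)"
      have ca: "convex_on UNIV ?a" "coercive ?a" "convex_on UNIV ?b" "coercive ?b"
        using A B n by (auto intro: convex_slice coercive_slice adm_convex adm_coercive)
      have eq: "?a \<sigma> = ?b \<sigma>" if "\<sigma> \<notin> {-?T<..<?T}" for \<sigma>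
      proof -
        have "?T \<le> norm (?z \<sigma>)" using that zn(2)[of \<sigma>] by auto
        then show ?thesis using adm_far[OF A] adm_far[OF B] by simp
      qed
      have rb: "\<bar>rd ?a 1 \<sigma>\<bar> \<le> L" "\<bar>rd ?b 1 \<sigma>\<bar> \<le> L" if "\<sigma> \<in> {-?T..?T}" for \<sigma>
      proof -
        have "norm (?z \<sigma>) \<le> 2 * ?T"
          using norm_triangle_ineq[of "\<sigma> *\<^sub>R perp n" "k *\<^sub>R n"] n that True by auto
        then show "\<bar>rd ?a 1 \<sigma>\<bar> \<le> L" "\<bar>rd ?b 1 \<sigma>\<bar> \<le> L" unfolding rd_slice using L(2) A B n by auto
      qed
      have h: "((\<lambda>x::real. x\<^sup>2) has_real_derivative 2 * x) (at x)" "((\<lambda>x::real. 2 * x) has_real_derivative 2) (at x)"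
        "continuous_on UNIV (\<lambda>x::real. 2::real)" for x
        by (auto intro!: derivative_eq_intros)
      have "dual_energy_density A B n k = (LBINT \<sigma>:{-?T..?T}. (rd ?a 1 \<sigma>)\<^sup>2 - (rd ?b 1 \<sigma>)\<^sup>2)"
        unfolding dual_energy_density_def rd_slice[symmetric]
      proof (rule LINT_zero_outside)
        fix \<sigma> assume "\<sigma> \<notin> {-?T..?T}"
        then have "rd ?a 1 \<sigma> = rd ?b 1 \<sigma>"
          by (intro rd_eq_outside[OF ca(1,3), of "{-?T..?T}"]) (use eq in auto)
        then show "(rd ?a 1 \<sigma>)\<^sup>2 - (rd ?b 1 \<sigma>)\<^sup>2 = 0" by simp
      qed
      also have "\<dots> = (LBINT k:{-L..L}. 2 * (lconj ?a k - lconj ?b k))"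
        by (rule integral_derivative_eq_integral_lconj[OF ca eq _ h rb]) (use T0 in auto)
      finally have eqn: "dual_energy_density A B n k = (LBINT k:{-L..L}. 2 * (lconj ?a k - lconj ?b k))" .
      have ab: "\<bar>lconj ?a k - lconj ?b k\<bar> \<le> s" for k
      proof -
        have i: "?a x - s \<le> ?b x" "?b x - s \<le> ?a x" for x using s[of "?z x"] by auto
        have "lconj ?b k \<le> lconj ?a k + s" by (rule lconj_mono_bound[OF ca(2)]) (rule i)
        moreover have "lconj ?a k \<le> lconj ?b k + s" by (rule lconj_mono_bound[OF ca(4)]) (rule i)
        ultimately show ?thesis by linarith
      qed
      have si: "set_integrable lborel {-L..L} (\<lambda>k. 2 * (lconj ?a k - lconj ?b k))"
        by (rule borel_integrable_atLeastAtMost')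
           (intro continuous_intros convex_continuous convex_lconj ca)
      have "- (2 * s) \<le> 2 * (lconj ?a k - lconj ?b k) \<and> 2 * (lconj ?a k - lconj ?b k) \<le> 2 * s" for k
      proof -
        have "\<And>x y :: real. \<bar>x - y\<bar> \<le> s \<Longrightarrow> - (2 * s) \<le> 2 * (x - y) \<and> 2 * (x - y) \<le> 2 * s"
          by (auto simp: abs_le_iff)
        then show ?thesis using ab by blast
      qed
      note LBINT_bounds[OF si _ this]
      then have "- (2 * s) * (L - (-L)) \<le> dual_energy_density A B n k" "dual_energy_density A B n k \<le> 2 * s * (L - (-L))"
        unfolding eqn using L(1) by auto
      moreover have "indicator {-?T..?T} k = (1::real)" using True by (auto simp: indicator_def)
      ultimately show ?thesis by (simp add: abs_le_iff algebra_simps)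
    qed
  qed
  then show ?thesis using L(1) by (intro that[of "4 * L"]) auto
qed

text \<open>\<open>q \<bullet> q\<close> is a sum of two squares of coordinates, that is, of ridge
  functions with constant second derivative, so only the dual energy density has to be
  estimated.\<close>

lemma energy_bound:
  obtains C where "C \<ge> 0" "\<And>A B s. adm2 A \<Longrightarrow> adm2 B \<Longrightarrow> (\<And>p. \<bar>A p - B p\<bar> \<le> s) \<Longrightarrow>
    \<bar>\<Phi> (\<lambda>q. q \<bullet> q) B - \<Phi> (\<lambda>q. q \<bullet> q) A\<bar> \<le> C * s"
proof -
  let ?T = "r + norm \<xi>"
  have T0: "?T \<ge> 0" using r by simp
  obtain C where C: "C \<ge> 0" "\<And>A B n k s. adm A \<Longrightarrow> adm B \<Longrightarrow> norm n = 1 \<Longrightarrow> (\<And>p. \<bar>A p - B p\<bar> \<le> s) \<Longrightarrow>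
    \<bar>dual_energy_density A B n k\<bar> \<le> C * s * indicator {-?T..?T} k"
    using dual_energy_bound by blast
  have h: "((\<lambda>x::real. x\<^sup>2) has_real_derivative 2 * x) (at x)" "((\<lambda>x::real. 2 * x) has_real_derivative 2) (at x)"
    "continuous_on UNIV (\<lambda>x::real. 2::real)" for x
    by (auto intro!: derivative_eq_intros)
  have one: "\<bar>\<Phi> (\<lambda>q. (n \<bullet> q)\<^sup>2) B - \<Phi> (\<lambda>q. (n \<bullet> q)\<^sup>2) A\<bar> \<le> (2 * ?T * C) * s"
    if A: "adm2 A" and B: "adm2 B" and s: "\<And>p. \<bar>A p - B p\<bar> \<le> s" and n: "norm n = 1" for A B n s
  proof -
    note R = \<Phi>_ridge[OF A B n h]
    have "integrable lborel (indicat_real {-?T..?T})"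
      by (rule integrable_real_indicator) (auto simp: emeasure_lborel_Icc_eq)
    then have ii: "integrable lborel (\<lambda>k. C * s * indicator {-?T..?T} k)" by (rule integrable_mult_right)
    have bd: "\<bar>dual_energy_density A B n k\<bar> \<le> C * s * indicator {-?T..?T} k" for k
      by (rule C(2)[OF adm2_adm[OF A] adm2_adm[OF B] n s])
    have i1: "integrable lborel (dual_energy_density A B n)" using integrable_mult_right[OF R(1), of "1/2"] by simp
    have "\<bar>\<integral>k. dual_energy_density A B n k \<partial>lborel\<bar> \<le> (\<integral>k. \<bar>dual_energy_density A B n k\<bar> \<partial>lborel)"
      by (rule integral_abs_bound)
    also have "\<dots> \<le> (\<integral>k. C * s * indicator {-?T..?T} k \<partial>lborel)"
      by (rule integral_mono[OF integrable_abs[OF i1] ii bd])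
    also have "\<dots> = C * s * (2 * ?T)" using T0 by simp
    finally have "\<bar>\<integral>k. dual_energy_density A B n k \<partial>lborel\<bar> \<le> C * s * (2 * ?T)" .
    moreover have "\<Phi> (\<lambda>q. (n \<bullet> q)\<^sup>2) B - \<Phi> (\<lambda>q. (n \<bullet> q)\<^sup>2) A = (\<integral>k. dual_energy_density A B n k \<partial>lborel)"
      using R(2) by simp
    ultimately show ?thesis by (simp add: mult_ac)
  qed
  show ?thesis
  proof (rule that[of "2 * (2 * ?T * C)"])
    show "0 \<le> 2 * (2 * ?T * C)" using T0 C by simp
    fix A B s assume A: "adm2 A" and B: "adm2 B" and s: "\<And>p. \<bar>A p - B p\<bar> \<le> s"
    have sp: "\<Phi> (\<lambda>q. q \<bullet> q) V = \<Phi> (\<lambda>q. (axis 1 1 \<bullet> q)\<^sup>2) V + \<Phi> (\<lambda>q. (axis 2 1 \<bullet> q)\<^sup>2) V" if "adm2 V" for V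
    proof -
      have "(\<lambda>q::real^2. q \<bullet> q) = (\<lambda>q. (axis 1 1 \<bullet> q)\<^sup>2 + (axis 2 1 \<bullet> q)\<^sup>2)"
        by (auto simp: inner_real2 axis_def power2_eq_square)
      then show ?thesis by (simp only:) (rule \<Phi>_add[OF _ _ adm2_adm[OF that]]; intro continuous_intros)
    qed
    show "\<bar>\<Phi> (\<lambda>q. q \<bullet> q) B - \<Phi> (\<lambda>q. q \<bullet> q) A\<bar> \<le> 2 * (2 * ?T * C) * s"
      using one[OF A B s, of "axis 1 1"] one[OF A B s, of "axis 2 1"] sp[OF A] sp[OF B]
      by (simp add: abs_le_iff algebra_simps)
  qed
qed

text \<open>The perturbation \<open>M / 2 * norm q\<^sup>2\<close> makes \<open>f\<close> convex, and its contribution is controlled by the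
  uniform distance.\<close>

lemma \<Phi>_cut_bound:
  assumes f: "continuous_on UNIV f"
    and taylor: "\<And>L. \<exists>M\<ge>0. \<forall>p q. norm p \<le> L \<longrightarrow> norm q \<le> L \<longrightarrow> f p + f' p \<bullet> (q - p) - M * ((q - p) \<bullet> (q - p)) \<le> f q"
  obtains C where "C \<ge> 0" "\<And>B s. adm2 B \<Longrightarrow> (\<And>p. B p \<le> U p) \<Longrightarrow> (\<And>p. U p - s \<le> B p) \<Longrightarrow> \<Phi> f B \<le> \<Phi> f U + C * s"
proof -
  obtain L where L: "\<And>V x. adm V \<Longrightarrow> x \<in> K \<Longrightarrow> norm (rgrad (lconj V) x) \<le> L" using gradient_bound by metis
  obtain M where M: "M \<ge> 0" "\<And>p q. norm p \<le> L \<Longrightarrow> norm q \<le> L \<Longrightarrow> f p + f' p \<bullet> (q - p) - M * ((q - p) \<bullet> (q - p)) \<le> f q"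
    using taylor[of L] by blast
  obtain C where C: "C \<ge> 0" "\<And>A B s. adm2 A \<Longrightarrow> adm2 B \<Longrightarrow> (\<And>p. \<bar>A p - B p\<bar> \<le> s) \<Longrightarrow>
    \<bar>\<Phi> (\<lambda>q. q \<bullet> q) B - \<Phi> (\<lambda>q. q \<bullet> q) A\<bar> \<le> C * s" using energy_bound by blast
  let ?h = "\<lambda>q. f q + M * (q \<bullet> q)"
  have cq: "continuous_on UNIV (\<lambda>q::real^2. M * (q \<bullet> q))" by (intro continuous_intros)
  have ch: "continuous_on UNIV ?h" using f cq by (rule continuous_on_add)
  \<comment> \<open>The added square absorbs the defect
    \<open>M * ((q - p) \<bullet> (q - p))\<close> exactly and shifts the supporting slope by
    \<open>2 * M\<close> times \<open>p\<close>.\<close>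
  have supp: "?h p + (f' p + (2 * M) *\<^sub>R p) \<bullet> (q - p) \<le> ?h q" if "norm p \<le> L" "norm q \<le> L" for p q
  proof -
    have "(q - p) \<bullet> (q - p) = q \<bullet> q - p \<bullet> p - 2 * (p \<bullet> (q - p))"
      by (simp add: inner_diff_left inner_diff_right inner_commute[of q p])
    then have "M * ((q - p) \<bullet> (q - p)) = M * (q \<bullet> q) - M * (p \<bullet> p) - 2 * M * (p \<bullet> (q - p))"
      by (simp add: algebra_simps)
    then show ?thesis using M(2)[OF that] by (simp add: inner_add_left)
  qed
  have sq: "\<Phi> (\<lambda>q. M * (q \<bullet> q)) V = M * \<Phi> (\<lambda>q. q \<bullet> q) V" for V
    unfolding \<Phi>_def by (simp add: set_lebesgue_integral_def mult.left_commute)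
  show ?thesis
  proof (rule that[of "M * C"])
    show "0 \<le> M * C" using M C by simp
    fix B s assume B: "adm2 B" "\<And>p. B p \<le> U p" "\<And>p. U p - s \<le> B p"
    have "\<Phi> ?h B \<le> \<Phi> ?h U" by (rule \<Phi>_antimono[OF ch adm_U(1) B(1,2) L supp])
    moreover have "\<Phi> ?h V = \<Phi> f V + M * \<Phi> (\<lambda>q. q \<bullet> q) V" if "adm V" for V
      using \<Phi>_add[OF f cq that] by (simp add: sq)
    ultimately have "\<Phi> f B + M * \<Phi> (\<lambda>q. q \<bullet> q) B \<le> \<Phi> f U + M * \<Phi> (\<lambda>q. q \<bullet> q) U"
      using adm2_adm[OF B(1)] adm_U(1) by simp
    moreover have "\<bar>\<Phi> (\<lambda>q. q \<bullet> q) B - \<Phi> (\<lambda>q. q \<bullet> q) U\<bar> \<le> C * s"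
    proof (rule C(2)[OF adm_U(2) B(1)])
      show "\<bar>U p - B p\<bar> \<le> s" for p using B(2,3)[of p] by simp
    qed
    then have "M * (\<Phi> (\<lambda>q. q \<bullet> q) U - \<Phi> (\<lambda>q. q \<bullet> q) B) \<le> M * (C * s)"
      using M(1) by (intro mult_left_mono) auto
    ultimately show "\<Phi> f B \<le> \<Phi> f U + M * C * s" by (simp add: algebra_simps)
  qed
qed

end

section \<open>The first variation\<close>

context cap
begin

lemma \<Phi>_tendsto_uniform:
  assumes f: "continuous_on UNIV f" and Vj: "\<And>j. adm (Vj j)" and V: "adm2 V"
    and close: "\<And>j p. \<bar>Vj j p - V p\<bar> \<le> c j" and c: "c \<longlonglongrightarrow> 0"
  shows "(\<lambda>j. \<Phi> f (Vj j)) \<longlonglongrightarrow> \<Phi> f V"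
proof (rule \<Phi>_tendsto[OF f Vj V])
  fix y
  have b: "\<bar>lconj (Vj j) y - lconj V y\<bar> \<le> c j" for j
  proof -
    have i: "Vj j x - c j \<le> V x" "V x - c j \<le> Vj j x" for x using close[of j x] by auto
    have "lconj V y \<le> lconj (Vj j) y + c j" by (rule lconj_mono_bound[OF adm_coercive[OF Vj]]) (rule i)
    moreover have "lconj (Vj j) y \<le> lconj V y + c j" by (rule lconj_mono_bound[OF adm_coercive[OF adm2_adm[OF V]]]) (rule i)
    ultimately show ?thesis by linarith
  qed
  have "(\<lambda>j. lconj (Vj j) y - lconj V y) \<longlonglongrightarrow> 0"
    by (rule Lim_null_comparison[OF _ c]) (use b in auto)
  then show "(\<lambda>j. lconj (Vj j) y) \<longlonglongrightarrow> lconj V y" by (simp add: LIM_zero_iff)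
qed

text \<open>Danskin's theorem: since \<open>g\<close> is differentiable on \<open>K\<close>, the transform of \<open>U - t * W\<close> is
  \<open>g + t * W (\<nabla> g)\<close> up to \<open>o(t)\<close>, so convexifying \<open>U - t * W\<close> loses only \<open>o(t)\<close>.\<close>

lemma convexified_decrease:
  assumes B: "adm B" and UB: "\<And>p. U p \<le> B p" and near: "\<And>p. r / 2 \<le> norm (p - \<xi>) \<Longrightarrow> B p = U p"
    and \<epsilon>: "\<epsilon> > 0"
  obtains t0 where "t0 > 0" "\<And>t. 0 < t \<Longrightarrow> t \<le> t0 \<Longrightarrow>
    \<exists>A. adm A \<and> (\<forall>p. A p \<le> U p - t * (B p - U p)) \<and> (\<forall>p. U p - t * (B p - U p) - t * \<epsilon> \<le> A p)"
proof -
  define W where "W = (\<lambda>p. B p - U p)"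
  have W0: "W p \<ge> 0" for p using UB[of p] by (simp add: W_def)
  have W\<eta>: "W p \<le> \<eta>" for p
  proof -
    have "\<bar>B p - U p\<bar> \<le> \<eta>" using B by (simp add: adm_def)
    then show ?thesis by (simp add: W_def)
  qed
  have Wz: "W p = 0" if "r / 2 \<le> norm (p - \<xi>)" for p using near[OF that] by (simp add: W_def)
  have "continuous_on (cball \<xi> r) W"
    unfolding W_def using convex_continuous[OF adm_convex[OF B]] convex_continuous[OF U(1)] by (intro continuous_on_diff)
  then have "uniformly_continuous_on (cball \<xi> r) W" by (rule compact_uniformly_continuous) simp
  then obtain d' where d': "d' > 0" "\<And>p q. p \<in> cball \<xi> r \<Longrightarrow> q \<in> cball \<xi> r \<Longrightarrow> dist q p < d' \<Longrightarrow> dist (W q) (W p) < \<epsilon>"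
    using \<epsilon> unfolding uniformly_continuous_on_def by blast
  \<comment> \<open>A change of slope below \<open>d\<close> alters \<open>W\<close> by at most
    \<open>\<epsilon>\<close> and cannot lead from the support of \<open>W\<close> out of the ball
    of radius \<open>r\<close>.\<close>
  define d where "d = min d' (r / 2)"
  have d: "d > 0" using d' r by (simp add: d_def)
  have Wd: "W p \<le> W q + \<epsilon>" if pq: "norm (p - q) < d" for p q
  proof (cases "norm (p - \<xi>) < r / 2")
    case True
    have "norm (q - \<xi>) \<le> norm (p - q) + norm (p - \<xi>)"
      using norm_triangle_ineq4[of "p - \<xi>" "p - q"] by simp
    then have "norm (q - \<xi>) \<le> r" using True pq by (simp add: d_def)
    then have "dist (W q) (W p) < \<epsilon>"
      by (intro d'(2)) (use True pq r in \<open>auto simp: dist_norm norm_minus_commute d_def\<close>)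
    then show ?thesis by (simp add: dist_real_def)
  next
    case False
    then show ?thesis using Wz[of p] W0[of q] \<epsilon> by simp
  qed
  have Wq: "norm (q - \<xi>) < r" if "norm (p - q) < d" "W p \<noteq> 0" for p q
  proof -
    have "norm (p - \<xi>) < r / 2" using Wz[of p] that by fastforce
    moreover have "norm (q - \<xi>) \<le> norm (p - q) + norm (p - \<xi>)"
      using norm_triangle_ineq4[of "p - \<xi>" "p - q"] by simp
    ultimately show ?thesis using that by (simp add: d_def)
  qed
  obtain \<theta> where \<theta>: "\<theta> > 0"
    "\<And>x p q. x \<in> K \<Longrightarrow> g x + lconj g p - p \<bullet> x \<le> \<theta> \<Longrightarrow> subgrad g x q \<Longrightarrow> norm (p - q) < d"
  proof -
    have u: "p = q" if "x \<in> K" "subgrad g x p" "subgrad g x q" for x p q using uniq[of x p q] K that by blast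
    show ?thesis by (rule eps_subgrad_modulus[OF g K(1) _ d that]) (rule u)
  qed
  \<comment> \<open>The second bound makes the gap of every relevant slope at most
    \<open>\<theta>\<close>; the third leaves room for \<open>W\<close> and
    \<open>\<epsilon>\<close> together within the tolerance \<open>\<eta>\<close>.\<close>
  define t0 where "t0 = min 1 (min (\<theta> / \<eta>) (\<eta> / (\<eta> + \<epsilon>)))"
  have t0: "t0 > 0" using \<theta> \<eta> \<epsilon> by (simp add: t0_def)
  show ?thesis
  proof (rule that[OF t0])
    fix t assume t: "0 < t" "t \<le> t0"
    have t1: "t \<le> 1" "t * \<eta> \<le> \<theta>" "t * (\<eta> + \<epsilon>) \<le> \<eta>"
      using t \<eta> \<epsilon> by (auto simp: t0_def pos_le_divide_eq)
    have tW: "0 \<le> t * W p" "t * W p \<le> t * \<eta>" "t * W p \<le> \<eta>" for p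
    proof -
      show "0 \<le> t * W p" "t * W p \<le> t * \<eta>" using t W0 W\<eta> by (auto intro: mult_left_mono)
      then show "t * W p \<le> \<eta>" using t1 \<eta> mult_right_mono[OF t1(1), of \<eta>] by linarith
    qed
    define Z where "Z = (\<lambda>p. U p - t * W p)"
    have cZ: "coercive Z" by (rule coercive_mono[OF U(2), where c=\<eta>]) (use tW(3) in \<open>simp add: Z_def\<close>)
    define v where "v = lconj Z"
    have U_ge: "x \<bullet> p - U p \<le> g x" for x p using lconj_ge[OF U(2), of x p] U(3) by simp
    \<comment> \<open>Only slopes with gap below \<open>t * W p\<close> at \<open>x\<close> can lift
      the conjugate of \<open>Z\<close> above \<open>g x\<close>.\<close>
    have v_le: "v x \<le> g x + c" if "\<And>p. g x + U p - p \<bullet> x < t * W p \<Longrightarrow> t * W p \<le> c" "c \<ge> 0" for x c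
      unfolding v_def
    proof (rule lconj_le)
      fix p
      have "p \<bullet> x - U p \<le> g x" using U_ge[of x p] by (simp add: inner_commute)
      then show "x \<bullet> p - Z p \<le> g x + c"
        using that(1)[of p] that(2) by (cases "g x + U p - p \<bullet> x < t * W p") (auto simp: Z_def inner_commute)
    qed
    have outK: "v x \<le> g x" if "x \<notin> K" for x
    proof -
      have "t * W p \<le> 0" if "g x + U p - p \<bullet> x < t * W p" for p
      proof (cases "norm (p - \<xi>) < r / 2")
        case True
        then have "norm (p - \<xi>) \<le> r" using r by simp
        moreover have "g x + lconj g p - p \<bullet> x \<le> \<eta>" using that tW(3)[of p] by simp
        ultimately show ?thesis using caps \<open>x \<notin> K\<close> by blast
      next
        case False
        then show ?thesis using Wz[of p] by simp
      qed
      then show ?thesis using v_le[of x 0] by simp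
    qed
    \<comment> \<open>At a point of \<open>K\<close> such slopes are within \<open>d\<close> of the
      subgradient \<open>q\<close>, so their \<open>W\<close> exceeds \<open>W q\<close> by at most
      \<open>\<epsilon>\<close>.\<close>
    have inK: "v x \<le> g x + t * (W q + \<epsilon>)" "r \<le> norm (q - \<xi>) \<Longrightarrow> v x \<le> g x" if x: "x \<in> K" "subgrad g x q" for x q
    proof -
      have close: "norm (p - q) < d" if "g x + U p - p \<bullet> x < t * W p" for p
        by (rule \<theta>(2)[OF x(1) _ x(2)]) (use that tW(2)[of p] t1(2) in simp)
      show "v x \<le> g x + t * (W q + \<epsilon>)"
        by (rule v_le) (use close Wd t W0 \<epsilon> in \<open>auto intro!: mult_left_mono add_nonneg_nonneg mult_nonneg_nonneg\<close>)
      assume far: "r \<le> norm (q - \<xi>)"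
      have "t * W p \<le> 0" if "g x + U p - p \<bullet> x < t * W p" for p
        using Wq[OF close[OF that]] far by (cases "W p = 0") auto
      then show "v x \<le> g x" using v_le[of x 0] by simp
    qed
    have gv: "g x \<le> v x" for x
      using lconj_mono_bound[OF cZ, of 0 U x] tW(1) U(3) by (simp add: Z_def v_def)
    have cv: "coercive v" by (rule coercive_mono[OF g(2), where c=0]) (use gv in simp)
    \<comment> \<open>The biconjugate of \<open>Z\<close>, hence its convex envelope.\<close>
    define A where "A = lconj v"
    have AZ: "A p \<le> U p - t * W p" for p
      unfolding A_def
    proof (rule lconj_le)
      fix x show "p \<bullet> x - v x \<le> U p - t * W p"
        using lconj_ge[OF cZ, of x p] by (simp add: v_def Z_def inner_commute)
    qed
    have Alow: "U p - t * W p - t * \<epsilon> \<le> A p \<and> (r \<le> norm (p - \<xi>) \<longrightarrow> U p \<le> A p)" for p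
    proof -
      obtain x where x: "g x + U p = p \<bullet> x" using lconj_attained[OF g] .
      then have s: "subgrad g x p" using subgrad_iff_lconj[OF g(2)] by simp
      have A: "p \<bullet> x - v x \<le> A p" unfolding A_def by (rule lconj_ge[OF cv])
      show ?thesis
      proof (cases "x \<in> K")
        case False
        have "t * \<epsilon> \<ge> 0" using t \<epsilon> by simp
        then show ?thesis using outK[OF False] A x tW(1)[of p] by linarith
      next
        case True
        have "U p - t * W p - t * \<epsilon> \<le> A p" using inK(1)[OF True s] A x by (simp add: algebra_simps)
        moreover have "U p \<le> A p" if "r \<le> norm (p - \<xi>)" using inK(2)[OF True s that] A x by simp
        ultimately show ?thesis by simp
      qed
    qed
    have "adm A"
      unfolding adm_def
    proof (intro conjI allI impI)
      show "convex_on UNIV A" unfolding A_def by (rule convex_lconj[OF cv])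
      fix p
      show "A p = U p" if "r \<le> norm (p - \<xi>)" using AZ[of p] Alow[of p] Wz[of p] that r by auto
      have "t * W p + t * \<epsilon> \<le> \<eta>" using tW(2)[of p] t1(3) by (simp add: algebra_simps)
      then show "\<bar>A p - U p\<bar> \<le> \<eta>" using AZ[of p] Alow[of p] tW(1)[of p] \<eta> by (simp add: abs_le_iff)
    qed
    then show "\<exists>A. adm A \<and> (\<forall>p. A p \<le> U p - t * (B p - U p)) \<and> (\<forall>p. U p - t * (B p - U p) - t * \<epsilon> \<le> A p)"
      using AZ Alow unfolding W_def by blast
  qed
qed

text \<open>With \<open>q\<close> the energy along \<open>U + t * (B - U)\<close>, the left side is
  \<open>q' 0 / 2\<close>. Let \<open>A\<close> be the convexified \<open>U - t * W\<close>. A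
  suitable point \<open>Y\<close> between \<open>(U + A) / 2\<close> and \<open>V1\<close> lies
  below \<open>U\<close> by at most \<open>t * \<epsilon>\<close>, so
  \<open>\<Phi>_cut_bound\<close> limits its energy. Expanding that energy by
  \<open>\<Phi>_quadratic\<close>, using minimality at \<open>(U + A) / 2\<close> and dividing by
  the parameter of \<open>Y\<close> yields the claim in the limit.\<close>

lemma first_variation:
  assumes f: "continuous_on UNIV f"
    and taylor: "\<And>L. \<exists>M\<ge>0. \<forall>p q. norm p \<le> L \<longrightarrow> norm q \<le> L \<longrightarrow> f p + f' p \<bullet> (q - p) - M * ((q - p) \<bullet> (q - p)) \<le> f q"
    and min: "\<And>V. adm2 V \<Longrightarrow> \<Phi> f U \<le> \<Phi> f V"
    and B: "adm B" and UB: "\<And>p. U p \<le> B p" and near: "\<And>p. r / 2 \<le> norm (p - \<xi>) \<Longrightarrow> B p = U p"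
    and V1: "adm2 V1" "\<And>p. V1 p = U p / 2 + B p / 2" and V2: "adm2 V2" "\<And>p. V2 p = (1 - 1/2) * U p + (1/2) * V1 p"
  shows "4 * \<Phi> f V2 - 3 * \<Phi> f U - \<Phi> f V1 \<le> 0"
proof -
  define W where "W = (\<lambda>p. B p - U p)"
  have W0: "W p \<ge> 0" for p using UB[of p] by (simp add: W_def)
  have W\<eta>: "W p \<le> \<eta>" for p
  proof -
    have "\<bar>B p - U p\<bar> \<le> \<eta>" using B by (simp add: adm_def)
    then show ?thesis by (simp add: W_def)
  qed
  obtain C where C: "C \<ge> 0" "\<And>B s. adm2 B \<Longrightarrow> (\<And>p. B p \<le> U p) \<Longrightarrow> (\<And>p. U p - s \<le> B p) \<Longrightarrow> \<Phi> f B \<le> \<Phi> f U + C * s"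
    using \<Phi>_cut_bound[OF f taylor] by blast
  define \<epsilon> where "\<epsilon> = (\<lambda>j. 1 / real (Suc j))"
  have \<epsilon>: "\<epsilon> j > 0" "\<epsilon> j \<le> 1" for j by (auto simp: \<epsilon>_def)
  have \<epsilon>0: "\<epsilon> \<longlonglongrightarrow> 0" unfolding \<epsilon>_def by (rule LIMSEQ_Suc[OF lim_const_over_n])
  have "\<exists>t A. 0 < t \<and> t \<le> \<epsilon> j \<and> adm A \<and> (\<forall>p. A p \<le> U p - t * W p) \<and> (\<forall>p. U p - t * W p - t * \<epsilon> j \<le> A p)" for j
  proof -
    obtain t0 where t0: "t0 > 0" "\<And>t. 0 < t \<Longrightarrow> t \<le> t0 \<Longrightarrow>
      \<exists>A. adm A \<and> (\<forall>p. A p \<le> U p - t * (B p - U p)) \<and> (\<forall>p. U p - t * (B p - U p) - t * \<epsilon> j \<le> A p)"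
      using convexified_decrease[OF B UB near \<epsilon>(1)] by blast
    have "0 < min t0 (\<epsilon> j)" "min t0 (\<epsilon> j) \<le> t0" "min t0 (\<epsilon> j) \<le> \<epsilon> j" using t0(1) \<epsilon>(1)[of j] by auto
    then show ?thesis using t0(2) unfolding W_def by blast
  qed
  then obtain t A where tA: "\<And>j. 0 < t j" "\<And>j. t j \<le> \<epsilon> j" "\<And>j. adm (A j)" "\<And>j p. A j p \<le> U p - t j * W p"
    "\<And>j p. U p - t j * W p - t j * \<epsilon> j \<le> A j p" by metis
  define X where "X = (\<lambda>j p. U p / 2 + A j p / 2)"
  define M where "M = (\<lambda>j p. (1 - 1/2) * X j p + (1/2) * V1 p)"
  \<comment> \<open>The solution of \<open>(1 - \<mu>) * t = \<mu>\<close>: the decrease by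
    \<open>t * W\<close> on one side and the increase by \<open>W\<close> on the other then cancel
    in \<open>Y\<close>.\<close>
  define \<mu> where "\<mu> = (\<lambda>j. t j / (1 + t j))"
  define Y where "Y = (\<lambda>j p. (1 - \<mu> j) * X j p + \<mu> j * V1 p)"
  have t1: "t j \<le> 1" for j using tA(2)[of j] \<epsilon>(2)[of j] by linarith
  have \<mu>: "0 < \<mu> j" "\<mu> j \<le> t j" "\<mu> j \<le> 1" "t j \<le> 2 * \<mu> j" "(1 - \<mu> j) * t j = \<mu> j" for j
  proof -
    have p: "0 < 1 + t j" using tA(1)[of j] by linarith
    show "0 < \<mu> j" "\<mu> j \<le> 1" using tA(1)[of j] by (auto simp: \<mu>_def)
    show eq: "(1 - \<mu> j) * t j = \<mu> j" using p by (simp add: \<mu>_def field_simps)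
    show "\<mu> j \<le> t j" "t j \<le> 2 * \<mu> j" using p tA(1)[of j] t1[of j] by (auto simp: \<mu>_def field_simps)
  qed
  have t0: "t \<longlonglongrightarrow> 0"
    by (rule Lim_null_comparison[OF _ \<epsilon>0]) (use tA(1,2) in \<open>auto simp: abs_of_pos\<close>)
  have \<mu>0: "\<mu> \<longlonglongrightarrow> 0"
    by (rule Lim_null_comparison[OF _ t0]) (use \<mu>(1,2) in \<open>auto simp: abs_of_pos\<close>)
  have X: "adm2 (X j)" for j unfolding X_def by (rule adm2_half[OF tA(3)])
  have M: "adm2 (M j)" for j using adm2_combination[OF X V1(1), of "1/2"] unfolding M_def by simp
  have Y: "adm2 (Y j)" for j
    unfolding Y_def by (rule adm2_combination[OF X V1(1)]) (use \<mu>(1,3)[of j] in auto)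
  have XU: "\<bar>X j p - U p\<bar> \<le> t j * (\<eta> + 1)" for j p
  proof -
    have "0 \<le> t j * W p" "t j * W p \<le> t j * \<eta>" "t j * \<epsilon> j \<le> t j * 1" "0 \<le> t j * \<epsilon> j"
      using tA(1)[of j] W0 W\<eta> \<epsilon> less_imp_le by (auto intro: mult_left_mono simp: less_imp_le)
    then show ?thesis using tA(4)[of j p] tA(5)[of p j] \<eta> by (simp add: X_def abs_le_iff algebra_simps)
  qed
  have lim0: "(\<lambda>j. t j * (\<eta> + 1)) \<longlonglongrightarrow> 0" using tendsto_mult_right_zero[OF t0] tendsto_mult[OF t0 tendsto_const, of "\<eta> + 1"] by simp
  have limX: "(\<lambda>j. \<Phi> f (X j)) \<longlonglongrightarrow> \<Phi> f U"
    by (rule \<Phi>_tendsto_uniform[OF f adm2_adm[OF X] adm_U(2) XU lim0])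
  have limM: "(\<lambda>j. \<Phi> f (M j)) \<longlonglongrightarrow> \<Phi> f V2"
  proof (rule \<Phi>_tendsto_uniform[OF f adm2_adm[OF M] V2(1) _ lim0])
    fix j p
    show "\<bar>M j p - V2 p\<bar> \<le> t j * (\<eta> + 1)" using XU[of j p] by (simp add: M_def V2(2) abs_le_iff)
  qed
  have ineq: "(2 * \<mu> j - 3) * \<Phi> f (X j) + 4 * (1 - \<mu> j) * \<Phi> f (M j) + (2 * \<mu> j - 1) * \<Phi> f V1 \<le> 2 * C * \<epsilon> j" for j
  proof -
    have YU: "Y j p \<le> U p" "U p - t j * \<epsilon> j \<le> Y j p" for p
    proof -
      have "Y j p = U p + (1 - \<mu> j) * (A j p - U p) / 2 + \<mu> j * W p / 2"
        by (simp add: Y_def X_def V1(2) W_def field_simps)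
      moreover have "(1 - \<mu> j) * (A j p - U p) \<le> (1 - \<mu> j) * (- (t j * W p))"
        using tA(4)[of j p] \<mu>(3)[of j] by (intro mult_left_mono) auto
      moreover have "(1 - \<mu> j) * (- (t j * W p) - t j * \<epsilon> j) \<le> (1 - \<mu> j) * (A j p - U p)"
        using tA(5)[of p j] \<mu>(3)[of j] by (intro mult_left_mono) auto
      moreover have "(1 - \<mu> j) * (- (t j * W p)) = - (\<mu> j * W p)"
        using \<mu>(5)[of j] by (metis mult.assoc mult_minus_right)
      moreover have "(1 - \<mu> j) * (- (t j * W p) - t j * \<epsilon> j) = - (\<mu> j * W p) - \<mu> j * \<epsilon> j"
      proof -
        have "(1 - \<mu> j) * (- (t j * W p) - t j * \<epsilon> j) = - (((1 - \<mu> j) * t j) * W p) - ((1 - \<mu> j) * t j) * \<epsilon> j"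
          by (simp add: algebra_simps)
        then show ?thesis unfolding \<mu>(5) .
      qed
      moreover have "\<mu> j * \<epsilon> j \<le> t j * \<epsilon> j" "0 \<le> \<mu> j * \<epsilon> j"
        using \<mu>(1,2)[of j] \<epsilon>(1)[of j] by (auto intro: mult_right_mono)
      ultimately show "Y j p \<le> U p" "U p - t j * \<epsilon> j \<le> Y j p" by linarith+
    qed
    have "\<Phi> f (Y j) \<le> \<Phi> f U + C * (t j * \<epsilon> j)" by (rule C(2)[OF Y YU])
    moreover have "\<Phi> f (Y j) = (1 - \<mu> j) * (1 - 2 * \<mu> j) * \<Phi> f (X j) + 4 * \<mu> j * (1 - \<mu> j) * \<Phi> f (M j) + \<mu> j * (2 * \<mu> j - 1) * \<Phi> f V1"
      unfolding Y_def M_def by (rule \<Phi>_quadratic[OF f X V1(1)]) (use \<mu>[of j] in auto)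
    moreover have "\<Phi> f U \<le> \<Phi> f (X j)" by (rule min[OF X])
    \<comment> \<open>Beyond \<open>1\<close>, the interpolation coefficient of \<open>X\<close>
      carries a factor \<open>\<mu> j\<close>; the part with coefficient \<open>1\<close> is
      absorbed by minimality, and the rest can be divided by \<open>\<mu> j\<close>.\<close>
    moreover have "(1 - \<mu> j) * (1 - 2 * \<mu> j) * \<Phi> f (X j) = \<Phi> f (X j) + \<mu> j * ((2 * \<mu> j - 3) * \<Phi> f (X j))"
      by (simp add: algebra_simps)
    ultimately have "\<mu> j * ((2 * \<mu> j - 3) * \<Phi> f (X j)) + 4 * \<mu> j * (1 - \<mu> j) * \<Phi> f (M j) + \<mu> j * (2 * \<mu> j - 1) * \<Phi> f V1 \<le> C * (t j * \<epsilon> j)"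
      by linarith
    also have "\<dots> \<le> C * ((2 * \<mu> j) * \<epsilon> j)"
      using C(1) \<mu>(4)[of j] \<epsilon>(1)[of j] by (intro mult_left_mono mult_right_mono) auto
    finally have "\<mu> j * ((2 * \<mu> j - 3) * \<Phi> f (X j) + 4 * (1 - \<mu> j) * \<Phi> f (M j) + (2 * \<mu> j - 1) * \<Phi> f V1) \<le> \<mu> j * (2 * C * \<epsilon> j)"
      by (simp add: algebra_simps)
    then show ?thesis using \<mu>(1)[of j] by (simp only: mult_le_cancel_left_pos)
  qed
  have "(\<lambda>j. (2 * \<mu> j - 3) * \<Phi> f (X j) + 4 * (1 - \<mu> j) * \<Phi> f (M j) + (2 * \<mu> j - 1) * \<Phi> f V1)
      \<longlonglongrightarrow> (2 * 0 - 3) * \<Phi> f U + 4 * (1 - 0) * \<Phi> f V2 + (2 * 0 - 1) * \<Phi> f V1"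
    by (intro tendsto_add tendsto_mult tendsto_diff tendsto_const \<mu>0 limX limM)
  moreover have "(\<lambda>j. 2 * C * \<epsilon> j) \<longlonglongrightarrow> 2 * C * 0" by (intro tendsto_mult tendsto_const \<epsilon>0)
  ultimately have "(2 * 0 - 3) * \<Phi> f U + 4 * (1 - 0) * \<Phi> f V2 + (2 * 0 - 1) * \<Phi> f V1 \<le> 2 * C * 0"
    by (rule LIMSEQ_le) (use ineq in blast)
  then show ?thesis by simp
qed

end

lemma LBINT_neg:
  fixes \<phi> :: "real \<Rightarrow> real"
  assumes c: "continuous_on {a..b} \<phi>" and le: "\<And>s. s \<in> {a..b} \<Longrightarrow> \<phi> s \<le> 0" and s0: "s0 \<in> {a..b}" "\<phi> s0 < 0" and ab: "a < b"
  shows "(LBINT s:{a..b}. \<phi> s) < 0"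
proof -
  have i: "set_integrable lborel {a..b} \<phi>" by (rule borel_integrable_atLeastAtMost'[OF c])
  have ic: "(\<lambda>s. 0::real) integrable_on {a..b}" "\<phi> integrable_on {a..b}" using c by (auto intro: integrable_continuous_real)
  have "(LBINT s:{a..b}. \<phi> s) = integral {a..b} \<phi>" using set_borel_integral_eq_integral(2)[OF i] .
  also have "\<dots> < integral {a..b} (\<lambda>s. 0)"
  proof -
    have "integral {a..b} (\<lambda>s. - \<phi> s) \<noteq> 0"
      using integral_eq_0_iff[of a b "\<lambda>s. - \<phi> s"] c le ab s0 by (force intro: continuous_on_minus)
    moreover have "integral {a..b} \<phi> \<le> integral {a..b} (\<lambda>s. 0)" using ic le by (intro integral_le) auto
    ultimately show ?thesis by (simp add: integral_neg)
  qed
  finally show ?thesis by simp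
qed

context crease
begin

text \<open>The combination in \<open>crease_identity\<close> equals \<open>8 * (\<Phi> f V1 -
  \<Phi> f U) - 6 * (4 * \<Phi> f V2 - 3 * \<Phi> f U - \<Phi> f V1)\<close>. Minimality and
  \<open>first_variation\<close> make it nonnegative, whereas the crease gives a negative
  value.\<close>

lemma crease_contradiction:
  assumes f: "continuous_on UNIV f"
    and taylor: "\<And>L. \<exists>M\<ge>0. \<forall>p q. norm p \<le> L \<longrightarrow> norm q \<le> L \<longrightarrow> f p + f' p \<bullet> (q - p) - M * ((q - p) \<bullet> (q - p)) \<le> f q"
    and min: "\<And>V. adm2 V \<Longrightarrow> \<Phi> f U \<le> \<Phi> f V"
    and near: "\<And>p. r / 2 \<le> norm (p - \<xi>) \<Longrightarrow> B p = U p" and pos: "B \<xi> > U \<xi>" "j > 0"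
    and h: "\<And>x. (h has_real_derivative h' x) (at x)" "\<And>x. (h' has_real_derivative h'' x) (at x)"
      "continuous_on UNIV h''" and hf: "\<And>\<tau>. f (\<tau> *\<^sub>R e + \<xi>) = h \<tau>"
    and neg: "\<And>\<tau>. \<bar>\<tau>\<bar> \<le> r \<Longrightarrow> h'' \<tau> < 0"
  shows False
proof -
  obtain L where L: "L > 0" "\<And>s. s \<notin> {-L<..<L} \<Longrightarrow> Bl s = Ul s" using line_conj_outside by blast
  have UB: "U p \<le> B p" for p by (simp add: B_def)
  have fv: "4 * \<Phi> f V2 - 3 * \<Phi> f U - \<Phi> f V1 \<le> 0"
    by (rule first_variation[OF f taylor min adm_B UB near adm2_V(1) _ adm2_V(2)]) (auto simp: V1_def V2_def)
  have "(LBINT \<tau>:{-r..r}. h'' \<tau> * (B (\<tau> *\<^sub>R e + \<xi>) - U (\<tau> *\<^sub>R e + \<xi>))) < 0"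
  proof (rule LBINT_neg[where ?s0.0=0])
    show "continuous_on {-r..r} (\<lambda>\<tau>. h'' \<tau> * (B (\<tau> *\<^sub>R e + \<xi>) - U (\<tau> *\<^sub>R e + \<xi>)))"
      by (intro continuous_on_mult continuous_on_diff continuous_on_subset[OF h(3)] convex_continuous line) simp
    show "h'' s * (B (s *\<^sub>R e + \<xi>) - U (s *\<^sub>R e + \<xi>)) \<le> 0" if "s \<in> {-r..r}" for s
      using neg[of s] UB[of "s *\<^sub>R e + \<xi>"] that by (intro mult_nonpos_nonneg) (auto simp: abs_le_iff)
    show "h'' 0 * (B (0 *\<^sub>R e + \<xi>) - U (0 *\<^sub>R e + \<xi>)) < 0" using neg[of 0] pos(1) r by (simp add: mult_neg_pos)
  qed (use r in auto)
  then have "line_energy L f < 0" using line_energy_smooth(1)[OF L h hf] by simp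
  then have "j * line_energy L f < 0" using pos(2) by (simp add: mult_pos_neg)
  then have "14 * \<Phi> f V1 - 24 * \<Phi> f V2 + 10 * \<Phi> f U < 0" using crease_identity[OF L f] by simp
  then show False using fv min[OF adm2_V(1)] by linarith
qed

end

section \<open>Integrands of class \<open>C\<^sup>2\<close>\<close>

lemma gderiv_grad:
  fixes h :: "'a::euclidean_space \<Rightarrow> real"
  assumes "GDERIV h x :> D" shows "grad h x = D"
  unfolding grad_def
proof (rule the_equality)
  show "GDERIV h x :> D" by (rule assms)
  fix E assume "GDERIV h x :> E"
  then have "(\<lambda>y. y \<bullet> E) = (\<lambda>y. y \<bullet> D)" using assms unfolding gderiv_def by (rule has_derivative_unique)
  then have "(E - D) \<bullet> E = (E - D) \<bullet> D" by meson
  then have "(E - D) \<bullet> (E - D) = 0" by (simp add: inner_diff_right)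
  then show "E = D" by simp
qed

lemma differentiable_gderiv:
  fixes h :: "'a::euclidean_space \<Rightarrow> real"
  assumes "h differentiable (at x)" shows "GDERIV h x :> grad h x"
proof -
  obtain D where D: "(h has_derivative D) (at x)" using assms unfolding differentiable_def by blast
  have "linear D" using D has_derivative_bounded_linear bounded_linear.linear by blast
  then have "D y = y \<bullet> adjoint D 1" for y using adjoint_works[of D y 1] by simp
  then have "GDERIV h x :> adjoint D 1" using D unfolding gderiv_def by (metis (no_types, lifting) ext)
  then show ?thesis using gderiv_grad by metis
qed

lemma C2D:
  fixes f :: "real^'n \<Rightarrow> real"
  assumes "C2 f"
  shows "GDERIV f x :> grad f x" "(grad f has_derivative (\<lambda>v. hessian f x *v v)) (at x)" "continuous_on UNIV (hessian f)"
    "continuous_on UNIV f" "continuous_on UNIV (grad f)"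
proof -
  show "GDERIV f x :> grad f x" by (rule differentiable_gderiv) (use assms in \<open>simp add: C2_def\<close>)
  show "(grad f has_derivative (\<lambda>v. hessian f x *v v)) (at x)"
    using assms unfolding C2_def hessian_def by (simp add: jacobian_works[symmetric])
  show "continuous_on UNIV (hessian f)" using assms by (simp add: C2_def)
  show "continuous_on UNIV f" "continuous_on UNIV (grad f)"
    using assms unfolding C2_def by (auto simp: continuous_on_eq_continuous_at intro: differentiable_imp_continuous_within)
qed

lemma has_derivative_line: "((\<lambda>t::real. x + t *\<^sub>R d) has_derivative (\<lambda>h. h *\<^sub>R d)) (at t)"
  by (auto intro!: derivative_eq_intros)

lemma gderiv_line:
  fixes f :: "'a::euclidean_space \<Rightarrow> real"
  assumes "GDERIV f (x + t *\<^sub>R d) :> D"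
  shows "((\<lambda>t. f (x + t *\<^sub>R d)) has_real_derivative D \<bullet> d) (at t)"
proof -
  have "(f has_derivative (\<lambda>h. h \<bullet> D)) (at (x + t *\<^sub>R d))" using assms by (simp only: gderiv_def)
  then have "((\<lambda>t. f (x + t *\<^sub>R d)) has_derivative (\<lambda>h. (h *\<^sub>R d) \<bullet> D)) (at t)"
    by (rule has_derivative_compose[OF has_derivative_line])
  moreover have "(\<lambda>h. (h *\<^sub>R d) \<bullet> D) = (*) (D \<bullet> d)" by (simp add: fun_eq_iff inner_commute)
  ultimately show ?thesis unfolding has_field_derivative_def by (simp only:)
qed

lemma hessian_line:
  fixes f :: "real^'n \<Rightarrow> real"
  assumes "C2 f"
  shows "((\<lambda>t. grad f (x + t *\<^sub>R d) \<bullet> e) has_real_derivative (hessian f (x + t *\<^sub>R d) *v d) \<bullet> e) (at t)"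
proof -
  have "((\<lambda>t. grad f (x + t *\<^sub>R d)) has_derivative (\<lambda>h. hessian f (x + t *\<^sub>R d) *v (h *\<^sub>R d))) (at t)"
    by (rule has_derivative_compose[OF has_derivative_line C2D(2)[OF assms]])
  then have "((\<lambda>t. grad f (x + t *\<^sub>R d) \<bullet> e) has_derivative (\<lambda>h. (hessian f (x + t *\<^sub>R d) *v (h *\<^sub>R d)) \<bullet> e)) (at t)"
    by (rule has_derivative_inner_left)
  moreover have "(\<lambda>h. (hessian f (x + t *\<^sub>R d) *v (h *\<^sub>R d)) \<bullet> e) = (*) ((hessian f (x + t *\<^sub>R d) *v d) \<bullet> e)"
    by (simp add: fun_eq_iff matrix_vector_mult_scaleR)
  ultimately show ?thesis unfolding has_field_derivative_def by (simp only:)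
qed

text \<open>Schwarz's theorem: both sides are the limit of the second difference quotient of \<open>f\<close>.\<close>

lemma second_difference:
  fixes f :: "real^'n \<Rightarrow> real"
  assumes f: "C2 f" and e: "\<epsilon> > 0"
  obtains \<delta> where "\<delta> > 0" "\<And>t. 0 < t \<Longrightarrow> t < \<delta> \<Longrightarrow>
    \<bar>f (x + t *\<^sub>R a + t *\<^sub>R b) - f (x + t *\<^sub>R a) - f (x + t *\<^sub>R b) + f x - t\<^sup>2 * ((hessian f x *v b) \<bullet> a)\<bar> \<le> \<epsilon> * t\<^sup>2"
proof -
  let ?H = "hessian f x"
  let ?N = "norm a + norm b + 1"
  have N: "?N > 0" by (simp add: add_nonneg_pos)
  have "\<forall>c>0. \<exists>d>0. \<forall>y. norm (y - x) < d \<longrightarrow> norm (grad f y - grad f x - ?H *v (y - x)) \<le> c * norm (y - x)"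
    using C2D(2)[OF f, of x] unfolding has_derivative_at_alt by blast
  moreover have "\<epsilon> / (2 * ?N\<^sup>2) > 0" using e N by simp
  ultimately have "\<exists>d>0. \<forall>y. norm (y - x) < d \<longrightarrow> norm (grad f y - grad f x - ?H *v (y - x)) \<le> \<epsilon> / (2 * ?N\<^sup>2) * norm (y - x)"
    by blast
  then obtain d where d: "d > 0" "\<And>y. norm (y - x) < d \<Longrightarrow>
      norm (grad f y - grad f x - ?H *v (y - x)) \<le> \<epsilon> / (2 * ?N\<^sup>2) * norm (y - x)"
    by blast
  show ?thesis
  proof (rule that[of "d / ?N"])
    show "0 < d / ?N" using d N by simp
    fix t assume t: "0 < t" "t < d / ?N"
    then have tN: "t * ?N < d" using N by (simp add: pos_less_divide_eq)
    \<comment> \<open>The increment in the direction \<open>b\<close>, as a function of the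
      displacement along \<open>a\<close>: one application of the mean value theorem reduces the
      second difference to the expansion of \<open>grad f\<close> at \<open>x\<close>.\<close>
    let ?\<phi> = "\<lambda>s. f ((x + t *\<^sub>R b) + s *\<^sub>R a) - f (x + s *\<^sub>R a)"
    let ?\<phi>' = "\<lambda>s. grad f ((x + t *\<^sub>R b) + s *\<^sub>R a) \<bullet> a - grad f (x + s *\<^sub>R a) \<bullet> a"
    have "\<exists>z>0. z < t \<and> ?\<phi> t - ?\<phi> 0 = (t - 0) * ?\<phi>' z"
      by (rule MVT2[OF t(1)]) (intro DERIV_diff gderiv_line C2D(1)[OF f])
    then obtain z where z: "0 < z" "z < t" "?\<phi> t - ?\<phi> 0 = t * ?\<phi>' z" by auto
    let ?y1 = "(x + t *\<^sub>R b) + z *\<^sub>R a" and ?y2 = "x + z *\<^sub>R a"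
    have n1: "norm (?y1 - x) \<le> t * ?N"
    proof -
      have "norm (?y1 - x) = norm (t *\<^sub>R b + z *\<^sub>R a)" by (simp add: algebra_simps)
      also have "\<dots> \<le> t * norm b + z * norm a" using norm_triangle_ineq[of "t *\<^sub>R b" "z *\<^sub>R a"] t z by simp
      also have "\<dots> \<le> t * norm b + t * norm a" using z by (intro add_left_mono mult_right_mono) auto
      also have "\<dots> \<le> t * ?N" using t by (simp add: algebra_simps)
      finally show ?thesis .
    qed
    have n2: "norm (?y2 - x) \<le> t * ?N"
    proof -
      have "norm (?y2 - x) = z * norm a" using z by simp
      also have "\<dots> \<le> t * norm a" using z by (intro mult_right_mono) auto
      also have "\<dots> \<le> t * ?N" using t by (simp add: algebra_simps)
      finally show ?thesis .
    qed
    let ?R = "\<lambda>y. grad f y - grad f x - ?H *v (y - x)"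
    have R: "norm (?R y) \<le> \<epsilon> / (2 * ?N\<^sup>2) * (t * ?N)" if "norm (y - x) \<le> t * ?N" for y
    proof -
      have "norm (?R y) \<le> \<epsilon> / (2 * ?N\<^sup>2) * norm (y - x)" using that tN by (intro d(2)) simp
      also have "\<dots> \<le> \<epsilon> / (2 * ?N\<^sup>2) * (t * ?N)" using that e N by (intro mult_left_mono) auto
      finally show ?thesis .
    qed
    have "?\<phi>' z = (?R ?y1 - ?R ?y2) \<bullet> a + t * ((?H *v b) \<bullet> a)"
    proof -
      have "(a - c - d) - (b - c - e) = a - b - (d - e)" for a b c d e :: "real^'n" by simp
      then have "?R ?y1 - ?R ?y2 = grad f ?y1 - grad f ?y2 - ?H *v ((?y1 - x) - (?y2 - x))"
        unfolding matrix_vector_mult_diff_distrib[of _ "?y1 - x" "?y2 - x"] by blast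
      also have "(?y1 - x) - (?y2 - x) = t *\<^sub>R b" by simp
      finally have eq: "?R ?y1 - ?R ?y2 = grad f ?y1 - grad f ?y2 - t *\<^sub>R (?H *v b)"
        by (simp only: matrix_vector_mult_scaleR)
      show ?thesis unfolding eq by (simp add: inner_diff_left)
    qed
    then have "\<bar>?\<phi>' z - t * ((?H *v b) \<bullet> a)\<bar> \<le> norm (?R ?y1 - ?R ?y2) * norm a"
      using Cauchy_Schwarz_ineq2[of "?R ?y1 - ?R ?y2" a] by simp
    also have "\<dots> \<le> (2 * (\<epsilon> / (2 * ?N\<^sup>2) * (t * ?N))) * ?N"
    proof (rule mult_mono)
      show "norm (?R ?y1 - ?R ?y2) \<le> 2 * (\<epsilon> / (2 * ?N\<^sup>2) * (t * ?N))"
        using norm_triangle_ineq4[of "?R ?y1" "?R ?y2"] R[OF n1] R[OF n2] by linarith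
    qed (use e t N in auto)
    also have "\<dots> = \<epsilon> * t"
    proof -
      have "\<And>n. n > 0 \<Longrightarrow> 2 * (\<epsilon> / (2 * n\<^sup>2) * (t * n)) * n = \<epsilon> * t" by (simp add: power2_eq_square)
      then show ?thesis using N by blast
    qed
    finally have b: "\<bar>?\<phi>' z - t * ((?H *v b) \<bullet> a)\<bar> \<le> \<epsilon> * t" .
    have "f (x + t *\<^sub>R a + t *\<^sub>R b) - f (x + t *\<^sub>R a) - f (x + t *\<^sub>R b) + f x - t\<^sup>2 * ((?H *v b) \<bullet> a)
        = t * (?\<phi>' z - t * ((?H *v b) \<bullet> a))"
    proof -
      have "f (x + t *\<^sub>R a + t *\<^sub>R b) - f (x + t *\<^sub>R a) - f (x + t *\<^sub>R b) + f x = ?\<phi> t - ?\<phi> 0"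
        by (simp add: add_ac)
      also have "\<dots> - t\<^sup>2 * ((?H *v b) \<bullet> a) = t * (?\<phi>' z - t * ((?H *v b) \<bullet> a))"
        unfolding z(3) power2_eq_square right_diff_distrib mult.assoc ..
      finally show ?thesis .
    qed
    then have "\<bar>f (x + t *\<^sub>R a + t *\<^sub>R b) - f (x + t *\<^sub>R a) - f (x + t *\<^sub>R b) + f x - t\<^sup>2 * ((?H *v b) \<bullet> a)\<bar>
        = t * \<bar>?\<phi>' z - t * ((?H *v b) \<bullet> a)\<bar>"
      using t by (simp only: abs_mult abs_of_pos)
    also have "\<dots> \<le> t * (\<epsilon> * t)" using b t by (intro mult_left_mono) auto
    finally show "\<bar>f (x + t *\<^sub>R a + t *\<^sub>R b) - f (x + t *\<^sub>R a) - f (x + t *\<^sub>R b) + f x - t\<^sup>2 * ((?H *v b) \<bullet> a)\<bar> \<le> \<epsilon> * t\<^sup>2"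
      by (simp add: power2_eq_square mult_ac)
  qed
qed

lemma hessian_symmetric:
  fixes f :: "real^'n \<Rightarrow> real"
  assumes f: "C2 f" shows "(hessian f x *v a) \<bullet> b = (hessian f x *v b) \<bullet> a"
proof -
  let ?A = "(hessian f x *v a) \<bullet> b" and ?B = "(hessian f x *v b) \<bullet> a"
  have "\<bar>?A - ?B\<bar> \<le> 0 + \<epsilon>" if "\<epsilon> > 0" for \<epsilon>
  proof -
    have e2: "\<epsilon> / 2 > 0" using that by simp
    obtain d1 where d1: "d1 > 0" "\<And>t. 0 < t \<Longrightarrow> t < d1 \<Longrightarrow>
      \<bar>f (x + t *\<^sub>R a + t *\<^sub>R b) - f (x + t *\<^sub>R a) - f (x + t *\<^sub>R b) + f x - t\<^sup>2 * ?B\<bar> \<le> \<epsilon> / 2 * t\<^sup>2"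
      using second_difference[OF f e2] by blast
    obtain d2 where d2: "d2 > 0" "\<And>t. 0 < t \<Longrightarrow> t < d2 \<Longrightarrow>
      \<bar>f (x + t *\<^sub>R b + t *\<^sub>R a) - f (x + t *\<^sub>R b) - f (x + t *\<^sub>R a) + f x - t\<^sup>2 * ?A\<bar> \<le> \<epsilon> / 2 * t\<^sup>2"
      using second_difference[OF f e2] by blast
    define t where "t = min d1 d2 / 2"
    have t: "0 < t" "t < d1" "t < d2" using d1 d2 by (auto simp: t_def)
    have eq: "x + t *\<^sub>R b + t *\<^sub>R a = x + t *\<^sub>R a + t *\<^sub>R b" by simp
    have "\<bar>t\<^sup>2 * ?A - t\<^sup>2 * ?B\<bar> \<le> \<epsilon> / 2 * t\<^sup>2 + \<epsilon> / 2 * t\<^sup>2"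
      using d1(2)[OF t(1,2)] d2(2)[OF t(1,3)] unfolding eq by linarith
    then have "t\<^sup>2 * \<bar>?A - ?B\<bar> \<le> t\<^sup>2 * \<epsilon>"
      by (simp add: right_diff_distrib[symmetric] abs_mult mult.commute)
    then show ?thesis using t(1) by simp
  qed
  then have "\<bar>?A - ?B\<bar> \<le> 0" by (rule field_le_epsilon)
  then show ?thesis by simp
qed

text \<open>Roots of the characteristic polynomial; finiteness is what makes the \<open>Min\<close>
  in \<open>smallest_eigenvalue\<close> meaningful.\<close>

lemma finite_eigenvalues:
  fixes A :: "real^2^2" shows "finite (eigenvalues A)"
proof -
  let ?p = "[: A$1$1 * A$2$2 - A$1$2 * A$2$1, - (A$1$1 + A$2$2), 1 :]"
  have "poly ?p l = 0" if l: "l \<in> eigenvalues A" for l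
  proof -
    obtain v where v: "v \<noteq> 0" "A *v v = l *\<^sub>R v" using l unfolding eigenvalues_def by blast
    have 1: "A$1$1 * v$1 + A$1$2 * v$2 = l * v$1" and 2: "A$2$1 * v$1 + A$2$2 * v$2 = l * v$2"
      using v(2) by (auto simp: vec_eq_iff matrix_vector_mult_def sum_2 forall_2)
    have "(l * l - (A$1$1 + A$2$2) * l + (A$1$1 * A$2$2 - A$1$2 * A$2$1)) * v$1 = 0"
      using 1 2 by algebra
    moreover have "(l * l - (A$1$1 + A$2$2) * l + (A$1$1 * A$2$2 - A$1$2 * A$2$1)) * v$2 = 0"
      using 1 2 by algebra
    moreover have "v$1 \<noteq> 0 \<or> v$2 \<noteq> 0" using v(1) by (auto simp: vec_eq_iff forall_2)
    ultimately have "l * l - (A$1$1 + A$2$2) * l + (A$1$1 * A$2$2 - A$1$2 * A$2$1) = 0" by auto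
    then show ?thesis by (simp add: algebra_simps)
  qed
  then have "eigenvalues A \<subseteq> {l. poly ?p l = 0}" by blast
  then show ?thesis by (rule finite_subset) (rule poly_roots_finite, simp)
qed

text \<open>A vector \<open>e\<close> on which a semidefinite form vanishes is orthogonal to
  everything for that form, so \<open>A *v e = 0\<close>, and the smallest eigenvalue would be
  zero.\<close>

lemma definite_cases:
  fixes A :: "real^2^2"
  assumes sym: "\<And>a b. (A *v a) \<bullet> b = (A *v b) \<bullet> a" and ne: "smallest_eigenvalue A \<noteq> 0"
  obtains (indefinite) e where "norm e = 1" "(A *v e) \<bullet> e < 0" | (definite) "\<And>e. e \<noteq> 0 \<Longrightarrow> (A *v e) \<bullet> e > 0"
proof (cases "\<exists>e. (A *v e) \<bullet> e < 0")
  case True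
  then obtain e where e: "(A *v e) \<bullet> e < 0" by blast
  then have "e \<noteq> 0" by auto
  then have "(A *v sgn e) \<bullet> sgn e < 0"
    using e by (simp add: sgn_div_norm matrix_vector_mult_scaleR mult_pos_neg)
  then show ?thesis using indefinite[of "sgn e"] \<open>e \<noteq> 0\<close> by (simp add: norm_sgn)
next
  case False
  then have psd: "(A *v e) \<bullet> e \<ge> 0" for e by (simp add: not_less)
  have "(A *v e) \<bullet> e > 0" if e: "e \<noteq> 0" for e
  proof (rule ccontr)
    assume "\<not> (A *v e) \<bullet> e > 0"
    then have z: "(A *v e) \<bullet> e = 0" using psd[of e] by simp
    have "(A *v e) \<bullet> b = 0" for b
    proof (rule ccontr)
      let ?c = "(A *v e) \<bullet> b" and ?d = "(A *v b) \<bullet> b"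
      assume c: "?c \<noteq> 0"
      have q: "0 \<le> 2 * t * ?c + t\<^sup>2 * ?d" for t
      proof -
        have "(A *v (e + t *\<^sub>R b)) \<bullet> (e + t *\<^sub>R b) = 2 * t * ?c + t\<^sup>2 * ?d"
          using z sym[of b e] by (simp add: matrix_vector_right_distrib matrix_vector_mult_scaleR inner_add_left inner_add_right power2_eq_square algebra_simps)
        then show ?thesis using psd[of "e + t *\<^sub>R b"] by simp
      qed
      have D: "?d \<ge> 0" by (rule psd)
      \<comment> \<open>Close to the minimiser \<open>- ?c / ?d\<close> of the quadratic; the
        summand \<open>1\<close> covers \<open>?d = 0\<close>.\<close>
      define t where "t = - ?c / (?d + 1)"
      have tn: "t * (?d + 1) = - ?c" using D by (simp add: t_def)
      have "0 \<le> 2 * t * ?c + t\<^sup>2 * ?d" by (rule q)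
      also have "\<dots> \<le> 2 * t * ?c + t\<^sup>2 * (?d + 1)" by (intro add_left_mono mult_left_mono) auto
      also have "t\<^sup>2 * (?d + 1) = - (t * ?c)" using tn by (metis mult.assoc mult_minus_right power2_eq_square)
      also have "2 * t * ?c + - (t * ?c) = - (?c\<^sup>2) / (?d + 1)" by (simp add: t_def power2_eq_square)
      also have "\<dots> < 0" using c D by (intro divide_neg_pos) auto
      finally show False by simp
    qed
    then have "(A *v e) \<bullet> (A *v e) = 0" .
    then have "A *v e = 0" by simp
    then have "0 \<in> eigenvalues A" using e by (auto simp: eigenvalues_def)
    moreover have "0 \<le> l" if l: "l \<in> eigenvalues A" for l
    proof -
      obtain v where v: "v \<noteq> 0" "A *v v = l *\<^sub>R v" using l unfolding eigenvalues_def by blast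
      have "0 \<le> l * (v \<bullet> v)" using psd[of v] v(2) by simp
      moreover have "v \<bullet> v > 0" using v(1) by simp
      ultimately show ?thesis by (simp add: zero_le_mult_iff)
    qed
    ultimately have "smallest_eigenvalue A = 0"
      unfolding smallest_eigenvalue_def by (intro Min_eqI finite_eigenvalues) auto
    then show False using ne by simp
  qed
  then show ?thesis by (rule definite)
qed

lemma continuous_hessian_form:
  fixes f :: "real^'n \<Rightarrow> real"
  assumes "C2 f" shows "continuous_on UNIV (\<lambda>p. (hessian f p *v a) \<bullet> b)"
proof -
  have "continuous_on UNIV (\<lambda>p. hessian f p $ i $ j)" for i j
    by (intro continuous_on_component C2D(3)[OF assms])
  then show ?thesis
    unfolding inner_vec_def matrix_vector_mult_def vec_lambda_beta inner_real_def
    by (intro continuous_on_sum continuous_on_mult continuous_on_const)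
qed

text \<open>The Hessian is bounded on the ball, hence the gradient is Lipschitz there. This supplies
  the quadratic lower bound \<open>taylor\<close> of the energy estimates.\<close>

lemma C2_semiconvex:
  fixes f :: "real^'n \<Rightarrow> real"
  assumes f: "C2 f"
  shows "\<exists>M\<ge>0. \<forall>p q. norm p \<le> L \<longrightarrow> norm q \<le> L \<longrightarrow> f p + grad f p \<bullet> (q - p) - M * ((q - p) \<bullet> (q - p)) \<le> f q"
proof -
  have "bounded (hessian f ` cball 0 L)"
    by (intro compact_imp_bounded compact_continuous_image continuous_on_subset[OF C2D(3)[OF f]]) auto
  then obtain b where b: "\<And>p. norm p \<le> L \<Longrightarrow> norm (hessian f p) \<le> b"
    unfolding bounded_iff by (metis imageI mem_cball_0)
  define M where "M = max 0 (real CARD('n) * real CARD('n) * b)"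
  have o: "onorm ((*v) (hessian f p)) \<le> M" if "norm p \<le> L" for p
  proof -
    have "\<bar>hessian f p $ i $ j\<bar> \<le> b" for i j
      using component_le_norm_cart[of "hessian f p $ i" j] Finite_Cartesian_Product.norm_nth_le[of "hessian f p" i] b[OF that] by linarith
    then have "onorm ((*v) (hessian f p)) \<le> real CARD('n) * real CARD('n) * b" by (rule onorm_le_matrix_component)
    then show ?thesis by (simp add: M_def)
  qed
  have lip: "norm (grad f q - grad f p) \<le> M * norm (q - p)" if "norm p \<le> L" "norm q \<le> L" for p q
  proof (rule differentiable_bound[of "cball 0 L" "grad f" "\<lambda>p. (*v) (hessian f p)"])
    show "(grad f has_derivative (*v) (hessian f x)) (at x within cball 0 L)" for x
      by (rule has_derivative_at_withinI) (rule C2D(2)[OF f])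
  qed (use o that in auto)
  have "f p + grad f p \<bullet> (q - p) - M * ((q - p) \<bullet> (q - p)) \<le> f q" if pq: "norm p \<le> L" "norm q \<le> L" for p q
  proof -
    let ?\<phi> = "\<lambda>t. f (p + t *\<^sub>R (q - p))"
    have "\<exists>z>0. z < 1 \<and> ?\<phi> 1 - ?\<phi> 0 = (1 - 0) * (grad f (p + z *\<^sub>R (q - p)) \<bullet> (q - p))"
      by (rule MVT2) (auto intro: gderiv_line C2D(1)[OF f])
    then obtain z where z: "0 < z" "z < 1" "f q - f p = grad f (p + z *\<^sub>R (q - p)) \<bullet> (q - p)" by auto
    let ?m = "p + z *\<^sub>R (q - p)"
    have "?m = (1 - z) *\<^sub>R p + z *\<^sub>R q" by (simp add: algebra_simps)
    then have "?m \<in> cball 0 L" using convexD_alt[OF convex_cball[of 0 L], of p q z] pq z by auto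
    then have "norm (grad f ?m - grad f p) \<le> M * norm (?m - p)" by (intro lip pq) auto
    also have "\<dots> \<le> M * norm (q - p)" using z by (intro mult_left_mono) (auto simp: M_def mult_left_le_one_le)
    finally have "norm (grad f ?m - grad f p) * norm (q - p) \<le> M * norm (q - p) * norm (q - p)"
      by (rule mult_right_mono) simp
    moreover have "\<bar>(grad f ?m - grad f p) \<bullet> (q - p)\<bar> \<le> norm (grad f ?m - grad f p) * norm (q - p)"
      by (rule Cauchy_Schwarz_ineq2)
    moreover have "M * norm (q - p) * norm (q - p) = M * ((q - p) \<bullet> (q - p))"
      by (metis mult.assoc power2_eq_square power2_norm_eq_inner)
    moreover have "(grad f ?m - grad f p) \<bullet> (q - p) = (f q - f p) - grad f p \<bullet> (q - p)"
      by (simp add: z(3) inner_diff_left)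
    ultimately show ?thesis by linarith
  qed
  then show ?thesis by (intro exI[of _ M]) (simp add: M_def)
qed

text \<open>Positivity at the single point \<open>\<xi>\<close> suffices: the linear approximation
  of \<open>grad f\<close> at \<open>\<xi>\<close> has error at most \<open>m / 2\<close> times the
  distance, where \<open>m\<close> is the minimum of the form on the unit sphere.\<close>

lemma strictly_above_tangent:
  fixes f :: "real^'n \<Rightarrow> real"
  assumes f: "C2 f" and pos: "\<And>e. e \<noteq> 0 \<Longrightarrow> (hessian f \<xi> *v e) \<bullet> e > 0"
  obtains d where "d > 0" "\<And>q. norm (q - \<xi>) < d \<Longrightarrow> q \<noteq> \<xi> \<Longrightarrow> f \<xi> + grad f \<xi> \<bullet> (q - \<xi>) < f q"
proof -
  let ?H = "hessian f \<xi>"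
  obtain m where m: "m > 0" "\<And>e. m * (e \<bullet> e) \<le> (?H *v e) \<bullet> e"
  proof -
    have c: "continuous_on (sphere 0 1) (\<lambda>e. (?H *v e) \<bullet> e)"
      by (intro continuous_intros linear_continuous_on matrix_vector_mul_bounded_linear)
    have "sphere (0::real^'n) 1 \<noteq> {}" by simp
    then obtain e0 where e0: "e0 \<in> sphere 0 1" "\<And>e. e \<in> sphere 0 1 \<Longrightarrow> (?H *v e0) \<bullet> e0 \<le> (?H *v e) \<bullet> e"
      using continuous_attains_inf[OF compact_sphere _ c] by blast
    show ?thesis
    proof (rule that[of "(?H *v e0) \<bullet> e0"])
      show "0 < (?H *v e0) \<bullet> e0" using e0(1) by (intro pos) auto
      fix e :: "real^'n"
      show "(?H *v e0) \<bullet> e0 * (e \<bullet> e) \<le> (?H *v e) \<bullet> e"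
      proof (cases "e = 0")
        case False
        have "(?H *v e0) \<bullet> e0 \<le> (?H *v sgn e) \<bullet> sgn e" using False by (intro e0(2)) (simp add: norm_sgn)
        also have "\<dots> = ((?H *v e) \<bullet> e) / (e \<bullet> e)"
          by (simp add: sgn_div_norm matrix_vector_mult_scaleR field_simps dot_square_norm power2_eq_square)
        finally show ?thesis using False by (simp add: pos_le_divide_eq)
      qed simp
    qed
  qed
  have "\<forall>c>0. \<exists>d>0. \<forall>y. norm (y - \<xi>) < d \<longrightarrow> norm (grad f y - grad f \<xi> - ?H *v (y - \<xi>)) \<le> c * norm (y - \<xi>)"
    using C2D(2)[OF f, of \<xi>] unfolding has_derivative_at_alt by blast
  moreover have "m / 2 > 0" using m(1) by simp
  ultimately have "\<exists>d>0. \<forall>y. norm (y - \<xi>) < d \<longrightarrow> norm (grad f y - grad f \<xi> - ?H *v (y - \<xi>)) \<le> m / 2 * norm (y - \<xi>)"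
    by blast
  then obtain d where d: "d > 0" "\<And>y. norm (y - \<xi>) < d \<Longrightarrow>
      norm (grad f y - grad f \<xi> - ?H *v (y - \<xi>)) \<le> m / 2 * norm (y - \<xi>)" by blast
  show ?thesis
  proof (rule that[OF d(1)])
    fix q assume q: "norm (q - \<xi>) < d" "q \<noteq> \<xi>"
    let ?v = "q - \<xi>"
    have "\<exists>z>0. z < 1 \<and> f (\<xi> + 1 *\<^sub>R ?v) - f (\<xi> + 0 *\<^sub>R ?v) = (1 - 0) * (grad f (\<xi> + z *\<^sub>R ?v) \<bullet> ?v)"
      by (rule MVT2) (auto intro: gderiv_line C2D(1)[OF f])
    then obtain z where z: "0 < z" "z < 1" "f q - f \<xi> = grad f (\<xi> + z *\<^sub>R ?v) \<bullet> ?v" by auto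
    let ?R = "grad f (\<xi> + z *\<^sub>R ?v) - grad f \<xi> - ?H *v (z *\<^sub>R ?v)"
    have "norm (z *\<^sub>R ?v) \<le> norm ?v" using z by (simp add: mult_left_le_one_le)
    then have "norm ?R \<le> m / 2 * norm (z *\<^sub>R ?v)" using d(2)[of "\<xi> + z *\<^sub>R ?v"] q(1) by simp
    then have "norm ?R * norm ?v \<le> m / 2 * norm (z *\<^sub>R ?v) * norm ?v" by (rule mult_right_mono) simp
    also have "\<dots> = z * (m / 2 * (?v \<bullet> ?v))" using z(1) by (simp add: dot_square_norm power2_eq_square)
    finally have "\<bar>?R \<bullet> ?v\<bar> \<le> z * (m / 2 * (?v \<bullet> ?v))"
      using Cauchy_Schwarz_ineq2[of ?R ?v] by linarith
    moreover have "?R \<bullet> ?v = (f q - f \<xi>) - grad f \<xi> \<bullet> ?v - z * ((?H *v ?v) \<bullet> ?v)"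
      by (simp add: z(3) inner_diff_left matrix_vector_mult_scaleR)
    moreover have "z * (m * (?v \<bullet> ?v)) \<le> z * ((?H *v ?v) \<bullet> ?v)" using m(2) z(1) by (intro mult_left_mono) auto
    moreover have "0 < z * (m / 2 * (?v \<bullet> ?v))" using z(1) m(1) q(2) by (intro mult_pos_pos) auto
    moreover have "z * (m * (?v \<bullet> ?v)) = z * (m / 2 * (?v \<bullet> ?v)) + z * (m / 2 * (?v \<bullet> ?v))" by (simp add: field_simps)
    ultimately show "f \<xi> + grad f \<xi> \<bullet> ?v < f q" by linarith
  qed
qed

section \<open>Minimality contradicts both signs of the Hessian\<close>

lemma gderiv_transform_open:
  assumes "GDERIV v x :> D" "open S" "x \<in> S" "\<And>y. y \<in> S \<Longrightarrow> v y = w y"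
  shows "GDERIV w x :> D"
  using assms has_derivative_transform_within_open[of v _ x UNIV S w] unfolding gderiv_def by simp

lemma open_AE_empty:
  fixes S :: "'a::euclidean_space set"
  assumes "open S" "AE x in lborel. x \<notin> S" shows "S = {}"
proof -
  have "S \<in> null_sets lborel" using assms by (subst AE_iff_null_sets) auto
  then have "negligible S" by (simp add: negligible_iff_null_sets null_sets_completionI)
  then show ?thesis using open_not_negligible[OF assms(1)] by blast
qed

context cap
begin

lemma adm2_gderiv:
  assumes "adm2 V" "x \<in> D" shows "GDERIV (lconj V) x :> rgrad (lconj V) x"
proof (rule gderiv_unique_subgrad[OF adm_lconj(1,2)[OF adm2_adm[OF assms(1)]] rd_rgrad(2)[OF assms]])
  show "q = rgrad (lconj V) x" if "subgrad (lconj V) x q" for q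
    by (rule adm2_uniq[OF assms that rd_rgrad(2)[OF assms]])
qed

text \<open>If \<open>f\<close> is strictly above its tangent plane at \<open>\<xi>\<close>, cutting \<open>g\<close> by a plane of slope \<open>\<xi>\<close> decreases
  the integral strictly by Jensen's inequality, unless the part cut off has constant gradient \<open>\<xi>\<close>.\<close>

lemma cut_contradiction:
  assumes f: "continuous_on UNIV f"
    and min: "\<And>V. adm V \<Longrightarrow> (AE x in lborel. x \<in> K \<longrightarrow> GDERIV (lconj V) x :> rgrad (lconj V) x) \<Longrightarrow> \<Phi> f U \<le> \<Phi> f V"
    and d: "d > 0" "\<And>q. norm (q - \<xi>) < d \<Longrightarrow> q \<noteq> \<xi> \<Longrightarrow> f \<xi> + a \<bullet> (q - \<xi>) < f q"
  shows False
proof -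
  have dr: "min d r > 0" using d r by simp
  obtain \<theta> where \<theta>: "\<theta> > 0"
    "\<And>x p q. x \<in> K \<Longrightarrow> g x + lconj g p - p \<bullet> x \<le> \<theta> \<Longrightarrow> subgrad g x q \<Longrightarrow> norm (p - q) < min d r"
  proof -
    have u: "p = q" if "x \<in> K" "subgrad g x p" "subgrad g x q" for x p q using uniq[of x p q] K that by blast
    show ?thesis by (rule eps_subgrad_modulus[OF g K(1) _ dr that]) (rule u)
  qed
  \<comment> \<open>The depth of the cut: at most \<open>\<eta>\<close> keeps it within
    \<open>K\<close> and the transform admissible, at most \<open>\<theta>\<close> keeps the
    gradients that are cut off within \<open>min d r\<close> of \<open>\<xi>\<close>.\<close>
  define s where "s = min \<eta> \<theta>"
  have s: "s > 0" "s \<le> \<eta>" "s \<le> \<theta>" using \<eta> \<theta> by (auto simp: s_def)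
  define c where "c = U \<xi> - s"
  define y where "y = (\<lambda>x. max (g x) (\<xi> \<bullet> x - c))"
  have gy: "g x \<le> y x" "y x \<le> g x + s" for x
    using lconj_ge[OF g(2), of \<xi> x] s(1) by (auto simp: y_def c_def)
  have cy: "convex_on UNIV y" unfolding y_def by (rule convex_max[OF g(1) convex_affine_inner])
  have coy: "coercive y" by (rule coercive_mono[OF g(2), where c=0]) (use gy in simp)
  define V where "V = lconj y"
  have yV: "lconj V = y" unfolding V_def by (rule lconj_lconj[OF cy coy])
  have VU: "V p \<le> U p" for p unfolding V_def using lconj_mono_bound[OF g(2), of 0 y p] gy(1) by simp
  have UV: "U p \<le> V p + s" for p
    unfolding V_def by (rule lconj_mono_bound[OF coy]) (use gy(2) in \<open>simp add: algebra_simps\<close>)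
  let ?S = "{x. g x < \<xi> \<bullet> x - c}"
  have SK: "x \<in> K" and SG: "subgrad g x q \<Longrightarrow> norm (\<xi> - q) < min d r" if "x \<in> ?S" for x q
  proof -
    have lt: "g x + U \<xi> - \<xi> \<bullet> x < s" using that by (simp add: c_def)
    show xK: "x \<in> K" by (rule caps[of \<xi>]) (use lt s r in auto)
    show "norm (\<xi> - q) < min d r" if "subgrad g x q" by (rule \<theta>(2)[OF xK _ that]) (use lt s in simp)
  qed
  have V: "adm V"
    unfolding adm_def
  proof (intro conjI allI impI)
    show "convex_on UNIV V" unfolding V_def by (rule convex_lconj[OF coy])
    fix p
    show "\<bar>V p - U p\<bar> \<le> \<eta>" using VU[of p] UV[of p] s(1,2) by (simp add: abs_le_iff)
    \<comment> \<open>A slope this far from \<open>\<xi>\<close> touches \<open>g\<close> outside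
      the cut, where \<open>y = g\<close>, so its conjugate value is preserved.\<close>
    assume far: "r \<le> norm (p - \<xi>)"
    obtain x where x: "g x + U p = p \<bullet> x" using lconj_attained[OF g] .
    then have "subgrad g x p" using subgrad_iff_lconj[OF g(2)] by simp
    then have "x \<notin> ?S" using SG[of x p] far by (auto simp: norm_minus_commute)
    then have "y x = g x" by (simp add: y_def)
    then have "U p \<le> V p" unfolding V_def using lconj_ge[OF coy, of p x] x by simp
    then show "V p = U p" using VU[of p] by simp
  qed
  have cut: "AE x in lborel. rgrad (lconj V) x = (if g x < \<xi> \<bullet> x - c then \<xi> else rgrad g x)"
  proof -
    have "lconj V = (\<lambda>x. max (lconj U x) (\<xi> \<bullet> x - c))" by (simp only: yV y_def U(3))
    from cut_gradient_AE[OF adm_U(1) V this] show ?thesis by (simp only: U(3))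
  qed
  have opS: "open ?S" using convex_continuous[OF g(1)] by (intro open_Collect_less continuous_intros) auto
  have neg: "convex_on UNIV (\<lambda>x. - (\<xi> \<bullet> x - c))"
    by (rule convex_onI) (auto simp: algebra_simps inner_add_right)
  have gU: "GDERIV g x :> rgrad g x" "subgrad g x (rgrad g x)" if "x \<in> K" for x
    using adm2_gderiv[OF adm_U(2), of x] rd_rgrad(2)[OF adm_U(2), of x] K(2) that U(3) by auto
  have "AE x in lborel. x \<notin> frontier ?S" by (intro AE_not_in frontier_null convex_below[OF g(1) neg])
  with cut have "AE x in lborel. x \<in> K \<longrightarrow> GDERIV (lconj V) x :> rgrad (lconj V) x"
  proof eventually_elim
    case (elim x)
    show ?case
    proof (cases "x \<in> ?S")
      case True
      have "((\<lambda>x. \<xi> \<bullet> x - c) has_derivative (\<lambda>h. h \<bullet> \<xi>)) (at x)"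
        by (auto intro!: derivative_eq_intros simp: inner_commute)
      then have "GDERIV (\<lambda>x. \<xi> \<bullet> x - c) x :> \<xi>" by (simp add: gderiv_def)
      then have "GDERIV (lconj V) x :> \<xi>"
        by (rule gderiv_transform_open[OF _ opS True]) (simp add: yV y_def)
      then show ?thesis using elim True by simp
    next
      case False
      then have x: "x \<in> - closure ?S" using elim opS by (simp add: frontier_def interior_open)
      have "GDERIV (lconj V) x :> rgrad g x" if "x \<in> K"
      proof (rule gderiv_transform_open[OF gU(1)[OF that] _ x])
        show "g z = lconj V z" if z: "z \<in> - closure ?S" for z
        proof -
          have "z \<notin> ?S" using z closure_subset[of ?S] by blast
          then show ?thesis by (simp add: yV y_def)
        qed
      qed auto
      then show ?thesis using elim False by simp
    qed
  qed
  then have UV: "\<Phi> f U \<le> \<Phi> f V" by (rule min[OF V])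
  let ?z = "\<lambda>q. f q + (- a) \<bullet> q"
  have cz: "continuous_on UNIV (\<lambda>q. (- a) \<bullet> q)" "continuous_on UNIV ?z" using f by (auto intro!: continuous_intros)
  note iz = \<Phi>_integrable[OF cz(2) adm_U(1)] \<Phi>_integrable[OF cz(2) V]
  have "\<Phi> ?z U \<le> \<Phi> ?z V"
    using UV \<Phi>_add[OF f cz(1) adm_U(1)] \<Phi>_add[OF f cz(1) V] \<Phi>_linear[OF adm_U(1) V, of "-a"] by simp
  then have le0: "(LBINT x:K. ?z (rgrad (lconj U) x) - ?z (rgrad (lconj V) x)) \<le> 0"
    unfolding set_integral_diff(2)[OF iz] \<Phi>_def by simp
  let ?h = "\<lambda>x. indicat_real K x * (?z (rgrad (lconj U) x) - ?z (rgrad (lconj V) x))"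
  have ih: "integrable lborel ?h" using set_integral_diff(1)[OF iz] by (simp add: set_integrable_def)
  have pos: "AE x in lborel. 0 \<le> ?h x"
    using cut
  proof eventually_elim
    case (elim x)
    show ?case
    proof (cases "x \<in> ?S")
      case True
      then have "norm (rgrad g x - \<xi>) < d" using SG[OF True gU(2)[OF SK[OF True]]] by (simp add: norm_minus_commute)
      then have "f \<xi> + a \<bullet> (rgrad g x - \<xi>) \<le> f (rgrad g x)" using d(2)[of "rgrad g x"] by (cases "rgrad g x = \<xi>") auto
      then show ?thesis using True elim U(3) by (simp add: inner_diff_right)
    next
      case False
      then show ?thesis using elim U(3) by simp
    qed
  qed
  have "(\<integral>x. ?h x \<partial>lborel) \<le> 0" using le0 by (simp add: set_lebesgue_integral_def)
  moreover have "(\<integral>x. ?h x \<partial>lborel) \<ge> 0" by (rule integral_nonneg_AE[OF pos])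
  ultimately have "AE x in lborel. ?h x = 0" using integral_nonneg_eq_0_iff_AE[OF ih pos] by simp
  \<comment> \<open>Equality in Jensen's inequality forces gradient \<open>\<xi>\<close> almost
    everywhere on \<open>?S\<close>, so \<open>g\<close> coincides there with its supporting affine
    function of slope \<open>\<xi>\<close>, first almost everywhere and then by openness everywhere.
    Thus \<open>?S\<close> is the contact set, which is closed and nonempty; being open too, it
    would be the whole plane, but it lies in \<open>K\<close>.\<close>
  let ?O = "?S \<inter> {x. g x \<noteq> \<xi> \<bullet> x - U \<xi>}"
  have "AE x in lborel. x \<notin> ?O"
    using \<open>AE x in lborel. ?h x = 0\<close> cut
  proof eventually_elim
    case (elim x)
    show ?case
    proof
      assume O: "x \<in> ?O"
      then have S: "x \<in> ?S" by simp
      have sg: "subgrad g x (rgrad g x)" by (rule gU(2)[OF SK[OF S]])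
      have n: "norm (rgrad g x - \<xi>) < d" using SG[OF S sg] by (simp add: norm_minus_commute)
      have "f (rgrad g x) - a \<bullet> rgrad g x = f \<xi> - a \<bullet> \<xi>" using elim S SK[OF S] U(3) by simp
      then have "rgrad g x = \<xi>" using d(2)[OF n] by (force simp: inner_diff_right)
      then have "g x + U \<xi> = \<xi> \<bullet> x" using sg subgrad_iff_lconj[OF g(2)] by simp
      then show False using O by simp
    qed
  qed
  moreover have "open ?O"
    using convex_continuous[OF g(1)] by (intro open_Int opS open_Collect_neq continuous_intros) auto
  ultimately have "?O = {}" by (intro open_AE_empty)
  then have S: "?S = {x. g x = \<xi> \<bullet> x - U \<xi>}" using s(1) by (auto simp: c_def)
  have "closed {x. g x = \<xi> \<bullet> x - U \<xi>}"
    using convex_continuous[OF g(1)] by (intro closed_Collect_eq continuous_intros) auto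
  then have "?S = {} \<or> ?S = UNIV" using opS S clopen by metis
  moreover obtain x where "g x + U \<xi> = \<xi> \<bullet> x" using lconj_attained[OF g] .
  then have "x \<in> ?S" unfolding S by simp
  ultimately have "?S = UNIV" by blast
  then have "UNIV \<subseteq> K" using SK by blast
  then show False using compact_imp_bounded[OF K(1)] not_bounded_UNIV by (metis top.extremum_uniqueI)
qed

text \<open>A tent that exceeds \<open>U\<close> at \<open>\<xi>\<close> but not beyond distance
  \<open>r / 2\<close>. Let \<open>x0\<close> be a contact point of slope \<open>\<xi>\<close>. By
  uniqueness of subgradients \<open>U\<close> lies strictly above its affine minorant of gradient
  \<open>x0\<close> except at \<open>\<xi>\<close>: by at least \<open>c\<close> on the sphere of
  radius \<open>r / 2\<close>, and beyond it at least linearly by convexity. The tent is built on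
  this minorant.\<close>

lemma indefinite_contradiction:
  assumes f: "C2 f"
    and min: "\<And>V. adm V \<Longrightarrow> (AE x in lborel. x \<in> K \<longrightarrow> GDERIV (lconj V) x :> rgrad (lconj V) x) \<Longrightarrow> \<Phi> f U \<le> \<Phi> f V"
    and e: "norm e = 1" and neg: "\<And>p. norm (p - \<xi>) \<le> r \<Longrightarrow> (hessian f p *v e) \<bullet> e < 0"
  shows False
proof -
  obtain x0 where x0: "g x0 + U \<xi> = \<xi> \<bullet> x0" using lconj_attained[OF g] .
  have x0K: "x0 \<in> K" by (rule caps[of \<xi>]) (use x0 r \<eta> in auto)
  let ?D = "\<lambda>p. U p - (x0 \<bullet> p - g x0)"
  have D0: "?D \<xi> = 0" using x0 by (simp add: inner_commute)
  have cD: "convex_on UNIV ?D"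
  proof -
    have "convex_on UNIV (\<lambda>p. - (x0 \<bullet> p - g x0))" by (rule convex_onI) (auto simp: algebra_simps inner_add_right)
    from convex_on_add[OF U(1) this] show ?thesis by (simp only: diff_conv_add_uminus)
  qed
  obtain c where c: "c > 0" "\<And>p. norm (p - \<xi>) = r / 2 \<Longrightarrow> c \<le> ?D p"
  proof -
    have "sphere \<xi> (r / 2) \<noteq> {}" using r by simp
    from continuous_attains_inf[OF compact_sphere this convex_continuous[OF cD]]
    obtain p1 where p1: "p1 \<in> sphere \<xi> (r / 2)" "\<And>p. p \<in> sphere \<xi> (r / 2) \<Longrightarrow> ?D p1 \<le> ?D p" by blast
    have ge: "?D p1 \<ge> 0" using lconj_ge[OF g(2), of p1 x0] by (simp add: inner_commute)
    have "?D p1 \<noteq> 0"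
    proof
      assume "?D p1 = 0"
      then have "subgrad g x0 p1" using subgrad_iff_lconj[OF g(2)] by (simp add: inner_commute)
      moreover have "subgrad g x0 \<xi>" using x0 subgrad_iff_lconj[OF g(2)] by simp
      ultimately have "p1 = \<xi>" using uniq[of x0 p1 \<xi>] x0K K(2) by blast
      then show False using p1(1) r by simp
    qed
    then show ?thesis using ge p1(2) by (intro that[of "?D p1"]) (auto simp: dist_norm norm_minus_commute)
  qed
  have far: "c * norm (p - \<xi>) \<le> (r / 2) * ?D p" if p: "r / 2 \<le> norm (p - \<xi>)" for p
  proof -
    let ?n = "norm (p - \<xi>)"
    have n: "?n > 0" using p r by linarith
    let ?t = "(r / 2) / ?n"
    have t: "0 \<le> ?t" "?t \<le> 1" using p r n by (auto simp: pos_divide_le_eq)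
    let ?m = "(1 - ?t) *\<^sub>R \<xi> + ?t *\<^sub>R p"
    have "?m - \<xi> = ?t *\<^sub>R (p - \<xi>)" by (simp add: algebra_simps)
    then have "norm (?m - \<xi>) = \<bar>?t\<bar> * ?n" by (simp only: norm_scaleR)
    then have "norm (?m - \<xi>) = r / 2" using n t(1) r by simp
    then have "c \<le> ?D ?m" by (rule c(2))
    also have "\<dots> \<le> (1 - ?t) * ?D \<xi> + ?t * ?D p" by (rule convex_onD[OF cD]) (use t in auto)
    also have "\<dots> = ?t * ?D p" unfolding D0 by simp
    finally have "c * ?n \<le> ?t * ?D p * ?n" using n by (intro mult_right_mono) auto
    also have "\<dots> = (r / 2) * ?D p" using n by simp
    finally show ?thesis .
  qed
  \<comment> \<open>The tent starts at height \<open>s = \<beta> / 2\<close> with slope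
    \<open>j = \<beta> / r\<close>, so at distance \<open>r / 2\<close> it has risen to at most
    \<open>\<beta> \<le> c\<close>; \<open>\<beta> \<le> \<eta>\<close> makes it admissible.\<close>
  define \<beta> where "\<beta> = min c \<eta>"
  have \<beta>: "\<beta> > 0" "\<beta> \<le> c" "\<beta> \<le> \<eta>" using c \<eta> by (auto simp: \<beta>_def)
  define s where "s = \<beta> / 2"
  define j where "j = \<beta> / r"
  define l0 where "l0 = - g x0 + s"
  have j: "j > 0" using \<beta> r by (simp add: j_def)
  have perp_le: "max (perp e \<bullet> (p - \<xi>)) 0 \<le> norm (p - \<xi>)" for p
    using Cauchy_Schwarz_ineq2[of "perp e" "p - \<xi>"] e by simp
  have tent: "l0 + x0 \<bullet> p + j * max (perp e \<bullet> (p - \<xi>)) 0 \<le> (x0 \<bullet> p - g x0) + s + j * norm (p - \<xi>)" for p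
    using mult_left_mono[OF perp_le, of j p] j by (simp add: l0_def)
  have below: "l0 + x0 \<bullet> p + j * max (perp e \<bullet> (p - \<xi>)) 0 \<le> U p" if p: "r / 2 \<le> norm (p - \<xi>)" for p
  proof -
    let ?n = "norm (p - \<xi>)"
    have "s \<le> j * ?n"
    proof -
      have "s = j * (r / 2)" using r by (simp add: s_def j_def)
      also have "\<dots> \<le> j * ?n" using p j by (intro mult_left_mono) auto
      finally show ?thesis .
    qed
    moreover have "2 * (j * ?n) \<le> ?D p"
    proof -
      have "r * (2 * (j * ?n)) = 2 * (\<beta> * ?n)" using r by (simp add: j_def)
      also have "\<dots> \<le> 2 * (c * ?n)" using \<beta>(2) by (intro mult_left_mono mult_right_mono) auto
      also have "\<dots> \<le> r * ?D p" using far[OF p] by simp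
      finally show ?thesis using r by (simp only: mult_le_cancel_left_pos)
    qed
    ultimately show ?thesis using tent[of p] by linarith
  qed
  have small: "l0 + x0 \<bullet> p + j * max (perp e \<bullet> (p - \<xi>)) 0 \<le> U p + \<eta>" for p
  proof (cases "r / 2 \<le> norm (p - \<xi>)")
    case True
    then show ?thesis using below[OF True] \<eta> by linarith
  next
    case False
    have "j * norm (p - \<xi>) \<le> j * (r / 2)" using False j by (intro mult_left_mono) auto
    also have "\<dots> = \<beta> / 2" using r by (simp add: j_def)
    finally have "s + j * norm (p - \<xi>) \<le> \<eta>" using \<beta>(3) by (simp add: s_def)
    moreover have "x0 \<bullet> p - g x0 \<le> U p" using lconj_ge[OF g(2), of p x0] by (simp add: inner_commute)
    ultimately show ?thesis using tent[of p] by linarith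
  qed
  interpret crease g K D \<xi> r \<eta> e x0 l0 j
  proof unfold_locales
    show "l0 + x0 \<bullet> p + j * max (perp e \<bullet> (p - \<xi>)) 0 \<le> U p" if "r \<le> norm (p - \<xi>)" for p
      by (rule below) (use that r in simp)
  qed (use e j small in auto)
  show False
  proof (rule crease_contradiction[of f "grad f" "\<lambda>\<tau>. f (\<xi> + \<tau> *\<^sub>R e)" "\<lambda>\<tau>. grad f (\<xi> + \<tau> *\<^sub>R e) \<bullet> e"
        "\<lambda>\<tau>. (hessian f (\<xi> + \<tau> *\<^sub>R e) *v e) \<bullet> e"])
    show "continuous_on UNIV f" by (rule C2D(4)[OF f])
    show "\<exists>M\<ge>0. \<forall>p q. norm p \<le> L \<longrightarrow> norm q \<le> L \<longrightarrow> f p + grad f p \<bullet> (q - p) - M * ((q - p) \<bullet> (q - p)) \<le> f q" for L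
      by (rule C2_semiconvex[OF f])
    show "\<Phi> f U \<le> \<Phi> f V" if "adm2 V" for V
      by (rule min[OF adm2_adm[OF that]]) (use adm2_gderiv[OF that] K(2) in blast)
    show "B p = U p" if "r / 2 \<le> norm (p - \<xi>)" for p using below[OF that] by (simp add: B_def G_def)
    show "U \<xi> < B \<xi>" unfolding B_def G_def using D0 \<beta>(1) by (simp add: l0_def s_def)
    show "0 < j" using \<beta>(1) r by (simp add: j_def)
    show "((\<lambda>\<tau>. f (\<xi> + \<tau> *\<^sub>R e)) has_real_derivative grad f (\<xi> + x *\<^sub>R e) \<bullet> e) (at x)" for x
      by (rule gderiv_line[OF C2D(1)[OF f]])
    show "((\<lambda>\<tau>. grad f (\<xi> + \<tau> *\<^sub>R e) \<bullet> e) has_real_derivative (hessian f (\<xi> + x *\<^sub>R e) *v e) \<bullet> e) (at x)" for x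
      by (rule hessian_line[OF f])
    show "continuous_on UNIV (\<lambda>\<tau>. (hessian f (\<xi> + \<tau> *\<^sub>R e) *v e) \<bullet> e)"
      by (rule continuous_on_compose2[OF continuous_hessian_form[OF f]]) (auto intro!: continuous_intros)
    show "f (\<tau> *\<^sub>R e + \<xi>) = f (\<xi> + \<tau> *\<^sub>R e)" for \<tau> by (simp add: add.commute)
    show "(hessian f (\<xi> + \<tau> *\<^sub>R e) *v e) \<bullet> e < 0" if "\<bar>\<tau>\<bar> \<le> r" for \<tau>
      by (rule neg) (use that e in simp)
  qed
qed

end

text \<open>Closed graph and compactness: subgradients at points converging to \<open>y\<close> are
  bounded, because \<open>u\<close> is bounded on a ball, and their limits are subgradients at
  \<open>y\<close>.\<close>

lemma subgrad_on_near:
  fixes u :: "'a::euclidean_space \<Rightarrow> real"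
  assumes u: "convex_on S u" and y: "y \<in> interior S" and bd: "\<And>x. x \<in> S \<Longrightarrow> \<bar>u x\<bar> \<le> M"
    and uniq: "\<And>q. subgrad_on S u y q \<Longrightarrow> q = p" and e: "e > 0"
  obtains d where "d > 0" "ball y d \<subseteq> S" "\<And>x q. x \<in> ball y d \<Longrightarrow> subgrad_on S u x q \<Longrightarrow> norm (q - p) < e"
proof (rule ccontr)
  assume no: "\<not> thesis"
  obtain d where d: "d > 0" "cball y (2 * d) \<subseteq> S"
  proof -
    obtain d0 where "d0 > 0" "cball y d0 \<subseteq> S" using y by (meson mem_interior_cball)
    then show ?thesis using that[of "d0 / 2"] by simp
  qed
  have "\<exists>x q. x \<in> ball y (min d (1 / real (Suc n))) \<and> subgrad_on S u x q \<and> e \<le> norm (q - p)" for n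
  proof (rule ccontr)
    assume a: "\<not> ?thesis"
    let ?d = "min d (1 / real (Suc n))"
    have "?d > 0" using d by simp
    moreover have "ball y ?d \<subseteq> S" using d by (auto intro!: subsetD[OF d(2)])
    moreover have "norm (q - p) < e" if "x \<in> ball y ?d" "subgrad_on S u x q" for x q using a that by (meson not_le)
    ultimately show False using no that by blast
  qed
  then obtain x q where xq: "\<And>n. x n \<in> ball y (min d (1 / real (Suc n)))" "\<And>n. subgrad_on S u (x n) (q n)"
    "\<And>n. e \<le> norm (q n - p)" by metis
  have xd: "dist y (x n) < d" "dist (x n) y < 1 / real (Suc n)" for n using xq(1)[of n] by (auto simp: dist_commute)
  have xS: "x n \<in> S" for n using xd(1)[of n] d by (intro subsetD[OF d(2)]) auto
  have qb: "norm (q n) \<le> 2 * M / d" for n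
  proof (cases "q n = 0")
    case True
    have "M \<ge> 0" using bd[OF xS, of 0] by linarith
    then show ?thesis using True d by simp
  next
    case False
    let ?z = "x n + (d / norm (q n)) *\<^sub>R q n"
    have "dist (x n) ?z = d" using False d by (simp add: dist_norm)
    then have "dist y ?z \<le> 2 * d" using dist_triangle[of y ?z "x n"] xd(1)[of n] by linarith
    then have zS: "?z \<in> S" using d(2) by auto
    then have "u (x n) + q n \<bullet> (?z - x n) \<le> u ?z" using xq(2)[of n] unfolding subgrad_on_def by blast
    moreover have "q n \<bullet> (?z - x n) = d * norm (q n)"
      using False by (simp add: dot_square_norm power2_eq_square)
    moreover have "\<bar>u (x n)\<bar> \<le> M" "\<bar>u ?z\<bar> \<le> M" using bd xS zS by auto
    ultimately have "d * norm (q n) \<le> 2 * M" by linarith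
    then show ?thesis using d by (simp add: field_simps)
  qed
  have "bounded (range q)" using qb unfolding bounded_iff by blast
  then obtain q' k where k: "strict_mono (k :: nat \<Rightarrow> nat)" "(q \<circ> k) \<longlonglongrightarrow> q'"
    using bounded_imp_convergent_subsequence by blast
  have "norm (dist (x n) y) \<le> 1 / real (Suc n)" for n using xd(2)[of n] by (simp del: of_nat_Suc)
  then have "(\<lambda>n. dist (x n) y) \<longlonglongrightarrow> 0"
    by (intro Lim_null_comparison[OF always_eventually LIMSEQ_Suc[OF lim_const_over_n[of 1]]] allI)
  then have "x \<longlonglongrightarrow> y" by (rule iffD2[OF tendsto_dist_iff])
  then have xk: "(x \<circ> k) \<longlonglongrightarrow> y" by (rule LIMSEQ_subseq_LIMSEQ[OF _ k(1)])
  have "continuous_on (interior S) u"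
    by (rule convex_on_continuous[OF open_interior convex_on_subset[OF u interior_subset]])
       (use u in \<open>auto simp: convex_on_def convex_interior\<close>)
  then have "isCont u y" using y by (simp add: continuous_on_eq_continuous_at)
  then have ux: "(\<lambda>n. u ((x \<circ> k) n)) \<longlonglongrightarrow> u y" using xk by (rule isCont_tendsto_compose)
  have "subgrad_on S u y q'"
    unfolding subgrad_on_def
  proof
    fix z assume z: "z \<in> S"
    have "(\<lambda>n. u ((x \<circ> k) n) + (q \<circ> k) n \<bullet> (z - (x \<circ> k) n)) \<longlonglongrightarrow> u y + q' \<bullet> (z - y)"
      by (intro tendsto_add tendsto_inner tendsto_diff tendsto_const ux k xk)
    then show "u y + q' \<bullet> (z - y) \<le> u z"
      by (rule LIMSEQ_le_const2) (use xq(2) z in \<open>auto simp: subgrad_on_def\<close>)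
  qed
  then have "q' = p" by (rule uniq)
  have "(\<lambda>n. norm ((q \<circ> k) n - p)) \<longlonglongrightarrow> norm (q' - p)"
    by (intro tendsto_norm tendsto_diff tendsto_const k(2))
  then have "e \<le> norm (q' - p)" by (rule LIMSEQ_le_const) (use xq(3) in auto)
  then show False using e \<open>q' = p\<close> by simp
qed

section \<open>Regularised lower boundary of a convex body\<close>

text \<open>\<open>C\<close> will be the closed body. Its lower boundary is a function on a compact
  set only, whereas the conjugation above is for finite coercive functions on the whole
  space.\<close>

locale compact_convex =
  fixes C :: "('a::euclidean_space \<times> real) set" and \<xi> :: 'a and \<rho> :: real
  assumes C: "compact C" "convex C" "C \<noteq> {}" and \<rho>: "\<rho> > 0"
begin

text \<open>The support function of \<open>C\<close> in the direction \<open>(p, -1)\<close>, that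
  is, the conjugate of the lower boundary.\<close>

definition supp :: "'a \<Rightarrow> real" where "supp p = (SUP z\<in>C. p \<bullet> fst z - snd z)"

text \<open>The term \<open>\<rho> * norm h\<close> outweighs every slope within
  \<open>\<rho>\<close> of \<open>\<xi>\<close>, so that moving off \<open>C\<close> does not pay;
  the square gives superlinear growth.\<close>

definition pen :: "'a \<Rightarrow> real" where "pen h = \<xi> \<bullet> h + \<rho> * norm h + h \<bullet> h"

text \<open>The infimal convolution with \<open>pen\<close> is finite and coercive; slopes within distance \<open>\<rho>\<close> of \<open>\<xi>\<close> are
  not affected by it.\<close>

definition low :: "'a \<Rightarrow> real" where "low x = (INF z\<in>C. snd z + pen (x - fst z))"

lemma supp_attained: obtains z where "z \<in> C" "supp p = p \<bullet> fst z - snd z" "\<And>v. v \<in> C \<Longrightarrow> p \<bullet> fst v - snd v \<le> supp p"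
proof -
  have c: "continuous_on C (\<lambda>z. p \<bullet> fst z - snd z)" by (intro continuous_intros)
  obtain z where z: "z \<in> C" "\<And>v. v \<in> C \<Longrightarrow> p \<bullet> fst v - snd v \<le> p \<bullet> fst z - snd z"
    using continuous_attains_sup[OF C(1,3) c] by blast
  then have eq: "supp p = p \<bullet> fst z - snd z"
    unfolding supp_def by (intro cSup_eq_maximum) auto
  show ?thesis by (rule that[OF z(1) eq]) (simp only: eq z(2))
qed

lemma low_attained: obtains z where "z \<in> C" "low x = snd z + pen (x - fst z)" "\<And>v. v \<in> C \<Longrightarrow> low x \<le> snd v + pen (x - fst v)"
proof -
  have c: "continuous_on C (\<lambda>z. snd z + pen (x - fst z))" unfolding pen_def by (intro continuous_intros)
  obtain z where z: "z \<in> C" "\<And>v. v \<in> C \<Longrightarrow> snd z + pen (x - fst z) \<le> snd v + pen (x - fst v)"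
    using continuous_attains_inf[OF C(1,3) c] by blast
  then have eq: "low x = snd z + pen (x - fst z)"
    unfolding low_def by (intro cInf_eq_minimum) auto
  show ?thesis by (rule that[OF z(1) eq]) (simp only: eq z(2))
qed

lemma supp_ge: "v \<in> C \<Longrightarrow> p \<bullet> fst v - snd v \<le> supp p" by (rule supp_attained[of p]) blast

lemma low_le: "v \<in> C \<Longrightarrow> low x \<le> snd v + pen (x - fst v)" by (rule low_attained[of x]) blast

lemma pen_zero [simp]: "pen 0 = 0" by (simp add: pen_def)

lemma convex_pen:
  assumes t: "0 \<le> t" "t \<le> 1" shows "pen ((1 - t) *\<^sub>R a + t *\<^sub>R b) \<le> (1 - t) * pen a + t * pen b"
proof -
  let ?m = "(1 - t) *\<^sub>R a + t *\<^sub>R b"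
  have "norm ?m \<le> (1 - t) * norm a + t * norm b"
    using norm_triangle_ineq[of "(1 - t) *\<^sub>R a" "t *\<^sub>R b"] t by simp
  then have n: "\<rho> * norm ?m \<le> \<rho> * ((1 - t) * norm a + t * norm b)" using \<rho> by (intro mult_left_mono) auto
  have mm: "?m \<bullet> ?m = (1 - t) * ((1 - t) * (a \<bullet> a) + t * (a \<bullet> b)) + t * ((1 - t) * (a \<bullet> b) + t * (b \<bullet> b))"
    by (simp add: inner_add_left inner_add_right inner_commute[of b a] distrib_left)
  have ab: "(a - b) \<bullet> (a - b) = (a \<bullet> a - a \<bullet> b) - (a \<bullet> b - b \<bullet> b)"
    by (simp add: inner_diff_left inner_diff_right inner_commute[of b a])
  have r: "(1 - t) * ((1 - t) * x + t * y) + t * ((1 - t) * y + t * z) = (1 - t) * x + t * z - t * (1 - t) * ((x - y) - (y - z))"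
    for x y z :: real
    by (simp add: algebra_simps)
  have q: "?m \<bullet> ?m \<le> (1 - t) * (a \<bullet> a) + t * (b \<bullet> b)"
  proof -
    have "0 \<le> t * (1 - t) * ((a - b) \<bullet> (a - b))" using t by simp
    then show ?thesis unfolding mm r ab by simp
  qed
  have l: "\<xi> \<bullet> ?m = (1 - t) * (\<xi> \<bullet> a) + t * (\<xi> \<bullet> b)" by (simp add: inner_add_right)
  have "pen ?m \<le> ((1 - t) * (\<xi> \<bullet> a) + t * (\<xi> \<bullet> b)) + \<rho> * ((1 - t) * norm a + t * norm b) + ((1 - t) * (a \<bullet> a) + t * (b \<bullet> b))"
    unfolding pen_def[of ?m] l by (intro add_mono n q order_refl)
  also have "\<dots> = (1 - t) * pen a + t * pen b"
    unfolding pen_def by (simp add: algebra_simps)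
  finally show ?thesis .
qed

lemma convex_low: "convex_on UNIV low"
proof (rule convex_onI)
  fix t :: real and a b :: 'a assume t: "0 < t" "t < 1"
  obtain za where za: "za \<in> C" "low a = snd za + pen (a - fst za)" using low_attained[of a] by blast
  obtain zb where zb: "zb \<in> C" "low b = snd zb + pen (b - fst zb)" using low_attained[of b] by blast
  let ?z = "(1 - t) *\<^sub>R za + t *\<^sub>R zb"
  have "?z \<in> C" using convexD_alt[OF C(2) za(1) zb(1), of t] t by simp
  then have "low ((1 - t) *\<^sub>R a + t *\<^sub>R b) \<le> snd ?z + pen ((1 - t) *\<^sub>R a + t *\<^sub>R b - fst ?z)" by (rule low_le)
  also have "(1 - t) *\<^sub>R a + t *\<^sub>R b - fst ?z = (1 - t) *\<^sub>R (a - fst za) + t *\<^sub>R (b - fst zb)" by (simp add: algebra_simps)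
  also have "snd ?z + pen ((1 - t) *\<^sub>R (a - fst za) + t *\<^sub>R (b - fst zb)) \<le> snd ?z + ((1 - t) * pen (a - fst za) + t * pen (b - fst zb))"
    using t by (intro add_left_mono convex_pen) auto
  also have "\<dots> = (1 - t) * low a + t * low b" by (simp add: za(2) zb(2) algebra_simps)
  finally show "low ((1 - t) *\<^sub>R a + t *\<^sub>R b) \<le> (1 - t) * low a + t * low b" .
qed simp

lemma low_split: "p \<bullet> x - (snd z + pen (x - fst z)) =
    (p \<bullet> fst z - snd z) + ((p - \<xi>) \<bullet> (x - fst z) - \<rho> * norm (x - fst z) - (x - fst z) \<bullet> (x - fst z))"
  by (simp add: pen_def inner_diff_left inner_diff_right)

lemma coercive_low: "coercive low"
proof (rule coerciveI)
  fix p
  show "\<exists>c. \<forall>x. p \<bullet> x - low x \<le> c"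
  proof (intro exI allI)
    fix x
    obtain z where z: "z \<in> C" "low x = snd z + pen (x - fst z)" using low_attained[of x] by blast
    let ?h = "x - fst z" and ?a = "p - \<xi>"
    have "(?a - ?h) \<bullet> (?a - ?h) = ?a \<bullet> ?a - 2 * (?a \<bullet> ?h) + ?h \<bullet> ?h"
    proof -
      have "(a - h) \<bullet> (a - h) = a \<bullet> a - 2 * (a \<bullet> h) + h \<bullet> h" for a h :: 'a
        by (simp add: inner_diff_left inner_diff_right inner_commute[of h a])
      then show ?thesis .
    qed
    then have "?a \<bullet> ?h \<le> ?a \<bullet> ?a + ?h \<bullet> ?h"
      using inner_ge_zero[of "?a - ?h"] inner_ge_zero[of ?a] inner_ge_zero[of ?h] by linarith
    moreover have "0 \<le> \<rho> * norm ?h" using \<rho> by simp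
    moreover have "p \<bullet> fst z - snd z \<le> supp p" by (rule supp_ge[OF z(1)])
    moreover have "p \<bullet> x - low x = (p \<bullet> fst z - snd z) + (?a \<bullet> ?h - \<rho> * norm ?h - ?h \<bullet> ?h)"
      unfolding z(2) by (rule low_split)
    ultimately show "p \<bullet> x - low x \<le> supp p + ?a \<bullet> ?a" by linarith
  qed
qed

lemma lconj_low:
  assumes p: "norm (p - \<xi>) \<le> \<rho>" shows "lconj low p = supp p"
proof (rule antisym)
  show "lconj low p \<le> supp p"
  proof (rule lconj_le)
    fix x
    obtain z where z: "z \<in> C" "low x = snd z + pen (x - fst z)" using low_attained[of x] by blast
    let ?h = "x - fst z"
    have "(p - \<xi>) \<bullet> ?h \<le> norm (p - \<xi>) * norm ?h" by (rule norm_cauchy_schwarz)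
    also have "\<dots> \<le> \<rho> * norm ?h" using p by (intro mult_right_mono) auto
    finally have "(p - \<xi>) \<bullet> ?h \<le> \<rho> * norm ?h" .
    moreover have "p \<bullet> x - low x = (p \<bullet> fst z - snd z) + ((p - \<xi>) \<bullet> ?h - \<rho> * norm ?h - ?h \<bullet> ?h)"
      unfolding z(2) by (rule low_split)
    ultimately show "p \<bullet> x - low x \<le> supp p"
      using supp_ge[OF z(1), of p] inner_ge_zero[of ?h] by linarith
  qed
  obtain z where z: "z \<in> C" "supp p = p \<bullet> fst z - snd z" using supp_attained[of p] by blast
  have "low (fst z) \<le> snd z" using low_le[OF z(1), of "fst z"] by simp
  then show "supp p \<le> lconj low p" using lconj_ge[OF coercive_low, of p "fst z"] z(2) by linarith
qed

text \<open>An approximate contact point of \<open>low\<close> is traced back to a point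
  \<open>z\<close> where the infimum is attained: the penalty exceeds what a slope within
  \<open>r\<close> of \<open>\<xi>\<close> can gain by \<open>(\<rho> - r)\<close> times the
  distance, so both the distance and the gap at \<open>z\<close> are controlled.\<close>

lemma low_near:
  assumes p: "norm (p - \<xi>) \<le> r" "r < \<rho>" and x: "low x + lconj low p - p \<bullet> x \<le> \<eta>"
  obtains z where "z \<in> C" "(\<rho> - r) * norm (x - fst z) \<le> \<eta>" "snd z + supp p - p \<bullet> fst z \<le> \<eta>"
proof -
  obtain z where z: "z \<in> C" "low x = snd z + pen (x - fst z)" using low_attained[of x] by blast
  let ?h = "x - fst z"
  have "(p - \<xi>) \<bullet> ?h \<le> norm (p - \<xi>) * norm ?h" by (rule norm_cauchy_schwarz)
  also have "\<dots> \<le> r * norm ?h" using p by (intro mult_right_mono) auto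
  finally have 1: "(p - \<xi>) \<bullet> ?h \<le> r * norm ?h" .
  have 2: "lconj low p = supp p" by (rule lconj_low) (use p in simp)
  have 3: "p \<bullet> x - low x = (p \<bullet> fst z - snd z) + ((p - \<xi>) \<bullet> ?h - \<rho> * norm ?h - ?h \<bullet> ?h)"
    unfolding z(2) by (rule low_split)
  have 4: "(\<rho> - r) * norm ?h = \<rho> * norm ?h - r * norm ?h" by (simp add: left_diff_distrib)
  have 5: "0 \<le> (\<rho> - r) * norm ?h" using p by simp
  show ?thesis
    by (rule that[OF z(1)]) (use 1 2 3 4 5 x supp_ge[OF z(1), of p] inner_ge_zero[of ?h] in linarith)+
qed

end

section \<open>The convex body below a bounded convex function\<close>

locale convex_fun =
  fixes \<Omega> :: "(real^2) set" and M :: real and u :: "real^2 \<Rightarrow> real"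
  assumes \<Omega>: "compact \<Omega>" "convex \<Omega>" "interior \<Omega> \<noteq> {}"
    and u: "convex_on \<Omega> u" "\<And>x. x \<in> \<Omega> \<Longrightarrow> 0 \<le> u x \<and> u x \<le> M"
begin

abbreviation "BD \<equiv> body \<Omega> M u"
text \<open>At the frontier of \<open>\<Omega>\<close> the function \<open>u\<close> may fail to be
  lower semicontinuous, so that \<open>BD\<close> is not closed; compactness arguments take place in
  \<open>C\<close>.\<close>

abbreviation "C \<equiv> closure BD"

lemma body_mem: "x \<in> \<Omega> \<Longrightarrow> (x, u x) \<in> BD" "x \<in> \<Omega> \<Longrightarrow> (x, M) \<in> BD"
  using u(2) by (auto simp: body_def)

lemma C_mem: "x \<in> \<Omega> \<Longrightarrow> (x, u x) \<in> C" using body_mem closure_subset by blast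

lemma convex_body: "convex BD"
proof (rule convexI)
  fix v w :: "(real^2) \<times> real" and s t :: real
  assume v: "v \<in> BD" and w: "w \<in> BD" and st: "0 \<le> s" "0 \<le> t" "s + t = 1"
  obtain y1 z1 y2 z2 where vw: "v = (y1, z1)" "w = (y2, z2)" by (metis surj_pair)
  have m: "y1 \<in> \<Omega>" "y2 \<in> \<Omega>" "u y1 \<le> z1" "u y2 \<le> z2" "z1 \<le> M" "z2 \<le> M" using v w vw by (auto simp: body_def)
  have "s *\<^sub>R y1 + t *\<^sub>R y2 \<in> \<Omega>" using \<Omega>(2) m st by (auto simp: convex_def)
  moreover have "u (s *\<^sub>R y1 + t *\<^sub>R y2) \<le> s * u y1 + t * u y2" using u(1) m st by (auto simp: convex_on_def)
  moreover have "s * u y1 + t * u y2 \<le> s * z1 + t * z2" using m st by (intro add_mono mult_left_mono) auto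
  moreover have "s * z1 + t * z2 \<le> s * M + t * M" using m st by (intro add_mono mult_left_mono) auto
  moreover have "s * M + t * M = M" using st by (metis distrib_right mult_1)
  ultimately show "s *\<^sub>R v + t *\<^sub>R w \<in> BD" by (simp add: body_def vw)
qed

lemma body_subset: "BD \<subseteq> \<Omega> \<times> {0..M}"
proof -
  have "0 \<le> z" if "x \<in> \<Omega>" "u x \<le> z" for x z using u(2)[OF that(1)] that(2) by linarith
  then show ?thesis by (auto simp: body_def)
qed

lemma C_subset: "C \<subseteq> \<Omega> \<times> {0..M}"
  by (rule closure_minimal[OF body_subset]) (intro closed_Times compact_imp_closed \<Omega> closed_atLeastAtMost)

lemma compact_C: "compact C" "convex C" "C \<noteq> {}"
proof -
  have "bounded (\<Omega> \<times> {0..M})" by (intro bounded_Times compact_imp_bounded \<Omega>) auto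
  then have "bounded BD" using body_subset by (rule bounded_subset)
  then show "compact C" by simp
  show "convex C" by (rule convex_closure[OF convex_body])
  obtain x where "x \<in> \<Omega>" using \<Omega>(3) interior_subset[of \<Omega>] by blast
  then have "(x, u x) \<in> C" by (rule C_mem)
  then show "C \<noteq> {}" by (metis emptyE)
qed

lemma C_halfspace:
  assumes "\<And>x. x \<in> \<Omega> \<Longrightarrow> c + p \<bullet> x \<le> u x" "(y, w) \<in> C" shows "c + p \<bullet> y \<le> w"
proof -
  have "c + p \<bullet> x \<le> z" if "x \<in> \<Omega>" "u x \<le> z" for x z using assms(1)[OF that(1)] that(2) by linarith
  then have "BD \<subseteq> {z. c + p \<bullet> fst z \<le> snd z}" by (auto simp: body_def)
  moreover have "closed {z::(real^2)\<times>real. c + p \<bullet> fst z \<le> snd z}" by (intro closed_Collect_le continuous_intros)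
  ultimately have "C \<subseteq> {z. c + p \<bullet> fst z \<le> snd z}" by (rule closure_minimal)
  then show ?thesis using assms(2) by auto
qed

lemma C_above:
  assumes "(y, w) \<in> C" "subgrad_on \<Omega> u x p" shows "u x + p \<bullet> (y - x) \<le> w"
  using C_halfspace[of "u x - p \<bullet> x" p y w] assms by (auto simp: subgrad_on_def inner_diff_right algebra_simps)

lemma C_interior:
  assumes "(y, w) \<in> C" "y \<in> interior \<Omega>" shows "u y \<le> w"
proof -
  obtain p where "subgrad_on \<Omega> u y p" using subgrad_on_exists[OF u(1) assms(2)] .
  from C_above[OF assms(1) this] show ?thesis by simp
qed

lemma continuous_interior: "continuous_on (interior \<Omega>) u"
  by (rule convex_on_continuous[OF open_interior convex_on_subset[OF u(1) interior_subset]]) (rule convex_interior[OF \<Omega>(2)])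

section \<open>Support planes, subgradients and singular points\<close>

lemma plane_of_support_slope:
  assumes "(x, z) \<in> C" "\<And>v. v \<in> BD \<Longrightarrow> p \<bullet> fst v - snd v \<le> p \<bullet> x - z"
  shows "plane_of_support BD (x, z) {v. (p, -1::real) \<bullet> v = p \<bullet> x - z}"
  unfolding plane_of_support_def using assms(2)
  by (intro exI[of _ "(p, -1)"] exI[of _ "p \<bullet> x - z"]) (auto simp: zero_prod_def)

lemma frontier_slope:
  assumes "(x, z) \<in> C" "\<And>v. v \<in> BD \<Longrightarrow> p \<bullet> fst v - snd v \<le> p \<bullet> x - z"
  shows "(x, z) \<in> frontier BD"
proof -
  have "(x, z) \<notin> interior BD"
  proof
    assume "(x, z) \<in> interior BD"
    then obtain e where e: "e > 0" "cball (x, z) e \<subseteq> BD" by (meson mem_interior_cball)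
    have "(x, z - e) \<in> cball (x, z) e" using e by (simp add: dist_Pair_Pair dist_real_def)
    then have "p \<bullet> x - (z - e) \<le> p \<bullet> x - z" using assms(2)[of "(x, z - e)"] e by auto
    then show False using e by simp
  qed
  then show ?thesis using assms(1) by (simp add: frontier_def)
qed

text \<open>Each subgradient gives a support plane at the graph point, and the plane determines the
  slope; at a regular point there is only one plane.\<close>

lemma subgrad_unique:
  assumes x: "x \<in> interior \<Omega>" and reg: "(x, u x) \<notin> sing BD"
    and p: "subgrad_on \<Omega> u x p" and q: "subgrad_on \<Omega> u x q"
  shows "p = q"
proof -
  have xO: "x \<in> \<Omega>" using x interior_subset by blast
  have le: "p \<bullet> fst v - snd v \<le> p \<bullet> x - u x" if "v \<in> BD" "subgrad_on \<Omega> u x p" for v p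
    using C_above[of "fst v" "snd v" x p] that closure_subset[of BD] by (auto simp: inner_diff_right)
  have fr: "(x, u x) \<in> frontier BD" by (rule frontier_slope[OF C_mem[OF xO] le[OF _ p]])
  then have "\<exists>!H. plane_of_support BD (x, u x) H" using reg by (simp add: sing_def regular_point_def)
  then obtain H0 where H0: "\<And>H. plane_of_support BD (x, u x) H \<Longrightarrow> H = H0" by (elim ex1E) blast
  have "{v. (p, -1::real) \<bullet> v = p \<bullet> x - u x} = {v. (q, -1::real) \<bullet> v = q \<bullet> x - u x}"
  proof -
    note pl = plane_of_support_slope[OF C_mem[OF xO], of p] plane_of_support_slope[OF C_mem[OF xO], of q]
    have e1: "{v. (p, -1::real) \<bullet> v = p \<bullet> x - u x} = H0" by (rule H0, rule pl(1), rule le[OF _ p])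
    have e2: "{v. (q, -1::real) \<bullet> v = q \<bullet> x - u x} = H0" by (rule H0, rule pl(2), rule le[OF _ q])
    show ?thesis by (rule trans[OF e1 e2[symmetric]])
  qed
  moreover have "(x + (p - q), u x + p \<bullet> (p - q)) \<in> {v. (p, -1::real) \<bullet> v = p \<bullet> x - u x}" by (simp add: inner_add_right)
  ultimately have "(x + (p - q), u x + p \<bullet> (p - q)) \<in> {v. (q, -1::real) \<bullet> v = q \<bullet> x - u x}" by blast
  then have "(p - q) \<bullet> (p - q) = 0" by (simp add: inner_add_right inner_diff_left)
  then show ?thesis by simp
qed

text \<open>Over the frontier of \<open>\<Omega>\<close> a supporting line of
  \<open>\<Omega>\<close> always yields a vertical support plane, so a nonvertical one is a second
  plane. Nonvertical is expressed by \<open>(x, z + 1) \<notin> H\<close>.\<close>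

lemma sing_vertical:
  assumes x: "x \<notin> interior \<Omega>" and fr: "(x, z) \<in> frontier BD" and H: "plane_of_support BD (x, z) H" "(x, z + 1) \<notin> H"
  shows "(x, z) \<in> sing BD"
proof -
  have xO: "x \<in> \<Omega>" using fr C_subset by (auto simp: frontier_def)
  then have "x \<in> closure \<Omega>" "x \<notin> rel_interior \<Omega>"
    using x \<Omega>(3) closure_subset by (auto simp: rel_interior_nonempty_interior)
  then obtain a where a: "a \<noteq> 0" "\<And>y. y \<in> closure \<Omega> \<Longrightarrow> a \<bullet> x \<le> a \<bullet> y"
    using supporting_hyperplane_relative_frontier[OF \<Omega>(2)] by metis
  have a': "(- a) \<bullet> y \<le> (- a) \<bullet> x" if "y \<in> \<Omega>" for y using a(2)[of y] that closure_subset by auto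
  let ?H = "{v. (- a, 0) \<bullet> v = (- a) \<bullet> x}"
  have "plane_of_support BD (x, z) ?H"
    unfolding plane_of_support_def using a(1) a'
    by (intro exI[of _ "(- a, 0)"] exI[of _ "(- a) \<bullet> x"]) (auto simp: zero_prod_def body_def)
  moreover have "(x, z + 1) \<in> ?H" by simp
  ultimately have "\<not> (\<exists>!H. plane_of_support BD (x, z) H)"
  proof (intro notI)
    assume pl: "plane_of_support BD (x, z) ?H" and mem: "(x, z + 1) \<in> ?H" and "\<exists>!H. plane_of_support BD (x, z) H"
    then obtain H0 where H0: "\<And>H. plane_of_support BD (x, z) H \<Longrightarrow> H = H0" by (elim ex1E) blast
    have "H = ?H" by (rule trans[OF H0[OF H(1)] H0[OF pl, symmetric]])
    then have "(x, z + 1) \<in> H" using mem by (rule ssubst)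
    then show False using H(2) by contradiction
  qed
  then show ?thesis using fr by (simp add: sing_def regular_point_def)
qed

lemma sing_subset: "closure (convex hull sing BD) \<subseteq> C"
proof (rule closure_minimal)
  have "sing BD \<subseteq> C" by (auto simp: sing_def frontier_def)
  then show "convex hull sing BD \<subseteq> C" by (rule hull_minimal) (rule compact_C(2))
qed simp

lemma top_sing:
  assumes "x \<in> frontier \<Omega>" shows "(x, M) \<in> sing BD"
proof -
  have "closure \<Omega> = \<Omega>" by (rule closure_closed[OF compact_imp_closed[OF \<Omega>(1)]])
  then have xO: "x \<in> \<Omega>" "x \<notin> interior \<Omega>" using assms by (simp_all add: frontier_def)
  have B: "(x, M) \<in> BD" by (rule body_mem[OF xO(1)])
  have "(x, M) \<notin> interior BD"
  proof
    assume "(x, M) \<in> interior BD"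
    then obtain e where e: "e > 0" "cball (x, M) e \<subseteq> BD" by (meson mem_interior_cball)
    have "(x, M + e) \<in> cball (x, M) e" using e by (simp add: dist_Pair_Pair dist_real_def)
    then have "(x, M + e) \<in> BD" using e by blast
    then show False using e by (simp add: body_def)
  qed
  then have fr: "(x, M) \<in> frontier BD" using B closure_subset[of BD] by (simp add: frontier_def subset_iff)
  have pl: "plane_of_support BD (x, M) {v. (0, 1) \<bullet> v = M}"
    unfolding plane_of_support_def
    by (intro exI[of _ "(0, 1)"] exI[of _ M]) (auto simp: zero_prod_def body_def)
  have "(x, M + 1) \<notin> {v. (0, 1) \<bullet> v = M}" by simp
  then show ?thesis by (rule sing_vertical[OF xO(2) fr pl])
qed

text \<open>A plane separates a point of \<open>C\<close> strictly from the closed hull. The rim at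
  height \<open>M\<close> over the frontier of \<open>\<Omega>\<close> is singular, and
  \<open>\<Omega>\<close> is the convex hull of its frontier, so the entire top lies on the side of
  the hull. Hence the plane is not vertical and stays below \<open>M\<close> over
  \<open>\<Omega>\<close>.\<close>

lemma separation:
  assumes "\<not> C \<subseteq> closure (convex hull sing BD)"
  obtains \<xi>0 l0 x1 where "\<And>x. x \<in> \<Omega> \<Longrightarrow> \<xi>0 \<bullet> x + l0 < M" "\<And>x z. (x, z) \<in> sing BD \<Longrightarrow> \<xi>0 \<bullet> x + l0 < z"
    "x1 \<in> interior \<Omega>" "u x1 < \<xi>0 \<bullet> x1 + l0"
proof -
  let ?K = "closure (convex hull sing BD)"
  obtain v where v: "v \<in> C" "v \<notin> ?K" using assms by blast
  obtain a b where ab: "a \<bullet> v < b" "\<And>x. x \<in> ?K \<Longrightarrow> b < a \<bullet> x"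
    using separating_hyperplane_closed_point[of ?K v] v(2) by (auto simp: convex_closure)
  obtain \<alpha> \<gamma> where a: "a = (\<alpha>, \<gamma>)" by (metis surj_pair)
  obtain x0 z0 where v0: "v = (x0, z0)" by (metis surj_pair)
  have lt: "\<alpha> \<bullet> x0 + \<gamma> * z0 < b" using ab(1) by (simp add: a v0)
  have top: "b < \<alpha> \<bullet> x + \<gamma> * M" if x: "x \<in> \<Omega>" for x
  proof -
    have "\<Omega> = convex hull (frontier \<Omega>)" by (rule Krein_Milman_frontier[OF \<Omega>(2,1)])
    moreover have "convex hull (frontier \<Omega>) \<subseteq> {x. b < \<alpha> \<bullet> x + \<gamma> * M}"
    proof (rule hull_minimal)
      have "sing BD \<subseteq> ?K" using hull_subset[of "sing BD" convex] closure_subset by blast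
      then show "frontier \<Omega> \<subseteq> {x. b < \<alpha> \<bullet> x + \<gamma> * M}" using top_sing ab(2) by (fastforce simp: a)
      have "{x. b < \<alpha> \<bullet> x + \<gamma> * M} = {x. b - \<gamma> * M < \<alpha> \<bullet> x}" by auto
      then show "convex {x. b < \<alpha> \<bullet> x + \<gamma> * M}" using convex_halfspace_gt by simp
    qed
    ultimately show ?thesis using x by blast
  qed
  have x0: "x0 \<in> \<Omega>" "z0 \<le> M" using v(1) v0 C_subset by auto
  have \<gamma>: "\<gamma> > 0"
  proof (rule ccontr)
    assume "\<not> \<gamma> > 0"
    then have "\<gamma> * M \<le> \<gamma> * z0" using x0(2) by (intro mult_left_mono_neg) auto
    then show False using top[OF x0(1)] lt by linarith
  qed
  define \<xi>0 where "\<xi>0 = (- 1 / \<gamma>) *\<^sub>R \<alpha>"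
  define l0 where "l0 = b / \<gamma>"
  have l: "\<xi>0 \<bullet> x + l0 < z \<longleftrightarrow> b < \<alpha> \<bullet> x + \<gamma> * z" "z < \<xi>0 \<bullet> x + l0 \<longleftrightarrow> \<alpha> \<bullet> x + \<gamma> * z < b" for x z
  proof -
    have "\<gamma> * (\<xi>0 \<bullet> x + l0) = b - \<alpha> \<bullet> x" using \<gamma> by (simp add: \<xi>0_def l0_def algebra_simps)
    moreover have "\<xi>0 \<bullet> x + l0 < z \<longleftrightarrow> \<gamma> * (\<xi>0 \<bullet> x + l0) < \<gamma> * z" "z < \<xi>0 \<bullet> x + l0 \<longleftrightarrow> \<gamma> * z < \<gamma> * (\<xi>0 \<bullet> x + l0)"
      using \<gamma> by simp_all
    ultimately show "\<xi>0 \<bullet> x + l0 < z \<longleftrightarrow> b < \<alpha> \<bullet> x + \<gamma> * z" "z < \<xi>0 \<bullet> x + l0 \<longleftrightarrow> \<alpha> \<bullet> x + \<gamma> * z < b" by auto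
  qed
  have op: "open {v::(real^2)\<times>real. snd v < \<xi>0 \<bullet> fst v + l0}" by (intro open_Collect_less continuous_intros)
  have "v \<in> {v. snd v < \<xi>0 \<bullet> fst v + l0}" using l(2) lt v0 by simp
  then have "{v. snd v < \<xi>0 \<bullet> fst v + l0} \<inter> C \<noteq> {}" using v(1) by blast
  then have "{v. snd v < \<xi>0 \<bullet> fst v + l0} \<inter> BD \<noteq> {}" unfolding open_Int_closure_eq_empty[OF op] .
  then obtain x2 where x2: "x2 \<in> \<Omega>" "u x2 < \<xi>0 \<bullet> x2 + l0" by (fastforce simp: body_def)
  obtain c where c: "c \<in> interior \<Omega>" using \<Omega>(3) by blast
  have cO: "c \<in> \<Omega>" using c interior_subset by blast
  define \<delta> where "\<delta> = \<xi>0 \<bullet> x2 + l0 - u x2"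
  \<comment> \<open>Large enough that the step \<open>t = \<delta> / (2 * \<Delta>)\<close> towards
    the interior point \<open>c\<close> uses up at most half of the margin
    \<open>\<delta>\<close>.\<close>
  define \<Delta> where "\<Delta> = \<bar>\<xi>0 \<bullet> c + l0 - u c\<bar> + \<delta> + 1"
  have \<delta>: "\<delta> > 0" using x2 by (simp add: \<delta>_def)
  then have D: "\<Delta> > \<delta>" by (simp add: \<Delta>_def)
  define t where "t = \<delta> / (2 * \<Delta>)"
  have t: "0 < t" "t < 1" using \<delta> D by (auto simp: t_def)
  define x1 where "x1 = (1 - t) *\<^sub>R x2 + t *\<^sub>R c"
  have "x1 = x2 - t *\<^sub>R (x2 - c)" by (simp add: x1_def algebra_simps)
  then have i: "x1 \<in> interior \<Omega>" using mem_interior_convex_shrink[OF \<Omega>(2) c x2(1), of t] t by simp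
  have "u x1 \<le> (1 - t) * u x2 + t * u c" unfolding x1_def by (rule convex_onD[OF u(1)]) (use t x2 cO in auto)
  moreover have "\<xi>0 \<bullet> x1 + l0 = (1 - t) * (\<xi>0 \<bullet> x2 + l0) + t * (\<xi>0 \<bullet> c + l0)"
    by (simp add: x1_def inner_add_right algebra_simps)
  moreover have "(1 - t) * u x2 + t * u c < (1 - t) * (\<xi>0 \<bullet> x2 + l0) + t * (\<xi>0 \<bullet> c + l0)"
  proof -
    have "(1 - t) * (\<xi>0 \<bullet> x2 + l0) + t * (\<xi>0 \<bullet> c + l0) - ((1 - t) * u x2 + t * u c) = \<delta> - t * (\<delta> - (\<xi>0 \<bullet> c + l0 - u c))"
      by (simp add: \<delta>_def algebra_simps)
    moreover have "t * (\<delta> - (\<xi>0 \<bullet> c + l0 - u c)) \<le> t * \<Delta>" using t by (intro mult_left_mono) (auto simp: \<Delta>_def)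
    moreover have "t * \<Delta> = \<delta> / 2" using D \<delta> by (simp add: t_def)
    ultimately show ?thesis using \<delta> by linarith
  qed
  ultimately have "u x1 < \<xi>0 \<bullet> x1 + l0" by linarith
  moreover have "\<xi>0 \<bullet> x + l0 < z" if "(x, z) \<in> sing BD" for x z
  proof -
    have "(x, z) \<in> ?K" using that hull_subset[of "sing BD" convex] closure_subset by blast
    then show ?thesis using ab(2)[of "(x, z)"] l(1) by (simp add: a)
  qed
  ultimately show ?thesis using that[of \<xi>0 l0 x1] top l(1) i by blast
qed

text \<open>A contact point below the cutting plane is not singular, so \<open>sing_vertical\<close>
  excludes that it lies over the frontier of \<open>\<Omega>\<close>. This is where vertical
  boundary parts of the body are avoided.\<close>

lemma exact_minimiser:
  assumes l: "\<And>x z. (x, z) \<in> sing BD \<Longrightarrow> l x < z"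
    and yw: "(y, w) \<in> C" "w < l y" and min: "\<And>v. v \<in> C \<Longrightarrow> p \<bullet> fst v - snd v \<le> p \<bullet> y - w"
  shows "y \<in> interior \<Omega>" "w = u y" "subgrad_on \<Omega> u y p"
proof -
  have minB: "p \<bullet> fst v - snd v \<le> p \<bullet> y - w" if "v \<in> BD" for v using min that closure_subset by blast
  show y: "y \<in> interior \<Omega>"
  proof (rule ccontr)
    assume "y \<notin> interior \<Omega>"
    then have "(y, w) \<in> sing BD"
    proof (rule sing_vertical)
      show "(y, w) \<in> frontier BD" by (rule frontier_slope[OF yw(1) minB])
      show "plane_of_support BD (y, w) {v. (p, -1::real) \<bullet> v = p \<bullet> y - w}" by (rule plane_of_support_slope[OF yw(1) minB])
      show "(y, w + 1) \<notin> {v. (p, -1::real) \<bullet> v = p \<bullet> y - w}" by simp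
    qed
    then show False using l yw(2) by fastforce
  qed
  have yO: "y \<in> \<Omega>" using y interior_subset by blast
  show w: "w = u y" using C_interior[OF yw(1) y] min[OF C_mem[OF yO]] by simp
  show "subgrad_on \<Omega> u y p"
    unfolding subgrad_on_def using min[OF C_mem] w by (force simp: inner_diff_right)
qed

text \<open>A contact point of slope \<open>\<xi>0\<close> lies at least \<open>\<delta>\<close>
  below the cutting plane, and changing the slope by \<open>\<rho>\<close> costs at most
  \<open>2 * R * \<rho>\<close>; the denominator \<open>2 * R + 1\<close> leaves this strictly below
  \<open>\<delta>\<close>.\<close>

lemma slopes_near:
  assumes x1: "x1 \<in> \<Omega>" "u x1 < \<xi>0 \<bullet> x1 + l0"
  obtains \<rho> where "\<rho> > 0" "\<And>p y w. norm (p - \<xi>0) \<le> \<rho> \<Longrightarrow> (y, w) \<in> C \<Longrightarrow>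
    (\<And>v. v \<in> C \<Longrightarrow> p \<bullet> fst v - snd v \<le> p \<bullet> y - w) \<Longrightarrow> w < \<xi>0 \<bullet> y + l0"
proof -
  obtain R where R: "\<And>x. x \<in> \<Omega> \<Longrightarrow> norm x \<le> R" using compact_imp_bounded[OF \<Omega>(1)] unfolding bounded_iff by blast
  have R0: "R \<ge> 0" using R[OF x1(1)] norm_ge_zero order_trans by blast
  define \<delta> where "\<delta> = \<xi>0 \<bullet> x1 + l0 - u x1"
  have \<delta>: "\<delta> > 0" using x1 by (simp add: \<delta>_def)
  show ?thesis
  proof (rule that[of "\<delta> / (2 * R + 1)"])
    show "0 < \<delta> / (2 * R + 1)" using \<delta> R0 by simp
    fix p y w assume p: "norm (p - \<xi>0) \<le> \<delta> / (2 * R + 1)" and yw: "(y, w) \<in> C"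
      and min: "\<And>v. v \<in> C \<Longrightarrow> p \<bullet> fst v - snd v \<le> p \<bullet> y - w"
    have yO: "y \<in> \<Omega>" using yw C_subset by auto
    have "norm (y - x1) \<le> 2 * R" using R[OF yO] R[OF x1(1)] norm_triangle_ineq4[of y x1] by linarith
    then have "(p - \<xi>0) \<bullet> (y - x1) \<le> (\<delta> / (2 * R + 1)) * (2 * R)"
      using p R0 \<delta> by (intro order_trans[OF norm_cauchy_schwarz] mult_mono) auto
    also have "\<dots> < \<delta>"
    proof -
      have "\<And>c::real. c > 0 \<Longrightarrow> \<delta> / c * (c - 1) = \<delta> - \<delta> / c" by (simp add: right_diff_distrib)
      from this[of "2 * R + 1"] show ?thesis using \<delta> R0 by simp
    qed
    finally have "(p - \<xi>0) \<bullet> (y - x1) < \<delta>" .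
    moreover have "p \<bullet> x1 - u x1 \<le> p \<bullet> y - w" using min[OF C_mem[OF x1(1)]] by simp
    ultimately show "w < \<xi>0 \<bullet> y + l0" by (simp add: \<delta>_def inner_diff_left inner_diff_right)
  qed
qed

end

lemma compact_pos_lower_bound:
  fixes h :: "'a::topological_space \<Rightarrow> real"
  assumes "compact K" "continuous_on K h" "\<And>x. x \<in> K \<Longrightarrow> h x > 0"
  obtains d where "d > 0" "\<And>x. x \<in> K \<Longrightarrow> d \<le> h x"
proof (cases "K = {}")
  case True
  then show ?thesis using that[of 1] by simp
next
  case False
  then obtain x where "x \<in> K" "\<And>y. y \<in> K \<Longrightarrow> h x \<le> h y" using continuous_attains_inf[OF assms(1) _ assms(2)] by blast
  then show ?thesis using that[of "h x"] assms(3) by simp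
qed

context convex_fun
begin

lemma low_le_u:
  assumes "\<rho> > 0" "x \<in> \<Omega>" shows "compact_convex.low C \<xi> \<rho> x \<le> u x"
proof -
  interpret cc: compact_convex C \<xi> \<rho> using compact_C assms(1) by unfold_locales
  show ?thesis using cc.low_le[OF C_mem[OF assms(2)], of x] by simp
qed

text \<open>The supporting plane of slope \<open>q\<close> at \<open>x\<close> lies below
  \<open>C\<close>, and the penalty makes up for the difference between \<open>q\<close> and
  \<open>\<xi>\<close>.\<close>

lemma low_eq_u:
  assumes \<rho>: "\<rho> > 0" and x: "x \<in> \<Omega>" and q: "subgrad_on \<Omega> u x q" "norm (q - \<xi>) \<le> \<rho>"
  shows "compact_convex.low C \<xi> \<rho> x = u x"
proof (rule antisym)
  interpret cc: compact_convex C \<xi> \<rho> using compact_C \<rho> by unfold_locales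
  obtain z where z: "z \<in> C" "cc.low x = snd z + cc.pen (x - fst z)" by (rule cc.low_attained[of x])
  let ?h = "x - fst z"
  have "u x + q \<bullet> (fst z - x) \<le> snd z" by (rule C_above[OF _ q(1)]) (use z(1) in simp)
  moreover have "q \<bullet> (fst z - x) = - (q \<bullet> ?h)" by (simp add: inner_diff_right)
  moreover have "(q - \<xi>) \<bullet> ?h \<le> \<rho> * norm ?h"
    using order_trans[OF norm_cauchy_schwarz mult_right_mono[OF q(2) norm_ge_zero]] .
  moreover have "(q - \<xi>) \<bullet> ?h = q \<bullet> ?h - \<xi> \<bullet> ?h" by (rule inner_diff_left)
  moreover have "cc.low x = snd z + (\<xi> \<bullet> ?h + \<rho> * norm ?h + ?h \<bullet> ?h)" using z(2) by (simp only: cc.pen_def)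
  ultimately show "u x \<le> cc.low x" using inner_ge_zero[of ?h] by linarith
qed (rule low_le_u[OF \<rho> x])

text \<open>By contradiction and compactness: approximate contact points with gaps tending to zero
  accumulate at an exact contact point \<open>(y, w)\<close> for some slope \<open>p0\<close>. There
  \<open>y\<close> is interior and \<open>p0\<close> is the only subgradient, so the required
  properties hold in a whole neighbourhood of \<open>y\<close>.\<close>

lemma cap_region:
  fixes l :: "real^2 \<Rightarrow> real"
  assumes sing: "\<And>x z. (x, z) \<in> sing BD \<Longrightarrow> l x < z" and l: "continuous_on UNIV l"
    and slopes: "\<And>p y w. norm (p - \<xi>) \<le> r \<Longrightarrow> (y, w) \<in> C \<Longrightarrow>
      (\<And>v. v \<in> C \<Longrightarrow> p \<bullet> fst v - snd v \<le> p \<bullet> y - w) \<Longrightarrow> w < l y"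
    and r: "0 < r" "r < \<rho>"
  defines "g \<equiv> compact_convex.low C \<xi> \<rho>"
  obtains \<eta> where "\<eta> > 0" "\<And>x p. norm (p - \<xi>) \<le> r \<Longrightarrow> g x + lconj g p - p \<bullet> x \<le> \<eta> \<Longrightarrow>
    x \<in> interior \<Omega> \<and> u x < l x \<and> g x = u x \<and> (\<exists>q. subgrad_on \<Omega> u x q \<and> norm (q - \<xi>) \<le> \<rho>)"
proof (rule ccontr)
  assume no: "\<not> thesis"
  have \<rho>: "\<rho> > 0" using r by simp
  interpret cc: compact_convex C \<xi> \<rho> using compact_C \<rho> by unfold_locales
  let ?good = "\<lambda>x. x \<in> interior \<Omega> \<and> u x < l x \<and> g x = u x \<and> (\<exists>q. subgrad_on \<Omega> u x q \<and> norm (q - \<xi>) \<le> \<rho>)"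
  have "\<exists>x p. norm (p - \<xi>) \<le> r \<and> g x + lconj g p - p \<bullet> x \<le> 1 / real (Suc n) \<and> \<not> ?good x" for n
  proof (rule ccontr)
    assume a: "\<not> ?thesis"
    have good: "?good x" if "norm (p - \<xi>) \<le> r" "g x + lconj g p - p \<bullet> x \<le> 1 / real (Suc n)" for x p
      using a that by metis
    have thesis by (rule that[of "1 / real (Suc n)"]) (simp, rule good)
    then show False using no by contradiction
  qed
  then obtain x p where xp: "\<And>n. norm (p n - \<xi>) \<le> r" "\<And>n. g (x n) + lconj g (p n) - p n \<bullet> x n \<le> 1 / real (Suc n)"
    "\<And>n. \<not> ?good (x n)" by metis
  \<comment> \<open>The \<open>x n\<close> are arbitrary points of the plane; compactness is
    available for the points \<open>z n\<close> of \<open>C\<close> from which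
    \<open>low_near\<close> reaches them.\<close>
  let ?P = "\<lambda>n z. z \<in> C \<and> (\<rho> - r) * norm (x n - fst z) \<le> 1 / real (Suc n) \<and> snd z + cc.supp (p n) - p n \<bullet> fst z \<le> 1 / real (Suc n)"
  have "\<exists>z. ?P n z" for n
    by (rule cc.low_near[OF xp(1) r(2) xp(2)[unfolded g_def], of n]) (intro exI conjI)
  then have "\<forall>n. \<exists>z. ?P n z" by (rule allI)
  from choice[OF this] obtain z where zz: "\<forall>n. ?P n (z n)" by (rule exE)
  note z = conjunct1[OF spec[OF zz]] conjunct1[OF conjunct2[OF spec[OF zz]]] conjunct2[OF conjunct2[OF spec[OF zz]]]
  have cpt: "compact (cball \<xi> r \<times> C)" by (rule compact_Times[OF compact_cball compact_C(1)])
  have "p n \<in> cball \<xi> r" for n using xp(1)[of n] unfolding mem_cball dist_norm by (subst norm_minus_commute)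
  then have "(p n, z n) \<in> cball \<xi> r \<times> C" for n using z(1) by (rule SigmaI)
  then have "\<exists>l\<in>cball \<xi> r \<times> C. \<exists>k::nat \<Rightarrow> nat. strict_mono k \<and> ((\<lambda>n. (p n, z n)) \<circ> k) \<longlonglongrightarrow> l"
    by (intro cpt[unfolded compact_def, rule_format])
  then obtain a k where a: "a \<in> cball \<xi> r \<times> C" and k: "strict_mono (k :: nat \<Rightarrow> nat)" "((\<lambda>n. (p n, z n)) \<circ> k) \<longlonglongrightarrow> a"
    by (elim bexE exE conjE)
  obtain p0 y w where a': "a = (p0, (y, w))" by (metis surj_pair)
  have pk: "(\<lambda>n. p (k n)) \<longlonglongrightarrow> p0" and zk: "(\<lambda>n. z (k n)) \<longlonglongrightarrow> (y, w)"
    using tendsto_fst[OF k(2)] tendsto_snd[OF k(2)] by (simp_all add: a' o_def)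
  have p0: "norm (p0 - \<xi>) \<le> r" and yw: "(y, w) \<in> C"
    using a unfolding a' mem_Times_iff fst_conv snd_conv mem_cball dist_norm by (simp_all only: norm_minus_commute[of \<xi>])
  have lim0: "(\<lambda>n. 1 / real (Suc (k n))) \<longlonglongrightarrow> 0"
    using LIMSEQ_subseq_LIMSEQ[OF LIMSEQ_Suc[OF lim_const_over_n[of 1]] k(1)] by (simp add: o_def)
  have min: "p0 \<bullet> fst v - snd v \<le> p0 \<bullet> y - w" if v: "v \<in> C" for v
  proof -
    have "p (k n) \<bullet> fst v - snd v \<le> p (k n) \<bullet> fst (z (k n)) - snd (z (k n)) + 1 / real (Suc (k n))" for n
      using cc.supp_ge[OF v, of "p (k n)"] z(3)[of "k n"] by linarith
    moreover have "(\<lambda>n. p (k n) \<bullet> fst v - snd v) \<longlonglongrightarrow> p0 \<bullet> fst v - snd v"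
      by (intro tendsto_intros pk)
    moreover have "(\<lambda>n. p (k n) \<bullet> fst (z (k n)) - snd (z (k n)) + 1 / real (Suc (k n))) \<longlonglongrightarrow> p0 \<bullet> fst (y, w) - snd (y, w) + 0"
      by (intro tendsto_add tendsto_diff tendsto_inner tendsto_fst tendsto_snd pk zk lim0)
    ultimately have "p0 \<bullet> fst v - snd v \<le> p0 \<bullet> fst (y, w) - snd (y, w) + 0" by (intro LIMSEQ_le) auto
    then show ?thesis by simp
  qed
  have lt: "w < l y" by (rule slopes[OF p0 yw min])
  note ex = exact_minimiser[where l=l and y=y and w=w and p=p0, OF sing yw lt min]
  have reg: "(y, u y) \<notin> sing BD" using sing[of y "u y"] lt ex(2) by auto
  have bd: "\<bar>u x\<bar> \<le> M" if "x \<in> \<Omega>" for x using u(2)[OF that] by simp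
  have un: "q = p0" if "subgrad_on \<Omega> u y q" for q by (rule subgrad_unique[OF ex(1) reg that ex(3)])
  \<comment> \<open>\<open>\<rho> - r\<close> is the room between \<open>p0\<close>, which is within
    \<open>r\<close> of \<open>\<xi>\<close>, and the radius \<open>\<rho>\<close> required by
    \<open>low_eq_u\<close>.\<close>
  obtain d where d: "d > 0" "ball y d \<subseteq> \<Omega>" "\<And>x q. x \<in> ball y d \<Longrightarrow> subgrad_on \<Omega> u x q \<Longrightarrow> norm (q - p0) < \<rho> - r"
    using subgrad_on_near[OF u(1) ex(1) bd un, of "\<rho> - r"] r by (metis diff_gt_0_iff_gt)
  have op: "open (interior \<Omega> \<inter> {x. u x < l x} \<inter> ball y d)"
  proof -
    have "{x \<in> interior \<Omega>. u x < l x} = interior \<Omega> \<inter> (\<lambda>x. l x - u x) -` {0<..}" by auto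
    moreover have "open (interior \<Omega> \<inter> (\<lambda>x. l x - u x) -` {0<..})"
      by (intro continuous_open_preimage continuous_on_diff continuous_on_subset[OF l] continuous_interior) auto
    ultimately have "open {x \<in> interior \<Omega>. u x < l x}" by simp
    moreover have "interior \<Omega> \<inter> {x. u x < l x} = {x \<in> interior \<Omega>. u x < l x}" by auto
    ultimately show ?thesis by (metis open_Int open_ball)
  qed
  have yin: "y \<in> interior \<Omega> \<inter> {x. u x < l x} \<inter> ball y d" using ex(1,2) lt d(1) by simp
  have xk: "(\<lambda>n. x (k n)) \<longlonglongrightarrow> y"
  proof -
    have "norm (x (k n) - fst (z (k n))) \<le> (1 / real (Suc (k n))) / (\<rho> - r)" for n
      using z(2)[of "k n"] r(2) by (simp only: pos_le_divide_eq diff_gt_0_iff_gt mult.commute)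
    then have ev: "\<forall>\<^sub>F n in sequentially. norm (x (k n) - fst (z (k n))) \<le> (1 / real (Suc (k n))) / (\<rho> - r)"
      by (intro always_eventually allI)
    have "(\<lambda>n. (1 / real (Suc (k n))) / (\<rho> - r)) \<longlonglongrightarrow> 0 / (\<rho> - r)"
      by (rule tendsto_divide[OF lim0 tendsto_const]) (use r in simp)
    then have "(\<lambda>n. (1 / real (Suc (k n))) / (\<rho> - r)) \<longlonglongrightarrow> 0" by (simp only: div_0)
    from Lim_null_comparison[OF ev this] have "(\<lambda>n. x (k n) - fst (z (k n))) \<longlonglongrightarrow> 0" .
    then have "(\<lambda>n. (x (k n) - fst (z (k n))) + fst (z (k n))) \<longlonglongrightarrow> 0 + fst (y, w)"
      by (intro tendsto_add tendsto_fst zk)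
    then show ?thesis by simp
  qed
  have "eventually (\<lambda>n. x (k n) \<in> interior \<Omega> \<inter> {x. u x < l x} \<inter> ball y d) sequentially"
    by (rule topological_tendstoD[OF xk op yin])
  then obtain n where n: "x (k n) \<in> interior \<Omega>" "u (x (k n)) < l (x (k n))" "x (k n) \<in> ball y d"
    unfolding eventually_sequentially by blast
  obtain q where q: "subgrad_on \<Omega> u (x (k n)) q" using subgrad_on_exists[OF u(1) n(1)] .
  have "norm (q - \<xi>) \<le> norm (q - p0) + norm (p0 - \<xi>)" using norm_triangle_ineq[of "q - p0" "p0 - \<xi>"] by simp
  then have q2: "norm (q - \<xi>) \<le> \<rho>" using d(3)[OF n(3) q] p0 by linarith
  have "g (x (k n)) = u (x (k n))"
    unfolding g_def by (rule low_eq_u[OF \<rho> subsetD[OF interior_subset n(1)] q q2])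
  then show False using xp(3)[of "k n"] n q q2 by metis
qed

text \<open>At a point outside \<open>K\<close> an affine minorant of \<open>u\<close> stays below \<open>v\<close> on \<open>K\<close>: otherwise \<open>v\<close>, being convex
  along the segment to that point, would be below it just outside \<open>K\<close>, where \<open>v = u\<close>.\<close>

lemma convex_glue:
  assumes K: "compact K" "K \<subseteq> D" and D: "open D" "D \<subseteq> interior \<Omega>" and v: "convex_on UNIV v"
    and le: "\<And>x. x \<in> \<Omega> \<Longrightarrow> x \<notin> K \<Longrightarrow> v x \<le> u x" and eq: "\<And>x. x \<in> D \<Longrightarrow> x \<notin> K \<Longrightarrow> v x = u x"
  shows "convex_on \<Omega> (\<lambda>x. if x \<in> K then v x else u x)"
proof -
  let ?w = "\<lambda>x. if x \<in> K then v x else u x"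
  have wv: "v x \<le> ?w x" if "x \<in> \<Omega>" for x using le[OF that] by simp
  \<comment> \<open>Convexity will follow at interior points from an affine minorant touching there,
    both inside \<open>K\<close> and outside.\<close>
  have minorant: "\<exists>p. subgrad_on \<Omega> ?w x p" if x: "x \<in> interior \<Omega>" for x
  proof (cases "x \<in> K")
    case True
    obtain p where p: "subgrad v x p" using subgrad_exists[OF v] .
    have "?w x + p \<bullet> (y - x) \<le> ?w y" if "y \<in> \<Omega>" for y
    proof -
      have "v x + p \<bullet> (y - x) \<le> v y" using p unfolding subgrad_def by blast
      then show ?thesis using True wv[OF that] by simp
    qed
    then show ?thesis unfolding subgrad_on_def by blast
  next
    case False
    obtain p where p: "subgrad_on \<Omega> u x p" using subgrad_on_exists[OF u(1) x] .
    let ?a = "\<lambda>y. u x + p \<bullet> (y - x)"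
    have ua: "?a y \<le> u y" if "y \<in> \<Omega>" for y using p that by (simp add: subgrad_on_def)
    have xO: "x \<in> \<Omega>" using x interior_subset by blast
    have "?a y \<le> v y" if y: "y \<in> K" for y
    proof (rule ccontr)
      assume lt: "\<not> ?a y \<le> v y"
      let ?z = "\<lambda>s. (1 - s) *\<^sub>R y + s *\<^sub>R x"
      have cz: "continuous_on S ?z" for S by (intro continuous_intros)
      let ?A = "{0..1} \<inter> ?z -` K"
      have cA: "compact ?A" by (intro compact_Int_closed compact_Icc closed_vimage compact_imp_closed[OF K(1)] cz)
      have "0 \<in> ?A" using y by simp
      then have "?A \<noteq> {}" by (metis emptyE)
      from compact_attains_sup[OF cA this] obtain s0 where s0: "s0 \<in> ?A" "\<And>s. s \<in> ?A \<Longrightarrow> s \<le> s0" by (elim bexE) blast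
      have s0': "0 \<le> s0" "s0 \<le> 1" "?z s0 \<in> K" using s0(1) by auto
      have "s0 \<noteq> 1" using s0'(3) False by auto
      then have s01: "s0 < 1" using s0' by simp
      have oD: "open (?z -` D)" by (intro open_vimage D(1) cz)
      have "s0 \<in> ?z -` D" using s0'(3) K(2) by auto
      then obtain d where d: "d > 0" "ball s0 d \<subseteq> ?z -` D" by (rule openE[OF oD])
      define s1 where "s1 = s0 + min (d / 2) ((1 - s0) / 2)"
      have s1: "s0 < s1" "s1 < 1" "s1 \<in> ball s0 d" using d s01 by (auto simp: s1_def dist_real_def min_def field_simps)
      have zD: "?z s1 \<in> D" using d(2) s1(3) by blast
      have zK: "?z s1 \<notin> K"
      proof
        assume "?z s1 \<in> K"
        then have "s1 \<in> ?A" using s1 s0' by simp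
        then show False using s0(2)[of s1] s1(1) by simp
      qed
      have zO: "?z s1 \<in> \<Omega>" using zD D(2) interior_subset by blast
      have "v (?z s1) \<le> (1 - s1) * v y + s1 * v x" by (rule convex_onD[OF v]) (use s1 s0' in auto)
      also have "\<dots> < (1 - s1) * ?a y + s1 * ?a x"
      proof -
        have "(1 - s1) * v y < (1 - s1) * ?a y" using lt s1(2) by simp
        moreover have "s1 * v x \<le> s1 * ?a x" using le[OF xO False] s1(1) s0'(1) by (intro mult_left_mono) auto
        ultimately show ?thesis by linarith
      qed
      also have "\<dots> = ?a (?z s1)" by (simp add: inner_diff_right inner_add_right algebra_simps)
      also have "\<dots> \<le> v (?z s1)" using ua[OF zO] eq[OF zD zK] by simp
      finally show False by simp
    qed
    then have "subgrad_on \<Omega> ?w x p" using ua False by (simp add: subgrad_on_def)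
    then show ?thesis by blast
  qed
  have KO: "K \<subseteq> interior \<Omega>" using K(2) D(2) by (rule subset_trans)
  show ?thesis
  proof (rule convex_onI)
    show "convex \<Omega>" by (rule \<Omega>(2))
    fix t :: real and a b assume t: "0 < t" "t < 1" and ab: "a \<in> \<Omega>" "b \<in> \<Omega>"
    let ?m = "(1 - t) *\<^sub>R a + t *\<^sub>R b"
    show "?w ?m \<le> (1 - t) * ?w a + t * ?w b"
    proof (cases "?m \<in> interior \<Omega>")
      case True
      then obtain p where p: "subgrad_on \<Omega> ?w ?m p" using minorant by blast
      have "a - ?m = t *\<^sub>R (a - b)" "b - ?m = (1 - t) *\<^sub>R (b - a)" by (simp_all add: algebra_simps)
      then have e: "?w ?m + p \<bullet> (t *\<^sub>R (a - b)) \<le> ?w a" "?w ?m + p \<bullet> ((1 - t) *\<^sub>R (b - a)) \<le> ?w b"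
        using p ab unfolding subgrad_on_def by metis+
      have "(1 - t) * (?w ?m + p \<bullet> (t *\<^sub>R (a - b))) + t * (?w ?m + p \<bullet> ((1 - t) *\<^sub>R (b - a))) = ?w ?m"
        by (simp add: inner_diff_right algebra_simps)
      moreover have "(1 - t) * (?w ?m + p \<bullet> (t *\<^sub>R (a - b))) \<le> (1 - t) * ?w a" "t * (?w ?m + p \<bullet> ((1 - t) *\<^sub>R (b - a))) \<le> t * ?w b"
        by (rule mult_left_mono[OF e(1)], use t in simp, rule mult_left_mono[OF e(2)], use t in simp)
      moreover have "\<And>a b c x y :: real. a + b = c \<Longrightarrow> a \<le> x \<Longrightarrow> b \<le> y \<Longrightarrow> c \<le> x + y" by linarith
      ultimately show ?thesis by blast
    next
      case False
      \<comment> \<open>If an inner point of the chord is on the frontier of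
        \<open>\<Omega>\<close>, so are both ends; then all three points avoid \<open>K\<close> and
        convexity of \<open>u\<close> applies.\<close>
      have "?m = b - (1 - t) *\<^sub>R (b - a)" "?m = a - t *\<^sub>R (a - b)" by (simp_all add: algebra_simps)
      then have "a \<notin> interior \<Omega>" "b \<notin> interior \<Omega>"
        using False mem_interior_convex_shrink[OF \<Omega>(2), of a b "1 - t"] mem_interior_convex_shrink[OF \<Omega>(2), of b a t] t ab by auto
      then have "a \<notin> K" "b \<notin> K" "?m \<notin> K" using KO False by auto
      then show ?thesis using convex_onD[OF u(1), of t a b] t ab by simp
    qed
  qed
qed

end

section \<open>Competitors of the minimiser\<close>

lemma grad_cong_open:
  assumes "open S" "x \<in> S" "\<And>y. y \<in> S \<Longrightarrow> v y = w y"
  shows "grad v x = grad w x"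
proof -
  have "gderiv v x = gderiv w x"
    using gderiv_transform_open[OF _ assms(1,2), of v _ w] gderiv_transform_open[OF _ assms(1,2), of w _ v] assms(3)
    by (intro ext iffI) metis+
  then show ?thesis unfolding grad_def by simp
qed

context convex_fun
begin

text \<open>Transfers minimality from \<open>F\<close> to \<open>\<Phi>\<close>. The competitor is
  \<open>lconj V\<close> on \<open>K\<close> and \<open>u\<close> elsewhere; \<open>room\<close>
  keeps it between \<open>0\<close> and \<open>M\<close>, since \<open>lconj V\<close> differs from
  \<open>g\<close> by at most \<open>\<eta>\<close>. Its integrand differs from that of
  \<open>u\<close> by an integrable function supported in \<open>K\<close>, so it satisfies
  \<open>F_defined\<close>.\<close>

lemma competitor:
  assumes cap: "cap g K D \<xi> r \<eta>" and DO: "D \<subseteq> interior \<Omega>" and gu: "\<And>x. x \<in> \<Omega> \<Longrightarrow> g x \<le> u x" "\<And>x. x \<in> D \<Longrightarrow> g x = u x"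
    and room: "\<And>x. x \<in> K \<Longrightarrow> \<eta> \<le> u x \<and> \<eta> \<le> M - u x"
    and f: "continuous_on UNIV f" and min: "minimizes_F \<Omega> M f u"
    and V: "cap.adm g \<xi> r \<eta> V" and gd: "AE x in lborel. x \<in> K \<longrightarrow> GDERIV (lconj V) x :> rgrad (lconj V) x"
  shows "cap.\<Phi> K f (lconj g) \<le> cap.\<Phi> K f V"
proof -
  interpret cp: cap g K D \<xi> r \<eta> by (rule cap)
  note v = cp.adm_lconj[OF V]
  define w where "w = (\<lambda>x. if x \<in> K then lconj V x else u x)"
  have KO: "K \<subseteq> \<Omega>" using cp.K(2) DO interior_subset by (meson subset_trans)
  have out: "lconj V x = g x" if "x \<notin> K" for x by (rule cp.adm_outside[OF V that])
  have wD: "w x = lconj V x" if "x \<in> D" for x using out[of x] gu(2)[OF that] by (simp add: w_def)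
  have "convex_on \<Omega> w"
    unfolding w_def
  proof (rule convex_glue[OF cp.K cp.D DO v(1)])
    show "lconj V x \<le> u x" if "x \<in> \<Omega>" "x \<notin> K" for x using out[OF that(2)] gu(1)[OF that(1)] by simp
    show "lconj V x = u x" if "x \<in> D" "x \<notin> K" for x using out[OF that(2)] gu(2)[OF that(1)] by simp
  qed
  moreover have "0 \<le> w x \<and> w x \<le> M" if x: "x \<in> \<Omega>" for x
  proof (cases "x \<in> K")
    case True
    have "\<bar>lconj V x - g x\<bar> \<le> \<eta>" using V by (intro cp.adm_close) (simp_all add: cp.adm_def)
    moreover have "g x = u x" using gu(2) True cp.K(2) by blast
    ultimately show ?thesis using room[OF True] True by (auto simp: w_def abs_le_iff)
  next
    case False
    then show ?thesis using u(2)[OF x] by (simp add: w_def)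
  qed
  ultimately have wC: "w \<in> convex_class \<Omega> M" by (simp add: convex_class_def)
  have opO: "open (interior \<Omega> - K)" by (intro open_Diff open_interior compact_imp_closed cp.K)
  let ?h1 = "\<lambda>x. indicat_real \<Omega> x *\<^sub>R f (grad u x)"
  let ?hw = "\<lambda>x. indicat_real \<Omega> x *\<^sub>R f (grad w x)"
  let ?k = "\<lambda>v x. indicat_real K x *\<^sub>R f (rgrad (lconj v) x)"
  \<comment> \<open>The frontier of \<open>\<Omega>\<close> is left out as a null set, because
    \<open>grad\<close> there depends on values outside \<open>\<Omega>\<close>.\<close>
  have ae: "AE x in lborel. ?h1 x + (?k V x - ?k (lconj g) x) = ?hw x"
  proof -
    have "AE x in lborel. x \<notin> frontier \<Omega>" by (intro AE_not_in frontier_null \<Omega>)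
    with gd show ?thesis
    proof eventually_elim
      case (elim x)
      consider "x \<in> K" | "x \<notin> K" "x \<in> interior \<Omega>" | "x \<notin> \<Omega>"
        using elim closure_subset[of \<Omega>] by (auto simp: frontier_def)
      then show ?case
      proof cases
        case 1
        have xD: "x \<in> D" using 1 cp.K(2) by blast
        have "grad w x = grad (lconj V) x" by (rule grad_cong_open[OF cp.D xD wD])
        also have "\<dots> = rgrad (lconj V) x" using elim 1 by (intro gderiv_grad) simp
        finally have "grad w x = rgrad (lconj V) x" .
        moreover have "grad u x = rgrad g x"
        proof -
          have "grad u x = grad g x" by (rule grad_cong_open[OF cp.D xD]) (simp only: gu(2))
          also have "\<dots> = rgrad g x"
            using gderiv_grad[OF cp.adm2_gderiv[OF cp.adm_U(2) xD]] by (simp only: cp.U(3))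
          finally show ?thesis .
        qed
        moreover have "x \<in> \<Omega>" using 1 KO by blast
        ultimately show ?thesis using 1 by (simp add: cp.U(3))
      next
        case 2
        have "grad w x = grad u x" by (rule grad_cong_open[OF opO]) (use 2 in \<open>auto simp: w_def\<close>)
        then show ?thesis using 2 by simp
      next
        case 3
        then show ?thesis using KO by (auto simp: indicator_def)
      qed
    qed
  qed
  have i1: "integrable lebesgue ?h1" using min by (simp add: minimizes_F_def F_defined_def set_integrable_def)
  have kb: "integrable lborel (?k v)" if "cp.adm v" for v
    using cp.\<Phi>_integrable[OF f that] by (simp add: set_integrable_def)
  have ik: "integrable lebesgue (?k v)" "(\<integral>x. ?k v x \<partial>lebesgue) = cp.\<Phi> f v" if "cp.adm v" for v
  proof -
    have m: "?k v \<in> borel_measurable lborel" by (rule borel_measurable_integrable[OF kb[OF that]])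
    show "integrable lebesgue (?k v)" using kb[OF that] integrable_completion[OF m] by simp
    show "(\<integral>x. ?k v x \<partial>lebesgue) = cp.\<Phi> f v"
      using integral_completion[OF m] by (simp add: cp.\<Phi>_def set_lebesgue_integral_def)
  qed
  note iV = ik[OF V] and iU = ik[OF cp.adm_U(1)]
  have isum: "integrable lebesgue (\<lambda>x. ?h1 x + (?k V x - ?k (lconj g) x))"
    by (intro Bochner_Integration.integrable_add Bochner_Integration.integrable_diff i1 iV(1) iU(1))
  have aeL: "AE x in lebesgue. ?h1 x + (?k V x - ?k (lconj g) x) = ?hw x" by (rule AE_completion[OF ae])
  have mw: "?hw \<in> borel_measurable lebesgue" by (rule borel_measurable_AE[OF borel_measurable_integrable[OF isum] aeL])
  have iw: "integrable lebesgue ?hw" by (rule integrable_cong_AE_imp[OF isum mw]) (use aeL in \<open>simp add: eq_commute\<close>)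
  then have "F_defined \<Omega> f w" by (simp add: F_defined_def set_integrable_def)
  then have "F \<Omega> f u \<le> F \<Omega> f w" using min wC by (simp add: minimizes_F_def)
  also have "F \<Omega> f w = (\<integral>x. ?hw x \<partial>lebesgue)" by (simp add: F_def set_lebesgue_integral_def)
  also have "\<dots> = (\<integral>x. ?h1 x + (?k V x - ?k (lconj g) x) \<partial>lebesgue)"
    by (rule integral_cong_AE[OF mw borel_measurable_integrable[OF isum]]) (use aeL in \<open>simp add: eq_commute\<close>)
  also have "\<dots> = (\<integral>x. ?h1 x \<partial>lebesgue) + ((\<integral>x. ?k V x \<partial>lebesgue) - (\<integral>x. ?k (lconj g) x \<partial>lebesgue))"
    by (simp only: Bochner_Integration.integral_add[OF i1 Bochner_Integration.integrable_diff[OF iV(1) iU(1)]]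
        Bochner_Integration.integral_diff[OF iV(1) iU(1)])
  also have "(\<integral>x. ?h1 x \<partial>lebesgue) = F \<Omega> f u" by (simp add: F_def set_lebesgue_integral_def)
  finally show ?thesis unfolding iV(2) iU(2) by simp
qed

lemma local_definiteness:
  fixes f :: "real^2 \<Rightarrow> real"
  assumes f: "C2 f" and ne: "smallest_eigenvalue (hessian f \<xi>) \<noteq> 0"
  obtains (indefinite) e \<rho> where "\<rho> > 0" "norm e = 1" "\<And>p. norm (p - \<xi>) \<le> \<rho> \<Longrightarrow> (hessian f p *v e) \<bullet> e < 0"
    | (definite) d where "d > 0" "\<And>q. norm (q - \<xi>) < d \<Longrightarrow> q \<noteq> \<xi> \<Longrightarrow> f \<xi> + grad f \<xi> \<bullet> (q - \<xi>) < f q"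
proof (rule definite_cases[OF hessian_symmetric[OF f] ne])
  fix e assume e: "norm e = 1" "(hessian f \<xi> *v e) \<bullet> e < 0"
  have "open {p. (hessian f p *v e) \<bullet> e < 0}"
    by (rule open_Collect_less[OF continuous_hessian_form[OF f] continuous_on_const])
  then obtain d where d: "d > 0" "ball \<xi> d \<subseteq> {p. (hessian f p *v e) \<bullet> e < 0}"
    by (rule openE[of _ \<xi>]) (use e in auto)
  show thesis
  proof (rule indefinite[of "d / 2" e])
    fix p assume "norm (p - \<xi>) \<le> d / 2"
    then have "p \<in> ball \<xi> d" using d(1) by (simp add: dist_norm norm_minus_commute)
    then show "(hessian f p *v e) \<bullet> e < 0" using d(2) by blast
  qed (use d e in auto)
next
  assume pos: "\<And>e. e \<noteq> 0 \<Longrightarrow> (hessian f \<xi> *v e) \<bullet> e > 0"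
  show thesis
  proof (rule strictly_above_tangent[OF f])
    show "(hessian f \<xi> *v e) \<bullet> e > 0" if "e \<noteq> 0" for e by (rule pos[OF that])
    fix d assume "d > 0" "\<And>q. norm (q - \<xi>) < d \<Longrightarrow> q \<noteq> \<xi> \<Longrightarrow> f \<xi> + grad f \<xi> \<bullet> (q - \<xi>) < f q"
    then show thesis by (rule definite)
  qed
qed

lemma minimizer_body:
  assumes f: "C2 f" and nd: "nowhere_dense {\<xi>. smallest_eigenvalue (hessian f \<xi>) = 0}"
    and cl: "closed {\<xi>. smallest_eigenvalue (hessian f \<xi>) = 0}" and min: "minimizes_F \<Omega> M f u"
  shows "C \<subseteq> closure (convex hull sing BD)"
proof (rule ccontr)
  assume ne: "\<not> C \<subseteq> closure (convex hull sing BD)"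
  show False
  proof (rule separation[OF ne])
  fix \<xi>0 l0 x1 assume top: "\<And>x. x \<in> \<Omega> \<Longrightarrow> \<xi>0 \<bullet> x + l0 < M" and sing: "\<And>x z. (x, z) \<in> sing BD \<Longrightarrow> \<xi>0 \<bullet> x + l0 < z"
    and x1: "x1 \<in> interior \<Omega>" "u x1 < \<xi>0 \<bullet> x1 + l0"
  show False
  proof (rule slopes_near[OF subsetD[OF interior_subset x1(1)] x1(2)])
  fix \<rho>0 assume \<rho>0: "\<rho>0 > 0" and near: "\<And>p y w. norm (p - \<xi>0) \<le> \<rho>0 \<Longrightarrow> (y, w) \<in> C \<Longrightarrow>
    (\<And>v. v \<in> C \<Longrightarrow> p \<bullet> fst v - snd v \<le> p \<bullet> y - w) \<Longrightarrow> w < \<xi>0 \<bullet> y + l0"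
  let ?N = "{\<xi>. smallest_eigenvalue (hessian f \<xi>) = 0}"
  let ?O = "ball \<xi>0 (\<rho>0 / 2) - ?N"
  have opO: "open ?O" using cl by (intro open_Diff open_ball)
  have "?O \<noteq> {}"
  proof
    assume "?O = {}"
    then have "ball \<xi>0 (\<rho>0 / 2) \<subseteq> closure ?N" using closure_subset[of ?N] by blast
    then have "ball \<xi>0 (\<rho>0 / 2) \<subseteq> interior (closure ?N)" by (rule interior_maximal) simp
    then show False using nd \<rho>0 unfolding nowhere_dense_def by simp
  qed
  \<comment> \<open>A nonzero slope keeps the cut part of the graph off the constraint
    \<open>u \<ge> 0\<close>; an open set is never a single point, so one exists.\<close>
  moreover have "?O \<noteq> {0}" using opO not_open_singleton by metis
  ultimately obtain \<xi> where \<xi>: "\<xi> \<in> ?O" "\<xi> \<noteq> 0" by blast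
  have \<xi>N: "smallest_eigenvalue (hessian f \<xi>) \<noteq> 0" and \<xi>\<xi>0: "norm (\<xi> - \<xi>0) \<le> \<rho>0 / 2"
    using \<xi>(1) by (auto simp: dist_norm norm_minus_commute)
  let ?def = "\<exists>d>0. \<forall>q. norm (q - \<xi>) < d \<longrightarrow> q \<noteq> \<xi> \<longrightarrow> f \<xi> + grad f \<xi> \<bullet> (q - \<xi>) < f q"
  let ?indef = "\<lambda>\<rho>. \<exists>e. norm e = 1 \<and> (\<forall>p. norm (p - \<xi>) \<le> \<rho> \<longrightarrow> (hessian f p *v e) \<bullet> e < 0)"
  obtain \<rho>1 where \<rho>1: "\<rho>1 > 0" "?def \<or> ?indef \<rho>1"
  proof (rule local_definiteness[OF f \<xi>N])
    fix e \<rho> assume "\<rho> > 0" "norm e = 1" "\<And>p. norm (p - \<xi>) \<le> \<rho> \<Longrightarrow> (hessian f p *v e) \<bullet> e < 0"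
    then show thesis using that[of \<rho>] by blast
  next
    fix d assume "d > 0" "\<And>q. norm (q - \<xi>) < d \<Longrightarrow> q \<noteq> \<xi> \<Longrightarrow> f \<xi> + grad f \<xi> \<bullet> (q - \<xi>) < f q"
    then show thesis using that[of 1] by (metis zero_less_one)
  qed
  \<comment> \<open>The three bounds: contact points remain below the cutting plane, the Hessian
    keeps its sign, and the slope \<open>0\<close> is excluded.\<close>
  define \<rho> where "\<rho> = min (min (\<rho>0 / 2) \<rho>1) (norm \<xi> / 2)"
  define r where "r = \<rho> / 2"
  have \<rho>: "\<rho> > 0" "\<rho> \<le> \<rho>0 / 2" "\<rho> \<le> \<rho>1" "\<rho> < norm \<xi>"
  proof -
    have "norm \<xi> > 0" using \<xi>(2) by simp
    then show "\<rho> > 0" "\<rho> \<le> \<rho>0 / 2" "\<rho> \<le> \<rho>1" "\<rho> < norm \<xi>" using \<rho>0 \<rho>1(1) unfolding \<rho>_def by linarith+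
  qed
  have r: "0 < r" "r < \<rho>" using \<rho>(1) by (auto simp: r_def)
  define l where "l = (\<lambda>x. \<xi>0 \<bullet> x + l0)"
  have lc: "continuous_on UNIV l" unfolding l_def by (intro continuous_intros)
  have sl: "w < l y" if "norm (p - \<xi>) \<le> r" "(y, w) \<in> C" "\<And>v. v \<in> C \<Longrightarrow> p \<bullet> fst v - snd v \<le> p \<bullet> y - w" for p y w
  proof -
    have "norm (p - \<xi>0) \<le> norm (p - \<xi>) + norm (\<xi> - \<xi>0)" using norm_triangle_ineq[of "p - \<xi>" "\<xi> - \<xi>0"] by simp
    then have "norm (p - \<xi>0) \<le> \<rho>0" using that(1) \<xi>\<xi>0 r \<rho>(2) by linarith
    from near[OF this that(2,3)] show ?thesis by (simp only: l_def)
  qed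
  have sing': "l x < z" if "(x, z) \<in> sing BD" for x z using sing[OF that] by (simp only: l_def)
  interpret cc: compact_convex C \<xi> \<rho> using compact_C \<rho>(1) by unfold_locales
  let ?g = "cc.low"
  show False
  proof (rule cap_region[OF sing' lc sl r])
  fix \<eta>2 assume \<eta>2: "\<eta>2 > 0" and reg: "\<And>x p. norm (p - \<xi>) \<le> r \<Longrightarrow> ?g x + lconj ?g p - p \<bullet> x \<le> \<eta>2 \<Longrightarrow>
      x \<in> interior \<Omega> \<and> u x < l x \<and> ?g x = u x \<and> (\<exists>q. subgrad_on \<Omega> u x q \<and> norm (q - \<xi>) \<le> \<rho>)"
  \<comment> \<open>The sets of points with small gap for some slope near \<open>\<xi>\<close>:
    compact when the inequality is not strict, and contained in the open set \<open>D\<close> for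
    tolerances below \<open>\<eta>2\<close>.\<close>
  define Kf where "Kf = (\<lambda>\<eta>. {x. \<exists>p. norm (p - \<xi>) \<le> r \<and> ?g x + lconj ?g p - p \<bullet> x \<le> \<eta>})"
  define D where "D = (\<Union>p\<in>cball \<xi> r. {x. ?g x + lconj ?g p - p \<bullet> x < \<eta>2})"
  have gc: "continuous_on S ?g" for S by (rule convex_continuous[OF cc.convex_low])
  have Uc: "continuous_on S (lconj ?g)" for S by (rule convex_continuous[OF convex_lconj[OF cc.coercive_low]])
  have oD: "open D" unfolding D_def by (intro open_UN ballI open_Collect_less continuous_intros gc)
  have regD: "x \<in> interior \<Omega>" "u x < l x" "?g x = u x" "\<exists>q. subgrad_on \<Omega> u x q \<and> norm (q - \<xi>) \<le> \<rho>" if "x \<in> D" for x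
  proof -
    obtain p where p: "p \<in> cball \<xi> r" "?g x + lconj ?g p - p \<bullet> x < \<eta>2" using \<open>x \<in> D\<close> unfolding D_def by (elim UN_E) simp
    have "norm (p - \<xi>) \<le> r" using p(1) by (simp add: dist_norm norm_minus_commute)
    from reg[OF this less_imp_le[OF p(2)]] show "x \<in> interior \<Omega>" "u x < l x" "?g x = u x" "\<exists>q. subgrad_on \<Omega> u x q \<and> norm (q - \<xi>) \<le> \<rho>"
      by simp_all
  qed
  have KD: "Kf \<eta> \<subseteq> D" if "\<eta> < \<eta>2" for \<eta>
  proof
    fix x assume "x \<in> Kf \<eta>"
    then obtain p where p: "norm (p - \<xi>) \<le> r" "?g x + lconj ?g p - p \<bullet> x \<le> \<eta>" unfolding Kf_def by (elim CollectE exE conjE)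
    have "p \<in> cball \<xi> r" using p(1) by (simp add: dist_norm norm_minus_commute)
    then show "x \<in> D" unfolding D_def by (rule UN_I) (use p(2) that in simp)
  qed
  have DO: "D \<subseteq> interior \<Omega>" using regD(1) by (rule subsetI)
  have Kc: "compact (Kf \<eta>)" if "\<eta> < \<eta>2" for \<eta>
  proof -
    let ?T = "(\<Omega> \<times> cball \<xi> r) \<inter> {v. ?g (fst v) + lconj ?g (snd v) - snd v \<bullet> fst v \<le> \<eta>}"
    have "closed {v. ?g (fst v) + lconj ?g (snd v) - snd v \<bullet> fst v \<le> \<eta>}"
      by (intro closed_Collect_le continuous_intros continuous_on_compose2[OF gc[of UNIV]] continuous_on_compose2[OF Uc[of UNIV]]) simp_all
    then have "compact ?T" by (intro compact_Int_closed compact_Times \<Omega>(1) compact_cball)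
    then have "compact (fst ` ?T)" by (rule compact_continuous_image[OF continuous_on_fst[OF continuous_on_id]])
    moreover have "fst ` ?T = Kf \<eta>"
    proof (intro equalityI subsetI)
      fix x assume "x \<in> fst ` ?T"
      then obtain p where "norm (p - \<xi>) \<le> r" "?g x + lconj ?g p - p \<bullet> x \<le> \<eta>"
        by (auto simp: dist_norm norm_minus_commute)
      then show "x \<in> Kf \<eta>" unfolding Kf_def by (intro CollectI exI conjI)
    next
      fix x assume x: "x \<in> Kf \<eta>"
      then obtain p where p: "norm (p - \<xi>) \<le> r" "?g x + lconj ?g p - p \<bullet> x \<le> \<eta>" unfolding Kf_def by (elim CollectE exE conjE)
      have "x \<in> \<Omega>" using x KD[OF that] DO interior_subset by (meson subsetD)
      then have "(x, p) \<in> ?T" using p by (simp add: dist_norm norm_minus_commute)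
      then show "x \<in> fst ` ?T" by (rule image_eqI[rotated]) simp
    qed
    ultimately show ?thesis by (simp only:)
  qed
  have sub_on: "subgrad_on \<Omega> u x p" if "x \<in> D" "subgrad ?g x p" for x p
    unfolding subgrad_on_def
  proof
    fix y assume y: "y \<in> \<Omega>"
    have "?g x + p \<bullet> (y - x) \<le> ?g y" using that(2) unfolding subgrad_def by (rule spec)
    then show "u x + p \<bullet> (y - x) \<le> u y" using regD(3)[OF that(1)] low_le_u[OF \<rho>(1) y, of \<xi>] by linarith
  qed
  have uniq: "p = q" if "x \<in> D" "subgrad_on \<Omega> u x p" "subgrad_on \<Omega> u x q" for x p q
  proof (rule subgrad_unique[OF regD(1)[OF that(1)] _ that(2,3)])
    show "(x, u x) \<notin> sing BD" using sing'[of x "u x"] regD(2)[OF that(1)] by linarith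
  qed
  have h2: "\<eta>2 / 2 < \<eta>2" using \<eta>2 by simp
  obtain \<delta> where \<delta>: "\<delta> > 0" "\<And>x. x \<in> Kf (\<eta>2 / 2) \<Longrightarrow> \<delta> \<le> min (u x) (M - u x)"
  proof (rule compact_pos_lower_bound[OF Kc[OF h2], of "\<lambda>x. min (u x) (M - u x)"])
    show "continuous_on (Kf (\<eta>2 / 2)) (\<lambda>x. min (u x) (M - u x))"
      by (intro continuous_on_min continuous_on_diff continuous_on_const
          continuous_on_subset[OF continuous_interior subset_trans[OF KD[OF h2] DO]])
    fix x assume "x \<in> Kf (\<eta>2 / 2)"
    then have xD: "x \<in> D" using KD[OF h2] by (rule rev_subsetD)
    have xO: "x \<in> \<Omega>" using regD(1)[OF xD] interior_subset by (rule rev_subsetD)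
    have "u x < M" using regD(2)[OF xD] top[OF xO] unfolding l_def by linarith
    \<comment> \<open>Where \<open>u\<close> vanishes it has the subgradient \<open>0\<close>, but
      the only subgradient at a point of \<open>D\<close> is within
      \<open>\<rho> < norm \<xi>\<close> of \<open>\<xi>\<close>.\<close>
    moreover have "u x \<noteq> 0"
    proof
      assume "u x = 0"
      then have s0: "subgrad_on \<Omega> u x 0" using u(2) by (simp add: subgrad_on_def)
      obtain q where q: "subgrad_on \<Omega> u x q" "norm (q - \<xi>) \<le> \<rho>" using regD(4)[OF xD] by (elim exE conjE)
      have "q = 0" by (rule uniq[OF xD q(1) s0])
      then show False using q(2) \<rho>(4) by simp
    qed
    ultimately show "0 < min (u x) (M - u x)" using u(2)[OF xO] by simp
  qed (rule that)
  define \<eta> where "\<eta> = min (\<eta>2 / 2) \<delta>"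
  have \<eta>: "\<eta> > 0" "\<eta> \<le> \<eta>2 / 2" "\<eta> \<le> \<delta>" "\<eta> < \<eta>2" using \<eta>2 \<delta>(1) by (auto simp: \<eta>_def)
  have Kmono: "x \<in> Kf (\<eta>2 / 2)" if "x \<in> Kf \<eta>" for x
    using that \<eta>(2) unfolding Kf_def by (elim CollectE exE conjE) (intro CollectI exI conjI, assumption, erule (1) order_trans)
  have cap: "cap ?g (Kf \<eta>) D \<xi> r \<eta>"
  proof
    show "convex_on UNIV ?g" "coercive ?g" by (rule cc.convex_low, rule cc.coercive_low)
    show "compact (Kf \<eta>)" "Kf \<eta> \<subseteq> D" by (rule Kc[OF \<eta>(4)], rule KD[OF \<eta>(4)])
    show "p = q" if "x \<in> D" "subgrad ?g x p" "subgrad ?g x q" for x p q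
      by (rule uniq[OF that(1) sub_on[OF that(1,2)] sub_on[OF that(1,3)]])
    show "x \<in> Kf \<eta>" if "norm (p - \<xi>) \<le> r" "?g x + lconj ?g p - p \<bullet> x \<le> \<eta>" for p x
      unfolding Kf_def using that by (intro CollectI exI conjI)
  qed (use oD r(1) \<eta>(1) in simp_all)
  interpret cp: cap ?g "Kf \<eta>" D \<xi> r \<eta> by (rule cap)
  have minV: "cp.\<Phi> f (lconj ?g) \<le> cp.\<Phi> f V"
    if V: "cp.adm V" and gd: "AE x in lborel. x \<in> Kf \<eta> \<longrightarrow> GDERIV (lconj V) x :> rgrad (lconj V) x" for V
  proof (rule competitor[OF cap DO low_le_u[OF \<rho>(1)] regD(3) _ C2D(4)[OF f] min V gd])
    show "\<eta> \<le> u x \<and> \<eta> \<le> M - u x" if "x \<in> Kf \<eta>" for x using \<delta>(2)[OF Kmono[OF that]] \<eta>(3) by simp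
  qed
  from \<rho>1(2) show False
  proof
    assume ?def
    then obtain d where d: "d > 0" "\<And>q. norm (q - \<xi>) < d \<Longrightarrow> q \<noteq> \<xi> \<Longrightarrow> f \<xi> + grad f \<xi> \<bullet> (q - \<xi>) < f q" by blast
    show False by (rule cp.cut_contradiction[OF C2D(4)[OF f] minV d])
  next
    assume "?indef \<rho>1"
    then obtain e where e: "norm e = 1" "\<And>p. norm (p - \<xi>) \<le> \<rho>1 \<Longrightarrow> (hessian f p *v e) \<bullet> e < 0" by blast
    show False
    proof (rule cp.indefinite_contradiction[OF f minV e(1)])
      show "(hessian f p *v e) \<bullet> e < 0" if "norm (p - \<xi>) \<le> r" for p by (rule e(2)) (use that r \<rho>(3) in linarith)
    qed
  qed
  qed
  qed
  qed
qed

end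

theorem corollary1:
  fixes \<Omega> :: "(real^2) set" and M :: real
    and f u :: "real^2 \<Rightarrow> real"
  assumes "compact \<Omega>" and "convex \<Omega>" and "interior \<Omega> \<noteq> {}"
    and "M > 0"
    and "C2 f"
    and "closed {\<xi>. smallest_eigenvalue (hessian f \<xi>) = 0}"
    and "nowhere_dense {\<xi>. smallest_eigenvalue (hessian f \<xi>) = 0}"
    and "minimizes_F \<Omega> M f u"
  shows "(closed (body \<Omega> M u) \<longrightarrow>
            body \<Omega> M u = closure (convex hull (sing (body \<Omega> M u)))) \<and>
         closure (body \<Omega> M u) = closure (convex hull (sing (body \<Omega> M u)))"
proof -
  interpret convex_fun \<Omega> M u
    using assms(1-3,8) by unfold_locales (auto simp: minimizes_F_def convex_class_def)
  have "closure (body \<Omega> M u) = closure (convex hull (sing (body \<Omega> M u)))"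
    by (rule antisym[OF minimizer_body[OF assms(5,7,6,8)] sing_subset])
  then show ?thesis by (metis closure_closed)
qed

end
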